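(* Consider the following setting. Clean data $x^{(1)},\dots,x^{(n)}$ are independent samples from an unknown Gaussian distribution $\mathcal N(\mu,\Sigma)$ on $\mathbb{R}^d$ with $\mathrm{rank}(\Sigma)=k$. Sets $S^{(1)},\dots,S^{(n)}$ are drawn independently and uniformly at random from $\binom{[d]}{s}$. An adversary produces corrupted data $\tilde x^{(1)},\dots,\tilde x^{(n)}$ such that $\tilde x^{(i)}_j=x^{(i)}_j$ for every $i\in[n]$ and $j\in[d]\setminus S^{(i)}$ (the corrupted entries may be arbitrary). Let $U$ be the column space of $\Sigma$. There is an absolute constant $c_0>0$ such that, assuming $ks\le c_0 d$, there is an algorithm that, given only the corrupted data, outputs the subspace $U'=\mathrm{Span}(U\cup\{\mu\})$ with high probability, using $n=\tilde O(k^2)$ samples and $\mathrm{poly}(d)$ time (assuming exact real arithmetic).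
   Context: $\binom{[d]}{s}$ is the family of size-$s$ subsets of $[d]=\{1,\dots,d\}$. The notation $\tilde O(\cdot)$ hides factors polylogarithmic in $d$. *)

theory Defs
  imports "HOL-Probability.Probability" "Jordan_Normal_Form.DL_Rank"
begin

hide_type (open) Finite_Cartesian_Product.vec
hide_const (open) Finite_Cartesian_Product.vec Finite_Cartesian_Product.vec_nth
no_notation Finite_Cartesian_Product.vec_nth (infixl "$" 90)

section \<open>The real random access machine\<close>

text \<open>
  Exact real arithmetic: memory cells hold arbitrary reals, and each field operation and each
  comparison of reals is one step.  Addresses are natural numbers kept in separate index registers.
  Index registers admit no multiplication, and there is no conversion from reals to indices
  (no floor function), so that unit cost does not hide super-polynomial bit computation.
  Program constants are integers.  A program is one finite text, used for all input sizes.
\<close>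

record machine =
  ireg :: "nat \<Rightarrow> nat"
  rreg :: "nat \<Rightarrow> real"
  arr :: "nat \<Rightarrow> nat \<Rightarrow> nat \<Rightarrow> real"  \<comment> \<open>array name, row, column\<close>

text \<open>All arguments name registers, except the constants of \<open>IConst\<close> and \<open>RConst\<close>
  and the array name, which is the second argument of \<open>RLoad\<close> and the first of \<open>RStore\<close>.\<close>

datatype instr =
    IConst nat nat
  | IAdd nat nat nat
  | ISub nat nat nat
  | RConst nat int
  | RAdd nat nat nat
  | RSub nat nat nat
  | RMul nat nat nat
  | RDiv nat nat nat
  | RLoad nat nat nat nat
  | RStore nat nat nat nat

datatype test = ILess nat nat | RLess nat nat

datatype prog =
    Skip
  | Instr instr
  | Seq prog prog
  | If test prog prog
  | While test prog

fun step :: "instr \<Rightarrow> machine \<Rightarrow> machine" where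
  "step (IConst r c) m = m\<lparr>ireg := (ireg m)(r := c)\<rparr>"
| "step (IAdd r a b) m = m\<lparr>ireg := (ireg m)(r := ireg m a + ireg m b)\<rparr>"
| "step (ISub r a b) m = m\<lparr>ireg := (ireg m)(r := ireg m a - ireg m b)\<rparr>"
| "step (RConst r c) m = m\<lparr>rreg := (rreg m)(r := real_of_int c)\<rparr>"
| "step (RAdd r a b) m = m\<lparr>rreg := (rreg m)(r := rreg m a + rreg m b)\<rparr>"
| "step (RSub r a b) m = m\<lparr>rreg := (rreg m)(r := rreg m a - rreg m b)\<rparr>"
| "step (RMul r a b) m = m\<lparr>rreg := (rreg m)(r := rreg m a * rreg m b)\<rparr>"
| "step (RDiv r a b) m = m\<lparr>rreg := (rreg m)(r := rreg m a / rreg m b)\<rparr>"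
| "step (RLoad r a i j) m = m\<lparr>rreg := (rreg m)(r := arr m a (ireg m i) (ireg m j))\<rparr>"
| "step (RStore a i j r) m =
     m\<lparr>arr := (arr m)(a := (arr m a)(ireg m i := (arr m a (ireg m i))(ireg m j := rreg m r)))\<rparr>"

fun holds :: "test \<Rightarrow> machine \<Rightarrow> bool" where
  "holds (ILess a b) m \<longleftrightarrow> ireg m a < ireg m b"
| "holds (RLess a b) m \<longleftrightarrow> rreg m a < rreg m b"

text \<open>\<open>exec p m t m'\<close>: started in \<open>m\<close>, program \<open>p\<close> halts in \<open>m'\<close> after \<open>t\<close> steps.\<close>

inductive exec :: "prog \<Rightarrow> machine \<Rightarrow> nat \<Rightarrow> machine \<Rightarrow> bool" where
  Skip: "exec Skip m 1 m"
| Instr: "exec (Instr a) m 1 (step a m)"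
| Seq: "exec p m t m' \<Longrightarrow> exec p' m' t' m'' \<Longrightarrow> exec (Seq p p') m (t + t') m''"
| IfTrue: "holds b m \<Longrightarrow> exec p m t m' \<Longrightarrow> exec (If b p p') m (t + 1) m'"
| IfFalse: "\<not> holds b m \<Longrightarrow> exec p' m t m' \<Longrightarrow> exec (If b p p') m (t + 1) m'"
| WhileFalse: "\<not> holds b m \<Longrightarrow> exec (While b p) m 1 m"
| WhileTrue: "holds b m \<Longrightarrow> exec p m t m' \<Longrightarrow> exec (While b p) m' t' m'' \<Longrightarrow>
    exec (While b p) m (t + t' + 1) m''"

inductive_cases Skip_E: "exec Skip m t m'"
inductive_cases Instr_E: "exec (Instr a) m t m'"
inductive_cases Seq_E: "exec (Seq p p') m t m'"
inductive_cases If_E: "exec (If b p p') m t m'"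
inductive_cases While_E: "exec (While b p) m t m'"

lemma exec_deterministic:
  "exec p m t m' \<Longrightarrow> exec p m u m'' \<Longrightarrow> t = u \<and> m' = m''"
proof (induction arbitrary: u m'' rule: exec.induct)
  case (Skip m)
  then show ?case by (auto elim: Skip_E)
next
  case (Instr a m)
  then show ?case by (auto elim: Instr_E)
next
  case (Seq p m t m' p' t' m2)
  from Seq.prems obtain v w n where "exec p m v n" "exec p' n w m''" "u = v + w"
    by (auto elim: Seq_E)
  with Seq.IH(1)[of v n] Seq.IH(2)[of w m''] show ?case by simp
next
  case (IfTrue b m p t m' p')
  from IfTrue.prems IfTrue.hyps obtain v where "exec p m v m''" "u = v + 1"
    by (auto elim: If_E)
  with IfTrue.IH[of v m''] show ?case by simp
next
  case (IfFalse b m p' t m' p)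
  from IfFalse.prems IfFalse.hyps obtain v where "exec p' m v m''" "u = v + 1"
    by (auto elim: If_E)
  with IfFalse.IH[of v m''] show ?case by simp
next
  case (WhileFalse b m p)
  from WhileFalse.prems WhileFalse.hyps show ?case by (cases rule: While_E) auto
next
  case (WhileTrue b m p t m' t' m2)
  from WhileTrue.prems WhileTrue.hyps(1) obtain v w n
    where "exec p m v n" "exec (While b p) n w m''" "u = v + w + 1"
    by (cases rule: While_E) auto
  with WhileTrue.IH(1)[of v n] WhileTrue.IH(2)[of w m''] show ?case by simp
qed

text \<open>
  The input is the data matrix alone: \<open>n\<close> samples \<open>y 0, \<dots>, y (n - 1)\<close> with coordinates \<open>0, \<dots>, d - 1\<close>
  are the rows of array \<open>0\<close>, and index registers \<open>0\<close> and \<open>1\<close> hold its dimensions.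
  The output is a list of vectors: the first rows of array \<open>0\<close>, their number in index register \<open>0\<close>.
\<close>

definition input_state :: "nat \<Rightarrow> nat \<Rightarrow> (nat \<Rightarrow> nat \<Rightarrow> real) \<Rightarrow> machine" where
  "input_state n d y =
     \<lparr>ireg = (\<lambda>_. 0)(0 := n, 1 := d), rreg = (\<lambda>_. 0),
      arr = (\<lambda>a i j. if a = 0 \<and> i < n \<and> j < d then y i j else 0)\<rparr>"

definition output_vectors :: "nat \<Rightarrow> machine \<Rightarrow> real vec set" where
  "output_vectors d m = (\<lambda>l. vec d (arr m 0 l)) ` {..<ireg m 0}"

definition halts_within :: "prog \<Rightarrow> machine \<Rightarrow> real \<Rightarrow> bool" where
  "halts_within p m T \<longleftrightarrow> (\<exists>t m'. exec p m t m' \<and> real t \<le> T)"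

section \<open>Linear algebra and the data model\<close>

abbreviation span :: "nat \<Rightarrow> real vec set \<Rightarrow> real vec set" where
  "span d \<equiv> LinearCombinations.module.span class_ring (module_vec TYPE(real) d)"

abbreviation col_space :: "nat \<Rightarrow> real mat \<Rightarrow> real vec set" where
  "col_space d \<equiv> vec_space.col_space d"

definition outputs_subspace :: "prog \<Rightarrow> nat \<Rightarrow> nat \<Rightarrow> (nat \<Rightarrow> nat \<Rightarrow> real) \<Rightarrow> real vec set \<Rightarrow> bool" where
  "outputs_subspace p n d y W \<longleftrightarrow> (\<exists>t m. exec p (input_state n d y) t m \<and> span d (output_vectors d m) = W)"

text \<open>
  The normal law with mean \<open>\<mu>\<close> and (possibly singular) covariance \<open>\<Sigma>\<close> is the law of \<open>\<mu> + A z\<close>,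
  where \<open>A A\<^sup>T = \<Sigma>\<close> and \<open>z\<close> has independent standard normal coordinates.
  Points of \<open>d\<close>-space are functions on \<open>{..<d}\<close>.
\<close>

definition gaussian_law :: "nat \<Rightarrow> real vec \<Rightarrow> real mat \<Rightarrow> (nat \<Rightarrow> real) measure \<Rightarrow> bool" where
  "gaussian_law d \<mu> \<Sigma> G \<longleftrightarrow>
     (\<exists>m. \<exists>A \<in> carrier_mat d m. A * transpose_mat A = \<Sigma> \<and>
        G = distr (Pi\<^sub>M {..<m} (\<lambda>_. density lborel std_normal_density)) (Pi\<^sub>M {..<d} (\<lambda>_. borel))
              (\<lambda>z. \<lambda>i\<in>{..<d}. \<mu> $ i + (\<Sum>j<m. A $$ (i, j) * z j)))"

definition subsets_of_size :: "nat \<Rightarrow> nat \<Rightarrow> nat set set" where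
  "subsets_of_size d s = {S. S \<subseteq> {..<d} \<and> card S = s}"

text \<open>Joint law of the clean samples and the corruption sets, all independent.\<close>

definition clean_model ::
  "nat \<Rightarrow> nat \<Rightarrow> nat \<Rightarrow> (nat \<Rightarrow> real) measure \<Rightarrow> ((nat \<Rightarrow> nat \<Rightarrow> real) \<times> (nat \<Rightarrow> nat set)) measure" where
  "clean_model n d s G =
     Pi\<^sub>M {..<n} (\<lambda>_. G) \<Otimes>\<^sub>M Pi\<^sub>M {..<n} (\<lambda>_. uniform_count_measure (subsets_of_size d s))"

text \<open>
  The adversary sees all clean samples and all corruption sets; no measurability is imposed on it.
\<close>

definition admissible_adversary ::
  "nat \<Rightarrow> nat \<Rightarrow> ((nat \<Rightarrow> nat \<Rightarrow> real) \<Rightarrow> (nat \<Rightarrow> nat set) \<Rightarrow> nat \<Rightarrow> nat \<Rightarrow> real) \<Rightarrow> bool" where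
  "admissible_adversary n d adv \<longleftrightarrow>
     (\<forall>x S. \<forall>i<n. \<forall>j<d. j \<notin> S i \<longrightarrow> adv x S i j = x i j)"

text \<open>
  Since the adversary need not be measurable, probability at least \<open>q\<close> is inner probability.
\<close>

definition holds_with_prob :: "'a measure \<Rightarrow> real \<Rightarrow> ('a \<Rightarrow> bool) \<Rightarrow> bool" where
  "holds_with_prob M q P \<longleftrightarrow> (\<exists>E \<in> sets M. measure M E \<ge> q \<and> (\<forall>\<omega>\<in>E. P \<omega>))"

end

theory Submission
  imports Defs "HOL-Real_Asymp.Real_Asymp"
begin

text \<open>
  In suitable coordinates a clean sample is \<open>x = M y\<close>, where \<open>M\<close> is a fixed matrix with \<open>K \<le> k + 1\<close>
  columns and \<open>y = (1, g)\<close> for a standard normal vector \<open>g\<close>; the target subspace is the column space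
  of \<open>M\<close>.  So coordinate \<open>j\<close> of the data should be kept if and only if it is not a linear combination
  of the coordinates kept before, and the kept coordinates then give a basis.  A few corrupted rows
  can hide such a linear relation.

  To test coordinate \<open>j\<close>, whiten the rows restricted to the kept coordinates and \<open>j\<close>, and consider the
  matrices \<open>q = z z\<^sup>T - I\<close> of the whitened rows \<open>z\<close>.  For the clean rows the quadratic form
  \<open>\<Sum> \<langle>A, q\<rangle>\<^sup>2\<close> is at most a constant times \<open>n |A|\<^sup>2\<close>.  If some \<open>A\<close> violates this bound by a large
  factor, then most of the excess comes from corrupted rows, and downweighting the rows in proportion
  to \<open>\<langle>A, q\<rangle>\<^sup>2\<close> removes more corrupted than clean weight.  Such an \<open>A\<close> is found by power iteration on
  the Gram matrix of the \<open>q\<close>, without computing eigenvectors.  When no such \<open>A\<close> is left, a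
  relation that holds on the clean rows but fails on the remaining ones is impossible: it would be a direction \<open>u\<close>
  whose whole energy sits on the few corrupted rows, and \<open>A = u u\<^sup>T\<close> would violate the bound.

  Only coordinate \<open>j\<close> and the at most \<open>K\<close> kept ones matter for a test, so the corrupted rows number at
  most about \<open>(K + 1) s n / d\<close>, a small constant fraction of \<open>n\<close>.  That \<open>n\<close> of order \<open>k\<^sup>2\<close>, up to
  logarithms, suffices for the fourth-order bound on the clean rows is a matrix Chernoff bound in
  dimension \<open>K\<^sup>2\<close>, proved by estimating the trace of powers of \<open>\<Sum> q q\<^sup>T\<close> one summand at a time.
\<close>

section \<open>Moments of frame operators\<close>

text \<open>The program has no square roots and no eigenvectors, and it is given neither k nor s, so
  every test must be a rational comparison with a constant threshold. Three devices make this
  possible. Whitened rows enter only through inner products, in which the square roots of the norms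
  cancel. The Gram matrix of the centred outer products is a polynomial in those inner products. A
  large eigenvalue is detected by comparing two consecutive moments <q, S^p q>, whose log-convexity
  lets one late ratio control all earlier ones. Whitening uses all kept rows, so the adversary can
  distort the scale of the clean ones. The lower bound on the clean energy limits this: a unit
  direction in whitened coordinates pulls back to one of squared length at most 16. The upper bound
  on the clean rows needs truncation and a trace estimate, while the lower bound follows from blocks
  of about k^2 rows, for which plain second moments suffice. Decisions are exact: a residual is zero
  or not, and \<open>0 / 0 = 0\<close> turns \<open>x / x\<close> into an indicator.\<close>

definition dot :: "'b set \<Rightarrow> ('b \<Rightarrow> real) \<Rightarrow> ('b \<Rightarrow> real) \<Rightarrow> real" where
  "dot B u v = (\<Sum>a\<in>B. u a * v a)"

lemma dot_commute: "dot B u v = dot B v u"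
  by (simp add: dot_def mult.commute)

lemma dot_scale_right: "dot B u (\<lambda>a. c * v a) = c * dot B u v"
  by (simp add: dot_def sum_distrib_left mult.left_commute)

lemma dot_sum_right: "dot B u (\<lambda>a. \<Sum>i\<in>I. c i * w i a) = (\<Sum>i\<in>I. c i * dot B u (w i))"
proof -
  have "dot B u (\<lambda>a. \<Sum>i\<in>I. c i * w i a) = (\<Sum>a\<in>B. \<Sum>i\<in>I. c i * (u a * w i a))"
    by (simp add: dot_def sum_distrib_left mult.left_commute)
  also have "\<dots> = (\<Sum>i\<in>I. \<Sum>a\<in>B. c i * (u a * w i a))"
    by (rule sum.swap)
  finally show ?thesis by (simp add: dot_def sum_distrib_left)
qed

lemma dot_self_nonneg [simp]: "0 \<le> dot B u u"
  by (simp add: dot_def sum_nonneg)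

lemma dot_self_eq_0: "finite B \<Longrightarrow> dot B u u = 0 \<longleftrightarrow> (\<forall>a\<in>B. u a = 0)"
  by (simp add: dot_def sum_nonneg_eq_0_iff)

lemma dot_Cauchy_Schwarz: "(dot B u v)\<^sup>2 \<le> dot B u u * dot B v v"
  using Cauchy_Schwarz_ineq_sum[of u v B] by (simp add: dot_def power2_eq_square)

definition frame_op :: "'b set \<Rightarrow> 'i set \<Rightarrow> ('i \<Rightarrow> 'b \<Rightarrow> real) \<Rightarrow> ('b \<Rightarrow> real) \<Rightarrow> 'b \<Rightarrow> real" where
  "frame_op B I q v = (\<lambda>a. \<Sum>i\<in>I. dot B (q i) v * q i a)"

lemma dot_frame_op: "dot B u (frame_op B I q v) = (\<Sum>i\<in>I. dot B (q i) u * dot B (q i) v)"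
  unfolding frame_op_def dot_sum_right by (simp add: dot_commute mult.commute)

lemma frame_op_self_adjoint: "dot B u (frame_op B I q v) = dot B (frame_op B I q u) v"
  by (simp add: dot_frame_op dot_commute[of B "frame_op B I q u"] mult.commute)

lemma frame_op_power_self_adjoint:
  "dot B u ((frame_op B I q ^^ p) v) = dot B ((frame_op B I q ^^ p) u) v"
proof (induction p arbitrary: v)
  case (Suc p)
  then show ?case
    by (metis frame_op_self_adjoint funpow.simps(2) funpow_swap1 o_apply)
qed simp

definition frame_moment :: "'b set \<Rightarrow> 'i set \<Rightarrow> ('i \<Rightarrow> 'b \<Rightarrow> real) \<Rightarrow> ('b \<Rightarrow> real) \<Rightarrow> nat \<Rightarrow> real" where
  "frame_moment B I q v p = dot B v ((frame_op B I q ^^ p) v)"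

lemma frame_moment_add:
  "dot B ((frame_op B I q ^^ a) v) ((frame_op B I q ^^ b) v) = frame_moment B I q v (a + b)"
  by (simp add: frame_moment_def frame_op_power_self_adjoint funpow_add)

lemma frame_moment_even: "frame_moment B I q v (2 * l) = dot B ((frame_op B I q ^^ l) v) ((frame_op B I q ^^ l) v)"
  by (simp add: frame_moment_add mult_2)

lemma frame_moment_odd: "frame_moment B I q v (2 * l + 1) = (\<Sum>i\<in>I. (dot B (q i) ((frame_op B I q ^^ l) v))\<^sup>2)"
proof -
  have "frame_moment B I q v (l + Suc l) = dot B ((frame_op B I q ^^ l) v) (frame_op B I q ((frame_op B I q ^^ l) v))"
    by (simp only: frame_moment_add[symmetric] funpow.simps o_apply)
  then show ?thesis
    by (simp add: mult_2 dot_frame_op power2_eq_square)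
qed

lemma frame_moment_nonneg [simp]: "0 \<le> frame_moment B I q v p"
proof (cases "even p")
  case True
  then obtain l where "p = 2 * l" by (rule evenE)
  then show ?thesis by (simp add: frame_moment_even)
next
  case False
  then obtain l where "p = 2 * l + 1" by (rule oddE)
  then show ?thesis by (simp only: frame_moment_odd) (simp add: sum_nonneg)
qed

text \<open>Even and odd exponents need different Cauchy-Schwarz inequalities: for even ones in the
  space of vectors, applied to S^l v and S^(l+1) v; for odd ones over the index set I, applied to
  the coefficients of these two vectors. Splitting by parity stands in for a square root of
  S.\<close>

lemma frame_moment_log_convex:
  "(frame_moment B I q v (Suc p))\<^sup>2 \<le> frame_moment B I q v p * frame_moment B I q v (Suc (Suc p))"
proof (cases "even p")
  case True
  then obtain l where p: "p = 2 * l" by (rule evenE)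
  have e: "Suc (Suc p) = Suc l + Suc l" "Suc p = l + Suc l" "p = l + l" using p by auto
  have "(frame_moment B I q v (l + Suc l))\<^sup>2 \<le> frame_moment B I q v (l + l) * frame_moment B I q v (Suc l + Suc l)"
    unfolding frame_moment_add[symmetric] by (rule dot_Cauchy_Schwarz)
  then show ?thesis using e by metis
next
  case False
  then obtain l where p: "p = 2 * l + 1" by (rule oddE)
  let ?S = "frame_op B I q"
  have e: "Suc p = l + Suc (Suc l)" using p by simp
  have 1: "frame_moment B I q v (Suc p) = (\<Sum>i\<in>I. dot B (q i) ((?S ^^ l) v) * dot B (q i) ((?S ^^ Suc l) v))"
    unfolding e frame_moment_add[symmetric] by (simp add: dot_frame_op)
  have 2: "frame_moment B I q v p = (\<Sum>i\<in>I. (dot B (q i) ((?S ^^ l) v))\<^sup>2)"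
    unfolding p by (rule frame_moment_odd)
  have e': "Suc (Suc p) = 2 * Suc l + 1" using p by simp
  have 3: "frame_moment B I q v (Suc (Suc p)) = (\<Sum>i\<in>I. (dot B (q i) ((?S ^^ Suc l) v))\<^sup>2)"
    unfolding e' by (rule frame_moment_odd)
  show ?thesis unfolding 1 2 3 by (rule Cauchy_Schwarz_ineq_sum)
qed

section \<open>Log-convex sequences\<close>

locale log_convex_seq =
  fixes m :: "nat \<Rightarrow> real"
  assumes nonneg: "0 \<le> m a" and log_convex: "(m (Suc a))\<^sup>2 \<le> m a * m (Suc (Suc a))"
begin

text \<open>Log-convexity compares two neighbouring ratios of consecutive terms; cross
  multiplication keeps zero terms admissible.\<close>

lemma ratio_mono: "a \<le> b \<Longrightarrow> m (Suc a) * m b \<le> m a * m (Suc b)"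
proof (induction b rule: dec_induct)
  case (step b)
  show ?case
  proof (cases "m (Suc b) = 0")
    case True
    then show ?thesis using nonneg by simp
  next
    case False
    then have pos: "0 < m (Suc b)" using nonneg[of "Suc b"] by simp
    have "m (Suc a) * (m (Suc b))\<^sup>2 \<le> m (Suc a) * (m b * m (Suc (Suc b)))"
      by (intro mult_left_mono log_convex nonneg)
    also have "\<dots> = (m (Suc a) * m b) * m (Suc (Suc b))" by simp
    also have "\<dots> \<le> (m a * m (Suc b)) * m (Suc (Suc b))"
      by (intro mult_right_mono step nonneg)
    finally have "(m (Suc a) * m (Suc b)) * m (Suc b) \<le> (m a * m (Suc (Suc b))) * m (Suc b)"
      by (simp add: power2_eq_square mult_ac)
    then show ?thesis using pos by (rule mult_right_le_imp_le)
  qed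
qed simp

lemma mult_le_aux: "a \<le> b \<Longrightarrow> m a * m b \<le> m 0 * m (a + b)"
proof (induction a arbitrary: b)
  case (Suc a)
  have "m (Suc a) * m b \<le> m a * m (Suc b)" using Suc.prems by (intro ratio_mono) simp
  also have "\<dots> \<le> m 0 * m (a + Suc b)" using Suc.prems by (intro Suc.IH) simp
  finally show ?case by simp
qed simp

lemma mult_le: "m a * m b \<le> m 0 * m (a + b)"
  using mult_le_aux[of a b] mult_le_aux[of b a] by (cases "a \<le> b") (simp_all add: ac_simps)

text \<open>A form of Jensen's inequality for the normalized sequence \<open>m p / m 0\<close>,
  obtained by letting \<open>mult_le\<close> absorb one factor \<open>m 1\<close> at a time.\<close>

lemma power_le: "(m 1) ^ p * m 0 \<le> (m 0) ^ p * m p"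
proof (induction p)
  case (Suc p)
  have "(m 1) ^ Suc p * m 0 = m 1 * ((m 1) ^ p * m 0)" by simp
  also have "\<dots> \<le> m 1 * ((m 0) ^ p * m p)" by (intro mult_left_mono Suc nonneg)
  also have "\<dots> = (m 0) ^ p * (m 1 * m p)" by simp
  also have "\<dots> \<le> (m 0) ^ p * (m 0 * m (1 + p))" by (intro mult_left_mono mult_le zero_le_power nonneg)
  finally show ?case by (simp add: mult_ac)
qed simp

text \<open>Lyapunov's inequality: the s-th root of \<open>m s / m 0\<close> grows with s. Roots are
  avoided by multiplying with a power of \<open>m (Suc s)\<close>, which cancels at the end.\<close>

lemma root_mono: "(m s) ^ Suc s \<le> m 0 * (m (Suc s)) ^ s"
proof (induction s)
  case (Suc s)
  show ?case
  proof (cases "m (Suc s) = 0")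
    case False
    then have pos: "0 < m (Suc s)" using nonneg[of "Suc s"] by simp
    have "(m (Suc s)) ^ Suc (Suc s) * (m (Suc s)) ^ s = ((m (Suc s))\<^sup>2) ^ Suc s"
      unfolding power_mult[symmetric] power_add[symmetric] by (intro arg_cong[where f="\<lambda>k. m (Suc s) ^ k"]) simp
    also have "\<dots> \<le> (m s * m (Suc (Suc s))) ^ Suc s"
      by (intro power_mono log_convex) simp
    also have "\<dots> = (m s) ^ Suc s * (m (Suc (Suc s))) ^ Suc s" by (rule power_mult_distrib)
    also have "\<dots> \<le> (m 0 * (m (Suc s)) ^ s) * (m (Suc (Suc s))) ^ Suc s"
      by (intro mult_right_mono Suc zero_le_power nonneg)
    finally have "(m (Suc s)) ^ Suc (Suc s) * (m (Suc s)) ^ s \<le> (m 0 * (m (Suc (Suc s))) ^ Suc s) * (m (Suc s)) ^ s"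
      by (simp only: mult_ac)
    then show ?thesis using pos by (metis mult_right_le_imp_le zero_less_power)
  qed (simp add: nonneg)
qed simp

end

lemma log_convex_seq_frame_moment: "log_convex_seq (frame_moment B I q v)"
  by unfold_locales (simp_all add: frame_moment_log_convex)

lemma frame_moment_0: "frame_moment B I q v 0 = dot B v v"
  by (simp add: frame_moment_def)

lemma frame_moment_1: "frame_moment B I q v 1 = (\<Sum>i\<in>I. (dot B (q i) v)\<^sup>2)"
  by (simp add: frame_moment_def dot_frame_op power2_eq_square)

section \<open>Traces of powers and spectral bounds\<close>

definition frame_trace :: "'b set \<Rightarrow> 'i set \<Rightarrow> ('i \<Rightarrow> 'b \<Rightarrow> real) \<Rightarrow> nat \<Rightarrow> real" where
  "frame_trace B I q p = (\<Sum>e\<in>B. frame_moment B I q (\<lambda>a. of_bool (a = e)) p)"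

lemma dot_unit: "finite B \<Longrightarrow> e \<in> B \<Longrightarrow> dot B (\<lambda>a. of_bool (a = e)) v = v e"
  by (simp add: dot_def)

lemma dot_unit': "finite B \<Longrightarrow> e \<in> B \<Longrightarrow> dot B v (\<lambda>a. of_bool (a = e)) = v e"
  by (simp add: dot_def)

lemma frame_trace_nonneg: "0 \<le> frame_trace B I q p"
  by (simp add: frame_trace_def sum_nonneg)

lemma frame_trace_even:
  "frame_trace B I q (2 * l) = (\<Sum>e\<in>B. dot B ((frame_op B I q ^^ l) (\<lambda>a. of_bool (a = e))) ((frame_op B I q ^^ l) (\<lambda>a. of_bool (a = e))))"
  by (simp add: frame_trace_def frame_moment_even)

text \<open>The middle factor of S^(2l+1) supplies the sum over I, and self-adjointness moves the
  remaining powers from the unit vectors to \<open>q i\<close>.\<close>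

lemma frame_trace_odd:
  assumes "finite B"
  shows "frame_trace B I q (2 * l + 1) = (\<Sum>i\<in>I. frame_moment B I q (q i) (2 * l))"
proof -
  have "frame_trace B I q (2 * l + 1) = (\<Sum>e\<in>B. \<Sum>i\<in>I. (dot B (q i) ((frame_op B I q ^^ l) (\<lambda>a. of_bool (a = e))))\<^sup>2)"
    by (simp only: frame_trace_def frame_moment_odd)
  also have "\<dots> = (\<Sum>e\<in>B. \<Sum>i\<in>I. ((frame_op B I q ^^ l) (q i) e)\<^sup>2)"
    using assms by (intro sum.cong refl) (simp add: frame_op_power_self_adjoint dot_unit')
  also have "\<dots> = (\<Sum>i\<in>I. \<Sum>e\<in>B. ((frame_op B I q ^^ l) (q i) e)\<^sup>2)" by (rule sum.swap)
  finally show ?thesis by (simp add: frame_moment_even dot_def power2_eq_square)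
qed

lemma frame_moment_le_trace:
  assumes "finite B"
  shows "frame_moment B I q v (2 * l) \<le> dot B v v * frame_trace B I q (2 * l)"
proof -
  have "frame_moment B I q v (2 * l) = (\<Sum>e\<in>B. (dot B (\<lambda>a. of_bool (a = e)) ((frame_op B I q ^^ l) v))\<^sup>2)"
    using assms by (simp add: frame_moment_even dot_unit) (simp add: dot_def power2_eq_square)
  also have "\<dots> = (\<Sum>e\<in>B. (dot B ((frame_op B I q ^^ l) (\<lambda>a. of_bool (a = e))) v)\<^sup>2)"
    by (simp add: frame_op_power_self_adjoint)
  also have "\<dots> \<le> (\<Sum>e\<in>B. dot B ((frame_op B I q ^^ l) (\<lambda>a. of_bool (a = e))) ((frame_op B I q ^^ l) (\<lambda>a. of_bool (a = e))) * dot B v v)"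
    by (intro sum_mono dot_Cauchy_Schwarz)
  finally show ?thesis unfolding frame_trace_even by (simp add: sum_distrib_left mult.commute[of "dot B v v"])
qed

text \<open>The largest eigenvalue is at most the p-th root of the trace of the p-th power.
  Eigenvalues are bypassed: \<open>m.power_le\<close> passes from the quadratic form to the p-th
  moment, and for even p that moment is bounded by the trace.\<close>

lemma quadratic_form_le_of_trace:
  assumes "finite B" and tr: "frame_trace B I q p \<le> t ^ p" and t: "0 \<le> t" and p: "even p" "0 < p"
  shows "(\<Sum>i\<in>I. (dot B (q i) v)\<^sup>2) \<le> t * dot B v v"
proof (cases "dot B v v = 0")
  case True
  then have "dot B (q i) v = 0" for i
    using dot_Cauchy_Schwarz[of B "q i" v] by simp
  then show ?thesis using True by simp
next
  case False
  then have pos: "0 < dot B v v" using dot_self_nonneg[of B v] by linarith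
  interpret m: log_convex_seq "frame_moment B I q v" by (rule log_convex_seq_frame_moment)
  obtain l where l: "p = 2 * l" using p by (auto elim: evenE)
  have "(frame_moment B I q v 1) ^ p * dot B v v \<le> (dot B v v) ^ p * frame_moment B I q v p"
    using m.power_le[of p] by (simp only: frame_moment_0)
  also have "\<dots> \<le> (dot B v v) ^ p * (dot B v v * t ^ p)"
    using frame_moment_le_trace[OF assms(1), of I q v l] tr pos
    by (intro mult_left_mono) (auto simp: l intro: order_trans mult_left_mono)
  finally have "(frame_moment B I q v 1) ^ p * dot B v v \<le> (t * dot B v v) ^ p * dot B v v"
    by (simp add: power_mult_distrib mult_ac)
  then have "(frame_moment B I q v 1) ^ p \<le> (t * dot B v v) ^ p"
    using pos by (rule mult_right_le_imp_le)
  then have "frame_moment B I q v 1 \<le> t * dot B v v"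
    using p t pos by (intro power_mono_iff[THEN iffD1, of "frame_moment B I q v 1" _ p]) auto
  then show ?thesis by (simp only: frame_moment_1)
qed

text \<open>If each \<open>q i\<close> passes the ratio test at the late exponent 2P, log-convexity
  extends the bound \<theta> to all earlier ratios, so <q_i, S^(2P) q_i> \<le> \<theta>^(2P)
  |q_i|^2. Summing over i bounds <v, S^(2P+1) v> for every v by \<theta>^(2P) times the trace, and
  the (2P+1)-st root shrinks the trace to a factor 2.\<close>

lemma power_iteration_certificate:
  assumes fin: "finite B" "finite I" and \<theta>: "0 < \<theta>"
    and test: "\<And>i. i \<in> I \<Longrightarrow> frame_moment B I q (q i) (2 * P + 1) \<le> \<theta> * frame_moment B I q (q i) (2 * P)"
    and tr: "(\<Sum>i\<in>I. dot B (q i) (q i)) \<le> \<theta> * 2 ^ (2 * P + 1)"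
  shows "(\<Sum>i\<in>I. (dot B (q i) v)\<^sup>2) \<le> 2 * \<theta> * dot B v v"
proof (cases "dot B v v = 0")
  case True
  then have "dot B (q i) v = 0" for i
    using dot_Cauchy_Schwarz[of B "q i" v] by simp
  then show ?thesis using True by simp
next
  case False
  then have pos: "0 < dot B v v" using dot_self_nonneg[of B v] by linarith
  let ?m = "\<lambda>i. frame_moment B I q (q i)" and ?n = "frame_moment B I q v"
  have m2P: "?m i (2 * P) \<le> \<theta> ^ (2 * P) * dot B (q i) (q i)" if i: "i \<in> I" for i
  proof -
    interpret m: log_convex_seq "?m i" by (rule log_convex_seq_frame_moment)
    have "(?m i (2 * P)) ^ Suc (2 * P) \<le> ?m i 0 * (?m i (Suc (2 * P))) ^ (2 * P)"
      by (rule m.root_mono)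
    also have "\<dots> \<le> ?m i 0 * (\<theta> * ?m i (2 * P)) ^ (2 * P)"
      using test[OF i] by (intro mult_left_mono power_mono m.nonneg) simp
    finally have "?m i (2 * P) * (?m i (2 * P)) ^ (2 * P) \<le> (\<theta> ^ (2 * P) * ?m i 0) * (?m i (2 * P)) ^ (2 * P)"
      by (simp add: power_mult_distrib mult_ac)
    then have "?m i (2 * P) \<le> \<theta> ^ (2 * P) * ?m i 0 \<or> ?m i (2 * P) = 0"
      using m.nonneg[of "2 * P"] by (metis mult_right_le_imp_le zero_less_power less_eq_real_def)
    then show ?thesis using \<theta> by (auto simp: frame_moment_0)
  qed
  interpret n: log_convex_seq ?n by (rule log_convex_seq_frame_moment)
  have "?n (2 * P + 1) = (\<Sum>i\<in>I. (dot B ((frame_op B I q ^^ P) (q i)) v)\<^sup>2)"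
    by (simp only: frame_moment_odd frame_op_power_self_adjoint)
  also have "\<dots> \<le> (\<Sum>i\<in>I. ?m i (2 * P) * dot B v v)"
    unfolding frame_moment_even by (intro sum_mono dot_Cauchy_Schwarz)
  also have "\<dots> \<le> (\<Sum>i\<in>I. \<theta> ^ (2 * P) * dot B (q i) (q i) * dot B v v)"
    using m2P by (intro sum_mono mult_right_mono) auto
  also have "\<dots> = \<theta> ^ (2 * P) * (\<Sum>i\<in>I. dot B (q i) (q i)) * dot B v v"
    by (simp add: sum_distrib_left sum_distrib_right)
  also have "\<dots> \<le> \<theta> ^ (2 * P) * (\<theta> * 2 ^ (2 * P + 1)) * dot B v v"
    using \<theta> pos tr by (intro mult_right_mono mult_left_mono) auto
  also have "\<dots> = (2 * \<theta>) ^ (2 * P + 1) * dot B v v"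
    by (simp add: power_mult_distrib)
  finally have *: "?n (2 * P + 1) \<le> (2 * \<theta>) ^ (2 * P + 1) * dot B v v" .
  have "(?n 1) ^ (2 * P + 1) * dot B v v \<le> (dot B v v) ^ (2 * P + 1) * ?n (2 * P + 1)"
    using n.power_le[of "2 * P + 1"] by (simp only: frame_moment_0)
  also have "\<dots> \<le> (dot B v v) ^ (2 * P + 1) * ((2 * \<theta>) ^ (2 * P + 1) * dot B v v)"
    using * pos by (intro mult_left_mono) auto
  also have "\<dots> = (2 * \<theta> * dot B v v) ^ (2 * P + 1) * dot B v v"
    by (simp add: power_mult_distrib mult_ac)
  finally have "(?n 1) ^ (2 * P + 1) \<le> (2 * \<theta> * dot B v v) ^ (2 * P + 1)"
    using pos by (rule mult_right_le_imp_le)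
  then have "?n 1 \<le> 2 * \<theta> * dot B v v"
    using \<theta> pos by (intro power_mono_iff[THEN iffD1, of "?n 1" _ "2 * P + 1"]) auto
  then show ?thesis by (simp only: frame_moment_1)
qed

text \<open>\<open>shift_eval m R b c\<close> is the value of the moment functional \<open>x ^ a \<mapsto> m a\<close> at \<open>x ^ b * (x + R) ^ c\<close>.\<close>

fun shift_eval :: "(nat \<Rightarrow> real) \<Rightarrow> real \<Rightarrow> nat \<Rightarrow> nat \<Rightarrow> real" where
  "shift_eval m R b 0 = m b"
| "shift_eval m R b (Suc c) = shift_eval m R (Suc b) c + R * shift_eval m R b c"

text \<open>Peeling off the factors x + R one by one. The sum has the shape of
  \<open>frame_op_insert_telescope\<close>, which makes the two comparable term by term.\<close>

lemma shift_eval_unfold: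
  "shift_eval m R b c = m (b + c) + R * (\<Sum>e<c. shift_eval m R (b + e) (c - 1 - e))"
proof (induction c arbitrary: b)
  case (Suc c)
  have "(\<Sum>e<Suc c. shift_eval m R (b + e) (Suc c - 1 - e)) =
      shift_eval m R b c + (\<Sum>e<c. shift_eval m R (Suc b + e) (c - 1 - e))"
    by (subst sum.lessThan_Suc_shift) simp
  then show ?case using Suc[of "Suc b"] by (simp add: algebra_simps)
qed simp

lemma shift_eval_nonneg: "(\<And>a. 0 \<le> m a) \<Longrightarrow> 0 \<le> R \<Longrightarrow> 0 \<le> shift_eval m R b c"
  by (induction c arbitrary: b) auto

lemma shift_eval_geometric: "shift_eval (\<lambda>a. c0 * L ^ a) R b c = c0 * (L ^ b * (L + R) ^ c)"
  by (induction c arbitrary: b) (auto simp: algebra_simps)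

lemma shift_eval_mult_le:
  assumes "\<And>a b. m a * m b \<le> R * m (a + b)" "0 \<le> R"
  shows "m a * shift_eval m R b c \<le> R * shift_eval m R (a + b) c"
proof (induction c arbitrary: b)
  case (Suc c)
  have "m a * shift_eval m R b (Suc c) = m a * shift_eval m R (Suc b) c + R * (m a * shift_eval m R b c)"
    by (simp add: algebra_simps)
  also have "\<dots> \<le> R * shift_eval m R (a + Suc b) c + R * (R * shift_eval m R (a + b) c)"
    using assms(2) by (intro add_mono mult_left_mono Suc)
  finally show ?case by (simp add: algebra_simps)
qed (simp add: assms)

section \<open>Adding one vector to a frame operator\<close>

context
  fixes B :: "'b set" and I :: "'i set" and i :: 'i and q :: "'i \<Rightarrow> 'b \<Rightarrow> real"
  assumes fin: "finite B" "finite I" and i: "i \<notin> I"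
begin

private abbreviation "S \<equiv> frame_op B I q"
private abbreviation "S' \<equiv> frame_op B (insert i I) q"

text \<open>The identity S'^c - S^c = \<Sum> S^e (S' - S) S'^(c-1-e), where S' - S is the rank-one
  operator of \<open>q i\<close>.\<close>

lemma frame_op_insert_telescope:
  "dot B u ((S' ^^ c) v) = dot B u ((S ^^ c) v) +
    (\<Sum>e<c. dot B u ((S ^^ e) (q i)) * dot B (q i) ((S' ^^ (c - 1 - e)) v))"
proof (induction c arbitrary: u)
  case (Suc c)
  let ?w = "(S' ^^ c) v"
  have "dot B u ((S' ^^ Suc c) v) = dot B (S u) ?w + dot B u (q i) * dot B (q i) ?w"
    using fin i unfolding frame_op_self_adjoint[symmetric] funpow.simps o_apply dot_frame_op
    by (simp add: dot_commute)
  moreover have "(\<Sum>e<Suc c. dot B u ((S ^^ e) (q i)) * dot B (q i) ((S' ^^ (Suc c - 1 - e)) v)) =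
      dot B u (q i) * dot B (q i) ?w + (\<Sum>e<c. dot B (S u) ((S ^^ e) (q i)) * dot B (q i) ((S' ^^ (c - 1 - e)) v))"
    by (subst sum.lessThan_Suc_shift) (simp add: frame_op_self_adjoint)
  moreover have "dot B (S u) ((S ^^ c) v) = dot B u ((S ^^ Suc c) v)"
    by (simp add: frame_op_self_adjoint)
  ultimately show ?case using Suc[of "S u"] by simp
qed simp

text \<open>In its own moments, a new vector of squared length at most R counts no worse than
  replacing S by S + R. In the telescoped sum a product of two old moments is at most R times one
  moment, by log-convexity and |q_i|^2 \<le> R, so strong induction on c reproduces the recursion of
  \<open>shift_eval\<close>.\<close>

lemma frame_moment_insert_le:
  assumes R: "dot B (q i) (q i) \<le> R"
  shows "dot B (q i) ((S' ^^ c) (q i)) \<le> shift_eval (frame_moment B I q (q i)) R 0 c"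
    and "dot B ((S ^^ b) (q i)) ((S' ^^ c) (q i)) \<le> shift_eval (frame_moment B I q (q i)) R b c"
proof -
  let ?m = "frame_moment B I q (q i)"
  interpret m: log_convex_seq ?m by (rule log_convex_seq_frame_moment)
  have R0: "0 \<le> R" using R dot_self_nonneg order_trans by blast
  have mm: "?m a * ?m b \<le> R * ?m (a + b)" for a b
    by (rule order_trans[OF m.mult_le]) (simp add: frame_moment_0 R mult_right_mono)
  have mom: "dot B (q i) ((S ^^ e) (q i)) = ?m e" for e by (simp add: frame_moment_def)
  have 1: "dot B (q i) ((S' ^^ c) (q i)) \<le> shift_eval ?m R 0 c" for c
  proof (induction c rule: less_induct)
    case (less c)
    have "dot B (q i) ((S' ^^ c) (q i)) = ?m c + (\<Sum>e<c. ?m e * dot B (q i) ((S' ^^ (c - 1 - e)) (q i)))"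
      by (subst frame_op_insert_telescope) (simp add: mom)
    also have "\<dots> \<le> ?m c + (\<Sum>e<c. ?m e * shift_eval ?m R 0 (c - 1 - e))"
      using less by (intro add_left_mono sum_mono mult_left_mono) auto
    also have "\<dots> \<le> ?m c + (\<Sum>e<c. R * shift_eval ?m R (e + 0) (c - 1 - e))"
      by (intro add_left_mono sum_mono shift_eval_mult_le mm R0)
    also have "\<dots> = shift_eval ?m R 0 c"
      by (subst shift_eval_unfold[of _ _ 0 c]) (simp add: sum_distrib_left)
    finally show ?case .
  qed
  show "dot B (q i) ((S' ^^ c) (q i)) \<le> shift_eval ?m R 0 c" by (rule 1)
  have mom2: "dot B ((S ^^ b) (q i)) ((S ^^ e) (q i)) = ?m (b + e)" for e by (rule frame_moment_add)
  have "dot B ((S ^^ b) (q i)) ((S' ^^ c) (q i)) = ?m (b + c) + (\<Sum>e<c. ?m (b + e) * dot B (q i) ((S' ^^ (c - 1 - e)) (q i)))"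
    by (subst frame_op_insert_telescope) (simp add: mom2)
  also have "\<dots> \<le> ?m (b + c) + (\<Sum>e<c. ?m (b + e) * shift_eval ?m R 0 (c - 1 - e))"
    using 1 by (intro add_left_mono sum_mono mult_left_mono) auto
  also have "\<dots> \<le> ?m (b + c) + (\<Sum>e<c. R * shift_eval ?m R (b + e + 0) (c - 1 - e))"
    by (intro add_left_mono sum_mono shift_eval_mult_le mm R0)
  also have "\<dots> = shift_eval ?m R b c"
    by (subst shift_eval_unfold[of _ _ b c]) (simp add: sum_distrib_left)
  finally show "dot B ((S ^^ b) (q i)) ((S' ^^ c) (q i)) \<le> shift_eval ?m R b c" .
qed

text \<open>The bound involves the new vector only through the old moments <q_i, S^a q_i>, which are
  linear in q_i q_i^T. Their expectation over an independent q_i is therefore controlled by second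
  moments alone.\<close>

lemma frame_trace_insert_le:
  assumes R: "dot B (q i) (q i) \<le> R"
  shows "frame_trace B (insert i I) q p \<le>
    frame_trace B I q p + (\<Sum>e<p. shift_eval (frame_moment B I q (q i)) R e (p - 1 - e))"
proof -
  have "frame_trace B (insert i I) q p = frame_trace B I q p +
      (\<Sum>x\<in>B. \<Sum>e<p. (S ^^ e) (q i) x * (S' ^^ (p - 1 - e)) (q i) x)"
    unfolding frame_trace_def frame_moment_def sum.distrib[symmetric]
  proof (intro sum.cong refl)
    fix x assume x: "x \<in> B"
    let ?e = "\<lambda>a. of_bool (a = x)"
    have "dot B ?e ((S ^^ e) (q i)) * dot B (q i) ((S' ^^ c) ?e) = (S ^^ e) (q i) x * (S' ^^ c) (q i) x" for e c
      unfolding frame_op_power_self_adjoint[of B "q i"] using x fin by (simp add: dot_unit dot_unit')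
    then show "dot B ?e ((S' ^^ p) ?e) = dot B ?e ((S ^^ p) ?e) + (\<Sum>e<p. (S ^^ e) (q i) x * (S' ^^ (p - 1 - e)) (q i) x)"
      by (subst frame_op_insert_telescope) simp
  qed
  also have "(\<Sum>x\<in>B. \<Sum>e<p. (S ^^ e) (q i) x * (S' ^^ (p - 1 - e)) (q i) x) =
      (\<Sum>e<p. dot B ((S ^^ e) (q i)) ((S' ^^ (p - 1 - e)) (q i)))"
    by (subst sum.swap) (simp add: dot_def)
  also have "\<dots> \<le> (\<Sum>e<p. shift_eval (frame_moment B I q (q i)) R e (p - 1 - e))"
    by (intro sum_mono frame_moment_insert_le R)
  finally show ?thesis by simp
qed

end

section \<open>Centred outer products\<close>

definition quad :: "('a \<Rightarrow> real) \<Rightarrow> 'a \<times> 'a \<Rightarrow> real" where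
  "quad y = (\<lambda>(a, b). y a * y b - of_bool (a = b))"

lemma dot_prod: "dot (J \<times> J') A q = (\<Sum>a\<in>J. \<Sum>b\<in>J'. A (a, b) * q (a, b))"
  by (simp add: dot_def sum.cartesian_product)

lemma dot_quad:
  assumes "finite J"
  shows "dot (J \<times> J) A (quad z) = (\<Sum>a\<in>J. \<Sum>b\<in>J. A (a, b) * (z a * z b)) - (\<Sum>a\<in>J. A (a, a))"
proof -
  have "(\<Sum>a\<in>J. \<Sum>b\<in>J. A (a, b) * of_bool (a = b)) = (\<Sum>a\<in>J. A (a, a))"
    using assms by (intro sum.cong refl) simp
  then show ?thesis
    by (simp add: dot_prod quad_def right_diff_distrib sum_subtractf)
qed

lemma dot_quad_rank_one:
  assumes "finite J"
  shows "dot (J \<times> J) (\<lambda>(a, b). u a * u b) (quad z) = (dot J u z)\<^sup>2 - dot J u u"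
  unfolding dot_quad[OF assms] by (simp add: dot_def power2_eq_square sum_product mult_ac)

lemma dot_rank_one: "dot (J \<times> J) (\<lambda>(a, b). u a * u b) (\<lambda>(a, b). u a * u b) = (dot J u u)\<^sup>2"
  unfolding dot_prod by (simp add: dot_def power2_eq_square sum_product mult_ac)

text \<open>Only inner products of z and w and the dimension occur on the right, so the Gram matrix
  of centred outer products is computable from kernel values without forming any of them.\<close>

lemma dot_quad_quad:
  assumes "finite J"
  shows "dot (J \<times> J) (quad z) (quad w) = (dot J z w)\<^sup>2 - dot J z z - dot J w w + real (card J)"
proof -
  have "(\<Sum>a\<in>J. \<Sum>b\<in>J. quad z (a, b) * (w a * w b)) =
      (\<Sum>a\<in>J. \<Sum>b\<in>J. z a * w a * (z b * w b)) - (\<Sum>a\<in>J. \<Sum>b\<in>J. of_bool (a = b) * (w a * w b))"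
    unfolding sum_subtractf[symmetric] by (intro sum.cong refl) (simp add: quad_def algebra_simps)
  also have "(\<Sum>a\<in>J. \<Sum>b\<in>J. of_bool (a = b) * (w a * w b)) = dot J w w"
    unfolding dot_def using assms by (intro sum.cong refl) simp
  also have "(\<Sum>a\<in>J. \<Sum>b\<in>J. z a * w a * (z b * w b)) = (dot J z w)\<^sup>2"
    by (simp add: dot_def power2_eq_square sum_product)
  finally show ?thesis
    unfolding dot_quad[OF assms] by (simp add: quad_def sum_subtractf) (simp add: dot_def)
qed

lemma sum_mult_sum_cong_swap:
  "(\<Sum>a\<in>J. x a * (\<Sum>c\<in>Y. L a c * y c)) = (\<Sum>c\<in>Y. (\<Sum>a\<in>J. x a * L a c) * (y c :: real))"
proof -
  have "(\<Sum>a\<in>J. x a * (\<Sum>c\<in>Y. L a c * y c)) = (\<Sum>a\<in>J. \<Sum>c\<in>Y. x a * L a c * y c)"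
    by (simp add: sum_distrib_left mult.assoc)
  also have "\<dots> = (\<Sum>c\<in>Y. \<Sum>a\<in>J. x a * L a c * y c)" by (rule sum.swap)
  finally show ?thesis by (simp add: sum_distrib_right)
qed

lemma sum_square_le: "(\<Sum>i\<in>I. x i)\<^sup>2 \<le> real (card I) * (\<Sum>i\<in>I. (x i :: real)\<^sup>2)"
  using Cauchy_Schwarz_ineq_sum[of "\<lambda>_. 1" x I] by simp

lemma square_add_le: "(a + b)\<^sup>2 \<le> 2 * a\<^sup>2 + 2 * (b :: real)\<^sup>2"
  using sum_squares_bound[of a b] by (simp add: power2_sum)

section \<open>Whitened rows\<close>

locale whitened =
  fixes J :: "'b set" and R :: "nat set" and z :: "nat \<Rightarrow> 'b \<Rightarrow> real"
  assumes finJ: "finite J" and finR: "finite R"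
    and orthonormal: "a \<in> J \<Longrightarrow> b \<in> J \<Longrightarrow> (\<Sum>i\<in>R. z i a * z i b) = real (card R) * of_bool (a = b)"
begin

lemma sum_dot_square: "(\<Sum>i\<in>R. (dot J u (z i))\<^sup>2) = real (card R) * dot J u u"
proof -
  have "(\<Sum>i\<in>R. (dot J u (z i))\<^sup>2) = (\<Sum>i\<in>R. \<Sum>a\<in>J. \<Sum>b\<in>J. u a * u b * (z i a * z i b))"
    by (simp add: dot_def power2_eq_square sum_product mult_ac)
  also have "\<dots> = (\<Sum>a\<in>J. \<Sum>i\<in>R. \<Sum>b\<in>J. u a * u b * (z i a * z i b))" by (rule sum.swap)
  also have "\<dots> = (\<Sum>a\<in>J. \<Sum>b\<in>J. \<Sum>i\<in>R. u a * u b * (z i a * z i b))"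
    by (intro sum.cong refl sum.swap)
  also have "\<dots> = (\<Sum>a\<in>J. \<Sum>b\<in>J. u a * u b * (real (card R) * of_bool (a = b)))"
    by (intro sum.cong refl) (simp add: sum_distrib_left[symmetric] orthonormal)
  also have "\<dots> = (\<Sum>a\<in>J. u a * u a * real (card R))"
  proof (intro sum.cong refl)
    fix a assume a: "a \<in> J"
    have "(\<Sum>b\<in>J. u a * u b * (real (card R) * of_bool (a = b))) = (\<Sum>b\<in>J. if a = b then u a * u b * real (card R) else 0)"
      by (intro sum.cong refl) simp
    then show "(\<Sum>b\<in>J. u a * u b * (real (card R) * of_bool (a = b))) = u a * u a * real (card R)"
      using a finJ by simp
  qed
  finally show ?thesis by (simp add: dot_def sum_distrib_left mult_ac)
qed

text \<open>Testing the isotropy identity on \<open>z l\<close> itself: its own summand is already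
  |z_l|^4.\<close>

lemma leverage_le: "l \<in> R \<Longrightarrow> dot J (z l) (z l) \<le> real (card R)"
proof -
  assume l: "l \<in> R"
  have "(dot J (z l) (z l))\<^sup>2 \<le> (\<Sum>i\<in>R. (dot J (z l) (z i))\<^sup>2)"
    using l finR by (intro member_le_sum) auto
  also have "\<dots> = real (card R) * dot J (z l) (z l)" by (rule sum_dot_square)
  finally have "dot J (z l) (z l) * dot J (z l) (z l) \<le> real (card R) * dot J (z l) (z l)"
    by (simp add: power2_eq_square)
  then show ?thesis
    by (cases "dot J (z l) (z l) = 0") (auto intro: mult_right_le_imp_le simp: less_le)
qed

lemma sum_leverage: "(\<Sum>i\<in>R. dot J (z i) (z i)) = real (card R) * real (card J)"
proof -
  have "(\<Sum>i\<in>R. dot J (z i) (z i)) = (\<Sum>a\<in>J. \<Sum>i\<in>R. z i a * z i a)"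
    unfolding dot_def by (rule sum.swap)
  then show ?thesis by (simp add: orthonormal)
qed

lemma card_J_le: "R \<noteq> {} \<Longrightarrow> card J \<le> card R"
proof -
  assume "R \<noteq> {}"
  then have W: "0 < card R" using finR by (simp add: card_gt_0_iff)
  have "real (card R) * real (card J) \<le> (\<Sum>i\<in>R. real (card R))"
    unfolding sum_leverage[symmetric] by (intro sum_mono leverage_le)
  then have "real (card R) * real (card J) \<le> real (card R) * real (card R)" by simp
  then show ?thesis using W by (simp only: of_nat_0_less_iff mult_le_cancel_left_pos of_nat_le_iff)
qed

text \<open>Deliberately crude: it is the trace bound from which the power iteration starts, where
  any polynomial in card R is harmless.\<close>

lemma sum_quad_norm_le: "(\<Sum>i\<in>R. dot (J \<times> J) (quad (z i)) (quad (z i))) \<le> real (card R) ^ 3"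
proof (cases "R = {}")
  case False
  let ?W = "real (card R)" and ?D = "real (card J)"
  have "(\<Sum>i\<in>R. dot (J \<times> J) (quad (z i)) (quad (z i))) \<le> (\<Sum>i\<in>R. ?W * dot J (z i) (z i) - 2 * dot J (z i) (z i) + ?D)"
    unfolding dot_quad_quad[OF finJ] power2_eq_square
    using leverage_le by (intro sum_mono) (auto intro!: mult_right_mono)
  also have "\<dots> = ?W * (?W * ?D) - 2 * (?W * ?D) + ?W * ?D"
    by (simp add: sum.distrib sum_subtractf sum_distrib_left[symmetric] sum_leverage)
  also have "\<dots> \<le> ?W * (?W * ?D)" by simp
  also have "\<dots> \<le> ?W * (?W * ?W)" using card_J_le[OF False] by (intro mult_left_mono) auto
  finally show ?thesis by (simp add: power3_eq_cube mult.assoc)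
qed simp

lemma sum_dot_quad: "(\<Sum>i\<in>R. dot (J \<times> J) A (quad (z i))) = 0"
proof -
  have "(\<Sum>i\<in>R. dot (J \<times> J) A (quad (z i))) = (\<Sum>p\<in>J \<times> J. A p * (\<Sum>i\<in>R. quad (z i) p))"
    unfolding dot_def by (subst sum.swap) (simp add: sum_distrib_left)
  also have "\<dots> = 0"
    by (rule sum.neutral) (auto simp: quad_def sum_subtractf orthonormal)
  finally show ?thesis .
qed

context
  fixes I :: "nat set" and Y :: "'c set" and y :: "nat \<Rightarrow> 'c \<Rightarrow> real" and \<Lambda> :: "'b \<Rightarrow> 'c \<Rightarrow> real"
    and N C :: real
  assumes IR: "I \<subseteq> R" and finY: "finite Y" and I0: "I \<noteq> {}"
    and lin: "\<And>i b. i \<in> I \<Longrightarrow> b \<in> J \<Longrightarrow> z i b = (\<Sum>c\<in>Y. \<Lambda> b c * y i c)"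
    and N: "real (card R) \<le> N" and C: "0 \<le> C"
    and upper: "\<And>B. (\<Sum>i\<in>I. (dot (Y \<times> Y) B (quad (y i)))\<^sup>2) \<le> C * N * dot (Y \<times> Y) B B"
    and lower: "\<And>v. N / 16 * dot Y v v \<le> (\<Sum>i\<in>I. (dot Y v (y i))\<^sup>2)"
begin

text \<open>The clean rows carry energy at least (N/16) |v|^2 in any direction v, and all whitened
  rows together carry at most N |\<beta>|^2 in direction \<beta>. Comparing the two for v =
  \<Lambda>^T \<beta> limits the distortion that corrupted rows cause through the whitening.\<close>

lemma transfer_bound: "(\<Sum>c\<in>Y. (\<Sum>b\<in>J. \<beta> b * \<Lambda> b c)\<^sup>2) \<le> 16 * dot J \<beta> \<beta>"
proof -
  let ?v = "\<lambda>c. \<Sum>b\<in>J. \<beta> b * \<Lambda> b c"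
  have dots: "dot Y ?v (y i) = dot J \<beta> (z i)" if "i \<in> I" for i
    using that by (simp add: dot_def lin sum_mult_sum_cong_swap[symmetric])
  have "N / 16 * dot Y ?v ?v \<le> (\<Sum>i\<in>I. (dot J \<beta> (z i))\<^sup>2)"
    using lower[of ?v] by (simp add: dots)
  also have "\<dots> \<le> (\<Sum>i\<in>R. (dot J \<beta> (z i))\<^sup>2)"
    using IR finR by (intro sum_mono2) auto
  also have "\<dots> \<le> N * dot J \<beta> \<beta>"
    unfolding sum_dot_square using N by (intro mult_right_mono) auto
  finally have *: "N * (dot Y ?v ?v / 16) \<le> N * dot J \<beta> \<beta>" by simp
  have "0 < card R" using I0 IR finR by (auto simp: card_gt_0_iff)
  then have "0 < N" using N by (simp add: less_le_trans)
  with * have "dot Y ?v ?v / 16 \<le> dot J \<beta> \<beta>" by (rule mult_left_le_imp_le)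
  then show ?thesis by (simp add: dot_def power2_eq_square)
qed

text \<open>Pulling A back to B = \<Lambda>^T A \<Lambda> turns clean energies into those of the
  known sample y, at the cost of a factor 16^2 = 256 in the squared norm. The centring terms differ
  by a constant \<tau>, which accounts for the second summand. The constant is 1536 = 6 * 256, where
  6 = 2 + 4 collects the direct bound and the clean part of \<tau>.\<close>

lemma filter_energy_le:
  fixes A
  defines "E \<equiv> \<lambda>i. dot (J \<times> J) A (quad (z i))"
  shows "(\<Sum>i\<in>I. (E i)\<^sup>2) \<le> 1536 * C * N * dot (J \<times> J) A A + 4 * (real (card (R - I)) / real (card I)) * (\<Sum>i\<in>R - I. (E i)\<^sup>2)"
proof -
  define T where "T = (\<lambda>a c'. \<Sum>b\<in>J. A (a, b) * \<Lambda> b c')"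
  define B where "B = (\<lambda>(c, c'). \<Sum>a\<in>J. T a c' * \<Lambda> a c)"
  define b where "b = (\<lambda>i. dot (Y \<times> Y) B (quad (y i)))"
  define \<tau> where "\<tau> = (\<Sum>c\<in>Y. B (c, c)) - (\<Sum>a\<in>J. A (a, a))"
  have finI: "finite I" using IR finR by (rule finite_subset)
  have cI: "0 < real (card I)" using I0 finI by (simp add: card_gt_0_iff)
  have quadform: "(\<Sum>a\<in>J. \<Sum>b\<in>J. A (a, b) * (z i a * z i b)) = (\<Sum>c\<in>Y. \<Sum>c'\<in>Y. B (c, c') * (y i c * y i c'))"
    if i: "i \<in> I" for i
  proof -
    have "(\<Sum>a\<in>J. \<Sum>b\<in>J. A (a, b) * (z i a * z i b)) = (\<Sum>a\<in>J. z i a * (\<Sum>b\<in>J. A (a, b) * z i b))"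
      by (simp add: sum_distrib_left mult_ac)
    also have "\<dots> = (\<Sum>a\<in>J. z i a * (\<Sum>c'\<in>Y. T a c' * y i c'))"
      using i by (simp add: lin T_def sum_mult_sum_cong_swap cong: sum.cong)
    also have "\<dots> = (\<Sum>c'\<in>Y. (\<Sum>a\<in>J. z i a * T a c') * y i c')" by (rule sum_mult_sum_cong_swap)
    also have "\<dots> = (\<Sum>c'\<in>Y. (\<Sum>c\<in>Y. B (c, c') * y i c) * y i c')"
    proof (intro sum.cong refl arg_cong2[where f="(*)"])
      fix c'
      have "(\<Sum>a\<in>J. z i a * T a c') = (\<Sum>a\<in>J. T a c' * (\<Sum>c\<in>Y. \<Lambda> a c * y i c))"
        using i by (intro sum.cong refl) (simp add: lin)
      then show "(\<Sum>a\<in>J. z i a * T a c') = (\<Sum>c\<in>Y. B (c, c') * y i c)"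
        by (simp add: sum_mult_sum_cong_swap B_def)
    qed
    also have "\<dots> = (\<Sum>c'\<in>Y. \<Sum>c\<in>Y. B (c, c') * (y i c * y i c'))"
      by (simp add: sum_distrib_right mult.assoc)
    also have "\<dots> = (\<Sum>c\<in>Y. \<Sum>c'\<in>Y. B (c, c') * (y i c * y i c'))" by (rule sum.swap)
    finally show ?thesis .
  qed
  have E: "E i = b i + \<tau>" if "i \<in> I" for i
    unfolding E_def b_def \<tau>_def dot_quad[OF finJ] dot_quad[OF finY] quadform[OF that] by simp
  have "dot (Y \<times> Y) B B = (\<Sum>c'\<in>Y. \<Sum>c\<in>Y. (B (c, c'))\<^sup>2)"
    unfolding dot_prod by (subst sum.swap) (simp add: power2_eq_square)
  also have "\<dots> \<le> (\<Sum>c'\<in>Y. 16 * (\<Sum>a\<in>J. (T a c')\<^sup>2))"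
    using transfer_bound[of "\<lambda>a. T a c'" for c'] by (intro sum_mono) (simp add: B_def dot_def power2_eq_square)
  also have "\<dots> = 16 * (\<Sum>a\<in>J. \<Sum>c'\<in>Y. (T a c')\<^sup>2)"
    unfolding sum_distrib_left[symmetric] by (subst sum.swap) simp
  also have "\<dots> \<le> 16 * (\<Sum>a\<in>J. 16 * (\<Sum>b\<in>J. (A (a, b))\<^sup>2))"
    using transfer_bound[of "\<lambda>b. A (a, b)" for a] by (intro mult_left_mono sum_mono) (auto simp: T_def dot_def power2_eq_square)
  also have "\<dots> = 256 * dot (J \<times> J) A A"
    by (simp add: dot_prod power2_eq_square sum_distrib_left)
  finally have BA: "dot (Y \<times> Y) B B \<le> 256 * dot (J \<times> J) A A" .
  have N0: "0 \<le> N" using N by (meson of_nat_0_le_iff order_trans)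
  have bs: "(\<Sum>i\<in>I. (b i)\<^sup>2) \<le> C * N * (256 * dot (J \<times> J) A A)"
    unfolding b_def by (rule order_trans[OF upper mult_left_mono[OF BA]]) (simp add: C N0)
  \<comment> \<open>Whitening makes E sum to zero over R, which expresses \<tau> through the clean
    fluctuations b and the energies of the remaining rows.\<close>
  have "0 = (\<Sum>i\<in>I. E i) + (\<Sum>i\<in>R - I. E i)"
    using sum_dot_quad[of A] sum.subset_diff[OF IR finR, of E] unfolding E_def by simp
  then have "real (card I) * \<tau> = - ((\<Sum>i\<in>I. b i) + (\<Sum>i\<in>R - I. E i))"
    by (simp add: E sum.distrib)
  then have "(real (card I) * \<tau>)\<^sup>2 = ((\<Sum>i\<in>I. b i) + (\<Sum>i\<in>R - I. E i))\<^sup>2" by (simp only: power2_minus)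
  also have "\<dots> \<le> 2 * (\<Sum>i\<in>I. b i)\<^sup>2 + 2 * (\<Sum>i\<in>R - I. E i)\<^sup>2" by (rule square_add_le)
  also have "\<dots> \<le> 2 * (real (card I) * (\<Sum>i\<in>I. (b i)\<^sup>2)) + 2 * (real (card (R - I)) * (\<Sum>i\<in>R - I. (E i)\<^sup>2))"
    by (intro add_mono mult_left_mono sum_square_le) auto
  finally have "real (card I) * (real (card I) * \<tau>\<^sup>2) \<le> real (card I) *
      (2 * (\<Sum>i\<in>I. (b i)\<^sup>2) + 2 * (real (card (R - I)) / real (card I)) * (\<Sum>i\<in>R - I. (E i)\<^sup>2))"
    using cI by (simp add: distrib_left power_mult_distrib power2_eq_square[of "real (card I)"] mult_ac)
  then have \<tau>: "real (card I) * \<tau>\<^sup>2 \<le>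
      2 * (\<Sum>i\<in>I. (b i)\<^sup>2) + 2 * (real (card (R - I)) / real (card I)) * (\<Sum>i\<in>R - I. (E i)\<^sup>2)"
    using cI by (rule mult_left_le_imp_le)
  have "(\<Sum>i\<in>I. (E i)\<^sup>2) = (\<Sum>i\<in>I. (b i + \<tau>)\<^sup>2)" by (simp add: E)
  also have "\<dots> \<le> (\<Sum>i\<in>I. 2 * (b i)\<^sup>2 + 2 * \<tau>\<^sup>2)" by (intro sum_mono square_add_le)
  also have "\<dots> = 2 * (\<Sum>i\<in>I. (b i)\<^sup>2) + 2 * (real (card I) * \<tau>\<^sup>2)"
    by (simp add: sum.distrib sum_distrib_left)
  finally show ?thesis using \<tau> bs by (simp add: algebra_simps)
qed

end

text \<open>Since u vanishes on I, all of the energy card R sits on the other rows, so their centred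
  squares sum to card R - card (R - I). Cauchy-Schwarz turns this first-order excess into a lower
  bound for the sum of squares.\<close>

lemma degenerate_direction_energy:
  assumes I: "I \<subseteq> R" and u: "dot J u u = 1" "\<And>i. i \<in> I \<Longrightarrow> dot J u (z i) = 0"
  shows "(real (card R) - real (card (R - I)))\<^sup>2 \<le>
    real (card (R - I)) * (\<Sum>i\<in>R. (dot (J \<times> J) (\<lambda>(a, b). u a * u b) (quad (z i)))\<^sup>2)"
proof -
  let ?e = "\<lambda>i. (dot J u (z i))\<^sup>2 - 1"
  have E: "dot (J \<times> J) (\<lambda>(a, b). u a * u b) (quad (z i)) = ?e i" for i
    by (simp add: dot_quad_rank_one finJ u)
  have "real (card R) = (\<Sum>i\<in>I. (dot J u (z i))\<^sup>2) + (\<Sum>i\<in>R - I. (dot J u (z i))\<^sup>2)"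
    using sum_dot_square[of u] sum.subset_diff[OF I finR, of "\<lambda>i. (dot J u (z i))\<^sup>2"] u by simp
  then have "real (card R) - real (card (R - I)) = (\<Sum>i\<in>R - I. ?e i)"
    by (simp add: sum_subtractf u)
  then have "(real (card R) - real (card (R - I)))\<^sup>2 \<le> real (card (R - I)) * (\<Sum>i\<in>R - I. (?e i)\<^sup>2)"
    by (simp only: sum_square_le)
  also have "\<dots> \<le> real (card (R - I)) * (\<Sum>i\<in>R. (?e i)\<^sup>2)"
    using finR by (intro mult_left_mono sum_mono2) auto
  finally show ?thesis unfolding E .
qed

end

section \<open>Gram--Schmidt orthogonalization with coefficients\<close>

text \<open>A vector \<open>f :: nat + nat \<Rightarrow> real\<close> carries row values \<open>f (Inl i)\<close> and, as \<open>f (Inr c)\<close>, its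
  coefficients with respect to the original columns.\<close>

definition row_dot :: "nat \<Rightarrow> (nat + nat \<Rightarrow> real) \<Rightarrow> (nat + nat \<Rightarrow> real) \<Rightarrow> real" where
  "row_dot n f g = (\<Sum>i<n. f (Inl i) * g (Inl i))"

text \<open>Division by zero yields zero, so a column with zero residual is subtracted with factor
  zero and dependent columns need no case distinction.\<close>

primrec gs_reduce :: "nat \<Rightarrow> (nat \<Rightarrow> nat + nat \<Rightarrow> real) \<Rightarrow> (nat + nat \<Rightarrow> real) \<Rightarrow> nat \<Rightarrow> nat + nat \<Rightarrow> real" where
  "gs_reduce n F f 0 = f"
| "gs_reduce n F f (Suc a) = (\<lambda>x. gs_reduce n F f a x -
    row_dot n (F a) (gs_reduce n F f a) / row_dot n (F a) (F a) * F a x)"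

primrec gs :: "nat \<Rightarrow> (nat \<Rightarrow> nat + nat \<Rightarrow> real) \<Rightarrow> nat \<Rightarrow> nat \<Rightarrow> nat + nat \<Rightarrow> real" where
  "gs n U 0 = (\<lambda>_ _. 0)"
| "gs n U (Suc b) = (gs n U b)(b := gs_reduce n (gs n U b) (U b) b)"

lemma gs_reduce_cong: "(\<And>a'. a' < a \<Longrightarrow> F a' = F' a') \<Longrightarrow> gs_reduce n F f a = gs_reduce n F' f a"
  by (induction a) auto

lemma gs_stable: "b \<le> e \<Longrightarrow> a < b \<Longrightarrow> gs n U e a = gs n U b a"
  by (induction e rule: dec_induct) auto

lemma gs_unfold: "b < d \<Longrightarrow> gs n U d b = gs_reduce n (gs n U d) (U b) b"
  using gs_stable[of "Suc b" d b n U] gs_reduce_cong[of b "gs n U b" "gs n U d" n "U b"] gs_stable[of b d _ n U]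
  by simp

lemma row_dot_commute: "row_dot n f g = row_dot n g f"
  by (simp add: row_dot_def mult.commute)

lemma row_dot_diff_right: "row_dot n f (\<lambda>x. g x - c * h x) = row_dot n f g - c * row_dot n f h"
  by (simp add: row_dot_def right_diff_distrib sum_subtractf sum_distrib_left mult_ac)

lemma row_dot_self_nonneg: "0 \<le> row_dot n f f"
  by (simp add: row_dot_def sum_nonneg)

lemma row_dot_self_eq_0: "row_dot n f f = 0 \<longleftrightarrow> (\<forall>i<n. f (Inl i) = 0)"
  by (auto simp: row_dot_def sum_nonneg_eq_0_iff)

lemma gs_reduce_orthogonal:
  assumes "\<And>a b. a < b \<Longrightarrow> b < e \<Longrightarrow> row_dot n (F a) (F b) = 0"
  shows "e' \<le> e \<Longrightarrow> a < e' \<Longrightarrow> row_dot n (F a) (gs_reduce n F f e') = 0"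
proof (induction e')
  case (Suc c)
  show ?case
  proof (cases "a = c")
    case True
    \<comment> \<open>With \<open>x / 0 = 0\<close> nothing is subtracted in this case, and a column
      of norm zero is orthogonal to everything anyway.\<close>
    have "row_dot n (F c) (gs_reduce n F f c) = 0" if "row_dot n (F c) (F c) = 0"
      using that unfolding row_dot_self_eq_0 by (simp add: row_dot_def)
    then show ?thesis using True
      by (cases "row_dot n (F c) (F c) = 0") (simp_all only: gs_reduce.simps row_dot_diff_right, simp_all)
  next
    case False
    then have "row_dot n (F a) (gs_reduce n F f c) = 0" "row_dot n (F a) (F c) = 0"
      using Suc assms[of a c] by auto
    then show ?thesis by (simp only: gs_reduce.simps row_dot_diff_right)
  qed
qed simp

lemma gs_orthogonal: "a < b \<Longrightarrow> b < d \<Longrightarrow> row_dot n (gs n U d a) (gs n U d b) = 0"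
proof (induction b arbitrary: a rule: less_induct)
  case (less b)
  have "row_dot n (gs n U d a) (gs_reduce n (gs n U d) (U b) b) = 0"
    by (rule gs_reduce_orthogonal[of b]) (use less in auto)
  then show ?case using less by (simp add: gs_unfold)
qed

lemma gs_reduce_expand: "\<exists>h. \<forall>x. gs_reduce n F f a x = f x - (\<Sum>a'<a. h a' * F a' x)"
proof (induction a)
  case (Suc a)
  then obtain h where h: "\<And>x. gs_reduce n F f a x = f x - (\<Sum>a'<a. h a' * F a' x)" by blast
  let ?c = "row_dot n (F a) (gs_reduce n F f a) / row_dot n (F a) (F a)"
  have "gs_reduce n F f (Suc a) x = f x - (\<Sum>a'<Suc a. (h(a := ?c)) a' * F a' x)" for x
    using h[of x] by simp
  then show ?case by blast
qed simp

lemma gs_expand: "b < d \<Longrightarrow> \<exists>h. \<forall>x. U b x = gs n U d b x + (\<Sum>a<b. h a * gs n U d a x)"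
  using gs_reduce_expand[of n "gs n U d" "U b" b] gs_unfold[of b d n U] by (metis diff_add_cancel)

lemma gs_linear_closed:
  assumes "P (\<lambda>_. 0)" "\<And>f g c. P f \<Longrightarrow> P g \<Longrightarrow> P (\<lambda>x. f x - c * g x)" "\<And>b. b < e \<Longrightarrow> P (U b)"
  shows "P (gs n U e b)"
  using assms(3)
proof (induction e arbitrary: b)
  case (Suc e)
  have IH: "P (gs n U e b)" for b using Suc by simp
  have "P (gs_reduce n (gs n U e) (U e) a)" for a
    by (induction a) (simp_all only: gs_reduce.simps assms(2) IH Suc.prems lessI)
  then show ?case using IH by simp
qed (simp add: assms(1))

section \<open>A loop language and its compilation\<close>

text \<open>
  Expressions and statements refer to index registers directly.  At nesting level \<open>L\<close> the registers
  below \<open>L\<close> are readable, and a loop or a sum at that level counts in register \<open>L\<close>.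
\<close>

datatype expr = Num int | Ld nat nat nat | EAdd expr expr | ESub expr expr | EMul expr expr
  | EDiv expr expr | ESum nat expr | IfIndexLess nat nat expr expr | IfLess expr expr expr expr

datatype stmt = Store nat nat nat expr | For nat stmt | Then stmt stmt (infixr ";;" 60)

type_synonym arrays = "nat \<Rightarrow> nat \<Rightarrow> nat \<Rightarrow> real"

primrec eval_expr :: "expr \<Rightarrow> nat \<Rightarrow> (nat \<Rightarrow> nat) \<Rightarrow> arrays \<Rightarrow> real" where
  "eval_expr (Num c) L \<rho> A = real_of_int c"
| "eval_expr (Ld a i j) L \<rho> A = A a (\<rho> i) (\<rho> j)"
| "eval_expr (EAdd e f) L \<rho> A = eval_expr e L \<rho> A + eval_expr f L \<rho> A"
| "eval_expr (ESub e f) L \<rho> A = eval_expr e L \<rho> A - eval_expr f L \<rho> A"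
| "eval_expr (EMul e f) L \<rho> A = eval_expr e L \<rho> A * eval_expr f L \<rho> A"
| "eval_expr (EDiv e f) L \<rho> A = eval_expr e L \<rho> A / eval_expr f L \<rho> A"
| "eval_expr (ESum N e) L \<rho> A = (\<Sum>x<\<rho> N. eval_expr e (Suc L) (\<rho>(L := x)) A)"
| "eval_expr (IfIndexLess i j e f) L \<rho> A = (if \<rho> i < \<rho> j then eval_expr e L \<rho> A else eval_expr f L \<rho> A)"
| "eval_expr (IfLess a b e f) L \<rho> A =
    (if eval_expr a L \<rho> A < eval_expr b L \<rho> A then eval_expr e L \<rho> A else eval_expr f L \<rho> A)"

primrec iter :: "(nat \<Rightarrow> 'a \<Rightarrow> 'a) \<Rightarrow> nat \<Rightarrow> 'a \<Rightarrow> 'a" where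
  "iter f 0 a = a"
| "iter f (Suc n) a = f n (iter f n a)"

primrec run :: "stmt \<Rightarrow> nat \<Rightarrow> (nat \<Rightarrow> nat) \<Rightarrow> arrays \<Rightarrow> arrays" where
  "run (Store a i j e) = (\<lambda>L \<rho> A. A(a := (A a)(\<rho> i := (A a (\<rho> i))(\<rho> j := eval_expr e L \<rho> A))))"
| "run (For N p) = (\<lambda>L \<rho> A. iter (\<lambda>x. run p (Suc L) (\<rho>(L := x))) (\<rho> N) A)"
| "run (p ;; q) = (\<lambda>L \<rho> A. run q L \<rho> (run p L \<rho> A))"

primrec wf_expr :: "expr \<Rightarrow> nat \<Rightarrow> bool" where
  "wf_expr (Num c) L \<longleftrightarrow> True"
| "wf_expr (Ld a i j) L \<longleftrightarrow> i < L \<and> j < L"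
| "wf_expr (EAdd e f) L \<longleftrightarrow> wf_expr e L \<and> wf_expr f L"
| "wf_expr (ESub e f) L \<longleftrightarrow> wf_expr e L \<and> wf_expr f L"
| "wf_expr (EMul e f) L \<longleftrightarrow> wf_expr e L \<and> wf_expr f L"
| "wf_expr (EDiv e f) L \<longleftrightarrow> wf_expr e L \<and> wf_expr f L"
| "wf_expr (ESum N e) L \<longleftrightarrow> N < L \<and> wf_expr e (Suc L)"
| "wf_expr (IfIndexLess i j e f) L \<longleftrightarrow> i < L \<and> j < L \<and> wf_expr e L \<and> wf_expr f L"
| "wf_expr (IfLess a b e f) L \<longleftrightarrow> wf_expr a L \<and> wf_expr b L \<and> wf_expr e L \<and> wf_expr f L"

primrec wf_stmt :: "stmt \<Rightarrow> nat \<Rightarrow> bool" where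
  "wf_stmt (Store a i j e) L \<longleftrightarrow> i < L \<and> j < L \<and> wf_expr e L"
| "wf_stmt (For N p) L \<longleftrightarrow> N < L \<and> wf_stmt p (Suc L)"
| "wf_stmt (p ;; q) L \<longleftrightarrow> wf_stmt p L \<and> wf_stmt q L"

text \<open>Register L counts. There is no increment instruction, so the constant 1 is loaded into
  register L + 1, which is free between two runs of the body.\<close>

definition loop :: "nat \<Rightarrow> nat \<Rightarrow> prog \<Rightarrow> prog" where
  "loop L N p = Seq (Instr (IConst L 0))
    (While (ILess L N) (Seq p (Seq (Instr (IConst (Suc L) 1)) (Instr (IAdd L L (Suc L))))))"

text \<open>The value is left in real register r and the registers below r survive, so intermediate
  values form a stack and each node needs only r and r + 1.\<close>

primrec compile_expr :: "expr \<Rightarrow> nat \<Rightarrow> nat \<Rightarrow> prog" where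
  "compile_expr (Num c) L r = Instr (RConst r c)"
| "compile_expr (Ld a i j) L r = Instr (RLoad r a i j)"
| "compile_expr (EAdd e f) L r =
    Seq (compile_expr e L r) (Seq (compile_expr f L (Suc r)) (Instr (RAdd r r (Suc r))))"
| "compile_expr (ESub e f) L r =
    Seq (compile_expr e L r) (Seq (compile_expr f L (Suc r)) (Instr (RSub r r (Suc r))))"
| "compile_expr (EMul e f) L r =
    Seq (compile_expr e L r) (Seq (compile_expr f L (Suc r)) (Instr (RMul r r (Suc r))))"
| "compile_expr (EDiv e f) L r =
    Seq (compile_expr e L r) (Seq (compile_expr f L (Suc r)) (Instr (RDiv r r (Suc r))))"
| "compile_expr (ESum N e) L r =
    Seq (Instr (RConst r 0))
      (loop L N (Seq (compile_expr e (Suc L) (Suc r)) (Instr (RAdd r r (Suc r)))))"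
| "compile_expr (IfIndexLess i j e f) L r = If (ILess i j) (compile_expr e L r) (compile_expr f L r)"
| "compile_expr (IfLess a b e f) L r =
    Seq (compile_expr a L r) (Seq (compile_expr b L (Suc r))
      (If (RLess r (Suc r)) (compile_expr e L r) (compile_expr f L r)))"

primrec compile :: "stmt \<Rightarrow> nat \<Rightarrow> prog" where
  "compile (Store a i j e) L = Seq (compile_expr e L 0) (Instr (RStore a i j 0))"
| "compile (For N p) L = loop L N (compile p (Suc L))"
| "compile (p ;; q) L = Seq (compile p L) (compile q L)"

text \<open>X bounds all readable index registers. A conditional is charged for both branches, which
  keeps the bound a polynomial expression in X.\<close>

primrec expr_time :: "expr \<Rightarrow> nat \<Rightarrow> nat" where
  "expr_time (Num c) X = 1"
| "expr_time (Ld a i j) X = 1"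
| "expr_time (EAdd e f) X = expr_time e X + expr_time f X + 1"
| "expr_time (ESub e f) X = expr_time e X + expr_time f X + 1"
| "expr_time (EMul e f) X = expr_time e X + expr_time f X + 1"
| "expr_time (EDiv e f) X = expr_time e X + expr_time f X + 1"
| "expr_time (ESum N e) X = X * (expr_time e X + 4) + 3"
| "expr_time (IfIndexLess i j e f) X = expr_time e X + expr_time f X + 1"
| "expr_time (IfLess a b e f) X = expr_time a X + expr_time b X + expr_time e X + expr_time f X + 1"

primrec stmt_time :: "stmt \<Rightarrow> nat \<Rightarrow> nat" where
  "stmt_time (Store a i j e) X = expr_time e X + 1"
| "stmt_time (For N p) X = X * (stmt_time p X + 3) + 2"
| "stmt_time (p ;; q) X = stmt_time p X + stmt_time q X"

text \<open>Each iteration costs the body, the two counter instructions and the test; the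
  initialization and the last failing test make up the remaining 2. The body must also restore the
  counter, hence \<open>y < Suc L\<close>.\<close>

lemma exec_loop:
  assumes N: "N < L" and X: "\<rho> N \<le> X"
    and body: "\<And>x m. x < \<rho> N \<Longrightarrow> \<forall>y<L. ireg m y = \<rho> y \<Longrightarrow> ireg m L = x \<Longrightarrow> Inv x (arr m) (rreg m) \<Longrightarrow>
      \<exists>t m'. exec p m t m' \<and> t \<le> T \<and> (\<forall>y<Suc L. ireg m' y = ireg m y) \<and> Inv (Suc x) (arr m') (rreg m')"
    and m: "\<forall>y<L. ireg m y = \<rho> y" "Inv 0 (arr m) (rreg m)"
  shows "\<exists>t m'. exec (loop L N p) m t m' \<and> t \<le> X * (T + 3) + 2 \<and> (\<forall>y<L. ireg m' y = \<rho> y) \<and>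
    Inv (\<rho> N) (arr m') (rreg m')"
proof -
  let ?w = "While (ILess L N) (Seq p (Seq (Instr (IConst (Suc L) 1)) (Instr (IAdd L L (Suc L)))))"
  have main: "\<exists>t m'. exec ?w m t m' \<and> t \<le> k * (T + 3) + 1 \<and> (\<forall>y<L. ireg m' y = \<rho> y) \<and>
    Inv (\<rho> N) (arr m') (rreg m')"
    if "k + x = \<rho> N" "\<forall>y<L. ireg m y = \<rho> y" "ireg m L = x" "Inv x (arr m) (rreg m)" for k x m
    using that
  proof (induction k arbitrary: x m)
    case 0
    then have "\<not> holds (ILess L N) m" using N by simp
    then have "exec ?w m 1 m" by (rule exec.WhileFalse)
    then show ?case using 0 by (intro exI[of _ 1] exI[of _ m]) auto
  next
    case (Suc k)
    have x: "x < \<rho> N" using Suc.prems(1) by simp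
    obtain t m1 where m1: "exec p m t m1" "t \<le> T" "\<forall>y<Suc L. ireg m1 y = ireg m y" "Inv (Suc x) (arr m1) (rreg m1)"
      using body[OF x Suc.prems(2,3,4)] by blast
    define m2 where "m2 = step (IAdd L L (Suc L)) (step (IConst (Suc L) 1) m1)"
    have e2: "exec (Seq p (Seq (Instr (IConst (Suc L) 1)) (Instr (IAdd L L (Suc L))))) m (t + (1 + 1)) m2"
      unfolding m2_def by (rule exec.Seq m1(1) exec.Instr)+
    have m2: "\<forall>y<L. ireg m2 y = \<rho> y" "ireg m2 L = Suc x" "Inv (Suc x) (arr m2) (rreg m2)"
      using m1 Suc.prems by (auto simp: m2_def)
    from Suc.IH[of "Suc x" m2] m2 Suc.prems(1) obtain t' m' where
      "exec ?w m2 t' m'" "t' \<le> k * (T + 3) + 1" "\<forall>y<L. ireg m' y = \<rho> y" "Inv (\<rho> N) (arr m') (rreg m')"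
      by auto
    note m' = this
    have "holds (ILess L N) m" using x Suc.prems N by simp
    then have "exec ?w m (t + (1 + 1) + t' + 1) m'" using e2 m'(1) by (rule exec.WhileTrue)
    moreover have "t + (1 + 1) + t' + 1 \<le> Suc k * (T + 3) + 1" using m1(2) m'(2) by simp
    ultimately show ?case using m'(3,4) by blast
  qed
  let ?m = "step (IConst L 0) m"
  obtain t m' where r: "exec ?w ?m t m'" "t \<le> \<rho> N * (T + 3) + 1" "\<forall>y<L. ireg m' y = \<rho> y" "Inv (\<rho> N) (arr m') (rreg m')"
    using main[of "\<rho> N" 0 ?m] m by auto
  have "\<rho> N * (T + 3) \<le> X * (T + 3)" using X by (rule mult_right_mono) simp
  then have "1 + t \<le> X * (T + 3) + 2" using r(2) by linarith
  then show ?thesis unfolding loop_def using exec.Seq[OF exec.Instr r(1)] r(3,4) by blast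
qed

lemma compile_expr_correct:
  assumes "wf_expr e L" "\<forall>x<L. ireg m x = \<rho> x" "\<forall>x<L. \<rho> x \<le> X"
  shows "\<exists>t m'. exec (compile_expr e L r) m t m' \<and> t \<le> expr_time e X \<and> (\<forall>x<L. ireg m' x = ireg m x) \<and>
    arr m' = arr m \<and> rreg m' r = eval_expr e L \<rho> (arr m) \<and> (\<forall>x<r. rreg m' x = rreg m x)"
  using assms
proof (induction e arbitrary: L m \<rho> r)
  case (Num c)
  show ?case
    by (rule exI[of _ 1], rule exI[of _ "step (RConst r c) m"]) (use exec.Instr[of "RConst r c" m] in auto)
next
  case (Ld a i j)
  then show ?case
    by (intro exI[of _ 1] exI[of _ "step (RLoad r a i j) m"]) (use exec.Instr[of "RLoad r a i j" m] in auto)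
next
  case (EAdd e f)
  obtain t m1 where 1: "exec (compile_expr e L r) m t m1" "t \<le> expr_time e X" "\<forall>x<L. ireg m1 x = ireg m x"
    "arr m1 = arr m" "rreg m1 r = eval_expr e L \<rho> (arr m)" "\<forall>x<r. rreg m1 x = rreg m x"
    using EAdd.IH(1)[of L m \<rho> r] EAdd.prems by auto
  obtain u m2 where 2: "exec (compile_expr f L (Suc r)) m1 u m2" "u \<le> expr_time f X" "\<forall>x<L. ireg m2 x = ireg m1 x"
    "arr m2 = arr m1" "rreg m2 (Suc r) = eval_expr f L \<rho> (arr m1)" "\<forall>x<Suc r. rreg m2 x = rreg m1 x"
    using EAdd.IH(2)[of L m1 \<rho> "Suc r"] EAdd.prems 1 by auto
  have "exec (compile_expr (EAdd e f) L r) m (t + (u + 1)) (step (RAdd r r (Suc r)) m2)"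
    by (simp only: compile_expr.simps) (rule exec.Seq 1(1) 2(1) exec.Instr)+
  then show ?case using 1 2
    by (intro exI[of _ "t + (u + 1)"] exI[of _ "step (RAdd r r (Suc r)) m2"]) auto
next
  case (ESub e f)
  obtain t m1 where 1: "exec (compile_expr e L r) m t m1" "t \<le> expr_time e X" "\<forall>x<L. ireg m1 x = ireg m x"
    "arr m1 = arr m" "rreg m1 r = eval_expr e L \<rho> (arr m)" "\<forall>x<r. rreg m1 x = rreg m x"
    using ESub.IH(1)[of L m \<rho> r] ESub.prems by auto
  obtain u m2 where 2: "exec (compile_expr f L (Suc r)) m1 u m2" "u \<le> expr_time f X" "\<forall>x<L. ireg m2 x = ireg m1 x"
    "arr m2 = arr m1" "rreg m2 (Suc r) = eval_expr f L \<rho> (arr m1)" "\<forall>x<Suc r. rreg m2 x = rreg m1 x"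
    using ESub.IH(2)[of L m1 \<rho> "Suc r"] ESub.prems 1 by auto
  have "exec (compile_expr (ESub e f) L r) m (t + (u + 1)) (step (RSub r r (Suc r)) m2)"
    by (simp only: compile_expr.simps) (rule exec.Seq 1(1) 2(1) exec.Instr)+
  then show ?case using 1 2
    by (intro exI[of _ "t + (u + 1)"] exI[of _ "step (RSub r r (Suc r)) m2"]) auto
next
  case (EMul e f)
  obtain t m1 where 1: "exec (compile_expr e L r) m t m1" "t \<le> expr_time e X" "\<forall>x<L. ireg m1 x = ireg m x"
    "arr m1 = arr m" "rreg m1 r = eval_expr e L \<rho> (arr m)" "\<forall>x<r. rreg m1 x = rreg m x"
    using EMul.IH(1)[of L m \<rho> r] EMul.prems by auto
  obtain u m2 where 2: "exec (compile_expr f L (Suc r)) m1 u m2" "u \<le> expr_time f X" "\<forall>x<L. ireg m2 x = ireg m1 x"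
    "arr m2 = arr m1" "rreg m2 (Suc r) = eval_expr f L \<rho> (arr m1)" "\<forall>x<Suc r. rreg m2 x = rreg m1 x"
    using EMul.IH(2)[of L m1 \<rho> "Suc r"] EMul.prems 1 by auto
  have "exec (compile_expr (EMul e f) L r) m (t + (u + 1)) (step (RMul r r (Suc r)) m2)"
    by (simp only: compile_expr.simps) (rule exec.Seq 1(1) 2(1) exec.Instr)+
  then show ?case using 1 2
    by (intro exI[of _ "t + (u + 1)"] exI[of _ "step (RMul r r (Suc r)) m2"]) auto
next
  case (EDiv e f)
  obtain t m1 where 1: "exec (compile_expr e L r) m t m1" "t \<le> expr_time e X" "\<forall>x<L. ireg m1 x = ireg m x"
    "arr m1 = arr m" "rreg m1 r = eval_expr e L \<rho> (arr m)" "\<forall>x<r. rreg m1 x = rreg m x"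
    using EDiv.IH(1)[of L m \<rho> r] EDiv.prems by auto
  obtain u m2 where 2: "exec (compile_expr f L (Suc r)) m1 u m2" "u \<le> expr_time f X" "\<forall>x<L. ireg m2 x = ireg m1 x"
    "arr m2 = arr m1" "rreg m2 (Suc r) = eval_expr f L \<rho> (arr m1)" "\<forall>x<Suc r. rreg m2 x = rreg m1 x"
    using EDiv.IH(2)[of L m1 \<rho> "Suc r"] EDiv.prems 1 by auto
  have "exec (compile_expr (EDiv e f) L r) m (t + (u + 1)) (step (RDiv r r (Suc r)) m2)"
    by (simp only: compile_expr.simps) (rule exec.Seq 1(1) 2(1) exec.Instr)+
  then show ?case using 1 2
    by (intro exI[of _ "t + (u + 1)"] exI[of _ "step (RDiv r r (Suc r)) m2"]) auto
next
  case (ESum N e)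
  let ?Inv = "\<lambda>x A R. A = arr m \<and> R r = (\<Sum>y<x. eval_expr e (Suc L) (\<rho>(L := y)) (arr m)) \<and> (\<forall>y<r. R y = rreg m y)"
  let ?p = "Seq (compile_expr e (Suc L) (Suc r)) (Instr (RAdd r r (Suc r)))"
  have body: "\<exists>t m'. exec ?p m1 t m' \<and> t \<le> expr_time e X + 1 \<and> (\<forall>y<Suc L. ireg m' y = ireg m1 y) \<and> ?Inv (Suc x) (arr m') (rreg m')"
    if m1: "x < \<rho> N" "\<forall>y<L. ireg m1 y = \<rho> y" "ireg m1 L = x" "?Inv x (arr m1) (rreg m1)" for x m1
  proof -
    have h: "\<forall>y<Suc L. ireg m1 y = (\<rho>(L := x)) y" using m1 by (auto simp: less_Suc_eq)
    have h': "\<forall>y<Suc L. (\<rho>(L := x)) y \<le> X"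
      using ESum.prems m1 by (auto simp: less_Suc_eq intro: less_imp_le order_trans)
    have wf: "wf_expr e (Suc L)" using ESum.prems by simp
    obtain t m2 where 2: "exec (compile_expr e (Suc L) (Suc r)) m1 t m2" "t \<le> expr_time e X"
      "\<forall>x<Suc L. ireg m2 x = ireg m1 x" "arr m2 = arr m1"
      "rreg m2 (Suc r) = eval_expr e (Suc L) (\<rho>(L := x)) (arr m1)" "\<forall>x<Suc r. rreg m2 x = rreg m1 x"
      using ESum.IH[OF wf h h', of "Suc r"] by (elim exE conjE)
    then have "exec ?p m1 (t + 1) (step (RAdd r r (Suc r)) m2)" by - (rule exec.Seq exec.Instr | assumption)+
    then show ?thesis using 2 m1
      by (intro exI[of _ "t + 1"] exI[of _ "step (RAdd r r (Suc r)) m2"]) auto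
  qed
  let ?m = "step (RConst r 0) m"
  have "\<exists>t m'. exec (loop L N ?p) ?m t m' \<and> t \<le> X * (expr_time e X + 1 + 3) + 2 \<and> (\<forall>y<L. ireg m' y = \<rho> y) \<and> ?Inv (\<rho> N) (arr m') (rreg m')"
    by (rule exec_loop[where Inv = ?Inv, OF _ _ body]) (use ESum.prems in auto)
  then obtain t m' where "exec (loop L N ?p) ?m t m'" "t \<le> X * (expr_time e X + 1 + 3) + 2"
    "\<forall>y<L. ireg m' y = \<rho> y" "?Inv (\<rho> N) (arr m') (rreg m')" by blast
  moreover have "exec (compile_expr (ESum N e) L r) m (1 + t) m'"
    using \<open>exec (loop L N ?p) ?m t m'\<close> by (simp only: compile_expr.simps) (rule exec.Seq exec.Instr | assumption)+
  ultimately show ?case using ESum.prems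
    by (intro exI[of _ "1 + t"] exI[of _ m']) (auto simp: algebra_simps)
next
  case (IfIndexLess i j e f)
  show ?case
  proof (cases "\<rho> i < \<rho> j")
    case True
    obtain t m1 where 1: "exec (compile_expr e L r) m t m1" "t \<le> expr_time e X" "\<forall>x<L. ireg m1 x = ireg m x"
      "arr m1 = arr m" "rreg m1 r = eval_expr e L \<rho> (arr m)" "\<forall>x<r. rreg m1 x = rreg m x"
      using IfIndexLess.IH(1)[of L m \<rho> r] IfIndexLess.prems by auto
    then have "exec (compile_expr (IfIndexLess i j e f) L r) m (t + 1) m1"
      using True IfIndexLess.prems by (simp only: compile_expr.simps) (auto intro!: exec.IfTrue simp del: One_nat_def)
    then show ?thesis using 1 True by (intro exI[of _ "t + 1"] exI[of _ m1]) auto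
  next
    case False
    obtain t m1 where 1: "exec (compile_expr f L r) m t m1" "t \<le> expr_time f X" "\<forall>x<L. ireg m1 x = ireg m x"
      "arr m1 = arr m" "rreg m1 r = eval_expr f L \<rho> (arr m)" "\<forall>x<r. rreg m1 x = rreg m x"
      using IfIndexLess.IH(2)[of L m \<rho> r] IfIndexLess.prems by auto
    then have "exec (compile_expr (IfIndexLess i j e f) L r) m (t + 1) m1"
      using False IfIndexLess.prems by (simp only: compile_expr.simps) (auto intro!: exec.IfFalse simp del: One_nat_def)
    then show ?thesis using 1 False by (intro exI[of _ "t + 1"] exI[of _ m1]) auto
  qed
next
  case (IfLess a b e f)
  obtain t m1 where 1: "exec (compile_expr a L r) m t m1" "t \<le> expr_time a X" "\<forall>x<L. ireg m1 x = ireg m x"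
    "arr m1 = arr m" "rreg m1 r = eval_expr a L \<rho> (arr m)" "\<forall>x<r. rreg m1 x = rreg m x"
    using IfLess.IH(1)[of L m \<rho> r] IfLess.prems by auto
  obtain u m2 where 2: "exec (compile_expr b L (Suc r)) m1 u m2" "u \<le> expr_time b X" "\<forall>x<L. ireg m2 x = ireg m1 x"
    "arr m2 = arr m1" "rreg m2 (Suc r) = eval_expr b L \<rho> (arr m1)" "\<forall>x<Suc r. rreg m2 x = rreg m1 x"
    using IfLess.IH(2)[of L m1 \<rho> "Suc r"] IfLess.prems 1 by auto
  show ?case
  proof (cases "rreg m2 r < rreg m2 (Suc r)")
    case True
    obtain w m3 where 3: "exec (compile_expr e L r) m2 w m3" "w \<le> expr_time e X" "\<forall>x<L. ireg m3 x = ireg m2 x"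
      "arr m3 = arr m2" "rreg m3 r = eval_expr e L \<rho> (arr m2)" "\<forall>x<r. rreg m3 x = rreg m2 x"
      using IfLess.IH(3)[of L m2 \<rho> r] IfLess.prems 1 2 by auto
    have "exec (compile_expr (IfLess a b e f) L r) m (t + (u + (w + 1))) m3"
      using True by (simp only: compile_expr.simps) (rule exec.Seq 1(1) 2(1) 3(1) exec.IfTrue | simp)+
    then show ?thesis using 1 2 3 True by (intro exI[of _ "t + (u + (w + 1))"] exI[of _ m3]) auto
  next
    case False
    obtain w m3 where 3: "exec (compile_expr f L r) m2 w m3" "w \<le> expr_time f X" "\<forall>x<L. ireg m3 x = ireg m2 x"
      "arr m3 = arr m2" "rreg m3 r = eval_expr f L \<rho> (arr m2)" "\<forall>x<r. rreg m3 x = rreg m2 x"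
      using IfLess.IH(4)[of L m2 \<rho> r] IfLess.prems 1 2 by auto
    have "exec (compile_expr (IfLess a b e f) L r) m (t + (u + (w + 1))) m3"
      using False by (simp only: compile_expr.simps) (rule exec.Seq 1(1) 2(1) 3(1) exec.IfFalse | simp)+
    then show ?thesis using 1 2 3 False by (intro exI[of _ "t + (u + (w + 1))"] exI[of _ m3]) auto
  qed
qed

lemma compile_correct:
  assumes "wf_stmt p L" "\<forall>x<L. ireg m x = \<rho> x" "\<forall>x<L. \<rho> x \<le> X"
  shows "\<exists>t m'. exec (compile p L) m t m' \<and> t \<le> stmt_time p X \<and> (\<forall>x<L. ireg m' x = ireg m x) \<and>
    arr m' = run p L \<rho> (arr m)"
  using assms
proof (induction p arbitrary: L m \<rho>)
  case (Store a i j e)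
  obtain t m1 where 1: "exec (compile_expr e L 0) m t m1" "t \<le> expr_time e X" "\<forall>x<L. ireg m1 x = ireg m x"
    "arr m1 = arr m" "rreg m1 0 = eval_expr e L \<rho> (arr m)"
    using compile_expr_correct[of e L m \<rho> X 0] Store.prems by auto
  then have "exec (compile (Store a i j e) L) m (t + 1) (step (RStore a i j 0) m1)"
    by (simp only: compile.simps) (rule exec.Seq exec.Instr | assumption)+
  then show ?case using 1 Store.prems
    by (intro exI[of _ "t + 1"] exI[of _ "step (RStore a i j 0) m1"]) auto
next
  case (For N p)
  let ?Inv = "\<lambda>x A R. A = iter (\<lambda>x. run p (Suc L) (\<rho>(L := x))) x (arr m)"
  have body: "\<exists>t m'. exec (compile p (Suc L)) m1 t m' \<and> t \<le> stmt_time p X \<and> (\<forall>y<Suc L. ireg m' y = ireg m1 y) \<and> ?Inv (Suc x) (arr m') (rreg m')"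
    if m1: "x < \<rho> N" "\<forall>y<L. ireg m1 y = \<rho> y" "ireg m1 L = x" "?Inv x (arr m1) (rreg m1)" for x m1
  proof -
    have r: "\<forall>y<Suc L. ireg m1 y = (\<rho>(L := x)) y" using m1 by (auto simp: less_Suc_eq)
    have X: "\<forall>y<Suc L. (\<rho>(L := x)) y \<le> X"
      using For.prems m1 by (auto simp: less_Suc_eq intro: less_imp_le order_trans)
    have wf: "wf_stmt p (Suc L)" using For.prems by simp
    obtain t m' where "exec (compile p (Suc L)) m1 t m' \<and> t \<le> stmt_time p X \<and>
      (\<forall>y<Suc L. ireg m' y = ireg m1 y) \<and> arr m' = run p (Suc L) (\<rho>(L := x)) (arr m1)"
      using For.IH[OF wf r X] by (elim exE)
    then show ?thesis unfolding m1(4) iter.simps by (intro exI)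
  qed
  have "\<exists>t m'. exec (loop L N (compile p (Suc L))) m t m' \<and> t \<le> X * (stmt_time p X + 3) + 2 \<and> (\<forall>y<L. ireg m' y = \<rho> y) \<and> ?Inv (\<rho> N) (arr m') (rreg m')"
    by (rule exec_loop[where Inv = ?Inv, OF _ _ body]) (use For.prems in auto)
  then show ?case using For.prems by auto
next
  case (Then p q)
  obtain t m1 where 1: "exec (compile p L) m t m1" "t \<le> stmt_time p X" "\<forall>x<L. ireg m1 x = ireg m x"
    "arr m1 = run p L \<rho> (arr m)" using Then.IH(1)[of L m \<rho>] Then.prems by auto
  obtain u m2 where 2: "exec (compile q L) m1 u m2" "u \<le> stmt_time q X" "\<forall>x<L. ireg m2 x = ireg m1 x"
    "arr m2 = run q L \<rho> (arr m1)" using Then.IH(2)[of L m1 \<rho>] Then.prems 1 by auto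
  have "exec (compile (p ;; q) L) m (t + u) m2" by (simp only: compile.simps) (rule exec.Seq 1(1) 2(1))+
  then show ?case using 1 2 by (intro exI[of _ "t + u"] exI[of _ m2]) auto
qed

section \<open>Polynomial bounds on running times\<close>

definition poly_bounded :: "(nat \<Rightarrow> nat) \<Rightarrow> bool" where
  "poly_bounded f \<longleftrightarrow> (\<exists>c k. \<forall>X\<ge>1. f X \<le> c * X ^ k)"

lemma poly_bounded_const: "poly_bounded (\<lambda>X. c)"
  unfolding poly_bounded_def by (rule exI[of _ c], rule exI[of _ 0]) simp

lemma poly_bounded_add:
  assumes "poly_bounded f" "poly_bounded g" shows "poly_bounded (\<lambda>X. f X + g X)"
proof -
  obtain c k c' k' where h: "\<And>X. X \<ge> 1 \<Longrightarrow> f X \<le> c * X ^ k" "\<And>X. X \<ge> 1 \<Longrightarrow> g X \<le> c' * X ^ k'"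
    using assms unfolding poly_bounded_def by blast
  have "f X + g X \<le> (c + c') * X ^ (k + k')" if X: "X \<ge> 1" for X
  proof -
    have "c * X ^ k \<le> c * X ^ (k + k')" "c' * X ^ k' \<le> c' * X ^ (k + k')"
      using X by (intro mult_left_mono power_increasing; simp)+
    then show ?thesis using h[OF X] unfolding add_mult_distrib by linarith
  qed
  then show ?thesis unfolding poly_bounded_def by blast
qed

lemma poly_bounded_mult_arg:
  assumes "poly_bounded f" shows "poly_bounded (\<lambda>X. X * f X)"
proof -
  obtain c k where h: "\<And>X. X \<ge> 1 \<Longrightarrow> f X \<le> c * X ^ k"
    using assms unfolding poly_bounded_def by blast
  have "X * f X \<le> c * X ^ Suc k" if X: "X \<ge> 1" for X
    using mult_left_mono[OF h[OF X], of X] by (simp add: mult_ac)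
  then show ?thesis unfolding poly_bounded_def by blast
qed

lemma poly_bounded_Suc: "poly_bounded f \<Longrightarrow> poly_bounded (\<lambda>X. Suc (f X))"
  using poly_bounded_add[OF poly_bounded_const[of 1]] by simp

lemma poly_bounded_expr_time: "poly_bounded (expr_time e)"
  by (induction e) (simp_all add: poly_bounded_const poly_bounded_add poly_bounded_mult_arg poly_bounded_Suc)

lemma poly_bounded_stmt_time: "poly_bounded (stmt_time p)"
  by (induction p) (simp_all add: poly_bounded_const poly_bounded_add poly_bounded_mult_arg poly_bounded_Suc
    poly_bounded_expr_time)

lemma iter_eqI:
  assumes "P 0 = A" "\<And>x. x < N \<Longrightarrow> f x (P x) = P (Suc x)"
  shows "iter f N A = P N"
  using assms(2) by (induction N) (auto simp: assms(1))

lemma iter_invariant: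
  assumes "Q 0 A" "\<And>x A. x < N \<Longrightarrow> Q x A \<Longrightarrow> Q (Suc x) (f x A)"
  shows "Q N (iter f N A)"
  using assms(2) by (induction N) (auto simp: assms(1))

section \<open>The filter\<close>

text \<open>Rounding the weights to 0 or 1 makes all later statistics unweighted sums over the kept
  rows. The threshold 1/2 is written as \<open>1 < v i + v i\<close> because program constants are
  integers.\<close>

definition row_mask :: "(nat \<Rightarrow> real) \<Rightarrow> nat \<Rightarrow> real" where
  "row_mask v i = (if 1 < v i + v i then 1 else 0)"

definition matvec :: "nat \<Rightarrow> (nat \<Rightarrow> nat \<Rightarrow> real) \<Rightarrow> (nat \<Rightarrow> real) \<Rightarrow> nat \<Rightarrow> real" where
  "matvec n G c = (\<lambda>i. \<Sum>l<n. G i l * c l)"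

definition peak :: "nat \<Rightarrow> (nat \<Rightarrow> real) \<Rightarrow> real" where
  "peak n s = iter (\<lambda>i m. if m < s i then s i else m) n 0"

lemma peak_nonneg: "0 \<le> peak n s"
  unfolding peak_def by (induction n) auto

lemma le_peak: "i < n \<Longrightarrow> s i \<le> peak n s"
  unfolding peak_def by (induction n) (auto simp: less_Suc_eq)

lemma peak_attained: "peak n s = 0 \<or> (\<exists>i<n. peak n s = s i)"
  unfolding peak_def by (induction n) (auto simp: less_Suc_eq)

locale data =
  fixes n d :: nat and X :: "nat \<Rightarrow> nat \<Rightarrow> real" and thr :: real
begin

definition masked_columns :: "(nat \<Rightarrow> real) \<Rightarrow> (nat \<Rightarrow> real) \<Rightarrow> nat \<Rightarrow> nat + nat \<Rightarrow> real" where
  "masked_columns inn v b = case_sum (\<lambda>i. row_mask v i * inn b * X i b) (\<lambda>c. inn b * of_bool (b = c))"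

definition gs_cols :: "(nat \<Rightarrow> real) \<Rightarrow> (nat \<Rightarrow> real) \<Rightarrow> nat \<Rightarrow> nat + nat \<Rightarrow> real" where
  "gs_cols inn v = gs n (masked_columns inn v) d"

definition gs_norm :: "(nat \<Rightarrow> real) \<Rightarrow> (nat \<Rightarrow> real) \<Rightarrow> nat \<Rightarrow> real" where
  "gs_norm inn v b = row_dot n (gs_cols inn v b) (gs_cols inn v b)"

definition weight :: "(nat \<Rightarrow> real) \<Rightarrow> real" where
  "weight v = (\<Sum>i<n. row_mask v i)"

text \<open>Since \<open>0 / 0 = 0\<close>, this counts the columns with non-zero residual.\<close>

definition gs_dim :: "(nat \<Rightarrow> real) \<Rightarrow> (nat \<Rightarrow> real) \<Rightarrow> real" where
  "gs_dim inn v = (\<Sum>b<d. gs_norm inn v b / gs_norm inn v b)"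

text \<open>The inner product of two whitened rows. The square roots in their scaling cancel, so
  field operations suffice to compute it.\<close>

definition kernel :: "(nat \<Rightarrow> real) \<Rightarrow> (nat \<Rightarrow> real) \<Rightarrow> nat \<Rightarrow> nat \<Rightarrow> real" where
  "kernel inn v i l = weight v *
    (\<Sum>b<d. gs_cols inn v b (Inl i) * gs_cols inn v b (Inl l) / gs_norm inn v b)"

text \<open>Inner products of the centred outer products of the kept rows, by the formula of
  \<open>dot_quad_quad\<close>.\<close>

definition gram :: "(nat \<Rightarrow> real) \<Rightarrow> (nat \<Rightarrow> real) \<Rightarrow> nat \<Rightarrow> nat \<Rightarrow> real" where
  "gram inn v i l = row_mask v i * row_mask v l *
    (kernel inn v i l * kernel inn v i l - kernel inn v i i - kernel inn v l l + gs_dim inn v)"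

text \<open>Coefficients of S^n q_l with respect to the vectors q_i, where S is the frame operator
  of the kept rows. Iterating the n by n Gram matrix avoids working in the space of pairs of
  coordinates.\<close>

definition probe :: "(nat \<Rightarrow> real) \<Rightarrow> (nat \<Rightarrow> real) \<Rightarrow> nat \<Rightarrow> nat \<Rightarrow> real" where
  "probe inn v l = (matvec n (gram inn v) ^^ n) (\<lambda>i. of_bool (i = l))"

definition response :: "(nat \<Rightarrow> real) \<Rightarrow> (nat \<Rightarrow> real) \<Rightarrow> nat \<Rightarrow> nat \<Rightarrow> real" where
  "response inn v l = matvec n (gram inn v) (probe inn v l)"

text \<open>With A = S^n q_l the two sides are thr * weight * |A|^2 and \<Sum> <A, q_i>^2, that is,
  they compare the moments of q_l at 2n and 2n + 1. A suspicious l thus comes with an explicit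
  violating A.\<close>

definition suspicious :: "(nat \<Rightarrow> real) \<Rightarrow> (nat \<Rightarrow> real) \<Rightarrow> nat \<Rightarrow> bool" where
  "suspicious inn v l \<longleftrightarrow> thr * weight v * (\<Sum>i<n. probe inn v l i * response inn v l i) <
    (\<Sum>i<n. response inn v l i * response inn v l i)"

text \<open>Any suspicious l would serve; the fold keeps the last one because the program overwrites
  its score array.\<close>

definition scores :: "(nat \<Rightarrow> real) \<Rightarrow> (nat \<Rightarrow> real) \<Rightarrow> nat \<Rightarrow> real" where
  "scores inn v = iter (\<lambda>l s. if suspicious inn v l then (\<lambda>i. response inn v l i * response inn v l i) else s) n (\<lambda>_. 0)"

text \<open>The factor 2 makes the largest decrement exactly 1/2, the width of the interval above
  the keeping threshold. If nothing is suspicious, \<open>0 / 0 = 0\<close> leaves the weights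
  fixed.\<close>

definition reweigh :: "(nat \<Rightarrow> real) \<Rightarrow> (nat \<Rightarrow> real) \<Rightarrow> nat \<Rightarrow> real" where
  "reweigh inn v = (\<lambda>i. v i - scores inn v i / (2 * peak n (scores inn v)))"

lemma scores_cases:
  obtains "scores inn v = (\<lambda>_. 0)" "\<forall>l<n. \<not> suspicious inn v l"
  | l where "l < n" "suspicious inn v l" "scores inn v = (\<lambda>i. response inn v l i * response inn v l i)"
proof -
  let ?f = "\<lambda>l s. if suspicious inn v l then (\<lambda>i. response inn v l i * response inn v l i) else s"
  have "(iter ?f m (\<lambda>_. 0) = (\<lambda>_. 0) \<and> (\<forall>l<m. \<not> suspicious inn v l)) \<or>
    (\<exists>l<m. suspicious inn v l \<and> iter ?f m (\<lambda>_. 0) = (\<lambda>i. response inn v l i * response inn v l i))" for m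
    by (induction m) (auto simp: less_Suc_eq)
  from this[of n] that show thesis unfolding scores_def by blast
qed

definition kept :: "(nat \<Rightarrow> real) \<Rightarrow> nat set" where
  "kept v = {i. i < n \<and> 1 < v i + v i}"

lemma finite_kept [simp]: "finite (kept v)"
  by (simp add: kept_def)

lemma weight_eq: "weight v = real (card (kept v))"
proof -
  have "weight v = (\<Sum>i\<in>{..<n}. if i \<in> kept v then 1 else 0)"
    unfolding weight_def by (intro sum.cong refl) (simp add: row_mask_def kept_def)
  also have "\<dots> = real (card ({..<n} \<inter> kept v))" by (simp add: sum.If_cases)
  also have "{..<n} \<inter> kept v = kept v" by (auto simp: kept_def)
  finally show ?thesis .
qed

section \<open>The filter in terms of whitened rows\<close>

context
  fixes inn v :: "nat \<Rightarrow> real"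
begin

abbreviation "F \<equiv> gs_cols inn v"
abbreviation "\<nu> \<equiv> gs_norm inn v"

definition active :: "nat set" where "active = {b. b < d \<and> \<nu> b \<noteq> 0}"

definition whitened_row :: "nat \<Rightarrow> nat \<Rightarrow> real" where
  "whitened_row i b = sqrt (weight v) * F b (Inl i) / sqrt (\<nu> b)"

lemma gs_norm_nonneg: "0 \<le> \<nu> b"
  by (simp add: gs_norm_def row_dot_self_nonneg)

lemma gs_cols_rows: "F b (Inl i) = row_mask v i * (\<Sum>c<d. F b (Inr c) * X i c)"
proof -
  have "\<forall>i. F b (Inl i) = row_mask v i * (\<Sum>c<d. F b (Inr c) * X i c)"
    unfolding gs_cols_def
  proof (rule gs_linear_closed)
    fix f g :: "nat + nat \<Rightarrow> real" and c :: real
    assume f: "\<forall>i. f (Inl i) = row_mask v i * (\<Sum>c<d. f (Inr c) * X i c)"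
      and g: "\<forall>i. g (Inl i) = row_mask v i * (\<Sum>c<d. g (Inr c) * X i c)"
    show "\<forall>i. f (Inl i) - c * g (Inl i) = row_mask v i * (\<Sum>c'<d. (f (Inr c') - c * g (Inr c')) * X i c')"
    proof
      fix i
      have "(\<Sum>c'<d. (f (Inr c') - c * g (Inr c')) * X i c') = (\<Sum>c'<d. f (Inr c') * X i c') - c * (\<Sum>c'<d. g (Inr c') * X i c')"
        by (simp add: left_diff_distrib sum_subtractf sum_distrib_left mult.assoc)
      then show "f (Inl i) - c * g (Inl i) = row_mask v i * (\<Sum>c'<d. (f (Inr c') - c * g (Inr c')) * X i c')"
        using f[rule_format, of i] g[rule_format, of i] by (simp only: right_diff_distrib mult.left_commute)
    qed
  next
    fix b assume b: "b < d"
    show "\<forall>i. masked_columns inn v b (Inl i) = row_mask v i * (\<Sum>c<d. masked_columns inn v b (Inr c) * X i c)"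
    proof
      fix i
      have "(\<Sum>c<d. masked_columns inn v b (Inr c) * X i c) = (\<Sum>c<d. if b = c then inn b * X i c else 0)"
        by (intro sum.cong refl) (simp add: masked_columns_def)
      also have "\<dots> = inn b * X i b" using b by simp
      finally show "masked_columns inn v b (Inl i) = row_mask v i * (\<Sum>c<d. masked_columns inn v b (Inr c) * X i c)"
        by (simp add: masked_columns_def)
    qed
  qed simp
  then show ?thesis by blast
qed

lemma gs_cols_off_kept: "i < n \<Longrightarrow> i \<notin> kept v \<Longrightarrow> F b (Inl i) = 0"
  by (subst gs_cols_rows) (simp add: row_mask_def kept_def)

lemma gs_cols_coeff_inn: "inn c = 0 \<Longrightarrow> F b (Inr c) = 0"
  unfolding gs_cols_def by (rule gs_linear_closed) (auto simp: masked_columns_def)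

lemma gs_cols_coeff_upper: "b < d \<Longrightarrow> b < c \<Longrightarrow> F b (Inr c) = 0"
proof -
  assume b: "b < d" "b < c"
  have "gs n (masked_columns inn v) (Suc b) b (Inr c) = 0"
    by (rule gs_linear_closed) (use b in \<open>auto simp: masked_columns_def\<close>)
  then show ?thesis using b gs_stable[of "Suc b" d b] unfolding gs_cols_def by simp
qed

text \<open>The coefficients are triangular with diagonal \<open>inn\<close>, so when the
  orthogonalized column of a used coordinate vanishes, it exhibits a relation in which that
  coordinate has coefficient 1.\<close>

lemma gs_cols_coeff_diag: "b < d \<Longrightarrow> F b (Inr b) = inn b"
proof -
  assume b: "b < d"
  obtain h where h: "\<And>x. masked_columns inn v b x = F b x + (\<Sum>a<b. h a * F a x)"
    using gs_expand[OF b, of "masked_columns inn v" n] unfolding gs_cols_def by blast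
  have "(\<Sum>a<b. h a * F a (Inr b)) = 0"
    using b by (intro sum.neutral) (auto simp: gs_cols_coeff_upper)
  then show ?thesis using h[of "Inr b"] by (simp add: masked_columns_def)
qed

lemma gs_cols_orthogonal: "a < d \<Longrightarrow> b < d \<Longrightarrow> a \<noteq> b \<Longrightarrow> row_dot n (F a) (F b) = 0"
  using gs_orthogonal[of a b d n] gs_orthogonal[of b a d n] unfolding gs_cols_def
  by (cases "a < b") (auto simp: row_dot_commute)

lemma row_dot_kept: "row_dot n (F a) (F b) = (\<Sum>i\<in>kept v. F a (Inl i) * F b (Inl i))"
  unfolding row_dot_def by (rule sum.mono_neutral_right) (auto simp: kept_def gs_cols_off_kept)

lemma inactive_zero: "b < d \<Longrightarrow> b \<notin> active \<Longrightarrow> i < n \<Longrightarrow> F b (Inl i) = 0"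
  unfolding active_def gs_norm_def by (simp add: row_dot_self_eq_0)

lemma whitened_kept: "whitened active (kept v) whitened_row"
proof
  show "finite active" by (simp add: active_def)
  show "finite (kept v)" by simp
  fix a b assume ab: "a \<in> active" "b \<in> active"
  have "(\<Sum>i\<in>kept v. whitened_row i a * whitened_row i b) =
      (\<Sum>i\<in>kept v. weight v / (sqrt (\<nu> a) * sqrt (\<nu> b)) * (F a (Inl i) * F b (Inl i)))"
    by (intro sum.cong refl) (simp add: whitened_row_def weight_eq field_simps)
  also have "\<dots> = weight v / (sqrt (\<nu> a) * sqrt (\<nu> b)) * row_dot n (F a) (F b)"
    by (simp add: row_dot_kept sum_distrib_left)
  also have "\<dots> = real (card (kept v)) * of_bool (a = b)"
  proof (cases "a = b")
    case True
    then show ?thesis using ab gs_norm_nonneg[of b] by (simp add: weight_eq active_def gs_norm_def[symmetric])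
  next
    case False
    then show ?thesis using ab by (simp add: gs_cols_orthogonal active_def)
  qed
  finally show "(\<Sum>i\<in>kept v. whitened_row i a * whitened_row i b) = real (card (kept v)) * of_bool (a = b)" .
qed

interpretation W: whitened active "kept v" whitened_row by (rule whitened_kept)

lemma gs_dim_eq: "gs_dim inn v = real (card active)"
proof -
  have "gs_dim inn v = (\<Sum>b<d. if b \<in> active then 1 else 0)"
    unfolding gs_dim_def by (intro sum.cong refl) (simp add: active_def)
  also have "\<dots> = real (card ({..<d} \<inter> active))" by (simp add: sum.If_cases)
  also have "{..<d} \<inter> active = active" by (auto simp: active_def)
  finally show ?thesis .
qed

lemma kernel_eq: "kernel inn v i l = dot active (whitened_row i) (whitened_row l)"
proof -
  have "dot active (whitened_row i) (whitened_row l) = (\<Sum>b\<in>active. weight v * (F b (Inl i) * F b (Inl l) / \<nu> b))"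
    unfolding dot_def using gs_norm_nonneg
    by (intro sum.cong refl) (simp add: whitened_row_def weight_eq)
  also have "\<dots> = (\<Sum>b<d. weight v * (F b (Inl i) * F b (Inl l) / \<nu> b))"
    by (rule sum.mono_neutral_left) (auto simp: active_def)
  finally show ?thesis by (simp add: kernel_def sum_distrib_left)
qed

abbreviation "q \<equiv> \<lambda>i. quad (whitened_row i)"
abbreviation "A2 \<equiv> active \<times> active"
abbreviation "H \<equiv> frame_op A2 (kept v) q"

lemma finite_A2: "finite A2"
  by (simp add: active_def)

lemma gram_kept: "i \<in> kept v \<Longrightarrow> l \<in> kept v \<Longrightarrow> gram inn v i l = dot A2 (q i) (q l)"
  using W.finJ by (simp add: gram_def row_mask_def kept_def kernel_eq gs_dim_eq dot_quad_quad power2_eq_square)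

lemma gram_off1: "i < n \<Longrightarrow> i \<notin> kept v \<Longrightarrow> gram inn v i l = 0"
  by (simp add: gram_def row_mask_def kept_def)

lemma gram_off2: "l < n \<Longrightarrow> l \<notin> kept v \<Longrightarrow> gram inn v i l = 0"
  by (simp add: gram_def row_mask_def kept_def)

lemma matvec_kept: "i \<in> kept v \<Longrightarrow> matvec n (gram inn v) c i = dot A2 (q i) (\<lambda>p. \<Sum>l\<in>kept v. c l * q l p)"
proof -
  assume i: "i \<in> kept v"
  have "matvec n (gram inn v) c i = (\<Sum>l\<in>kept v. gram inn v i l * c l)"
    unfolding matvec_def by (rule sum.mono_neutral_right) (auto simp: kept_def gram_off2)
  then show ?thesis using i by (simp add: dot_sum_right gram_kept mult.commute)
qed

lemma matvec_off_kept: "i < n \<Longrightarrow> i \<notin> kept v \<Longrightarrow> matvec n (gram inn v) c i = 0"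
  by (simp add: matvec_def gram_off1)

text \<open>The synthesis map sending coefficients c to \<Sum> c_i q_i intertwines the Gram matrix
  with the frame operator, so powers correspond to powers.\<close>

lemma probe_power:
  assumes l: "l \<in> kept v"
  shows "(\<lambda>p. \<Sum>i\<in>kept v. (matvec n (gram inn v) ^^ t) (\<lambda>i. of_bool (i = l)) i * q i p) = (H ^^ t) (q l)"
proof (induction t)
  case 0
  have "(\<Sum>i\<in>kept v. of_bool (i = l) * q i p) = q l p" for p
    using l by (simp add: of_bool_def if_distrib[where f="\<lambda>x. x * _"] sum.delta cong: if_cong)
  then show ?case by simp
next
  case (Suc t)
  have "(\<Sum>i\<in>kept v. (matvec n (gram inn v) ^^ Suc t) (\<lambda>i. of_bool (i = l)) i * q i p) = H ((H ^^ t) (q l)) p" for p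
    unfolding Suc[symmetric] by (simp add: matvec_kept frame_op_def)
  then show ?case by simp
qed

lemma response_kept: "l \<in> kept v \<Longrightarrow> i \<in> kept v \<Longrightarrow> response inn v l i = dot A2 (q i) ((H ^^ n) (q l))"
  unfolding response_def probe_def by (simp add: matvec_kept probe_power)

lemma response_off_kept: "i < n \<Longrightarrow> i \<notin> kept v \<Longrightarrow> response inn v l i = 0"
  unfolding response_def by (rule matvec_off_kept)

lemma sum_response: "l \<in> kept v \<Longrightarrow>
    (\<Sum>i<n. response inn v l i * response inn v l i) = frame_moment A2 (kept v) q (q l) (2 * n + 1)"
proof -
  assume l: "l \<in> kept v"
  have "(\<Sum>i<n. response inn v l i * response inn v l i) = (\<Sum>i\<in>kept v. response inn v l i * response inn v l i)"
    by (rule sum.mono_neutral_right) (auto simp: kept_def response_off_kept)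
  then show ?thesis using l by (simp only: frame_moment_odd) (simp add: response_kept power2_eq_square)
qed

lemma sum_probe_response: "l \<in> kept v \<Longrightarrow>
    (\<Sum>i<n. probe inn v l i * response inn v l i) = frame_moment A2 (kept v) q (q l) (2 * n)"
proof -
  assume l: "l \<in> kept v"
  have "(\<Sum>i<n. probe inn v l i * response inn v l i) = (\<Sum>i\<in>kept v. probe inn v l i * response inn v l i)"
    by (rule sum.mono_neutral_right) (auto simp: kept_def response_off_kept)
  also have "\<dots> = (\<Sum>i\<in>kept v. probe inn v l i * dot A2 ((H ^^ n) (q l)) (q i))"
    using l by (simp add: response_kept dot_commute)
  also have "\<dots> = dot A2 ((H ^^ n) (q l)) (\<lambda>p. \<Sum>i\<in>kept v. probe inn v l i * q i p)"
    by (simp add: dot_sum_right)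
  also have "(\<lambda>p. \<Sum>i\<in>kept v. probe inn v l i * q i p) = (H ^^ n) (q l)"
    unfolding probe_def by (rule probe_power[OF l])
  finally show ?thesis by (simp add: frame_moment_even)
qed

text \<open>For a row outside the mask the first matrix-vector product is already zero, and the
  strict inequality then reads 0 < 0.\<close>

lemma suspicious_kept: "l < n \<Longrightarrow> suspicious inn v l \<Longrightarrow> l \<in> kept v"
proof (rule ccontr)
  assume l: "l < n" "suspicious inn v l" "l \<notin> kept v"
  let ?M = "matvec n (gram inn v)"
  have "?M (\<lambda>i. of_bool (i = l)) = (\<lambda>_. 0)"
    using l by (auto simp: matvec_def of_bool_def gram_off2 intro!: sum.neutral ext)
  moreover have "(?M ^^ t) (\<lambda>_. 0) = (\<lambda>_. 0)" for t
    by (induction t) (auto simp: matvec_def)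
  ultimately have "response inn v l = (\<lambda>_. 0)"
    unfolding response_def probe_def by (metis funpow_swap1)
  then show False using l(2) by (simp add: suspicious_def)
qed

lemma unsuspicious_energy:
  assumes thr: "1 \<le> thr" and R: "kept v \<noteq> {}" and uns: "\<forall>l<n. \<not> suspicious inn v l"
  shows "(\<Sum>i\<in>kept v. (dot A2 (q i) A)\<^sup>2) \<le> 2 * (thr * real (card (kept v))) * dot A2 A A"
proof (rule power_iteration_certificate[where P = n])
  let ?W = "real (card (kept v))"
  have W: "0 < ?W" using R by (simp add: card_gt_0_iff)
  show "finite A2" by (rule finite_A2)
  show "finite (kept v)" by simp
  show "0 < thr * ?W" using thr W by simp
  fix i assume i: "i \<in> kept v"
  then have "\<not> suspicious inn v i" using uns by (simp add: kept_def)
  then show "frame_moment A2 (kept v) q (q i) (2 * n + 1) \<le> thr * ?W * frame_moment A2 (kept v) q (q i) (2 * n)"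
    using i by (simp add: suspicious_def sum_response sum_probe_response weight_eq del: One_nat_def)
next
  let ?W = "real (card (kept v))"
  have "kept v \<subseteq> {..<n}" by (auto simp: kept_def)
  then have "card (kept v) \<le> n" using card_mono[of "{..<n}" "kept v"] by simp
  \<comment> \<open>Running n power steps is ample: this crude estimate already puts the cubic trace
    bound below thr * card (kept v) * 2^(2n+1).\<close>
  then have "?W \<le> 2 ^ n" by (metis of_nat_less_two_power le_less_trans less_imp_le of_nat_le_iff)
  then have "?W\<^sup>2 \<le> (2 ^ n)\<^sup>2" by (rule power_mono) simp
  also have "\<dots> \<le> 2 ^ (2 * n + 1)" by (simp add: power_even_eq)
  finally have "?W * ?W\<^sup>2 \<le> ?W * 2 ^ (2 * n + 1)" by (rule mult_left_mono) simp
  also have "\<dots> \<le> thr * ?W * 2 ^ (2 * n + 1)" using thr mult_right_mono[of 1 thr ?W] by (intro mult_right_mono) auto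
  finally show "(\<Sum>i\<in>kept v. dot A2 (q i) (q i)) \<le> thr * ?W * 2 ^ (2 * n + 1)"
    using W.sum_quad_norm_le by (simp add: power3_eq_cube power2_eq_square mult.assoc)
qed

end

end

section \<open>Analysis of the filter\<close>

text \<open>Here y i is the feature vector of row i and C the constant in the fourth-order bound.
  The factor 12288 is 8 * 1536, with 1536 from \<open>filter_energy_le\<close>; K + 1 in
  \<open>few\<close> is the largest number of columns that a single test looks at.\<close>

locale clean_data = data n d X thr for n d :: nat and X :: "nat \<Rightarrow> nat \<Rightarrow> real" and thr :: real +
  fixes K :: nat and y :: "nat \<Rightarrow> nat \<Rightarrow> real" and M :: "nat \<Rightarrow> nat \<Rightarrow> real"
    and S :: "nat \<Rightarrow> nat set" and C :: real
  assumes n_pos: "0 < n" and C: "1 \<le> C" and thr: "thr = 12288 * C"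
    and clean: "\<And>i j. i < n \<Longrightarrow> j < d \<Longrightarrow> j \<notin> S i \<Longrightarrow> X i j = (\<Sum>a<K. M j a * y i a)"
    and few: "\<And>j. j < d \<Longrightarrow> real (card {i. i < n \<and> j \<in> S i}) * real (K + 1) \<le> real n / (64 * thr)"
    and upper: "\<And>A. (\<Sum>i<n. (dot ({..<K} \<times> {..<K}) A (quad (y i)))\<^sup>2) \<le> C * real n * dot ({..<K} \<times> {..<K}) A A"
    and lower: "\<And>u. real n / 8 * dot {..<K} u u \<le> (\<Sum>i<n. (dot {..<K} u (y i))\<^sup>2)"
begin

lemma thr_ge: "12288 \<le> thr"
  using C thr by simp

text \<open>The removed rows carry little energy: its square is at most their number times their
  fourth-order energy, and \<open>upper\<close> for A = u u^T bounds the latter. Half of the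
  constant 1/8 is given up for them.\<close>

lemma lower_after_removal:
  assumes I: "I \<subseteq> {..<n}" and Q: "real (card ({..<n} - I)) \<le> 3 * (real n / (64 * thr))"
  shows "real n / 16 * dot {..<K} u u \<le> (\<Sum>i\<in>I. (dot {..<K} u (y i))\<^sup>2)"
proof -
  let ?Q = "{..<n} - I" and ?a = "\<lambda>i. (dot {..<K} u (y i))\<^sup>2" and ?N = "real n" and ?u = "dot {..<K} u u"
  have "(\<Sum>i\<in>?Q. (?a i)\<^sup>2) \<le> (\<Sum>i\<in>?Q. 2 * (?a i - ?u)\<^sup>2 + 2 * ?u\<^sup>2)"
    using square_add_le[of "?a i - ?u" ?u for i] by (intro sum_mono) simp
  also have "\<dots> \<le> (\<Sum>i<n. 2 * (?a i - ?u)\<^sup>2 + 2 * ?u\<^sup>2)"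
    by (intro sum_mono2) auto
  also have "\<dots> = 2 * (\<Sum>i<n. (?a i - ?u)\<^sup>2) + 2 * (?N * ?u\<^sup>2)"
    by (simp add: sum.distrib sum_distrib_left)
  also have "(\<Sum>i<n. (?a i - ?u)\<^sup>2) \<le> C * ?N * ?u\<^sup>2"
    using upper[of "\<lambda>(a, b). u a * u b"] by (simp add: dot_quad_rank_one dot_rank_one)
  also have "2 * (C * ?N * ?u\<^sup>2) + 2 * (?N * ?u\<^sup>2) \<le> 4 * (C * ?N * ?u\<^sup>2)"
    using C mult_right_mono[of 1 C "?N * ?u\<^sup>2"] by (simp add: mult.assoc)
  finally have 1: "(\<Sum>i\<in>?Q. (?a i)\<^sup>2) \<le> 4 * (C * ?N * ?u\<^sup>2)" by simp
  have "(\<Sum>i\<in>?Q. ?a i)\<^sup>2 \<le> real (card ?Q) * (\<Sum>i\<in>?Q. (?a i)\<^sup>2)" by (rule sum_square_le)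
  also have "\<dots> \<le> 3 * (?N / (64 * thr)) * (4 * (C * ?N * ?u\<^sup>2))"
    using Q 1 by (intro mult_mono) (auto simp: sum_nonneg intro: order_trans[rotated])
  also have "\<dots> = (12 * C / (64 * thr)) * (?N * ?u)\<^sup>2" by (simp add: power2_eq_square)
  also have "12 * C / (64 * thr) = 12 / (64 * 12288)" using C thr by simp
  also have "12 / (64 * 12288) * (?N * ?u)\<^sup>2 \<le> (1 / 16)\<^sup>2 * (?N * ?u)\<^sup>2"
    by (intro mult_right_mono) (simp_all add: power2_eq_square)
  finally have "(\<Sum>i\<in>?Q. ?a i)\<^sup>2 \<le> (1 / 16 * (?N * ?u))\<^sup>2" by (simp add: power_mult_distrib power_divide)
  then have "(\<Sum>i\<in>?Q. ?a i) \<le> 1 / 16 * (?N * ?u)" by (rule power2_le_imp_le) simp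
  moreover have "(\<Sum>i<n. ?a i) = (\<Sum>i\<in>?Q. ?a i) + (\<Sum>i\<in>I. ?a i)"
    using I by (intro sum.subset_diff) auto
  ultimately show ?thesis using lower[of u] by simp
qed

context
  fixes inn :: "nat \<Rightarrow> real"
  assumes inn01: "\<And>b. inn b = 0 \<or> inn b = 1" and card_inn: "card {b. b < d \<and> inn b = 1} \<le> K + 1"
begin

definition used :: "nat set" where "used = {b. b < d \<and> inn b = 1}"

definition outliers :: "nat set" where "outliers = {i. i < n \<and> S i \<inter> used \<noteq> {}}"

definition inliers :: "nat set" where "inliers = {..<n} - outliers"

lemma finite_outliers [simp]: "finite outliers" and finite_inliers [simp]: "finite inliers"
  by (simp_all add: outliers_def inliers_def)

lemma card_outliers: "real (card outliers) \<le> real n / (64 * thr)"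
proof -
  have fin: "finite used" by (simp add: used_def)
  have "outliers = (\<Union>j\<in>used. {i. i < n \<and> j \<in> S i})" by (auto simp: outliers_def)
  then have "card outliers \<le> (\<Sum>j\<in>used. card {i. i < n \<and> j \<in> S i})"
    using card_UN_le[OF fin] by simp
  then have "real (card outliers) \<le> real (\<Sum>j\<in>used. card {i. i < n \<and> j \<in> S i})"
    by (rule of_nat_mono)
  also have "\<dots> = (\<Sum>j\<in>used. real (card {i. i < n \<and> j \<in> S i}))" by simp
  also have "\<dots> \<le> (\<Sum>j\<in>used. real n / (64 * thr) / real (K + 1))"
  proof (intro sum_mono)
    fix j assume "j \<in> used"
    then have "real (card {i. i < n \<and> j \<in> S i}) * real (K + 1) \<le> real n / (64 * thr)"
      by (intro few) (simp add: used_def)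
    then show "real (card {i. i < n \<and> j \<in> S i}) \<le> real n / (64 * thr) / real (K + 1)"
      by (subst pos_le_divide_eq) auto
  qed
  also have "\<dots> = real (card used) * (real n / (64 * thr) / real (K + 1))" by simp
  also have "\<dots> \<le> real (K + 1) * (real n / (64 * thr) / real (K + 1))"
    using card_inn thr_ge unfolding used_def by (intro mult_right_mono) auto
  finally show ?thesis by simp
qed

text \<open>The invariant compares total losses, so it caps the number of lost inliers in terms of
  the outliers no matter how many rounds are run.\<close>

definition safe :: "(nat \<Rightarrow> real) \<Rightarrow> bool" where
  "safe v \<longleftrightarrow> (\<forall>i<n. 0 \<le> v i \<and> v i \<le> 1) \<and> (\<Sum>i\<in>inliers. 1 - v i) \<le> (\<Sum>i\<in>outliers. 1 - v i)"

lemma safe_init: "safe (\<lambda>_. 1)"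
  by (simp add: safe_def)

context
  fixes v :: "nat \<Rightarrow> real"
  assumes safe: "safe v"
begin

definition good :: "nat set" where "good = kept v \<inter> inliers"

lemma good_subset: "good \<subseteq> kept v" "good \<subseteq> {..<n}"
  by (auto simp: good_def kept_def)

lemma card_kept_good: "real (card (kept v - good)) \<le> real n / (64 * thr)"
proof -
  have "kept v - good \<subseteq> outliers" by (auto simp: good_def kept_def inliers_def)
  then have "card (kept v - good) \<le> card outliers" by (intro card_mono) auto
  then show ?thesis using card_outliers by linarith
qed

text \<open>A dropped inlier has lost at least 1/2 and an outlier has at most 1 to lose, so at most
  two inliers are dropped per outlier. The outliers themselves make the factor 3.\<close>

lemma card_not_good: "real (card ({..<n} - good)) \<le> 3 * (real n / (64 * thr))"
proof -
  have "(\<Sum>i\<in>inliers - kept v. 1 / 2) \<le> (\<Sum>i\<in>inliers - kept v. 1 - v i)"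
    by (intro sum_mono) (auto simp: inliers_def kept_def)
  also have "\<dots> \<le> (\<Sum>i\<in>inliers. 1 - v i)"
    using safe by (intro sum_mono2) (auto simp: inliers_def safe_def)
  also have "\<dots> \<le> (\<Sum>i\<in>outliers. 1 - v i)" using safe by (simp add: safe_def)
  also have "\<dots> \<le> (\<Sum>i\<in>outliers. 1)"
    using safe by (intro sum_mono) (auto simp: outliers_def safe_def)
  finally have 1: "real (card (inliers - kept v)) \<le> 2 * real (card outliers)" by simp
  have "{..<n} - good \<subseteq> (inliers - kept v) \<union> outliers" by (auto simp: good_def inliers_def)
  then have "card ({..<n} - good) \<le> card ((inliers - kept v) \<union> outliers)" by (intro card_mono) auto
  also have "\<dots> \<le> card (inliers - kept v) + card outliers" by (rule card_Un_le)
  finally show ?thesis using 1 card_outliers by linarith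
qed

lemma n_thr: "real n / (64 * thr) \<le> real n / 786432"
  using thr_ge by (intro divide_left_mono) auto

lemma card_good: "real n * (15 / 16) \<le> real (card good)"
proof -
  have "card ({..<n} - good) = n - card good"
    using good_subset(2) finite_subset[OF good_subset(2)] by (simp add: card_Diff_subset)
  moreover have "card good \<le> n" using card_mono[OF _ good_subset(2)] by simp
  ultimately have "real (card ({..<n} - good)) = real n - real (card good)" by simp
  then show ?thesis using card_not_good n_thr by linarith
qed

lemma card_kept_le: "card (kept v) \<le> n"
  using card_mono[of "{..<n}" "kept v"] by (auto simp: kept_def)

lemma card_kept: "real n * (15 / 16) \<le> real (card (kept v))"
  using card_good card_mono[OF finite_kept good_subset(1)] by linarith

lemma good_nonempty: "good \<noteq> {}"
  using card_good n_pos by auto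

lemma lower_good: "real n / 16 * dot {..<K} u u \<le> (\<Sum>i\<in>good. (dot {..<K} u (y i))\<^sup>2)"
  by (rule lower_after_removal[OF good_subset(2) card_not_good])

lemma upper_good: "(\<Sum>i\<in>good. (dot ({..<K} \<times> {..<K}) A (quad (y i)))\<^sup>2) \<le> C * real n * dot ({..<K} \<times> {..<K}) A A"
  by (rule order_trans[OF sum_mono2 upper]) (use good_subset(2) in auto)

lemma good_clean: "i \<in> good \<Longrightarrow> c < d \<Longrightarrow> inn c \<noteq> 0 \<Longrightarrow> X i c = (\<Sum>a<K. M c a * y i a)"
proof -
  assume a: "i \<in> good" "c < d" "inn c \<noteq> 0"
  then have "c \<in> used" using inn01[of c] by (simp add: used_def)
  then have "c \<notin> S i" "i < n" using a by (auto simp: good_def inliers_def outliers_def)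
  then show ?thesis using clean a by blast
qed

lemma gs_cols_good: "i \<in> good \<Longrightarrow> gs_cols inn v b (Inl i) = (\<Sum>a<K. (\<Sum>c<d. gs_cols inn v b (Inr c) * M c a) * y i a)"
proof -
  assume i: "i \<in> good"
  then have m: "row_mask v i = 1" using good_subset(1) by (auto simp: kept_def row_mask_def)
  have "gs_cols inn v b (Inl i) = (\<Sum>c<d. gs_cols inn v b (Inr c) * X i c)"
    by (subst gs_cols_rows) (simp add: m)
  also have "\<dots> = (\<Sum>c<d. gs_cols inn v b (Inr c) * (\<Sum>a<K. M c a * y i a))"
    using i by (intro sum.cong refl) (metis gs_cols_coeff_inn good_clean lessThan_iff mult_zero_left)
  also have "\<dots> = (\<Sum>a<K. (\<Sum>c<d. gs_cols inn v b (Inr c) * M c a) * y i a)"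
    by (rule sum_mult_sum_cong_swap)
  finally show ?thesis .
qed

lemma whitened_row_good: "i \<in> good \<Longrightarrow> whitened_row inn v i b =
    (\<Sum>a<K. sqrt (weight v) / sqrt (gs_norm inn v b) * (\<Sum>c<d. gs_cols inn v b (Inr c) * M c a) * y i a)"
  by (simp add: whitened_row_def gs_cols_good sum_distrib_left sum_divide_distrib mult_ac)

text \<open>The threshold is so large that the clean bound explains at most a quarter of the
  violating energy, and the recentring leaks at most a quarter of the corrupted part. So Vi \<le>
  (Vo + Vi) / 4 + Vo / 4, which even gives Vi \<le> (2/3) Vo.\<close>

lemma suspicious_scores:
  assumes l: "l < n" "suspicious inn v l"
  shows "(\<Sum>i\<in>good. response inn v l i * response inn v l i) \<le> (\<Sum>i\<in>kept v - good. response inn v l i * response inn v l i)"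
proof -
  interpret W: whitened "active inn v" "kept v" "whitened_row inn v" by (rule whitened_kept)
  let ?J2 = "active inn v \<times> active inn v" and ?q = "\<lambda>i. quad (whitened_row inn v i)"
  define A where "A = (frame_op ?J2 (kept v) ?q ^^ n) (?q l)"
  have lk: "l \<in> kept v" using l by (rule suspicious_kept)
  let ?E = "\<lambda>i. dot ?J2 A (?q i)"
  have resp: "response inn v l i = ?E i" if "i \<in> kept v" for i
    using response_kept[OF lk that] by (simp add: A_def dot_commute)
  have AA: "dot ?J2 A A = (\<Sum>i<n. probe inn v l i * response inn v l i)"
    by (simp add: sum_probe_response[OF lk] A_def frame_moment_even)
  have VV: "(\<Sum>i<n. response inn v l i * response inn v l i) = (\<Sum>i\<in>kept v. (?E i)\<^sup>2)"
    unfolding sum_response[OF lk] frame_moment_odd A_def[symmetric]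
    by (intro sum.cong refl arg_cong[where f = "\<lambda>x. x\<^sup>2"] dot_commute)
  let ?Vi = "\<Sum>i\<in>good. (?E i)\<^sup>2" and ?Vo = "\<Sum>i\<in>kept v - good. (?E i)\<^sup>2"
  have split: "(\<Sum>i\<in>kept v. (?E i)\<^sup>2) = ?Vo + ?Vi"
    by (rule sum.subset_diff[OF good_subset(1)]) simp
  have big: "thr * real (card (kept v)) * dot ?J2 A A < ?Vo + ?Vi"
    using l(2) unfolding suspicious_def VV AA[symmetric] weight_eq split .
  have bound: "?Vi \<le> 1536 * C * real n * dot ?J2 A A + 4 * (real (card (kept v - good)) / real (card good)) * ?Vo"
  proof (rule W.filter_energy_le[where Y = "{..<K}" and y = y and N = "real n" and C = C and I = good and
        \<Lambda> = "\<lambda>b a. sqrt (weight v) / sqrt (gs_norm inn v b) * (\<Sum>c<d. gs_cols inn v b (Inr c) * M c a)"])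
    show "good \<subseteq> kept v" "good \<noteq> {}" by (rule good_subset(1) good_nonempty)+
    show "real (card (kept v)) \<le> real n" using card_kept_le by simp
    show "0 \<le> C" using C by simp
  qed (rule finite_lessThan whitened_row_good upper_good lower_good | assumption)+
  have r: "real (card (kept v - good)) / real (card good) \<le> 1 / 16"
  proof -
    have "real (card (kept v - good)) \<le> real (card good) / 16"
      using card_kept_good n_thr card_good by linarith
    then show ?thesis using good_nonempty finite_subset[OF good_subset(1)]
      by (simp add: pos_divide_le_eq card_gt_0_iff)
  qed
  have Vo: "0 \<le> ?Vo" and Vi: "0 \<le> ?Vi" by (auto simp: sum_nonneg)
  have "1536 * C * real n * dot ?J2 A A = (thr / 8) * real n * dot ?J2 A A" using thr by simp
  \<comment> \<open>In 8 = 2 * 4 the 2 pays for replacing n by the number of kept rows, and the 4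
    yields the quarter.\<close>
  also have "\<dots> \<le> (thr / 8) * (2 * real (card (kept v))) * dot ?J2 A A"
    using card_kept thr_ge by (intro mult_right_mono mult_left_mono) auto
  also have "\<dots> = (thr * real (card (kept v)) * dot ?J2 A A) / 4" by simp
  also have "\<dots> \<le> (?Vo + ?Vi) / 4" using big by simp
  finally have qv: "?Vi \<le> (?Vo + ?Vi) / 4 + 4 * (1 / 16) * ?Vo"
    using bound mult_right_mono[OF r Vo] by linarith
  have imp: "a \<le> b" if "a \<le> (b + a) / 4 + 4 * (1 / 16) * b" "0 \<le> b" for a b :: real
    using that by (simp add: field_simps)
  have le: "?Vi \<le> ?Vo" by (rule imp[OF qv Vo])
  have e: "response inn v l i * response inn v l i = (?E i)\<^sup>2" if "i \<in> kept v" for i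
    unfolding resp[OF that] by (rule power2_eq_square[symmetric])
  have sums: "(\<Sum>i\<in>B. response inn v l i * response inn v l i) = (\<Sum>i\<in>B. (?E i)\<^sup>2)" if "B \<subseteq> kept v" for B
    by (rule sum.cong[OF refl]) (rule e[OF subsetD[OF that]])
  show ?thesis unfolding sums[OF good_subset(1)] sums[OF Diff_subset] by (rule le)
qed

lemma scores_nonneg: "0 \<le> scores inn v i"
  by (rule scores_cases[of inn v]) auto

lemma scores_off_kept: "i < n \<Longrightarrow> i \<notin> kept v \<Longrightarrow> scores inn v i = 0"
  by (rule scores_cases[of inn v]) (auto simp: response_off_kept)

lemma scores_safe: "(\<Sum>i\<in>inliers. scores inn v i) \<le> (\<Sum>i\<in>outliers. scores inn v i)"
proof -
  have 1: "(\<Sum>i\<in>inliers. scores inn v i) = (\<Sum>i\<in>good. scores inn v i)"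
  proof (rule sum.mono_neutral_right)
    show "\<forall>i\<in>inliers - good. scores inn v i = 0"
    proof
      fix i assume "i \<in> inliers - good"
      then have "i < n" "i \<notin> kept v" by (auto simp: good_def inliers_def)
      then show "scores inn v i = 0" by (rule scores_off_kept)
    qed
  qed (auto simp: good_def)
  have "(\<Sum>i\<in>good. scores inn v i) \<le> (\<Sum>i\<in>kept v - good. scores inn v i)"
  proof (rule scores_cases[of inn v])
    fix l assume "l < n" "suspicious inn v l" "scores inn v = (\<lambda>i. response inn v l i * response inn v l i)"
    then show ?thesis using suspicious_scores by simp
  qed simp
  also have "\<dots> \<le> (\<Sum>i\<in>outliers. scores inn v i)"
    by (rule sum_mono2) (auto simp: good_def inliers_def kept_def scores_nonneg)
  finally show ?thesis unfolding 1 .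
qed

lemma score_ratio: "i < n \<Longrightarrow> 0 \<le> scores inn v i / (2 * peak n (scores inn v))"
    "i < n \<Longrightarrow> scores inn v i / (2 * peak n (scores inn v)) \<le> 1 / 2"
proof -
  let ?p = "peak n (scores inn v)"
  show "i < n \<Longrightarrow> 0 \<le> scores inn v i / (2 * ?p)"
    by (simp add: peak_nonneg scores_nonneg)
  assume "i < n"
  then have "scores inn v i \<le> ?p" by (rule le_peak)
  then show "scores inn v i / (2 * ?p) \<le> 1 / 2"
    using peak_nonneg[of n "scores inn v"] by (cases "?p = 0") (auto simp: field_simps)
qed

text \<open>Weights stay nonnegative because decrements are at most 1/2 and hit only kept rows,
  whose weight exceeds 1/2. The comparison of losses is \<open>scores_safe\<close>, scaled by a
  common factor.\<close>

lemma safe_reweigh: "safe (reweigh inn v)"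
  unfolding safe_def
proof (intro conjI allI impI)
  let ?p = "peak n (scores inn v)"
  fix i assume i: "i < n"
  show "0 \<le> reweigh inn v i"
  proof (cases "i \<in> kept v")
    case True
    then show ?thesis using score_ratio(2)[OF i] by (simp add: reweigh_def kept_def)
  next
    case False
    then show ?thesis using safe i by (simp add: reweigh_def scores_off_kept safe_def)
  qed
  show "reweigh inn v i \<le> 1" using score_ratio(1)[OF i] safe i unfolding reweigh_def safe_def by fastforce
next
  let ?p = "peak n (scores inn v)"
  have "(\<Sum>i\<in>A. 1 - reweigh inn v i) = (\<Sum>i\<in>A. 1 - v i) + (\<Sum>i\<in>A. scores inn v i) / (2 * ?p)" for A
    by (simp only: reweigh_def sum_divide_distrib sum.distrib[symmetric]) (intro sum.cong refl, simp)
  moreover have "(\<Sum>i\<in>inliers. scores inn v i) / (2 * ?p) \<le> (\<Sum>i\<in>outliers. scores inn v i) / (2 * ?p)"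
    using scores_safe by (intro divide_right_mono) (auto simp: peak_nonneg)
  ultimately show "(\<Sum>i\<in>inliers. 1 - reweigh inn v i) \<le> (\<Sum>i\<in>outliers. 1 - reweigh inn v i)"
    using safe by (simp add: safe_def)
qed

lemma reweigh_fixed: "\<forall>l<n. \<not> suspicious inn v l \<Longrightarrow> reweigh inn v = v"
  by (rule scores_cases[of inn v]) (auto simp: reweigh_def)

text \<open>The row attaining the peak loses exactly 1/2 from a weight of at most 1, so it leaves
  the kept set, and no weight ever increases.\<close>

lemma reweigh_progress:
  assumes l: "l < n" "suspicious inn v l"
  shows "card (kept (reweigh inn v)) < card (kept v)"
proof (rule psubset_card_mono)
  show "finite (kept v)" by simp
  obtain l' where l': "l' < n" "suspicious inn v l'" "scores inn v = (\<lambda>i. response inn v l' i * response inn v l' i)"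
    by (rule scores_cases[of inn v]) (use l in auto)
  have "0 < (\<Sum>i<n. scores inn v i)"
  proof -
    have lk: "l' \<in> kept v" using l' by (auto intro: suspicious_kept)
    have "0 \<le> thr * weight v * (\<Sum>i<n. probe inn v l' i * response inn v l' i)"
      unfolding sum_probe_response[OF lk] using thr_ge by (intro mult_nonneg_nonneg) (auto simp: weight_eq)
    then show ?thesis using l'(2) unfolding suspicious_def l'(3) by linarith
  qed
  then obtain i where i: "i < n" "0 < scores inn v i"
    by (metis lessThan_iff not_less sum_nonpos)
  then have p: "0 < peak n (scores inn v)" using le_peak[of i n "scores inn v"] by linarith
  then obtain m where m: "m < n" "peak n (scores inn v) = scores inn v m"
    using peak_attained[of n "scores inn v"] by auto
  have mk: "m \<in> kept v" using m p scores_off_kept[of m] by auto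
  have "scores inn v m / (2 * peak n (scores inn v)) = 1 / 2" using m p by simp
  then have "reweigh inn v m \<le> 1 / 2" using safe m(1) by (simp add: reweigh_def safe_def)
  then have "m \<notin> kept (reweigh inn v)" by (simp add: kept_def)
  moreover have "reweigh inn v i \<le> v i" if "i < n" for i
    using score_ratio(1)[OF that] by (simp add: reweigh_def)
  then have "kept (reweigh inn v) \<subseteq> kept v" by (fastforce simp: kept_def)
  ultimately show "kept (reweigh inn v) \<subset> kept v" using mk by blast
qed

text \<open>No false relations: a combination of columns that vanishes on the kept rows vanishes on
  the good ones, where it is a linear form u of the features. The good features have energy in every
  direction, hence u = 0.\<close>

lemma relation_of_norm_zero:
  assumes b: "gs_norm inn v b = 0" and a: "a < K"
  shows "(\<Sum>c<d. gs_cols inn v b (Inr c) * M c a) = 0"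
proof -
  let ?u = "\<lambda>a. \<Sum>c<d. gs_cols inn v b (Inr c) * M c a"
  have "dot {..<K} ?u (y i) = 0" if "i \<in> good" for i
  proof -
    have "i < n" using that good_subset(2) by auto
    then have "gs_cols inn v b (Inl i) = 0" using b unfolding gs_norm_def row_dot_self_eq_0 by blast
    then show ?thesis unfolding dot_def using gs_cols_good[OF that, of b] by simp
  qed
  then have "real n / 16 * dot {..<K} ?u ?u \<le> 0" using lower_good[of ?u] by simp
  then have "dot {..<K} ?u ?u \<le> 0" using n_pos by (simp add: mult_le_0_iff)
  then have "dot {..<K} ?u ?u = 0" using dot_self_nonneg[of "{..<K}" ?u] by linarith
  then show ?thesis using a dot_self_eq_0[of "{..<K}" ?u] by simp
qed

text \<open>No missed relations. Since j is the last used column, its orthogonalized column occurs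
  in the expansion of no other used column; the direction obtained from the relation therefore has a
  nonzero entry at j.\<close>

lemma norm_zero_of_relation:
  assumes uns: "\<forall>l<n. \<not> suspicious inn v l"
    and j: "j \<in> used" "\<And>c. c \<in> used \<Longrightarrow> c \<le> j" "\<alpha> j \<noteq> 0"
    and rel: "\<And>a. a < K \<Longrightarrow> (\<Sum>c\<in>used. \<alpha> c * M c a) = 0"
  shows "gs_norm inn v j = 0"
proof (rule ccontr)
  assume \<nu>j: "gs_norm inn v j \<noteq> 0"
  interpret W: whitened "active inn v" "kept v" "whitened_row inn v" by (rule whitened_kept)
  let ?J = "active inn v" and ?F = "gs_cols inn v" and ?\<nu> = "gs_norm inn v"
  let ?W = "real (card (kept v))"
  have "0 < real n" using n_pos by simp
  then have W0: "0 < ?W" using card_kept by linarith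
  have fin: "finite used" by (simp add: used_def)
  have jd: "j < d" using j by (simp add: used_def)
  then have jJ: "j \<in> ?J" using \<nu>j by (simp add: active_def)
  have "\<forall>c. \<exists>h. c < d \<longrightarrow> (\<forall>x. masked_columns inn v c x = ?F c x + (\<Sum>a<c. h a * ?F a x))"
    using gs_expand[of _ d "masked_columns inn v" n] unfolding gs_cols_def by blast
  then obtain h where h: "\<And>c x. c < d \<Longrightarrow> masked_columns inn v c x = ?F c x + (\<Sum>a<c. h c a * ?F a x)" by metis
  define g where "g = (\<lambda>c a. if a = c then 1 else if a < c then h c a else (0::real))"
  have exp: "masked_columns inn v c x = (\<Sum>a<d. g c a * ?F a x)" if c: "c < d" for c x
  proof -
    have "(\<Sum>a<d. g c a * ?F a x) = (\<Sum>a\<in>insert c {..<c}. g c a * ?F a x)"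
      by (rule sum.mono_neutral_right) (use c in \<open>auto simp: g_def\<close>)
    also have "\<dots> = ?F c x + (\<Sum>a<c. h c a * ?F a x)"
      by (simp add: g_def) 
    finally show ?thesis using h[OF c] by simp
  qed
  define u' where "u' a = (\<Sum>c\<in>used. \<alpha> c * g c a)" for a
  have u'j: "u' j = \<alpha> j"
  proof -
    have "u' j = (\<Sum>c\<in>used. if c = j then \<alpha> c else 0)"
      unfolding u'_def using j(2) by (intro sum.cong refl) (force simp: g_def)
    then show ?thesis using fin j(1) by simp
  qed
  \<comment> \<open>The factor undoes the scaling of the whitened rows, so that pairing u with them
    returns the value of the relation on the data.\<close>
  define u where "u a = u' a * sqrt (?\<nu> a) / sqrt ?W" for a
  have uz: "dot ?J u (whitened_row inn v i) = (\<Sum>c\<in>used. \<alpha> c * masked_columns inn v c (Inl i))" if i: "i < n" for i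
  proof -
    have "dot ?J u (whitened_row inn v i) = (\<Sum>a\<in>?J. u' a * ?F a (Inl i))"
      unfolding dot_def using W0 gs_norm_nonneg[of inn v]
      by (intro sum.cong refl) (auto simp: u_def whitened_row_def weight_eq active_def)
    also have "\<dots> = (\<Sum>a<d. u' a * ?F a (Inl i))"
      by (rule sum.mono_neutral_left) (use i in \<open>auto simp: active_def intro!: inactive_zero[of _ inn v, unfolded active_def]\<close>)
    also have "\<dots> = (\<Sum>a<d. \<Sum>c\<in>used. \<alpha> c * (g c a * ?F a (Inl i)))"
      by (simp add: u'_def sum_distrib_right mult.assoc)
    also have "\<dots> = (\<Sum>c\<in>used. \<alpha> c * (\<Sum>a<d. g c a * ?F a (Inl i)))"
      by (subst sum.swap) (simp add: sum_distrib_left)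
    also have "\<dots> = (\<Sum>c\<in>used. \<alpha> c * masked_columns inn v c (Inl i))"
      by (intro sum.cong refl) (simp add: exp used_def)
    finally show ?thesis .
  qed
  have u0: "dot ?J u (whitened_row inn v i) = 0" if i: "i \<in> good" for i
  proof -
    have i': "i < n" "row_mask v i = 1" using i good_subset by (auto simp: kept_def row_mask_def)
    have "(\<Sum>c\<in>used. \<alpha> c * masked_columns inn v c (Inl i)) = (\<Sum>c\<in>used. \<alpha> c * (\<Sum>a<K. M c a * y i a))"
      using i i' good_clean by (intro sum.cong refl) (auto simp: masked_columns_def used_def)
    also have "\<dots> = (\<Sum>a<K. (\<Sum>c\<in>used. \<alpha> c * M c a) * y i a)" by (rule sum_mult_sum_cong_swap)
    also have "\<dots> = 0" by (simp add: rel)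
    finally show ?thesis using uz[OF i'(1)] by simp
  qed
  have "u j \<noteq> 0" using u'j j(3) \<nu>j W0 by (auto simp: u_def)
  then have "dot ?J u u \<noteq> 0" using jJ dot_self_eq_0[OF W.finJ] by blast
  then have uu: "0 < dot ?J u u" using dot_self_nonneg[of ?J u] by linarith
  define w where "w a = 1 / sqrt (dot ?J u u) * u a" for a
  have wdot: "dot ?J w x = 1 / sqrt (dot ?J u u) * dot ?J u x" for x
    by (simp only: w_def[abs_def] dot_commute[of _ _ x] dot_scale_right)
  have ww: "dot ?J w w = 1"
    unfolding wdot using uu by (subst dot_commute) (simp add: wdot)
  have w0: "dot ?J w (whitened_row inn v i) = 0" if "i \<in> good" for i using u0[OF that] by (simp add: wdot)
  let ?A = "\<lambda>(a, b). w a * w b" and ?q = "\<lambda>i. quad (whitened_row inn v i)"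
  let ?V = "\<Sum>i\<in>kept v. (dot (?J \<times> ?J) ?A (?q i))\<^sup>2"
  have "?V \<le> 2 * (thr * ?W) * dot (?J \<times> ?J) ?A ?A"
  proof -
    have "?V = (\<Sum>i\<in>kept v. (dot (?J \<times> ?J) (?q i) ?A)\<^sup>2)"
      by (intro sum.cong refl arg_cong[where f = "\<lambda>x. x\<^sup>2"] dot_commute)
    moreover have "1 \<le> thr" "kept v \<noteq> {}" using thr_ge W0 by auto
    ultimately show ?thesis using unsuspicious_energy[of v inn ?A] uns by metis
  qed
  then have V: "?V \<le> 2 * (thr * ?W)" by (simp add: dot_rank_one ww)
  let ?m = "real (card (kept v - good))" and ?N = "real n"
  have N0: "0 < ?N" using n_pos by simp
  \<comment> \<open>Almost all rows are kept and good, so the left side is at least n^2 / 4, while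
    the few other kept rows allow only n^2 / 32.\<close>
  have "?N / 2 \<le> ?W - ?m" using card_kept card_kept_good n_thr N0 by linarith
  then have "(?N / 2)\<^sup>2 \<le> (?W - ?m)\<^sup>2" using N0 by (intro power_mono) auto
  also have "\<dots> \<le> ?m * ?V" by (rule W.degenerate_direction_energy[OF good_subset(1) ww w0])
  also have "\<dots> \<le> (?N / (64 * thr)) * (2 * (thr * ?N))"
  proof (rule mult_mono[OF card_kept_good])
    have "?V \<le> 2 * (thr * ?W)" by (rule V)
    also have "\<dots> \<le> 2 * (thr * ?N)" using card_kept_le thr_ge by (intro mult_left_mono) auto
    finally show "?V \<le> 2 * (thr * ?N)" .
  qed (use thr_ge in \<open>auto simp: sum_nonneg\<close>)
  also have "\<dots> = ?N\<^sup>2 / 32" using thr_ge by (simp add: power2_eq_square)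
  finally show False using N0 by (simp add: power2_eq_square)
qed

end

lemma safe_iterate: "safe ((reweigh inn ^^ t) (\<lambda>_. 1))"
  by (induction t) (auto intro: safe_init safe_reweigh)

text \<open>A round with a suspicious row shrinks the kept set, and a round without one is a fixed
  point. Were a row still suspicious after n - 1 rounds, n rounds would have emptied the kept set,
  which always holds 15/16 of the rows.\<close>

lemma converged: "\<forall>l<n. \<not> suspicious inn ((reweigh inn ^^ (n - 1)) (\<lambda>_. 1)) l"
proof (rule ccontr)
  let ?v = "\<lambda>t. (reweigh inn ^^ t) (\<lambda>_. 1)"
  assume not: "\<not> (\<forall>l<n. \<not> suspicious inn (?v (n - 1)) l)"
  have stuck: "?v (t + e) = ?v t" if "\<forall>l<n. \<not> suspicious inn (?v t) l" for t e
    using that by (induction e) (auto simp: reweigh_fixed safe_iterate)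
  have bad: "\<exists>l<n. suspicious inn (?v t) l" if "t \<le> n - 1" for t
  proof (rule ccontr)
    assume "\<not> (\<exists>l<n. suspicious inn (?v t) l)"
    then have "?v (t + (n - 1 - t)) = ?v t" and "\<forall>l<n. \<not> suspicious inn (?v t) l" by (auto intro!: stuck)
    moreover have "t + (n - 1 - t) = n - 1" using that by simp
    ultimately show False using not by metis
  qed
  have "card (kept (?v t)) + t \<le> n" if "t \<le> n" for t
    using that
  proof (induction t)
    case 0
    show ?case using card_kept_le[OF safe_init] by simp
  next
    case (Suc t)
    have "t \<le> n - 1" using Suc.prems by simp
    from bad[OF this] obtain l where "l < n" "suspicious inn (?v t) l" by blast
    then have "card (kept (reweigh inn (?v t))) < card (kept (?v t))"
      by (rule reweigh_progress[OF safe_iterate])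
    then show ?case using Suc by simp
  qed
  from this[of n] have "card (kept (?v n)) = 0" by simp
  then show False using card_kept[OF safe_iterate, of n] n_pos by simp
qed

end

end

section \<open>Selecting independent coordinates\<close>

definition indep_rows :: "nat \<Rightarrow> (nat \<Rightarrow> nat \<Rightarrow> real) \<Rightarrow> nat set \<Rightarrow> bool" where
  "indep_rows K M B \<longleftrightarrow> (\<forall>t. (\<forall>a<K. (\<Sum>c\<in>B. t c * M c a) = 0) \<longrightarrow> (\<forall>c\<in>B. t c = 0))"

text \<open>Elimination of the last column with a pivot row p; the coefficient of p is then chosen
  to cancel the corrections.\<close>

lemma nontrivial_relation:
  assumes "finite B" "K < card B"
  shows "\<exists>t. (\<exists>c\<in>B. t c \<noteq> 0) \<and> (\<forall>a<K. (\<Sum>c\<in>B. t c * M c a) = (0::real))"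
  using assms
proof (induction K arbitrary: B M)
  case 0
  then obtain c where "c \<in> B" by fastforce
  then show ?case by (intro exI[of _ "\<lambda>_. 1"]) auto
next
  case (Suc K)
  show ?case
  proof (cases "\<forall>c\<in>B. M c K = 0")
    case True
    obtain t where t: "\<exists>c\<in>B. t c \<noteq> 0" "\<forall>a<K. (\<Sum>c\<in>B. t c * M c a) = 0"
      using Suc.IH[of B M] Suc.prems by auto
    then show ?thesis using True by (intro exI[of _ t]) (auto simp: less_Suc_eq)
  next
    case False
    then obtain p where p: "p \<in> B" "M p K \<noteq> 0" by blast
    let ?B = "B - {p}" and ?M = "\<lambda>c a. M c a - M c K / M p K * M p a"
    have "K < card ?B" using Suc.prems p by simp
    then obtain t where t: "\<exists>c\<in>?B. t c \<noteq> 0" "\<forall>a<K. (\<Sum>c\<in>?B. t c * ?M c a) = 0"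
      using Suc.IH[of ?B ?M] Suc.prems by auto
    define s where "s = t(p := - (\<Sum>c\<in>?B. t c * M c K / M p K))"
    have sum: "(\<Sum>c\<in>B. s c * M c a) = (\<Sum>c\<in>?B. t c * ?M c a)" for a
    proof -
      have "(\<Sum>c\<in>B. s c * M c a) = s p * M p a + (\<Sum>c\<in>?B. s c * M c a)"
        using Suc.prems p by (simp add: sum.remove)
      also have "(\<Sum>c\<in>?B. s c * M c a) = (\<Sum>c\<in>?B. t c * M c a)"
        by (intro sum.cong refl) (simp add: s_def)
      also have "s p * M p a = - (\<Sum>c\<in>?B. t c * (M c K / M p K * M p a))"
        by (simp add: s_def sum_distrib_right mult.assoc)
      finally show ?thesis by (simp add: right_diff_distrib sum_subtractf)
    qed
    have "(\<Sum>c\<in>B. s c * M c a) = 0" if "a < Suc K" for a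
    proof (cases "a = K")
      case True
      then show ?thesis unfolding sum using p by simp
    next
      case False
      then show ?thesis unfolding sum using t that by simp
    qed
    moreover have "\<exists>c\<in>B. s c \<noteq> 0" using t(1) by (auto simp: s_def)
    ultimately show ?thesis by blast
  qed
qed

lemma indep_rows_card: "finite B \<Longrightarrow> indep_rows K M B \<Longrightarrow> card B \<le> K"
proof (rule ccontr)
  assume h: "finite B" "indep_rows K M B" "\<not> card B \<le> K"
  then have "K < card B" by simp
  from nontrivial_relation[OF h(1) this, of M] obtain t where
    t: "\<exists>c\<in>B. t c \<noteq> 0" "\<forall>a<K. (\<Sum>c\<in>B. t c * M c a) = 0" by blast
  from h(2) have "(\<forall>a<K. (\<Sum>c\<in>B. t c * M c a) = 0) \<longrightarrow> (\<forall>c\<in>B. t c = 0)"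
    unfolding indep_rows_def by (rule spec)
  then have "\<forall>c\<in>B. t c = 0" using t(2) by (rule mp)
  then show False using t(1) by blast
qed

lemma indep_rows_subset:
  assumes "indep_rows K M B" "B' \<subseteq> B" "finite B"
  shows "indep_rows K M B'"
  unfolding indep_rows_def
proof (intro allI impI)
  fix t assume t: "\<forall>a<K. (\<Sum>c\<in>B'. t c * M c a) = 0"
  let ?t = "\<lambda>c. if c \<in> B' then t c else 0"
  have "(\<Sum>c\<in>B. ?t c * M c a) = (\<Sum>c\<in>B'. t c * M c a)" for a
    using assms by (intro sum.mono_neutral_cong_right) auto
  then have 0: "\<forall>a<K. (\<Sum>c\<in>B. ?t c * M c a) = 0" using t by simp
  from assms(1) have "(\<forall>a<K. (\<Sum>c\<in>B. ?t c * M c a) = 0) \<longrightarrow> (\<forall>c\<in>B. ?t c = 0)"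
    unfolding indep_rows_def by (rule spec)
  then have z: "\<forall>c\<in>B. ?t c = 0" using 0 by (rule mp)
  show "\<forall>c\<in>B'. t c = 0"
  proof
    fix c assume c: "c \<in> B'"
    then have "?t c = 0" using z assms(2) by blast
    then show "t c = 0" using c by simp
  qed
qed

text \<open>Serves to write each output vector as a combination M \<tau>_b of the columns of M.
  Independence gives a column e where the new row differs from its interpolation by the old ones,
  and dividing by this difference normalizes the new dual vector.\<close>

lemma dual_basis:
  assumes "finite B" "indep_rows K M B"
  shows "\<exists>\<tau>. \<forall>b\<in>B. \<forall>b'\<in>B. (\<Sum>a<K. M b' a * \<tau> b a) = of_bool (b' = b)"
  using assms
proof (induction B rule: finite_induct)
  case (insert p B)
  have ind: "indep_rows K M B" by (rule indep_rows_subset[OF insert.prems]) (use insert.hyps in auto)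
  then obtain \<tau> where \<tau>: "\<And>b b'. b \<in> B \<Longrightarrow> b' \<in> B \<Longrightarrow> (\<Sum>a<K. M b' a * \<tau> b a) = of_bool (b' = b)"
    using insert.IH by blast
  define T where "T b = (\<Sum>a<K. M p a * \<tau> b a)" for b
  have "\<exists>a<K. M p a - (\<Sum>b\<in>B. T b * M b a) \<noteq> 0"
  proof (rule ccontr)
    assume neg: "\<not> (\<exists>a<K. M p a - (\<Sum>b\<in>B. T b * M b a) \<noteq> 0)"
    let ?t = "\<lambda>c. if c = p then 1 else - T c"
    have "(\<Sum>c\<in>insert p B. ?t c * M c a) = 0" if "a < K" for a
    proof -
      have "(\<Sum>c\<in>B. ?t c * M c a) = (\<Sum>c\<in>B. - (T c * M c a))"
        using insert.hyps by (intro sum.cong refl) auto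
      then have "(\<Sum>c\<in>insert p B. ?t c * M c a) = M p a - (\<Sum>c\<in>B. T c * M c a)"
        using insert.hyps by (simp add: sum_negf)
      then show ?thesis using neg that by simp
    qed
    moreover from insert.prems have "(\<forall>a<K. (\<Sum>c\<in>insert p B. ?t c * M c a) = 0) \<longrightarrow> (\<forall>c\<in>insert p B. ?t c = 0)"
      unfolding indep_rows_def by (rule spec)
    ultimately have "\<forall>c\<in>insert p B. ?t c = 0" by blast
    then have "?t p = 0" by (rule bspec) simp
    then show False by simp
  qed
  then obtain e where e: "e < K" "M p e - (\<Sum>b\<in>B. T b * M b e) \<noteq> 0" by blast
  let ?D = "M p e - (\<Sum>b\<in>B. T b * M b e)"
  \<comment> \<open>Entry e minus its interpolation from B: paired with rows, this vanishes on B
    and, after division by \<open>?D\<close>, equals 1 on row p.\<close>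
  define \<rho> where "\<rho> a = (of_bool (a = e) - (\<Sum>b\<in>B. M b e * \<tau> b a)) / ?D" for a
  have rho: "(\<Sum>a<K. M c a * \<rho> a) = (M c e - (\<Sum>b\<in>B. M b e * (\<Sum>a<K. M c a * \<tau> b a))) / ?D" for c
  proof -
    have "(\<Sum>a<K. M c a * (of_bool (a = e) - (\<Sum>b\<in>B. M b e * \<tau> b a))) =
        (\<Sum>a<K. M c a * of_bool (a = e)) - (\<Sum>a<K. \<Sum>b\<in>B. M b e * (M c a * \<tau> b a))"
      by (simp add: right_diff_distrib sum_subtractf sum_distrib_left mult.left_commute)
    also have "(\<Sum>a<K. M c a * of_bool (a = e)) = M c e"
      using e(1) by simp
    also have "(\<Sum>a<K. \<Sum>b\<in>B. M b e * (M c a * \<tau> b a)) = (\<Sum>b\<in>B. M b e * (\<Sum>a<K. M c a * \<tau> b a))"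
      by (subst sum.swap) (simp add: sum_distrib_left)
    finally show ?thesis unfolding \<rho>_def by (simp add: sum_divide_distrib[symmetric])
  qed
  have rp: "(\<Sum>a<K. M p a * \<rho> a) = 1"
    unfolding rho T_def[symmetric] using e(2) by (simp add: mult.commute)
  have rb: "(\<Sum>a<K. M c a * \<rho> a) = 0" if c: "c \<in> B" for c
  proof -
    have "(\<Sum>b\<in>B. M b e * (\<Sum>a<K. M c a * \<tau> b a)) = (\<Sum>b\<in>B. if c = b then M b e else 0)"
      using c by (intro sum.cong refl) (simp add: \<tau>)
    also have "\<dots> = M c e" using c insert.hyps by simp
    finally show ?thesis unfolding rho by simp
  qed
  let ?\<tau> = "\<lambda>b a. if b = p then \<rho> a else \<tau> b a - T b * \<rho> a"
  have "(\<Sum>a<K. M b' a * ?\<tau> b a) = of_bool (b' = b)" if "b \<in> insert p B" "b' \<in> insert p B" for b b'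
  proof (cases "b = p")
    case True
    then show ?thesis using that insert.hyps rp rb by auto
  next
    case False
    then have "(\<Sum>a<K. M b' a * ?\<tau> b a) = (\<Sum>a<K. M b' a * \<tau> b a) - T b * (\<Sum>a<K. M b' a * \<rho> a)"
      by (simp add: right_diff_distrib sum_subtractf sum_distrib_left mult.left_commute)
    then show ?thesis using False that insert.hyps rp rb \<tau>[of b b'] by (auto simp: T_def)
  qed
  then show ?case by (intro exI[of _ ?\<tau>]) blast
qed simp

section \<open>Greedy selection of coordinates\<close>

context data
begin

text \<open>The exponent is n - 1 because the n-th round orthogonalizes with these weights before
  updating them once more, and its arrays are what the stage reads.\<close>

definition final_weights :: "(nat \<Rightarrow> real) \<Rightarrow> nat \<Rightarrow> real" where
  "final_weights inn = (reweigh inn ^^ (n - 1)) (\<lambda>_. 1)"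

definition stage_norm :: "(nat \<Rightarrow> real) \<Rightarrow> nat \<Rightarrow> real" where
  "stage_norm inn j = gs_norm (inn(j := 1)) (final_weights (inn(j := 1))) j"

primrec select :: "nat \<Rightarrow> nat \<Rightarrow> real" where
  "select 0 = (\<lambda>_. 0)"
| "select (Suc j) = (select j)(j := stage_norm (select j) j / stage_norm (select j) j)"

text \<open>For a rejected coordinate j this is the vanishing combination found by the
  orthogonalization, with coefficient 1 at j; for a selected one it is minus a unit vector. In both
  cases the negated entries at selected coordinates express coordinate j through them.\<close>

definition relation :: "nat \<Rightarrow> nat \<Rightarrow> real" where
  "relation j b = (1 - select (Suc j) j) *
      gs_cols ((select j)(j := 1)) (final_weights ((select j)(j := 1))) j (Inr b)
    - select (Suc j) j * of_bool (j = b)"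

definition basis_vec :: "nat \<Rightarrow> nat \<Rightarrow> real" where
  "basis_vec b c = select d b * (0 - relation c b)"

lemma select_01: "select j b = 0 \<or> select j b = 1"
  by (induction j) auto

lemma select_later: "j \<le> b \<Longrightarrow> select j b = 0"
  by (induction j) auto

lemma select_stable: "j \<le> e \<Longrightarrow> b < j \<Longrightarrow> select e b = select j b"
  by (induction e rule: dec_induct) auto

definition chosen :: "nat \<Rightarrow> nat set" where "chosen j = {b. select j b = 1}"

lemma chosen_subset: "chosen j \<subseteq> {..<j}"
  using select_later[of j] by (force simp: chosen_def not_less[symmetric])

lemma finite_chosen [simp]: "finite (chosen j)"
  using chosen_subset finite_subset by blast

lemma chosen_Suc: "chosen (Suc j) = (if stage_norm (select j) j = 0 then chosen j else insert j (chosen j))"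
  using select_later[of j j] by (auto simp: chosen_def)

lemma chosen_mono: "c \<le> e \<Longrightarrow> chosen c \<subseteq> chosen e"
  by (induction e rule: dec_induct) (auto simp: chosen_Suc)

end

context clean_data
begin

text \<open>Independence is carried along because it limits the chosen coordinates to K, hence the
  tested columns to K + 1, which is the number that the corruption bound allows for.\<close>

lemma stage:
  assumes j: "j < d" and ind: "indep_rows K M (chosen j)"
  defines "inn \<equiv> (select j)(j := 1)"
  shows "stage_norm (select j) j = 0 \<Longrightarrow> a < K \<Longrightarrow> (\<Sum>c<d. gs_cols inn (final_weights inn) j (Inr c) * M c a) = 0"
    and "indep_rows K M (chosen (Suc j))"
proof -
  have inn01: "inn b = 0 \<or> inn b = 1" for b using select_01[of j b] by (simp add: inn_def)
  have U: "{b. b < d \<and> inn b = 1} = insert j (chosen j)"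
    using j chosen_subset[of j] by (auto simp: inn_def chosen_def)
  have nj: "j \<notin> chosen j" using chosen_subset[of j] by auto
  have card: "card {b. b < d \<and> inn b = 1} \<le> K + 1"
    unfolding U using indep_rows_card[OF finite_chosen ind] nj by simp
  have U': "used inn = insert j (chosen j)" using used_def[OF inn01 card] U by simp
  note safe = safe_iterate[OF inn01 card, of "n - 1", folded final_weights_def]
  note conv = converged[OF inn01 card, folded final_weights_def]
  show "stage_norm (select j) j = 0 \<Longrightarrow> a < K \<Longrightarrow> (\<Sum>c<d. gs_cols inn (final_weights inn) j (Inr c) * M c a) = 0"
    unfolding stage_norm_def inn_def[symmetric] by (rule relation_of_norm_zero[OF inn01 card safe])
  show "indep_rows K M (chosen (Suc j))"
  proof (cases "stage_norm (select j) j = 0")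
    case True
    then show ?thesis using ind by (simp add: chosen_Suc)
  next
    case False
    have "indep_rows K M (insert j (chosen j))"
      unfolding indep_rows_def
    proof (intro allI impI)
      fix t assume t: "\<forall>a<K. (\<Sum>c\<in>insert j (chosen j). t c * M c a) = 0"
      have "t j = 0"
      proof (rule ccontr)
        assume "t j \<noteq> 0"
        have "gs_norm inn (final_weights inn) j = 0"
        proof (rule norm_zero_of_relation[OF inn01 card safe conv])
          show "j \<in> used inn" "t j \<noteq> 0" using U' \<open>t j \<noteq> 0\<close> by auto
          show "c \<le> j" if "c \<in> used inn" for c using that chosen_subset[of j] U' by auto
          show "(\<Sum>c\<in>used inn. t c * M c a) = 0" if "a < K" for a using t that U' by simp
        qed
        then show False using False unfolding stage_norm_def inn_def[symmetric] by contradiction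
      qed
      moreover have "\<forall>c\<in>chosen j. t c = 0"
      proof (rule mp)
        show "(\<forall>a<K. (\<Sum>c\<in>chosen j. t c * M c a) = 0) \<longrightarrow> (\<forall>c\<in>chosen j. t c = 0)"
          using ind unfolding indep_rows_def by (rule spec)
        show "\<forall>a<K. (\<Sum>c\<in>chosen j. t c * M c a) = 0" using t \<open>t j = 0\<close> nj by simp
      qed
      ultimately show "\<forall>c\<in>insert j (chosen j). t c = 0" by blast
    qed
    then show ?thesis using False by (simp add: chosen_Suc)
  qed
qed

lemma chosen_indep: "j \<le> d \<Longrightarrow> indep_rows K M (chosen j)"
proof (induction j)
  case 0
  have "chosen 0 = {}" using chosen_subset[of 0] by simp
  then show ?case by (simp add: indep_rows_def)
next
  case (Suc j)
  then show ?case by (intro stage) auto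
qed

lemma basis_vec_outside: "b \<notin> chosen d \<Longrightarrow> basis_vec b c = 0"
  using select_01[of d b] by (auto simp: chosen_def basis_vec_def)

text \<open>A rejected coordinate has a relation with coefficient 1 at itself that is otherwise
  supported on coordinates chosen earlier, so it can be solved for; a chosen coordinate expands
  trivially.\<close>

lemma basis_vec_expand:
  assumes c: "c < d" and a: "a < K"
  shows "M c a = (\<Sum>b\<in>chosen d. basis_vec b c * M b a)"
proof -
  have bv: "basis_vec b c = - relation c b" if "b \<in> chosen d" for b
    using that by (simp add: chosen_def basis_vec_def)
  have sel: "select d c = select (Suc c) c" using c by (intro select_stable) auto
  show ?thesis
  proof (cases "c \<in> chosen d")
    case True
    then have "select (Suc c) c = 1" using sel by (simp add: chosen_def)
    then have "relation c b = - of_bool (c = b)" for b by (simp add: relation_def)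
    then have "(\<Sum>b\<in>chosen d. basis_vec b c * M b a) = (\<Sum>b\<in>chosen d. if c = b then M b a else 0)"
      by (intro sum.cong refl) (simp add: bv)
    then show ?thesis using True by simp
  next
    case False
    then have s0: "select (Suc c) c = 0" using sel select_01[of d c] by (auto simp: chosen_def)
    then have nz: "stage_norm (select c) c = 0" by - (rule ccontr, simp)
    let ?inn = "(select c)(c := 1)"
    let ?F = "gs_cols ?inn (final_weights ?inn) c"
    have rel: "relation c b = ?F (Inr b)" for b using s0 by (simp add: relation_def)
    have "(\<Sum>b<d. relation c b * M b a) = 0"
      unfolding rel by (rule stage(1)[OF c chosen_indep nz a]) (use c in simp)
    moreover have "(\<Sum>b<d. relation c b * M b a) = (\<Sum>b\<in>insert c (chosen d). relation c b * M b a)"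
    proof (rule sum.mono_neutral_right)
      show "insert c (chosen d) \<subseteq> {..<d}" using c chosen_subset[of d] by auto
      show "\<forall>b\<in>{..<d} - insert c (chosen d). relation c b * M b a = 0"
      proof
        fix b assume b: "b \<in> {..<d} - insert c (chosen d)"
        have "b \<notin> chosen c" using b chosen_mono[of c d] c by auto
        then have "?inn b = 0" using b select_01[of c b] by (auto simp: chosen_def)
        then have "?F (Inr b) = 0" by (rule gs_cols_coeff_inn)
        then show "relation c b * M b a = 0" by (simp add: rel)
      qed
    qed simp
    moreover have "relation c c = 1" unfolding rel using gs_cols_coeff_diag[OF c, of ?inn] by simp
    ultimately have "M c a + (\<Sum>b\<in>chosen d. relation c b * M b a) = 0" using False by simp
    then show ?thesis by (simp add: bv sum_negf)
  qed
qed

end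

section \<open>The program\<close>

text \<open>
  Index registers \<open>0\<close>, \<open>1\<close>, \<open>2\<close> hold \<open>n\<close>, \<open>d\<close> and \<open>0\<close>.  Array \<open>0\<close> holds the data, \<open>1\<close> the row weights,
  \<open>2\<close> and \<open>3\<close> row values and coefficients of the orthogonalized columns, \<open>4\<close> their squared norms,
  \<open>5\<close> the selection flags, \<open>6\<close> the row mask, \<open>10\<close> the kernel, \<open>11\<close> the Gram matrix, \<open>12\<close> and \<open>13\<close> the
  probe and the response, \<open>14\<close> the scores and \<open>16\<close> the relations; \<open>7\<close>, \<open>8\<close>, \<open>9\<close>, \<open>15\<close> hold scalars.
  The filter threshold \<open>402653184\<close> is \<open>12288 * 32768\<close>, where \<open>32768\<close> is the constant in the upper bound
  for the clean samples.
\<close>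

definition Delta :: "nat \<Rightarrow> nat \<Rightarrow> expr" where
  "Delta i j = IfIndexLess i j (Num 0) (IfIndexLess j i (Num 0) (Num 1))"

definition gs_inner :: stmt where
  "gs_inner =
    Store 7 2 2 (EDiv (ESum 0 (EMul (Ld 2 6 7) (Ld 2 5 7))) (Ld 4 2 6)) ;;
    For 0 (Store 2 5 7 (ESub (Ld 2 5 7) (EMul (Ld 7 2 2) (Ld 2 6 7)))) ;;
    For 1 (Store 3 5 7 (ESub (Ld 3 5 7) (EMul (Ld 7 2 2) (Ld 3 6 7))))"

definition gs_column :: stmt where
  "gs_column =
    For 0 (Store 2 5 6 (EMul (EMul (Ld 6 2 6) (Ld 5 2 5)) (Ld 0 6 5))) ;;
    For 1 (Store 3 5 6 (EMul (Ld 5 2 5) (Delta 5 6))) ;;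
    For 5 gs_inner ;;
    Store 4 2 5 (ESum 0 (EMul (Ld 2 5 6) (Ld 2 5 6)))"

definition gs_prog :: stmt where
  "gs_prog =
    For 0 (Store 6 2 5 (IfLess (Num 1) (EAdd (Ld 1 2 5) (Ld 1 2 5)) (Num 1) (Num 0))) ;;
    For 1 gs_column"

definition gram_prog :: stmt where
  "gram_prog =
    Store 8 2 2 (ESum 0 (Ld 6 2 5)) ;;
    Store 9 2 2 (ESum 1 (EDiv (Ld 4 2 5) (Ld 4 2 5))) ;;
    For 0 (For 0 (Store 10 5 6
      (EMul (Ld 8 2 2) (ESum 1 (EDiv (EMul (Ld 2 7 5) (Ld 2 7 6)) (Ld 4 2 7)))))) ;;
    For 0 (For 0 (Store 11 5 6 (EMul (EMul (Ld 6 2 5) (Ld 6 2 6))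
      (EAdd (ESub (ESub (EMul (Ld 10 5 6) (Ld 10 5 6)) (Ld 10 5 5)) (Ld 10 6 6)) (Ld 9 2 2)))))"

text \<open>The product goes to array 13 first, since overwriting array 12 in place would feed new
  entries into later sums.\<close>

definition probe_step :: stmt where
  "probe_step =
    For 0 (Store 13 2 7 (ESum 0 (EMul (Ld 11 7 8) (Ld 12 2 8)))) ;;
    For 0 (Store 12 2 7 (Ld 13 2 7))"

definition probe_prog :: stmt where
  "probe_prog =
    For 0 (Store 12 2 6 (Delta 6 5)) ;;
    For 0 probe_step ;;
    For 0 (Store 13 2 6 (ESum 0 (EMul (Ld 11 6 7) (Ld 12 2 7)))) ;;
    For 0 (Store 14 2 6 (IfLess
      (EMul (EMul (Num 402653184) (Ld 8 2 2)) (ESum 0 (EMul (Ld 12 2 7) (Ld 13 2 7))))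
      (ESum 0 (EMul (Ld 13 2 7) (Ld 13 2 7)))
      (EMul (Ld 13 2 6) (Ld 13 2 6)) (Ld 14 2 6)))"

definition reweigh_prog :: stmt where
  "reweigh_prog =
    For 0 (Store 14 2 5 (Num 0)) ;;
    For 0 probe_prog ;;
    Store 15 2 2 (Num 0) ;;
    For 0 (Store 15 2 2 (IfLess (Ld 15 2 2) (Ld 14 2 5) (Ld 14 2 5) (Ld 15 2 2))) ;;
    For 0 (Store 1 2 5 (ESub (Ld 1 2 5) (EDiv (Ld 14 2 5) (EMul (Num 2) (Ld 15 2 2)))))"

definition round_prog :: stmt where
  "round_prog = gs_prog ;; gram_prog ;; reweigh_prog"

text \<open>The coordinate in register 3 is switched on for the n rounds, then its flag is
  overwritten by the verdict. Arrays 3 and 4 still hold the orthogonalization of the last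
  round.\<close>

definition stage_prog :: stmt where
  "stage_prog =
    For 0 (Store 1 2 4 (Num 1)) ;;
    Store 5 2 3 (Num 1) ;;
    For 0 round_prog ;;
    Store 5 2 3 (EDiv (Ld 4 2 3) (Ld 4 2 3)) ;;
    For 1 (Store 16 3 4 (ESub (EMul (ESub (Num 1) (Ld 5 2 3)) (Ld 3 3 4)) (EMul (Ld 5 2 3) (Delta 3 4))))"

definition main_stmt :: stmt where
  "main_stmt =
    For 1 stage_prog ;;
    For 1 (For 1 (Store 0 3 4 (EMul (Ld 5 2 3) (ESub (Num 0) (Ld 16 4 3)))))"

text \<open>Register 2 holds 0, so the last instruction copies d into register 0: all d rows are
  output, those of rejected coordinates being zero vectors.\<close>

definition subspace_prog :: prog where
  "subspace_prog = Seq (compile main_stmt 3) (Instr (IAdd 0 1 2))"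

section \<open>Effect of the loops on the arrays\<close>

definition set_row :: "arrays \<Rightarrow> nat \<Rightarrow> nat \<Rightarrow> nat \<Rightarrow> (nat \<Rightarrow> real) \<Rightarrow> arrays" where
  "set_row A a r N f = (\<lambda>a' r' y. if a' = a \<and> r' = r \<and> y < N then f y else A a' r' y)"

definition set_mat :: "arrays \<Rightarrow> nat \<Rightarrow> nat \<Rightarrow> nat \<Rightarrow> (nat \<Rightarrow> nat \<Rightarrow> real) \<Rightarrow> arrays" where
  "set_mat A a N N' f = (\<lambda>a' r' y. if a' = a \<and> r' < N \<and> y < N' then f r' y else A a' r' y)"

text \<open>The premise lets the expression read array a itself, at other rows or at entries from x
  on, which the loop has not yet overwritten. In-place updates are covered this way.\<close>

lemma run_row_loop:
  assumes "i < L" and stable: "\<And>x A1. x < \<rho> N \<Longrightarrow>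
      (\<And>a' r y. a' \<noteq> a \<or> r \<noteq> \<rho> i \<or> x \<le> y \<Longrightarrow> A1 a' r y = A a' r y) \<Longrightarrow>
      eval_expr e (Suc L) (\<rho>(L := x)) A1 = f x"
  shows "run (For N (Store a i L e)) L \<rho> A = set_row A a (\<rho> i) (\<rho> N) f"
proof -
  have "iter (\<lambda>x. run (Store a i L e) (Suc L) (\<rho>(L := x))) (\<rho> N) A = set_row A a (\<rho> i) (\<rho> N) f"
  proof (rule iter_eqI[where P = "\<lambda>x. set_row A a (\<rho> i) x f"])
    show "set_row A a (\<rho> i) 0 f = A" by (simp add: set_row_def)
    fix x assume x: "x < \<rho> N"
    have "eval_expr e (Suc L) (\<rho>(L := x)) (set_row A a (\<rho> i) x f) = f x"
      by (rule stable[OF x]) (auto simp: set_row_def)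
    then show "run (Store a i L e) (Suc L) (\<rho>(L := x)) (set_row A a (\<rho> i) x f) = set_row A a (\<rho> i) (Suc x) f"
      using assms(1) by (auto simp: set_row_def fun_eq_iff less_Suc_eq)
  qed
  then show ?thesis by simp
qed

lemma run_mat_loop:
  assumes lt: "N < L" "N' < L" and stable: "\<And>r x A1. r < \<rho> N \<Longrightarrow> x < \<rho> N' \<Longrightarrow>
      (\<And>a' r' y. a' \<noteq> a \<Longrightarrow> A1 a' r' y = A a' r' y) \<Longrightarrow>
      eval_expr e (Suc (Suc L)) (\<rho>(L := r, Suc L := x)) A1 = f r x"
  shows "run (For N (For N' (Store a L (Suc L) e))) L \<rho> A = set_mat A a (\<rho> N) (\<rho> N') f"
proof -
  have "iter (\<lambda>r. run (For N' (Store a L (Suc L) e)) (Suc L) (\<rho>(L := r))) (\<rho> N) A = set_mat A a (\<rho> N) (\<rho> N') f"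
  proof (rule iter_eqI[where P = "\<lambda>r. set_mat A a r (\<rho> N') f"])
    show "set_mat A a 0 (\<rho> N') f = A" by (simp add: set_mat_def)
    fix r assume r: "r < \<rho> N"
    have "run (For N' (Store a L (Suc L) e)) (Suc L) (\<rho>(L := r)) (set_mat A a r (\<rho> N') f) =
        set_row (set_mat A a r (\<rho> N') f) a ((\<rho>(L := r)) L) ((\<rho>(L := r)) N') (f r)"
    proof (rule run_row_loop)
      fix x A1 assume x: "x < (\<rho>(L := r)) N'"
        and A1: "\<And>a' r' y. a' \<noteq> a \<or> r' \<noteq> (\<rho>(L := r)) L \<or> x \<le> y \<Longrightarrow> A1 a' r' y = set_mat A a r (\<rho> N') f a' r' y"
      have "A1 a' r' y = A a' r' y" if "a' \<noteq> a" for a' r' y using A1[of a'] that by (simp add: set_mat_def)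
      then show "eval_expr e (Suc (Suc L)) ((\<rho>(L := r))(Suc L := x)) A1 = f r x"
        using stable[OF r] x lt by simp
    qed simp
    then show "run (For N' (Store a L (Suc L) e)) (Suc L) (\<rho>(L := r)) (set_mat A a r (\<rho> N') f) = set_mat A a (Suc r) (\<rho> N') f"
      using lt by (auto simp: set_row_def set_mat_def fun_eq_iff less_Suc_eq)
  qed
  then show ?thesis by simp
qed

lemma run_Store: "run (Store a i j e) L \<rho> A a' r y =
    (if a' = a \<and> r = \<rho> i \<and> y = \<rho> j then eval_expr e L \<rho> A else A a' r y)"
  by simp

lemma eval_Delta [simp]: "eval_expr (Delta i j) L \<rho> A = of_bool (\<rho> i = \<rho> j)"
  by (simp add: Delta_def)

lemma wf_Delta [simp]: "wf_expr (Delta i j) L \<longleftrightarrow> i < L \<and> j < L"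
  by (auto simp: Delta_def)

lemma wf_main: "wf_stmt main_stmt 3"
  by (simp add: main_stmt_def stage_prog_def round_prog_def gs_prog_def gs_column_def gs_inner_def
      gram_prog_def reweigh_prog_def probe_prog_def probe_step_def)

context data
begin

definition env :: "(nat \<Rightarrow> nat) \<Rightarrow> bool" where
  "env \<rho> \<longleftrightarrow> \<rho> 0 = n \<and> \<rho> 1 = d \<and> \<rho> 2 = 0"

lemma env_upd [simp]: "2 < r \<Longrightarrow> env (\<rho>(r := x)) \<longleftrightarrow> env \<rho>"
  by (auto simp: env_def)

lemma envD: "env \<rho> \<Longrightarrow> \<rho> 0 = n" "env \<rho> \<Longrightarrow> \<rho> (Suc 0) = d" "env \<rho> \<Longrightarrow> \<rho> 2 = 0"
  by (auto simp: env_def)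

definition holds_input :: "(nat \<Rightarrow> real) \<Rightarrow> (nat \<Rightarrow> real) \<Rightarrow> arrays \<Rightarrow> bool" where
  "holds_input inn v A \<longleftrightarrow> (\<forall>i<n. \<forall>b<d. A 0 i b = X i b) \<and> (\<forall>i<n. A 1 0 i = v i) \<and> (\<forall>b<d. A 5 0 b = inn b)"

definition holds_gs :: "(nat \<Rightarrow> real) \<Rightarrow> (nat \<Rightarrow> real) \<Rightarrow> arrays \<Rightarrow> bool" where
  "holds_gs inn v A \<longleftrightarrow> (\<forall>b<d. \<forall>i<n. A 2 b i = gs_cols inn v b (Inl i)) \<and>
    (\<forall>b<d. \<forall>c<d. A 3 b c = gs_cols inn v b (Inr c)) \<and> (\<forall>b<d. A 4 0 b = gs_norm inn v b)"

text \<open>The frame condition exempts only row b of arrays 2 and 3: the earlier rows are needed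
  intact by the following reduction steps.\<close>

lemma run_gs_inner:
  fixes inn v
  assumes env: "env \<rho>" and ab: "\<rho> 6 = a" "\<rho> 5 = b" "a < b" "b < d"
    and prev: "\<forall>b'<b. \<forall>i<n. A 2 b' i = gs_cols inn v b' (Inl i)"
      "\<forall>b'<b. \<forall>c<d. A 3 b' c = gs_cols inn v b' (Inr c)" "\<forall>b'<b. A 4 0 b' = gs_norm inn v b'"
  defines "f \<equiv> \<lambda>a. gs_reduce n (gs_cols inn v) (masked_columns inn v b) a"
  assumes cur: "\<forall>i<n. A 2 b i = f a (Inl i)" "\<forall>c<d. A 3 b c = f a (Inr c)"
  shows "let A' = run gs_inner 7 \<rho> A in (\<forall>i<n. A' 2 b i = f (Suc a) (Inl i)) \<and> (\<forall>c<d. A' 3 b c = f (Suc a) (Inr c)) \<and>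
    (\<forall>a' r y. (a' \<notin> {2, 3, 7} \<or> (a' \<noteq> 7 \<and> r \<noteq> b)) \<longrightarrow> A' a' r y = A a' r y)"
proof -
  note r = envD[OF env] ab
  let ?h = "row_dot n (gs_cols inn v a) (f a) / gs_norm inn v a"
  have ad: "a < d" using ab by simp
  have h: "eval_expr (EDiv (ESum 0 (EMul (Ld 2 6 7) (Ld 2 5 7))) (Ld 4 2 6)) 7 \<rho> A = ?h"
    using prev cur ab by (simp add: r row_dot_def)
  define A1 where "A1 = run (Store 7 2 2 (EDiv (ESum 0 (EMul (Ld 2 6 7) (Ld 2 5 7))) (Ld 4 2 6))) 7 \<rho> A"
  have A1: "A1 a' r' y = (if a' = 7 \<and> r' = 0 \<and> y = 0 then ?h else A a' r' y)" for a' r' y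
    unfolding A1_def run_Store h by (simp add: r)
  have "run (For 0 (Store 2 5 7 (ESub (Ld 2 5 7) (EMul (Ld 7 2 2) (Ld 2 6 7))))) 7 \<rho> A1 =
      set_row A1 2 (\<rho> 5) (\<rho> 0) (\<lambda>i. f (Suc a) (Inl i))"
    by (rule run_row_loop) (use prev cur ab in \<open>simp_all add: r A1 f_def gs_norm_def\<close>)
  moreover define A2 where "A2 = set_row A1 2 (\<rho> 5) (\<rho> 0) (\<lambda>i. f (Suc a) (Inl i))"
  moreover have "run (For 1 (Store 3 5 7 (ESub (Ld 3 5 7) (EMul (Ld 7 2 2) (Ld 3 6 7))))) 7 \<rho> A2 =
      set_row A2 3 (\<rho> 5) (\<rho> 1) (\<lambda>i. f (Suc a) (Inr i))"
    by (rule run_row_loop) (use prev cur ab in \<open>simp_all add: r A1 A2_def set_row_def f_def gs_norm_def\<close>)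
  ultimately have "run gs_inner 7 \<rho> A = set_row A2 3 (\<rho> 5) (\<rho> 1) (\<lambda>i. f (Suc a) (Inr i))"
    unfolding gs_inner_def run.simps(3) A1_def by (simp only:)
  then show ?thesis by (simp add: A2_def set_row_def r A1 Let_def)
qed

lemma run_gs_column:
  fixes inn v
  assumes env: "env \<rho>" and b: "\<rho> 5 = b" "b < d" and inp: "holds_input inn v A" "\<forall>i<n. A 6 0 i = row_mask v i"
    and prev: "\<forall>b'<b. \<forall>i<n. A 2 b' i = gs_cols inn v b' (Inl i)"
      "\<forall>b'<b. \<forall>c<d. A 3 b' c = gs_cols inn v b' (Inr c)" "\<forall>b'<b. A 4 0 b' = gs_norm inn v b'"
  shows "let A' = run gs_column 6 \<rho> A in
    (\<forall>b'<Suc b. \<forall>i<n. A' 2 b' i = gs_cols inn v b' (Inl i)) \<and>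
    (\<forall>b'<Suc b. \<forall>c<d. A' 3 b' c = gs_cols inn v b' (Inr c)) \<and> (\<forall>b'<Suc b. A' 4 0 b' = gs_norm inn v b') \<and>
    (\<forall>a' r y. a' \<notin> {2, 3, 4, 7} \<longrightarrow> A' a' r y = A a' r y)"
proof -
  note r = envD[OF env] b
  let ?U = "masked_columns inn v b" and ?F = "gs_cols inn v"
  define A1 where "A1 = set_row A 2 b n (\<lambda>i. ?U (Inl i))"
  have 1: "run (For 0 (Store 2 5 6 (EMul (EMul (Ld 6 2 6) (Ld 5 2 5)) (Ld 0 6 5)))) 6 \<rho> A = A1"
  proof -
    have "run (For 0 (Store 2 5 6 (EMul (EMul (Ld 6 2 6) (Ld 5 2 5)) (Ld 0 6 5)))) 6 \<rho> A = set_row A 2 (\<rho> 5) (\<rho> 0) (\<lambda>i. ?U (Inl i))"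
      by (rule run_row_loop) (use inp b in \<open>simp_all add: r masked_columns_def holds_input_def\<close>)
    then show ?thesis by (simp add: r A1_def)
  qed
  define A2 where "A2 = set_row A1 3 b d (\<lambda>c. ?U (Inr c))"
  have 2: "run (For 1 (Store 3 5 6 (EMul (Ld 5 2 5) (Delta 5 6)))) 6 \<rho> A1 = A2"
  proof -
    have "run (For 1 (Store 3 5 6 (EMul (Ld 5 2 5) (Delta 5 6)))) 6 \<rho> A1 = set_row A1 3 (\<rho> 5) (\<rho> 1) (\<lambda>c. ?U (Inr c))"
      by (rule run_row_loop) (use inp b in \<open>simp_all add: r masked_columns_def holds_input_def A1_def set_row_def\<close>)
    then show ?thesis by (simp add: r A2_def)
  qed
  let ?Q = "\<lambda>a A'. (\<forall>i<n. A' 2 b i = gs_reduce n ?F ?U a (Inl i)) \<and> (\<forall>c<d. A' 3 b c = gs_reduce n ?F ?U a (Inr c)) \<and>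
    (\<forall>a' r y. (a' \<notin> {2, 3, 7} \<or> (a' \<noteq> 7 \<and> r \<noteq> b)) \<longrightarrow> A' a' r y = A a' r y)"
  define A3 where "A3 = run (For 5 gs_inner) 6 \<rho> A2"
  have "?Q b (iter (\<lambda>x. run gs_inner (Suc 6) (\<rho>(6 := x))) b A2)"
  proof (rule iter_invariant[where Q = ?Q])
    show "?Q 0 A2" by (simp add: A2_def A1_def set_row_def)
    fix x A' assume x: "x < b" and Q: "?Q x A'"
    have p: "\<forall>b'<b. \<forall>i<n. A' 2 b' i = ?F b' (Inl i)" "\<forall>b'<b. \<forall>c<d. A' 3 b' c = ?F b' (Inr c)"
      "\<forall>b'<b. A' 4 0 b' = gs_norm inn v b'" using Q prev by auto
    have "let A'' = run gs_inner 7 (\<rho>(6 := x)) A' in (\<forall>i<n. A'' 2 b i = gs_reduce n ?F ?U (Suc x) (Inl i)) \<and>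
      (\<forall>c<d. A'' 3 b c = gs_reduce n ?F ?U (Suc x) (Inr c)) \<and>
      (\<forall>a' r y. (a' \<notin> {2, 3, 7} \<or> (a' \<noteq> 7 \<and> r \<noteq> b)) \<longrightarrow> A'' a' r y = A' a' r y)"
      by (rule run_gs_inner) (use env x b Q p in auto)
    then show "?Q (Suc x) (run gs_inner (Suc 6) (\<rho>(6 := x)) A')"
      using Q unfolding Let_def by simp
  qed
  then have Q: "?Q b A3" by (simp add: A3_def r)
  have Fb: "gs_reduce n ?F ?U b = ?F b" using gs_unfold[OF b(2), of n "masked_columns inn v"] unfolding gs_cols_def by simp
  have "run gs_column 6 \<rho> A = run (Store 4 2 5 (ESum 0 (EMul (Ld 2 5 6) (Ld 2 5 6)))) 6 \<rho> A3"
    unfolding gs_column_def run.simps(3) 1 2 A3_def ..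
  moreover have "eval_expr (ESum 0 (EMul (Ld 2 5 6) (Ld 2 5 6))) 6 \<rho> A3 = gs_norm inn v b"
    using Q by (simp add: r gs_norm_def row_dot_def Fb)
  ultimately have e: "run gs_column 6 \<rho> A a' r' y = (if a' = 4 \<and> r' = 0 \<and> y = b then gs_norm inn v b else A3 a' r' y)" for a' r' y
    by (simp only: run_Store r)
  show ?thesis unfolding Let_def e using Q prev by (auto simp: Fb less_Suc_eq)
qed

lemma run_gs_prog:
  assumes env: "env \<rho>" and inp: "holds_input inn v A"
  shows "let A' = run gs_prog 5 \<rho> A in holds_gs inn v A' \<and> holds_input inn v A' \<and> (\<forall>i<n. A' 6 0 i = row_mask v i) \<and>
    (\<forall>a' r y. a' \<notin> {2, 3, 4, 6, 7} \<longrightarrow> A' a' r y = A a' r y)"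
proof -
  note r = envD[OF env]
  define A1 where "A1 = set_row A 6 0 n (row_mask v)"
  have 1: "run (For 0 (Store 6 2 5 (IfLess (Num 1) (EAdd (Ld 1 2 5) (Ld 1 2 5)) (Num 1) (Num 0)))) 5 \<rho> A = A1"
  proof -
    have "run (For 0 (Store 6 2 5 (IfLess (Num 1) (EAdd (Ld 1 2 5) (Ld 1 2 5)) (Num 1) (Num 0)))) 5 \<rho> A = set_row A 6 (\<rho> 2) (\<rho> 0) (row_mask v)"
      by (rule run_row_loop) (use inp in \<open>simp_all add: r row_mask_def holds_input_def\<close>)
    then show ?thesis by (simp add: r A1_def)
  qed
  let ?Q = "\<lambda>b A'. (\<forall>b'<b. \<forall>i<n. A' 2 b' i = gs_cols inn v b' (Inl i)) \<and>
    (\<forall>b'<b. \<forall>c<d. A' 3 b' c = gs_cols inn v b' (Inr c)) \<and> (\<forall>b'<b. A' 4 0 b' = gs_norm inn v b') \<and>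
    (\<forall>a' r y. a' \<notin> {2, 3, 4, 7} \<longrightarrow> A' a' r y = A1 a' r y)"
  have inp1: "holds_input inn v A1" "\<forall>i<n. A1 6 0 i = row_mask v i"
    using inp by (simp_all add: A1_def set_row_def holds_input_def)
  have "?Q d (iter (\<lambda>x. run gs_column (Suc 5) (\<rho>(5 := x))) d A1)"
  proof (rule iter_invariant[where Q = ?Q])
    show "?Q 0 A1" by simp
    fix x A' assume x: "x < d" and Q: "?Q x A'"
    have "holds_input inn v A'" "\<forall>i<n. A' 6 0 i = row_mask v i" using Q inp1 by (simp_all add: holds_input_def)
    then have "let A'' = run gs_column 6 (\<rho>(5 := x)) A' in (\<forall>b'<Suc x. \<forall>i<n. A'' 2 b' i = gs_cols inn v b' (Inl i)) \<and>
      (\<forall>b'<Suc x. \<forall>c<d. A'' 3 b' c = gs_cols inn v b' (Inr c)) \<and> (\<forall>b'<Suc x. A'' 4 0 b' = gs_norm inn v b') \<and>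
      (\<forall>a' r y. a' \<notin> {2, 3, 4, 7} \<longrightarrow> A'' a' r y = A' a' r y)"
      by - (rule run_gs_column, use env x Q in auto)
    then show "?Q (Suc x) (run gs_column (Suc 5) (\<rho>(5 := x)) A')"
      using Q unfolding Let_def by simp
  qed
  moreover have "run gs_prog 5 \<rho> A = iter (\<lambda>x. run gs_column (Suc 5) (\<rho>(5 := x))) d A1"
    unfolding gs_prog_def run.simps(3) 1 by (simp add: r)
  ultimately have Q: "?Q d (run gs_prog 5 \<rho> A)" by simp
  show ?thesis unfolding Let_def holds_gs_def
    using Q inp1 by (auto simp: holds_input_def A1_def set_row_def)
qed


definition holds_gram :: "(nat \<Rightarrow> real) \<Rightarrow> (nat \<Rightarrow> real) \<Rightarrow> arrays \<Rightarrow> bool" where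
  "holds_gram inn v A \<longleftrightarrow> A 8 0 0 = weight v \<and> (\<forall>i<n. \<forall>l<n. A 11 i l = gram inn v i l)"

lemma run_gram_prog:
  assumes env: "env \<rho>" and gs: "holds_gs inn v A" "\<forall>i<n. A 6 0 i = row_mask v i"
  shows "let A' = run gram_prog 5 \<rho> A in holds_gram inn v A' \<and>
    (\<forall>a' r y. a' \<notin> {8, 9, 10, 11} \<longrightarrow> A' a' r y = A a' r y)"
proof -
  note r = envD[OF env]
  let ?e1 = "ESum 0 (Ld 6 2 5)" and ?e2 = "ESum 1 (EDiv (Ld 4 2 5) (Ld 4 2 5))"
  let ?e3 = "EMul (Ld 8 2 2) (ESum 1 (EDiv (EMul (Ld 2 7 5) (Ld 2 7 6)) (Ld 4 2 7)))"
  let ?e4 = "EMul (EMul (Ld 6 2 5) (Ld 6 2 6))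
      (EAdd (ESub (ESub (EMul (Ld 10 5 6) (Ld 10 5 6)) (Ld 10 5 5)) (Ld 10 6 6)) (Ld 9 2 2))"
  define A1 where "A1 = run (Store 8 2 2 ?e1) 5 \<rho> A"
  have A1: "A1 a' r' y = (if a' = 8 \<and> r' = 0 \<and> y = 0 then weight v else A a' r' y)" for a' r' y
    unfolding A1_def run_Store using gs by (simp add: r weight_def)
  define A2 where "A2 = run (Store 9 2 2 ?e2) 5 \<rho> A1"
  have A2: "A2 a' r' y = (if a' = 9 \<and> r' = 0 \<and> y = 0 then gs_dim inn v else A1 a' r' y)" for a' r' y
    unfolding A2_def run_Store using gs by (simp add: r gs_dim_def A1 holds_gs_def)
  define A3 where "A3 = set_mat A2 10 n n (kernel inn v)"
  have 3: "run (For 0 (For 0 (Store 10 5 6 ?e3))) 5 \<rho> A2 = A3"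
  proof -
    have "run (For 0 (For 0 (Store 10 5 (Suc 5) ?e3))) 5 \<rho> A2 = set_mat A2 10 (\<rho> 0) (\<rho> 0) (kernel inn v)"
      by (rule run_mat_loop) (use gs in \<open>simp_all add: r A1 A2 kernel_def holds_gs_def\<close>)
    then show ?thesis by (simp add: r A3_def)
  qed
  define A4 where "A4 = set_mat A3 11 n n (gram inn v)"
  have 4: "run (For 0 (For 0 (Store 11 5 6 ?e4))) 5 \<rho> A3 = A4"
  proof -
    have "run (For 0 (For 0 (Store 11 5 (Suc 5) ?e4))) 5 \<rho> A3 = set_mat A3 11 (\<rho> 0) (\<rho> 0) (gram inn v)"
      by (rule run_mat_loop) (use gs in \<open>simp_all add: r A1 A2 A3_def set_mat_def gram_def\<close>)
    then show ?thesis by (simp add: r A4_def)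
  qed
  have "run gram_prog 5 \<rho> A = A4"
    unfolding gram_prog_def run.simps(3) A1_def[symmetric] A2_def[symmetric] 3 4 ..
  then show ?thesis by (simp add: Let_def holds_gram_def A4_def A3_def set_mat_def A2 A1)
qed

lemma run_probe_prog:
  fixes inn v
  assumes thr: "thr = 402653184"
    and env: "env \<rho>" and l: "\<rho> 5 = l" "l < n" and gram: "holds_gram inn v A"
  defines "s \<equiv> A 14 0"
  shows "let A' = run probe_prog 6 \<rho> A in
    (\<forall>i<n. A' 14 0 i = (if suspicious inn v l then response inn v l i * response inn v l i else s i)) \<and>
    (\<forall>a' r y. a' \<notin> {12, 13, 14} \<longrightarrow> A' a' r y = A a' r y)"
proof -
  note r = envD[OF env] l
  let ?M = "matvec n (gram inn v)" and ?e = "\<lambda>i. of_bool (i = l) :: real"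
  define A1 where "A1 = set_row A 12 0 n ?e"
  have 1: "run (For 0 (Store 12 2 6 (Delta 6 5))) 6 \<rho> A = A1"
  proof -
    have "run (For 0 (Store 12 2 6 (Delta 6 5))) 6 \<rho> A = set_row A 12 (\<rho> 2) (\<rho> 0) ?e"
      by (rule run_row_loop) (simp_all add: r)
    then show ?thesis by (simp add: r A1_def)
  qed
  let ?Q = "\<lambda>t A'. (\<forall>i<n. A' 12 0 i = (?M ^^ t) ?e i) \<and> (\<forall>a' r y. a' \<notin> {12, 13} \<longrightarrow> A' a' r y = A a' r y)"
  define A2 where "A2 = run (For 0 probe_step) 6 \<rho> A1"
  have "?Q n (iter (\<lambda>x. run probe_step (Suc 6) (\<rho>(6 := x))) n A1)"
  proof (rule iter_invariant[where Q = ?Q])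
    show "?Q 0 A1" by (simp add: A1_def set_row_def)
    fix x A' assume x: "x < n" and Q: "?Q x A'"
    let ?r = "\<rho>(6 := x)"
    define B where "B = set_row A' 13 0 n (?M ((?M ^^ x) ?e))"
    have "run (For 0 (Store 13 2 7 (ESum 0 (EMul (Ld 11 7 8) (Ld 12 2 8))))) 7 ?r A' = set_row A' 13 (?r 2) (?r 0) (?M ((?M ^^ x) ?e))"
      by (rule run_row_loop) (use Q gram in \<open>simp_all add: r matvec_def holds_gram_def\<close>)
    then have B: "run (For 0 (Store 13 2 7 (ESum 0 (EMul (Ld 11 7 8) (Ld 12 2 8))))) 7 ?r A' = B" by (simp add: B_def r)
    have "run (For 0 (Store 12 2 7 (Ld 13 2 7))) 7 ?r B = set_row B 12 (?r 2) (?r 0) (?M ((?M ^^ x) ?e))"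
      by (rule run_row_loop) (simp_all add: r B_def set_row_def)
    then have "run probe_step 7 ?r A' = set_row B 12 0 n (?M ((?M ^^ x) ?e))"
      unfolding probe_step_def run.simps(3) B by (simp add: r)
    then show "?Q (Suc x) (run probe_step (Suc 6) ?r A')"
      using Q by (simp add: B_def set_row_def)
  qed
  then have Q: "?Q n A2" by (simp add: A2_def r)
  let ?e3 = "ESum 0 (EMul (Ld 11 6 7) (Ld 12 2 7))"
  define A3 where "A3 = set_row A2 13 0 n (response inn v l)"
  have 3: "run (For 0 (Store 13 2 6 ?e3)) 6 \<rho> A2 = A3"
  proof -
    have "run (For 0 (Store 13 2 6 ?e3)) 6 \<rho> A2 = set_row A2 13 (\<rho> 2) (\<rho> 0) (response inn v l)"
      by (rule run_row_loop) (use Q gram in \<open>simp_all add: r response_def probe_def matvec_def holds_gram_def\<close>)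
    then show ?thesis by (simp add: r A3_def)
  qed
  let ?e4 = "IfLess
      (EMul (EMul (Num 402653184) (Ld 8 2 2)) (ESum 0 (EMul (Ld 12 2 7) (Ld 13 2 7))))
      (ESum 0 (EMul (Ld 13 2 7) (Ld 13 2 7)))
      (EMul (Ld 13 2 6) (Ld 13 2 6)) (Ld 14 2 6)"
  let ?f = "\<lambda>i. if suspicious inn v l then response inn v l i * response inn v l i else s i"
  have A3: "A3 14 0 = s" "A3 8 0 0 = weight v" "\<And>i. i < n \<Longrightarrow> A3 13 0 i = response inn v l i"
    "\<And>i. i < n \<Longrightarrow> A3 12 0 i = probe inn v l i"
    using Q gram by (auto simp: A3_def set_row_def s_def probe_def holds_gram_def fun_eq_iff)
  have "run (For 0 (Store 14 2 6 ?e4)) 6 \<rho> A3 = set_row A3 14 (\<rho> 2) (\<rho> 0) ?f"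
    by (rule run_row_loop) (simp_all add: r A3 suspicious_def thr[symmetric])
  then have 4: "run (For 0 (Store 14 2 6 ?e4)) 6 \<rho> A3 = set_row A3 14 0 n ?f" by (simp add: r)
  have "run probe_prog 6 \<rho> A = set_row A3 14 0 n ?f"
    unfolding probe_prog_def run.simps(3) 1 A2_def[symmetric] 3 4 ..
  then show ?thesis using Q by (simp add: Let_def set_row_def A3_def)
qed

lemma run_reweigh_prog:
  assumes thr: "thr = 402653184"
    and env: "env \<rho>" and gram: "holds_gram inn v A" and v: "\<forall>i<n. A 1 0 i = v i"
  shows "let A' = run reweigh_prog 5 \<rho> A in (\<forall>i<n. A' 1 0 i = reweigh inn v i) \<and>
    (\<forall>a' r y. a' \<notin> {1, 12, 13, 14, 15} \<longrightarrow> A' a' r y = A a' r y)"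
proof -
  note r = envD[OF env]
  define A1 where "A1 = set_row A 14 0 n (\<lambda>_. 0)"
  have 1: "run (For 0 (Store 14 2 5 (Num 0))) 5 \<rho> A = A1"
  proof -
    have "run (For 0 (Store 14 2 5 (Num 0))) 5 \<rho> A = set_row A 14 (\<rho> 2) (\<rho> 0) (\<lambda>_. 0)"
      by (rule run_row_loop) (simp_all add: r)
    then show ?thesis by (simp add: r A1_def)
  qed
  let ?g = "\<lambda>l s. if suspicious inn v l then (\<lambda>i. response inn v l i * response inn v l i) else s"
  let ?Q = "\<lambda>l A'. (\<forall>i<n. A' 14 0 i = iter ?g l (\<lambda>_. 0) i) \<and> (\<forall>a' r y. a' \<notin> {12, 13, 14} \<longrightarrow> A' a' r y = A a' r y)"
  define A2 where "A2 = run (For 0 probe_prog) 5 \<rho> A1"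
  have "?Q n (iter (\<lambda>x. run probe_prog (Suc 5) (\<rho>(5 := x))) n A1)"
  proof (rule iter_invariant[where Q = ?Q])
    show "?Q 0 A1" by (simp add: A1_def set_row_def)
    fix x A' assume x: "x < n" and Q: "?Q x A'"
    have "holds_gram inn v A'" using Q gram by (simp add: holds_gram_def)
    then have "let A'' = run probe_prog 6 (\<rho>(5 := x)) A' in
      (\<forall>i<n. A'' 14 0 i = (if suspicious inn v x then response inn v x i * response inn v x i else A' 14 0 i)) \<and>
      (\<forall>a' r y. a' \<notin> {12, 13, 14} \<longrightarrow> A'' a' r y = A' a' r y)"
      by - (rule run_probe_prog[OF thr], use env x in auto)
    then show "?Q (Suc x) (run probe_prog (Suc 5) (\<rho>(5 := x)) A')"
      using Q unfolding Let_def by simp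
  qed
  then have Q: "?Q n A2" by (simp add: A2_def r)
  then have s: "\<forall>i<n. A2 14 0 i = scores inn v i" by (simp add: scores_def)
  define A3 where "A3 = run (Store 15 2 2 (Num 0)) 5 \<rho> A2"
  let ?e4 = "IfLess (Ld 15 2 2) (Ld 14 2 5) (Ld 14 2 5) (Ld 15 2 2)"
  define A4 where "A4 = run (For 0 (Store 15 2 2 ?e4)) 5 \<rho> A3"
  let ?P = "\<lambda>i A'. A' 15 0 0 = iter (\<lambda>i m. if m < scores inn v i then scores inn v i else m) i 0 \<and>
    (\<forall>a' r y. a' \<noteq> 15 \<longrightarrow> A' a' r y = A2 a' r y)"
  have "?P n (iter (\<lambda>x. run (Store 15 2 2 ?e4) (Suc 5) (\<rho>(5 := x))) n A3)"
    by (rule iter_invariant[where Q = ?P]) (use s in \<open>auto simp: A3_def r\<close>)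
  moreover have A4: "A4 = iter (\<lambda>x. run (Store 15 2 2 ?e4) (Suc 5) (\<rho>(5 := x))) n A3"
    unfolding A4_def run.simps(2) r(1) ..
  ultimately have P: "A4 15 0 0 = peak n (scores inn v)" "\<And>a' r y. a' \<noteq> 15 \<Longrightarrow> A4 a' r y = A2 a' r y"
    unfolding A4 peak_def by blast+
  let ?e5 = "ESub (Ld 1 2 5) (EDiv (Ld 14 2 5) (EMul (Num 2) (Ld 15 2 2)))"
  have "run (For 0 (Store 1 2 5 ?e5)) 5 \<rho> A4 = set_row A4 1 (\<rho> 2) (\<rho> 0) (reweigh inn v)"
    by (rule run_row_loop) (use Q v s in \<open>simp_all add: r P reweigh_def\<close>)
  then have 5: "run (For 0 (Store 1 2 5 ?e5)) 5 \<rho> A4 = set_row A4 1 0 n (reweigh inn v)" by (simp add: r)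
  have "run reweigh_prog 5 \<rho> A = set_row A4 1 0 n (reweigh inn v)"
    unfolding reweigh_prog_def run.simps(3) 1 A2_def[symmetric] A3_def[symmetric] A4_def[symmetric] 5 ..
  then show ?thesis using Q by (simp add: Let_def set_row_def P)
qed

lemma run_round_prog:
  assumes thr: "thr = 402653184" and env: "env \<rho>" and inp: "holds_input inn v A"
  shows "let A' = run round_prog 5 \<rho> A in holds_gs inn v A' \<and> holds_input inn (reweigh inn v) A' \<and>
    (\<forall>a' r y. a' \<in> {5, 16} \<longrightarrow> A' a' r y = A a' r y)"
proof -
  define A1 where "A1 = run gs_prog 5 \<rho> A"
  have 1: "holds_gs inn v A1" "holds_input inn v A1" "\<forall>i<n. A1 6 0 i = row_mask v i"
    "\<forall>a' r y. a' \<notin> {2, 3, 4, 6, 7} \<longrightarrow> A1 a' r y = A a' r y"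
    using run_gs_prog[OF env inp] by (simp_all add: A1_def Let_def)
  define A2 where "A2 = run gram_prog 5 \<rho> A1"
  have 2: "holds_gram inn v A2" "\<forall>a' r y. a' \<notin> {8, 9, 10, 11} \<longrightarrow> A2 a' r y = A1 a' r y"
    using run_gram_prog[OF env 1(1,3)] by (simp_all add: A2_def Let_def)
  define A3 where "A3 = run reweigh_prog 5 \<rho> A2"
  have "\<forall>i<n. A2 1 0 i = v i" using 1(2) 2(2) by (simp add: holds_input_def)
  then have 3: "\<forall>i<n. A3 1 0 i = reweigh inn v i" "\<forall>a' r y. a' \<notin> {1, 12, 13, 14, 15} \<longrightarrow> A3 a' r y = A2 a' r y"
    using run_reweigh_prog[OF thr env 2(1)] by (simp_all add: A3_def Let_def)
  have "run round_prog 5 \<rho> A = A3" by (simp add: round_prog_def A1_def A2_def A3_def)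
  then show ?thesis using 1 2(2) 3 by (simp add: Let_def holds_gs_def holds_input_def)
qed

lemma run_stage_prog:
  assumes thr: "thr = 402653184" and n: "0 < n" and env: "env \<rho>" and j: "\<rho> 3 = j" "j < d"
    and X: "\<forall>i<n. \<forall>b<d. A 0 i b = X i b" and sel: "\<forall>b<d. A 5 0 b = select j b"
    and rel: "\<forall>c<j. \<forall>b<d. A 16 c b = relation c b"
  shows "let A' = run stage_prog 4 \<rho> A in (\<forall>i<n. \<forall>b<d. A' 0 i b = X i b) \<and>
    (\<forall>b<d. A' 5 0 b = select (Suc j) b) \<and> (\<forall>c<Suc j. \<forall>b<d. A' 16 c b = relation c b)"
proof -
  note r = envD[OF env] j
  let ?inn = "(select j)(j := 1)" and ?one = "\<lambda>_. 1 :: real"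
  define A1 where "A1 = set_row A 1 0 n ?one"
  have 1: "run (For 0 (Store 1 2 4 (Num 1))) 4 \<rho> A = A1"
  proof -
    have "run (For 0 (Store 1 2 4 (Num 1))) 4 \<rho> A = set_row A 1 (\<rho> 2) (\<rho> 0) ?one"
      by (rule run_row_loop) (simp_all add: r)
    then show ?thesis by (simp add: r A1_def)
  qed
  define A2 where "A2 = run (Store 5 2 3 (Num 1)) 4 \<rho> A1"
  have A2: "A2 a' r' y = (if a' = 5 \<and> r' = 0 \<and> y = j then 1 else A1 a' r' y)" for a' r' y
    unfolding A2_def run_Store by (simp add: r)
  let ?v = "\<lambda>t. (reweigh ?inn ^^ t) ?one"
  \<comment> \<open>After t rounds the orthogonalization in the arrays belongs to the weights before
    the t-th update, hence the index t - 1.\<close>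
  let ?Q = "\<lambda>t A'. holds_input ?inn (?v t) A' \<and> (0 < t \<longrightarrow> holds_gs ?inn (?v (t - 1)) A') \<and>
    (\<forall>a' r y. a' \<in> {5, 16} \<longrightarrow> A' a' r y = A2 a' r y)"
  define A3 where "A3 = run (For 0 round_prog) 4 \<rho> A2"
  have "?Q n (iter (\<lambda>x. run round_prog (Suc 4) (\<rho>(4 := x))) n A2)"
  proof (rule iter_invariant[where Q = ?Q])
    show "?Q 0 A2" using X sel by (simp add: holds_input_def A2 A1_def set_row_def)
    fix x A' assume x: "x < n" and Q: "?Q x A'"
    have "let A'' = run round_prog 5 (\<rho>(4 := x)) A' in holds_gs ?inn (?v x) A'' \<and>
      holds_input ?inn (reweigh ?inn (?v x)) A'' \<and> (\<forall>a' r y. a' \<in> {5, 16} \<longrightarrow> A'' a' r y = A' a' r y)"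
      by (rule run_round_prog[OF thr]) (use env Q in auto)
    then show "?Q (Suc x) (run round_prog (Suc 4) (\<rho>(4 := x)) A')"
      using Q unfolding Let_def by simp
  qed
  then have Q: "?Q n A3" by (simp add: A3_def r)
  then have gs: "holds_gs ?inn (final_weights ?inn) A3" using n by (simp add: final_weights_def)
  define A4 where "A4 = run (Store 5 2 3 (EDiv (Ld 4 2 3) (Ld 4 2 3))) 4 \<rho> A3"
  have A4: "A4 a' r' y = (if a' = 5 \<and> r' = 0 \<and> y = j then select (Suc j) j else A3 a' r' y)" for a' r' y
    unfolding A4_def run_Store using gs j by (simp add: r holds_gs_def stage_norm_def)
  let ?e5 = "ESub (EMul (ESub (Num 1) (Ld 5 2 3)) (Ld 3 3 4)) (EMul (Ld 5 2 3) (Delta 3 4))"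
  have "run (For 1 (Store 16 3 4 ?e5)) 4 \<rho> A4 = set_row A4 16 (\<rho> 3) (\<rho> 1) (relation j)"
  proof (rule run_row_loop)
    fix x A' assume x: "x < \<rho> 1" and A': "\<And>a' r y. a' \<noteq> 16 \<or> r \<noteq> \<rho> 3 \<or> x \<le> y \<Longrightarrow> A' a' r y = A4 a' r y"
    have "A' 5 0 j = select (Suc j) j" using A' by (simp add: A4 del: select.simps)
    moreover have "A' 3 j x = gs_cols ?inn (final_weights ?inn) j (Inr x)"
      using A' gs x j by (simp add: A4 holds_gs_def r)
    ultimately show "eval_expr ?e5 (Suc 4) (\<rho>(4 := x)) A' = relation j x"
      by (simp add: r relation_def del: select.simps)
  qed simp
  then have 5: "run (For 1 (Store 16 3 4 ?e5)) 4 \<rho> A4 = set_row A4 16 j d (relation j)" by (simp add: r)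
  have e: "run stage_prog 4 \<rho> A = set_row A4 16 j d (relation j)"
    unfolding stage_prog_def run.simps(3) 1 A2_def[symmetric] A3_def[symmetric] A4_def[symmetric] 5 ..
  have "A3 5 0 b = select j b" if "b < d" "b \<noteq> j" for b using Q that sel by (simp add: A2 A1_def set_row_def)
  moreover have "A3 16 c b = relation c b" if "c < j" "b < d" for b c using Q that rel by (simp add: A2 A1_def set_row_def)
  moreover have "A3 0 i b = X i b" if "i < n" "b < d" for i b using Q that by (simp add: holds_input_def)
  ultimately show ?thesis unfolding e Let_def by (auto simp: set_row_def A4 less_Suc_eq)
qed

lemma run_main:
  assumes thr: "thr = 402653184" and n: "0 < n" and env: "env \<rho>"
    and X: "\<forall>i<n. \<forall>b<d. A 0 i b = X i b" and zero: "A 5 = (\<lambda>_ _. 0)"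
  shows "\<forall>b<d. \<forall>c<d. run main_stmt 3 \<rho> A 0 b c = basis_vec b c"
proof -
  note r = envD[OF env]
  let ?Q = "\<lambda>j (A' :: arrays). (\<forall>i<n. \<forall>b<d. A' 0 i b = X i b) \<and> (\<forall>b<d. A' 5 0 b = select j b) \<and> (\<forall>c<j. \<forall>b<d. A' 16 c b = relation c b)"
  define A1 where "A1 = run (For 1 stage_prog) 3 \<rho> A"
  have "?Q d (iter (\<lambda>x. run stage_prog (Suc 3) (\<rho>(3 := x))) d A)"
  proof (rule iter_invariant[where Q = ?Q])
    show "?Q 0 A" using X zero by simp
    fix x A' assume x: "x < d" and Q: "?Q x A'"
    have "let A'' = run stage_prog 4 (\<rho>(3 := x)) A' in (\<forall>i<n. \<forall>b<d. A'' 0 i b = X i b) \<and>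
      (\<forall>b<d. A'' 5 0 b = select (Suc x) b) \<and> (\<forall>c<Suc x. \<forall>b<d. A'' 16 c b = relation c b)"
      by (rule run_stage_prog[OF thr n]) (use env x Q in auto)
    then show "?Q (Suc x) (run stage_prog (Suc 3) (\<rho>(3 := x)) A')"
      unfolding Let_def by (simp del: select.simps)
  qed
  then have Q: "?Q d A1" by (simp add: A1_def r)
  let ?e = "EMul (Ld 5 2 3) (ESub (Num 0) (Ld 16 4 3))"
  have "run (For 1 (For 1 (Store 0 3 (Suc 3) ?e))) 3 \<rho> A1 = set_mat A1 0 (\<rho> 1) (\<rho> 1) basis_vec"
    by (rule run_mat_loop) (use Q in \<open>simp_all add: r basis_vec_def\<close>)
  then have "run main_stmt 3 \<rho> A = set_mat A1 0 d d basis_vec"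
    unfolding main_stmt_def run.simps(3) A1_def[symmetric] by (simp add: r)
  then show ?thesis by (simp add: set_mat_def)
qed

end

text \<open>Halting in time is claimed for arbitrary data, as the theorem demands. The contents of
  the output refer to the arrays left by the last round, so they are tied to there being
  one.\<close>

lemma subspace_prog_exec:
  fixes x :: "nat \<Rightarrow> nat \<Rightarrow> real"
  shows "\<exists>t m. exec subspace_prog (input_state n d x) t m \<and> t \<le> stmt_time main_stmt (max n d) + 1 \<and>
    ireg m 0 = d \<and> (0 < n \<longrightarrow> (\<forall>b<d. \<forall>c<d. arr m 0 b c = data.basis_vec n d x 402653184 b c))"
proof -
  let ?m = "input_state n d x" and ?\<rho> = "(\<lambda>_. 0)(0 := n, 1 := d) :: nat \<Rightarrow> nat"
  have r: "\<forall>i<3. ireg ?m i = ?\<rho> i" by (simp add: input_state_def)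
  have X: "\<forall>i<3. ?\<rho> i \<le> max n d" by auto
  obtain t m where m: "exec (compile main_stmt 3) ?m t m" "t \<le> stmt_time main_stmt (max n d)"
    "\<forall>i<3. ireg m i = ireg ?m i" "arr m = run main_stmt 3 ?\<rho> (arr ?m)"
    using compile_correct[OF wf_main r X] by blast
  let ?m' = "step (IAdd 0 1 2) m"
  have "exec subspace_prog ?m (t + 1) ?m'"
    unfolding subspace_prog_def by (rule exec.Seq[OF m(1) exec.Instr])
  moreover have "ireg ?m' 0 = d" using m(3) by (simp add: input_state_def)
  moreover have "\<forall>b<d. \<forall>c<d. arr ?m' 0 b c = data.basis_vec n d x 402653184 b c" if n: "0 < n"
  proof -
    have "\<forall>b<d. \<forall>c<d. run main_stmt 3 ?\<rho> (arr ?m) 0 b c = data.basis_vec n d x 402653184 b c"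
      by (rule data.run_main[OF refl n]) (auto simp: data.env_def input_state_def fun_eq_iff)
    then show ?thesis using m(4) by simp
  qed
  moreover have "t + 1 \<le> stmt_time main_stmt (max n d) + 1" using m(2) by simp
  ultimately show ?thesis by blast
qed

lemma subspace_prog_time: "\<exists>c k. \<forall>n d. 1 \<le> d \<longrightarrow> stmt_time main_stmt (max n d) + 1 \<le> c * (max n d) ^ k"
proof -
  obtain c k where h: "\<And>X. 1 \<le> X \<Longrightarrow> stmt_time main_stmt X + 1 \<le> c * X ^ k"
    using poly_bounded_add[OF poly_bounded_stmt_time poly_bounded_const[of 1]] unfolding poly_bounded_def by blast
  then show ?thesis by (intro exI[of _ c] exI[of _ k]) auto
qed

section \<open>Spans and ranks\<close>

lemma zero_in_span: "0\<^sub>v d \<in> span d W"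
proof -
  interpret V: vec_space "TYPE(real)" d .
  have "V.lincomb (\<lambda>_. 0) {} = 0\<^sub>v d" unfolding V.lincomb_def by simp
  then show ?thesis by (intro V.in_spanI[of _ "\<lambda>_. 0" "{}"]) auto
qed

lemma sum_in_span:
  fixes f :: "'a \<Rightarrow> nat \<Rightarrow> real"
  assumes W: "W \<subseteq> carrier_vec d" and "finite B" and "\<And>b. b \<in> B \<Longrightarrow> vec d (f b) \<in> span d W"
  shows "vec d (\<lambda>c. \<Sum>b\<in>B. t b * f b c) \<in> span d W"
  using assms(2,3)
proof (induction B rule: finite_induct)
  interpret V: vec_space "TYPE(real)" d .
  case empty
  have "vec d (\<lambda>c. \<Sum>b\<in>{}. t b * f b c) = 0\<^sub>v d" by (intro eq_vecI) auto
  then show ?case using zero_in_span by simp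
next
  interpret V: vec_space "TYPE(real)" d .
  case (insert b B)
  have "vec d (\<lambda>c. \<Sum>b\<in>insert b B. t b * f b c) = t b \<cdot>\<^sub>v vec d (f b) + vec d (\<lambda>c. \<Sum>b\<in>B. t b * f b c)"
    using insert.hyps by (intro eq_vecI) auto
  moreover have "t b \<cdot>\<^sub>v vec d (f b) \<in> span d W" by (rule V.smult_in_span[OF W]) (use insert in auto)
  moreover have "vec d (\<lambda>c. \<Sum>b\<in>B. t b * f b c) \<in> span d W" by (rule insert.IH) (use insert in auto)
  ultimately show ?case using V.span_add1[OF W] by simp
qed

text \<open>One inclusion uses the dual basis, which writes \<open>basis_vec b\<close> as M
  \<tau>_b. For the other, expanding the rows of M in the chosen rows writes M t as a combination of
  the \<open>basis_vec b\<close>.\<close>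

lemma (in clean_data) span_basis_vec:
  assumes W: "W \<subseteq> carrier_vec d"
    and cols: "\<And>a. a < K \<Longrightarrow> vec d (\<lambda>c. M c a) \<in> span d W"
    and rng: "\<And>w. w \<in> W \<Longrightarrow> \<exists>t. w = vec d (\<lambda>c. \<Sum>a<K. M c a * t a)"
  shows "span d ((\<lambda>l. vec d (basis_vec l)) ` {..<d}) = span d W"
proof -
  interpret V: vec_space "TYPE(real)" d .
  let ?U = "(\<lambda>l. vec d (basis_vec l)) ` {..<d}"
  have U: "?U \<subseteq> carrier_vec d" by auto
  have ind: "indep_rows K M (chosen d)" by (rule chosen_indep) simp
  obtain \<tau> where \<tau>: "\<And>b b'. b \<in> chosen d \<Longrightarrow> b' \<in> chosen d \<Longrightarrow> (\<Sum>a<K. M b' a * \<tau> b a) = of_bool (b' = b)"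
    using dual_basis[OF finite_chosen ind] by blast
  have "vec d (basis_vec b) \<in> span d W" for b
  proof (cases "b \<in> chosen d")
    case True
    have "basis_vec b c = (\<Sum>a<K. \<tau> b a * M c a)" if c: "c < d" for c
    proof -
      have "(\<Sum>a<K. \<tau> b a * M c a) = (\<Sum>a<K. \<tau> b a * (\<Sum>b'\<in>chosen d. M b' a * basis_vec b' c))"
        by (intro sum.cong refl) (simp add: basis_vec_expand[OF c] mult.commute)
      also have "\<dots> = (\<Sum>a<K. \<Sum>b'\<in>chosen d. \<tau> b a * M b' a * basis_vec b' c)"
        by (simp add: sum_distrib_left mult.assoc)
      also have "\<dots> = (\<Sum>b'\<in>chosen d. (\<Sum>a<K. M b' a * \<tau> b a) * basis_vec b' c)"
        by (subst sum.swap) (simp add: sum_distrib_left sum_distrib_right mult_ac)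
      also have "\<dots> = (\<Sum>b'\<in>chosen d. if b' = b then basis_vec b' c else 0)"
        by (intro sum.cong refl) (simp add: \<tau> True)
      finally show ?thesis using True by simp
    qed
    then have "vec d (basis_vec b) = vec d (\<lambda>c. \<Sum>a<K. \<tau> b a * M c a)" by (intro eq_vecI) auto
    also have "\<dots> \<in> span d W"
      using sum_in_span[OF W, of "{..<K}" "\<lambda>a c. M c a" "\<tau> b"] cols by simp
    finally show ?thesis .
  next
    case False
    then have "vec d (basis_vec b) = 0\<^sub>v d" by (intro eq_vecI) (auto simp: basis_vec_outside)
    then show ?thesis using zero_in_span by simp
  qed
  then have 1: "span d ?U \<subseteq> span d W" by (intro V.span_subsetI[OF W]) auto
  have "w \<in> span d ?U" if w: "w \<in> W" for w
  proof -
    obtain t where t: "w = vec d (\<lambda>c. \<Sum>a<K. M c a * t a)" using rng[OF w] by blast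
    have "(\<Sum>a<K. M c a * t a) = (\<Sum>b\<in>chosen d. (\<Sum>a<K. M b a * t a) * basis_vec b c)" if c: "c < d" for c
    proof -
      have "(\<Sum>a<K. M c a * t a) = (\<Sum>a<K. t a * (\<Sum>b\<in>chosen d. M b a * basis_vec b c))"
        by (intro sum.cong refl) (simp add: basis_vec_expand[OF c] mult.commute)
      also have "\<dots> = (\<Sum>a<K. \<Sum>b\<in>chosen d. t a * M b a * basis_vec b c)"
        by (simp add: sum_distrib_left mult.assoc)
      also have "\<dots> = (\<Sum>b\<in>chosen d. (\<Sum>a<K. M b a * t a) * basis_vec b c)"
        by (subst sum.swap) (simp add: sum_distrib_left sum_distrib_right mult_ac)
      finally show ?thesis .
    qed
    then have "w = vec d (\<lambda>c. \<Sum>b\<in>chosen d. (\<Sum>a<K. M b a * t a) * basis_vec b c)"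
      unfolding t by (intro eq_vecI) auto
    also have "\<dots> \<in> span d ?U"
    proof (rule sum_in_span[OF U finite_chosen])
      fix b assume "b \<in> chosen d"
      then have "vec d (basis_vec b) \<in> ?U" using chosen_subset[of d] by auto
      then show "vec d (basis_vec b) \<in> span d ?U" using V.in_own_span[of ?U] U by auto
    qed
    finally show ?thesis .
  qed
  then have 2: "span d W \<subseteq> span d ?U" by (intro V.span_subsetI[OF U]) auto
  from 1 2 show ?thesis by (rule subset_antisym)
qed

text \<open>The number m of columns of A is arbitrary in the Gaussian law, so A z must be reduced to
  as many independent normals as the rank. Gram-Schmidt on the rows of A yields A = L o1 with
  orthonormal rows \<open>o1\<close>, a map Q back, and a set T of independent rows that ties r to
  the rank.\<close>

lemma orthonormal_factorization:
  fixes a :: "nat \<Rightarrow> nat \<Rightarrow> real"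
  shows "\<exists>r o1 L Q T. T \<subseteq> {..<d} \<and> card T = r \<and>
    (\<forall>l<r. \<forall>l'<r. (\<Sum>j<m. o1 l j * o1 l' j) = of_bool (l = l')) \<and>
    (\<forall>i<d. \<forall>j<m. a i j = (\<Sum>l<r. L i l * o1 l j)) \<and>
    (\<forall>l<r. \<forall>j<m. o1 l j = (\<Sum>i<d. Q l i * a i j)) \<and>
    (\<forall>t. (\<forall>j<m. (\<Sum>b\<in>T. t b * a b j) = 0) \<longrightarrow> (\<forall>b\<in>T. t b = 0))"
proof -
  define U where "U b = case_sum (a b) (\<lambda>c. of_bool (b = c) :: real)" for b
  define F where "F = gs m U d"
  define \<nu> where "\<nu> b = row_dot m (F b) (F b)" for b
  define T where "T = {b. b < d \<and> \<nu> b \<noteq> 0}"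
  define r where "r = card T"
  have fin: "finite T" by (simp add: T_def)
  obtain e where e: "bij_betw e {..<r} T"
    using ex_bij_betw_nat_finite[OF fin] unfolding r_def atLeast0LessThan by blast
  have eT: "e l \<in> T" if "l < r" for l using e that by (auto simp: bij_betw_def)
  have e_inj: "e l = e l' \<longleftrightarrow> l = l'" if "l < r" "l' < r" for l l'
    using e that by (auto simp: bij_betw_def inj_on_def)
  have nu: "0 < \<nu> b" if "b \<in> T" for b
    using that row_dot_self_nonneg[of m "F b"] by (simp add: T_def \<nu>_def)
  have orth: "row_dot m (F b) (F c) = 0" if "b < d" "c < d" "b \<noteq> c" for b c
    using that gs_orthogonal[of b c d m U] gs_orthogonal[of c b d m U] unfolding F_def
    by (cases "b < c") (auto simp: row_dot_commute)
  have coeff: "F b (Inl j) = (\<Sum>i<d. F b (Inr i) * a i j)" for b j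
  proof -
    have "\<forall>j. F b (Inl j) = (\<Sum>i<d. F b (Inr i) * a i j)"
      unfolding F_def
    proof (rule gs_linear_closed)
      fix f g :: "nat + nat \<Rightarrow> real" and c :: real
      assume "\<forall>j. f (Inl j) = (\<Sum>i<d. f (Inr i) * a i j)" "\<forall>j. g (Inl j) = (\<Sum>i<d. g (Inr i) * a i j)"
      then show "\<forall>j. f (Inl j) - c * g (Inl j) = (\<Sum>i<d. (f (Inr i) - c * g (Inr i)) * a i j)"
        by (simp add: left_diff_distrib sum_subtractf sum_distrib_left mult.assoc)
    next
      fix b assume b: "b < d"
      have "(\<Sum>i<d. U b (Inr i) * a i j) = (\<Sum>i<d. if b = i then a i j else 0)" for j
        by (intro sum.cong refl) (simp add: U_def)
      then show "\<forall>j. U b (Inl j) = (\<Sum>i<d. U b (Inr i) * a i j)" using b by (simp add: U_def)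
    qed simp
    then show ?thesis by blast
  qed
  \<comment> \<open>The last two conjuncts record that the expansion is unit triangular;
    independence of the rows in T rests on this.\<close>
  have expand: "\<exists>g. (\<forall>j<m. a i j = (\<Sum>b\<in>T. g b * F b (Inl j))) \<and> g i = 1 \<and> (\<forall>b>i. g b = 0)" if i: "i < d" for i
  proof -
    obtain h where h: "\<And>x. U i x = F i x + (\<Sum>b<i. h b * F b x)"
      using gs_expand[OF i, of U m] unfolding F_def by blast
    define g where "g b = (if b = i then 1 else if b < i then h b else 0)" for b
    have "a i j = (\<Sum>b\<in>T. g b * F b (Inl j))" if j: "j < m" for j
    proof -
      have "a i j = F i (Inl j) + (\<Sum>b<i. h b * F b (Inl j))" using h[of "Inl j"] by (simp add: U_def)
      also have "\<dots> = (\<Sum>b\<in>insert i {..<i}. g b * F b (Inl j))"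
        by (simp add: g_def)
      also have "\<dots> = (\<Sum>b<d. g b * F b (Inl j))"
        by (rule sum.mono_neutral_left) (use i in \<open>auto simp: g_def\<close>)
      also have "\<dots> = (\<Sum>b\<in>T. g b * F b (Inl j))"
        by (rule sum.mono_neutral_right) (use j in \<open>auto simp: T_def \<nu>_def row_dot_self_eq_0\<close>)
      finally show ?thesis .
    qed
    moreover have "g i = 1" "\<forall>b>i. g b = 0" by (auto simp: g_def)
    ultimately show ?thesis by blast
  qed
  define o1 where "o1 l j = F (e l) (Inl j) / sqrt (\<nu> (e l))" for l j
  define Q where "Q l i = F (e l) (Inr i) / sqrt (\<nu> (e l))" for l i
  define L where "L i l = (\<Sum>j<m. a i j * o1 l j)" for i l
  have ortho: "(\<Sum>j<m. o1 l j * o1 l' j) = of_bool (l = l')" if l: "l < r" "l' < r" for l l'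
  proof -
    have "(\<Sum>j<m. o1 l j * o1 l' j) = row_dot m (F (e l)) (F (e l')) / (sqrt (\<nu> (e l)) * sqrt (\<nu> (e l')))"
      by (simp add: o1_def row_dot_def sum_divide_distrib)
    also have "\<dots> = of_bool (l = l')"
    proof (cases "l = l'")
      case True
      then show ?thesis using nu[OF eT[OF l(1)]] by (simp add: \<nu>_def[symmetric])
    next
      case False
      then show ?thesis using e_inj[OF l] eT[OF l(1)] eT[OF l(2)] by (simp add: orth T_def)
    qed
    finally show ?thesis .
  qed
  have aF: "(\<Sum>j<m. a i j * F b (Inl j)) = g b * \<nu> b"
    if g: "\<forall>j<m. a i j = (\<Sum>b\<in>T. g b * F b (Inl j))" and b: "b \<in> T" for i b g
  proof -
    have "(\<Sum>j<m. a i j * F b (Inl j)) = (\<Sum>j<m. \<Sum>c\<in>T. g c * (F c (Inl j) * F b (Inl j)))"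
      using g by (simp add: sum_distrib_right mult.assoc)
    also have "\<dots> = (\<Sum>c\<in>T. g c * row_dot m (F c) (F b))"
      by (subst sum.swap) (simp add: row_dot_def sum_distrib_left)
    also have "\<dots> = (\<Sum>c\<in>T. if c = b then g c * \<nu> c else 0)"
      using b by (intro sum.cong refl) (auto simp: orth T_def \<nu>_def)
    finally show ?thesis using b fin by simp
  qed
  have factor: "a i j = (\<Sum>l<r. L i l * o1 l j)" if i: "i < d" and j: "j < m" for i j
  proof -
    obtain g where g: "\<forall>j<m. a i j = (\<Sum>b\<in>T. g b * F b (Inl j))" using expand[OF i] by blast
    have "L i l * o1 l j = g (e l) * F (e l) (Inl j)" if l: "l < r" for l
    proof -
      have "L i l = g (e l) * \<nu> (e l) / sqrt (\<nu> (e l))"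
        using aF[OF g eT[OF l]] by (simp add: L_def o1_def sum_divide_distrib[symmetric])
      moreover have "0 < \<nu> (e l)" using nu[OF eT[OF l]] .
      ultimately show ?thesis by (simp add: o1_def)
    qed
    then have "(\<Sum>l<r. L i l * o1 l j) = (\<Sum>l<r. g (e l) * F (e l) (Inl j))" by simp
    also have "\<dots> = (\<Sum>b\<in>T. g b * F b (Inl j))" by (rule sum.reindex_bij_betw[OF e])
    finally show ?thesis using g j by simp
  qed
  have oQ: "o1 l j = (\<Sum>i<d. Q l i * a i j)" for l j
    by (simp add: o1_def Q_def coeff sum_divide_distrib)
  have indep: "\<forall>b\<in>T. t b = 0" if t: "\<forall>j<m. (\<Sum>b\<in>T. t b * a b j) = 0" for t
  proof (rule ccontr)
    assume "\<not> (\<forall>b\<in>T. t b = 0)"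
    define P where "P = {b \<in> T. t b \<noteq> 0}"
    have P: "finite P" "P \<noteq> {}" using \<open>\<not> (\<forall>b\<in>T. t b = 0)\<close> fin by (auto simp: P_def)
    \<comment> \<open>Pairing with the orthogonalized row of the largest index p kills all other
      terms, since a row b < p has no component along it.\<close>
    define p where "p = Max P"
    have p: "p \<in> T" "t p \<noteq> 0" using Max_in[OF P] by (auto simp: p_def P_def)
    have "t b * (\<Sum>j<m. a b j * F p (Inl j)) = (if b = p then t p * \<nu> p else 0)" if b: "b \<in> T" for b
    proof (cases "t b = 0")
      case False
      then have "b \<le> p" using b P by (auto simp: p_def P_def)
      obtain g where g: "\<forall>j<m. a b j = (\<Sum>c\<in>T. g c * F c (Inl j))" "g b = 1" "\<forall>c>b. g c = 0"
        using expand[of b] b by (auto simp: T_def)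
      then show ?thesis using aF[OF g(1) p(1)] \<open>b \<le> p\<close> by (auto simp: le_less)
    qed (use p in auto)
    then have "(\<Sum>b\<in>T. t b * (\<Sum>j<m. a b j * F p (Inl j))) = t p * \<nu> p"
      using p fin by simp
    moreover have "(\<Sum>b\<in>T. t b * (\<Sum>j<m. a b j * F p (Inl j))) = (\<Sum>j<m. (\<Sum>b\<in>T. t b * a b j) * F p (Inl j))"
      by (rule sum_mult_sum_cong_swap)
    ultimately show False using t p nu[OF p(1)] by simp
  qed
  show ?thesis
  proof (intro exI conjI)
    show "T \<subseteq> {..<d}" by (auto simp: T_def)
    show "card T = r" by (simp add: r_def)
    show "\<forall>l<r. \<forall>l'<r. (\<Sum>j<m. o1 l j * o1 l' j) = of_bool (l = l')" using ortho by blast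
    show "\<forall>i<d. \<forall>j<m. a i j = (\<Sum>l<r. L i l * o1 l j)" using factor by blast
    show "\<forall>l<r. \<forall>j<m. o1 l j = (\<Sum>i<d. Q l i * a i j)" using oQ by blast
    show "\<forall>t. (\<forall>j<m. (\<Sum>b\<in>T. t b * a b j) = 0) \<longrightarrow> (\<forall>b\<in>T. t b = 0)" using indep by blast
  qed
qed

text \<open>If a combination t of columns of A A^T vanishes, then w = A^T t satisfies A w = 0; as w
  lies in the row space, |w|^2 = 0, and independence of the rows of A applies.\<close>

lemma rank_ge_gram:
  fixes A :: "real mat"
  assumes A: "A \<in> carrier_mat d m" and T: "T \<subseteq> {..<d}"
    and ind: "\<And>t. (\<forall>j<m. (\<Sum>b\<in>T. t b * A $$ (b, j)) = 0) \<Longrightarrow> \<forall>b\<in>T. t b = 0"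
  shows "card T \<le> vec_space.rank d (A * transpose_mat A)"
proof -
  interpret V: vec_space "TYPE(real)" d .
  let ?S = "A * transpose_mat A"
  have fin: "finite T" using T finite_subset by blast
  have S: "?S \<in> carrier_mat d d" using A by simp
  have Sij: "?S $$ (c, b) = (\<Sum>j<m. A $$ (c, j) * A $$ (b, j))" if "c < d" "b < d" for c b
    using A that by (auto simp: scalar_prod_def atLeast0LessThan intro!: sum.cong)
  have ind': "\<forall>b\<in>T. t b = 0" if t: "\<forall>c<d. (\<Sum>b\<in>T. t b * ?S $$ (c, b)) = 0" for t
  proof (rule ind)
    define w where "w j = (\<Sum>b\<in>T. t b * A $$ (b, j))" for j
    have z: "(\<Sum>j<m. w j * A $$ (c, j)) = 0" if "c < d" for c
    proof -
      have "(\<Sum>j<m. w j * A $$ (c, j)) = (\<Sum>b\<in>T. t b * (\<Sum>j<m. A $$ (b, j) * A $$ (c, j)))"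
        unfolding w_def by (rule sum_mult_sum_cong_swap[symmetric])
      also have "\<dots> = (\<Sum>b\<in>T. t b * ?S $$ (c, b))"
        using T that by (intro sum.cong refl) (auto simp: Sij mult.commute)
      finally show ?thesis using t that by simp
    qed
    have "(\<Sum>j<m. w j * w j) = (\<Sum>b\<in>T. t b * (\<Sum>j<m. w j * A $$ (b, j)))"
    proof -
      have "(\<Sum>j<m. w j * w j) = (\<Sum>j<m. w j * (\<Sum>b\<in>T. A $$ (b, j) * t b))"
        by (simp add: w_def mult.commute)
      also have "\<dots> = (\<Sum>b\<in>T. (\<Sum>j<m. w j * A $$ (b, j)) * t b)" by (rule sum_mult_sum_cong_swap)
      finally show ?thesis by (simp add: mult.commute)
    qed
    also have "\<dots> = 0" using z T by (intro sum.neutral) auto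
    finally have "\<forall>j<m. w j = 0" by (simp add: sum_nonneg_eq_0_iff)
    then show "\<forall>j<m. (\<Sum>b\<in>T. t b * A $$ (b, j)) = 0" by (simp add: w_def)
  qed
  have colidx: "col ?S b $ c = ?S $$ (c, b)" if "c < d" "b < d" for c b
    by (rule index_col) (use S that in auto)
  have inj: "inj_on (col ?S) T"
  proof (rule inj_onI, rule ccontr)
    fix b b' assume b: "b \<in> T" "b' \<in> T" "col ?S b = col ?S b'" "b \<noteq> b'"
    let ?t = "\<lambda>c. of_bool (c = b) - of_bool (c = b') :: real"
    have "(\<Sum>x\<in>T. ?t x * ?S $$ (c, x)) = 0" if c: "c < d" for c
    proof -
      have "b < d" "b' < d" using b T by auto
      then have "?S $$ (c, b) = ?S $$ (c, b')" using colidx[OF c, of b] colidx[OF c, of b'] b(3) by metis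
      moreover have "(\<Sum>x\<in>T. ?t x * ?S $$ (c, x)) = (\<Sum>x\<in>T. if x = b then ?S $$ (c, x) else 0) - (\<Sum>x\<in>T. if x = b' then ?S $$ (c, x) else 0)"
        unfolding sum_subtractf[symmetric] by (intro sum.cong refl) auto
      ultimately show ?thesis using b fin by simp
    qed
    then have "?t b = 0" using ind'[of ?t] b by blast
    then show False using b by simp
  qed
  have "V.lin_indpt (col ?S ` T)"
  proof (rule V.finite_lin_indpt2)
    show "finite (col ?S ` T)" using fin by simp
    show sub: "col ?S ` T \<subseteq> carrier_vec d" using S T by auto
    fix f assume f: "V.lincomb f (col ?S ` T) = 0\<^sub>v d"
    have "(\<Sum>b\<in>T. f (col ?S b) * ?S $$ (c, b)) = 0" if c: "c < d" for c
    proof -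
      have "0 = V.lincomb f (col ?S ` T) $ c" using f c by simp
      also have "\<dots> = (\<Sum>x\<in>col ?S ` T. f x * x $ c)" by (rule V.lincomb_index[OF c sub])
      also have "\<dots> = (\<Sum>b\<in>T. f (col ?S b) * col ?S b $ c)" using inj by (simp add: sum.reindex)
      also have "\<dots> = (\<Sum>b\<in>T. f (col ?S b) * ?S $$ (c, b))"
        using T c by (intro sum.cong refl arg_cong2[where f = "(*)"] colidx) auto
      finally show ?thesis by simp
    qed
    then have "\<forall>c<d. (\<Sum>b\<in>T. f (col ?S b) * ?S $$ (c, b)) = 0" by (intro allI impI)
    from ind'[OF this] show "\<forall>v\<in>col ?S ` T. f v = 0" by blast
  qed
  moreover have "col ?S ` T \<subseteq> set (cols ?S)" using A T by (auto simp: cols_def)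
  ultimately have "card (col ?S ` T) \<le> V.rank ?S" using V.rank_ge_card_indpt[OF S] by blast
  then show ?thesis using inj by (simp add: card_image)
qed

section \<open>A matrix Chernoff bound by trace moments\<close>

lemma shift_eval_measurable:
  assumes "\<And>a. (\<lambda>x. m x a) \<in> borel_measurable N"
  shows "(\<lambda>x. shift_eval (m x) R b c) \<in> borel_measurable N"
  by (induction c arbitrary: b) (auto intro!: borel_measurable_add borel_measurable_times assms)

text \<open>\<open>shift_eval\<close> is linear in the moments with nonnegative coefficients, so
  bounds on expected moments pass through it.\<close>

lemma nn_integral_shift_eval_le:
  assumes meas: "\<And>a. (\<lambda>x. m x a) \<in> borel_measurable N" and nn: "\<And>x a. 0 \<le> m x a"
    and \<beta>: "\<And>a. 0 \<le> \<beta> a" and R: "0 \<le> R" and \<sigma>: "0 \<le> \<sigma>"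
    and le: "\<And>a. a \<le> b + c \<Longrightarrow> (\<integral>\<^sup>+ x. ennreal (m x a) \<partial>N) \<le> ennreal (\<sigma> * \<beta> a)"
  shows "(\<integral>\<^sup>+ x. ennreal (shift_eval (m x) R b c) \<partial>N) \<le> ennreal (\<sigma> * shift_eval \<beta> R b c)"
  using le
proof (induction c arbitrary: b)
  case (Suc c)
  have nn': "0 \<le> shift_eval (m x) R b c" for x b by (rule shift_eval_nonneg[OF nn R])
  have nb: "0 \<le> shift_eval \<beta> R b c" for b by (rule shift_eval_nonneg[OF \<beta> R])
  note [measurable] = shift_eval_measurable[OF meas]
  have "(\<integral>\<^sup>+ x. ennreal (shift_eval (m x) R b (Suc c)) \<partial>N) =
      (\<integral>\<^sup>+ x. ennreal (shift_eval (m x) R (Suc b) c) + ennreal R * ennreal (shift_eval (m x) R b c) \<partial>N)"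
    using R nn' by (intro nn_integral_cong) (simp add: ennreal_plus ennreal_mult)
  also have "\<dots> = (\<integral>\<^sup>+ x. ennreal (shift_eval (m x) R (Suc b) c) \<partial>N) + ennreal R * (\<integral>\<^sup>+ x. ennreal (shift_eval (m x) R b c) \<partial>N)"
    by (subst nn_integral_add) (auto simp: nn_integral_cmult)
  also have "\<dots> \<le> ennreal (\<sigma> * shift_eval \<beta> R (Suc b) c) + ennreal R * ennreal (\<sigma> * shift_eval \<beta> R b c)"
    using Suc.prems by (intro add_mono mult_left_mono Suc.IH) auto
  also have "\<dots> = ennreal (\<sigma> * shift_eval \<beta> R b (Suc c))"
    using R \<sigma> nb by (simp add: ennreal_plus[symmetric] ennreal_mult[symmetric] algebra_simps del: ennreal_plus)
  finally show ?case .
qed simp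

lemma frame_op_power_measurable:
  assumes "finite B" "finite I" "\<And>i b. i \<in> I \<Longrightarrow> b \<in> B \<Longrightarrow> (\<lambda>x. Q x i b) \<in> borel_measurable N"
    and "\<And>b. b \<in> B \<Longrightarrow> (\<lambda>x. v x b) \<in> borel_measurable N" "b \<in> B"
  shows "(\<lambda>x. (frame_op B I (Q x) ^^ p) (v x) b) \<in> borel_measurable N"
  using assms(5)
proof (induction p arbitrary: b)
  case (Suc p)
  show ?case unfolding funpow.simps o_apply frame_op_def dot_def
    using Suc.prems by (intro borel_measurable_sum borel_measurable_times assms(3) Suc.IH[unfolded frame_op_def dot_def])
qed (simp add: assms(4))

lemma frame_moment_measurable:
  assumes "finite B" "finite I" "\<And>i b. i \<in> I \<Longrightarrow> b \<in> B \<Longrightarrow> (\<lambda>x. Q x i b) \<in> borel_measurable N"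
    and "\<And>b. b \<in> B \<Longrightarrow> (\<lambda>x. v x b) \<in> borel_measurable N"
  shows "(\<lambda>x. frame_moment B I (Q x) (v x) p) \<in> borel_measurable N"
  unfolding frame_moment_def dot_def[of B "v x" for x]
  by (intro borel_measurable_sum borel_measurable_times assms frame_op_power_measurable)

lemma frame_trace_measurable:
  assumes "finite B" "finite I" "\<And>i b. i \<in> I \<Longrightarrow> b \<in> B \<Longrightarrow> (\<lambda>x. Q x i b) \<in> borel_measurable N"
  shows "(\<lambda>x. frame_trace B I (Q x) p) \<in> borel_measurable N"
  unfolding frame_trace_def by (intro borel_measurable_sum frame_moment_measurable assms) auto

lemma frame_op_cong: "(\<And>i. i \<in> I \<Longrightarrow> q i = q' i) \<Longrightarrow> frame_op B I q = frame_op B I q'"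
  unfolding frame_op_def by (intro ext sum.cong refl) simp

lemma frame_trace_cong: "(\<And>i. i \<in> I \<Longrightarrow> q i = q' i) \<Longrightarrow> frame_trace B I q p = frame_trace B I q' p"
  using frame_op_cong[of I q q' B] by (simp add: frame_trace_def frame_moment_def)

lemma frame_moment_cong: "(\<And>i. i \<in> I \<Longrightarrow> q i = q' i) \<Longrightarrow> frame_moment B I q v p = frame_moment B I q' v p"
  using frame_op_cong[of I q q' B] by (simp add: frame_moment_def)

locale bounded_random_vector = prob_space G for G :: "'x measure" +
  fixes B :: "'b set" and q :: "'x \<Rightarrow> 'b \<Rightarrow> real" and R \<sigma> :: real
  assumes finB: "finite B" and R: "0 < R" and \<sigma>: "0 \<le> \<sigma>"
    and meas: "\<And>b. b \<in> B \<Longrightarrow> (\<lambda>x. q x b) \<in> borel_measurable G"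
    and bound: "\<And>x. dot B (q x) (q x) \<le> R"
    and second: "\<And>A. (\<integral>\<^sup>+ x. ennreal ((dot B A (q x))\<^sup>2) \<partial>G) \<le> ennreal (\<sigma> * dot B A A)"
begin

lemma dot_meas: "(\<lambda>x. dot B A (q x)) \<in> borel_measurable G"
  unfolding dot_def by (intro borel_measurable_sum borel_measurable_times meas) auto

lemma nn_integral_sum_squares:
  assumes "finite E"
  shows "(\<integral>\<^sup>+ x. ennreal (\<Sum>e\<in>E. (dot B (A e) (q x))\<^sup>2) \<partial>G) \<le> ennreal (\<sigma> * (\<Sum>e\<in>E. dot B (A e) (A e)))"
proof -
  note [measurable] = dot_meas
  have "(\<integral>\<^sup>+ x. ennreal (\<Sum>e\<in>E. (dot B (A e) (q x))\<^sup>2) \<partial>G) = (\<Sum>e\<in>E. \<integral>\<^sup>+ x. ennreal ((dot B (A e) (q x))\<^sup>2) \<partial>G)"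
    by (subst nn_integral_sum[symmetric]) (auto simp: sum_ennreal)
  also have "\<dots> \<le> (\<Sum>e\<in>E. ennreal (\<sigma> * dot B (A e) (A e)))" by (intro sum_mono second)
  also have "\<dots> = ennreal (\<sigma> * (\<Sum>e\<in>E. dot B (A e) (A e)))"
    using \<sigma> by (simp add: sum_ennreal sum_distrib_left)
  finally show ?thesis .
qed

text \<open>For either parity the moment is a sum of squared linear functionals of
  \<open>q x\<close> whose vectors have total squared length \<open>frame_trace B I Q p\<close>; the
  second moment bound applies to each.\<close>

lemma nn_integral_frame_moment:
  assumes I: "finite I"
  shows "(\<integral>\<^sup>+ x. ennreal (frame_moment B I Q (q x) p) \<partial>G) \<le> ennreal (\<sigma> * frame_trace B I Q p)"
proof (cases "even p")
  case True
  then obtain l where p: "p = 2 * l" by (rule evenE)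
  let ?A = "\<lambda>e. (frame_op B I Q ^^ l) (\<lambda>a. of_bool (a = e))"
  have "frame_moment B I Q (q x) p = (\<Sum>e\<in>B. (dot B (?A e) (q x))\<^sup>2)" for x
  proof -
    have "frame_moment B I Q (q x) p = (\<Sum>e\<in>B. (dot B (\<lambda>a. of_bool (a = e)) ((frame_op B I Q ^^ l) (q x)))\<^sup>2)"
      unfolding p frame_moment_even using finB by (simp add: dot_unit) (simp add: dot_def power2_eq_square)
    then show ?thesis by (simp add: frame_op_power_self_adjoint)
  qed
  then show ?thesis using nn_integral_sum_squares[OF finB, of ?A] by (simp only: p frame_trace_even)
next
  case False
  then obtain l where p: "p = 2 * l + 1" by (rule oddE)
  let ?A = "\<lambda>i. (frame_op B I Q ^^ l) (Q i)"
  have "frame_moment B I Q (q x) p = (\<Sum>i\<in>I. (dot B (?A i) (q x))\<^sup>2)" for x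
    unfolding p frame_moment_odd by (simp only: frame_op_power_self_adjoint)
  then show ?thesis using nn_integral_sum_squares[OF I, of ?A]
    by (simp only: p frame_trace_odd[OF finB] frame_moment_even)
qed

interpretation P: product_prob_space "\<lambda>_ :: nat. G" UNIV
  by unfold_locales

text \<open>Induction on the number of samples, for all p \<le> P together, because the insertion
  bound for p involves expected traces of lower powers. One more sample multiplies the geometric
  bound by \<kappa>: with \<Lambda> = P R the increment (\<Lambda> + R)^p - \<Lambda>^p is at most 2
  \<Lambda>^p, from (1 + 1/P)^P \<le> e \<le> 3.\<close>

lemma trace_expectation:
  fixes P :: nat
  assumes P: "0 < P"
  defines "\<Lambda> \<equiv> real P * R" and "\<kappa> \<equiv> 1 + 2 * \<sigma> / R"
  shows "p \<le> P \<Longrightarrow> (\<integral>\<^sup>+ x. ennreal (frame_trace B {..<n} (\<lambda>i. q (x i)) p) \<partial>Pi\<^sub>M {..<n} (\<lambda>_. G)) \<le>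
    ennreal (real (card B) * \<kappa> ^ n * \<Lambda> ^ p)"
proof (induction n arbitrary: p)
  case 0
  have "frame_trace B {} q' p \<le> real (card B) * \<Lambda> ^ p" for q' :: "nat \<Rightarrow> 'b \<Rightarrow> real"
  proof (cases p)
    case 0
    then show ?thesis using finB by (simp add: frame_trace_def frame_moment_def dot_unit)
  next
    case (Suc p')
    have z: "frame_op B {} q' v = (\<lambda>_. 0)" for v by (simp add: frame_op_def)
    have "frame_trace B {} q' p = 0"
      by (simp add: frame_trace_def frame_moment_def Suc z dot_def)
    then show ?thesis using R P by (simp add: \<Lambda>_def)
  qed
  then have "(\<integral>\<^sup>+ x. ennreal (frame_trace B {} (\<lambda>i. q (x i)) p) \<partial>Pi\<^sub>M ({} :: nat set) (\<lambda>_. G)) \<le>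
      (\<integral>\<^sup>+ x. ennreal (real (card B) * \<Lambda> ^ p) \<partial>Pi\<^sub>M ({} :: nat set) (\<lambda>_. G))"
    by (intro nn_integral_mono ennreal_leI)
  also have "\<dots> = ennreal (real (card B) * \<Lambda> ^ p)"
    by (simp add: prob_space.emeasure_space_1[OF prob_space_PiM[OF prob_space_axioms]])
  finally show ?case by simp
next
  case (Suc n)
  let ?M = "Pi\<^sub>M {..<n} (\<lambda>_. G)"
  define c0 where "c0 = real (card B) * \<kappa> ^ n"
  define \<beta> where "\<beta> = (\<lambda>a. c0 * \<Lambda> ^ a)"
  have \<Lambda>0: "0 < \<Lambda>" and \<kappa>0: "0 \<le> \<kappa>" using R P \<sigma> by (auto simp: \<Lambda>_def \<kappa>_def)
  have c0: "0 \<le> c0" using \<kappa>0 by (simp add: c0_def)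
  have qm: "(\<lambda>x. q (x i) b) \<in> borel_measurable (Pi\<^sub>M J (\<lambda>_. G))" if "i \<in> J" "b \<in> B" for i b and J :: "nat set"
    using measurable_compose[OF measurable_component_singleton[OF that(1)] meas[OF that(2)]] .
  let ?T = "\<lambda>x. frame_trace B {..<n} (\<lambda>i. q (x i))"
  let ?s = "\<lambda>x. \<Sum>e<p. shift_eval (?T x) R e (p - 1 - e)"
  have Tm: "(\<lambda>x. ?T x a) \<in> borel_measurable ?M" for a
    by (intro frame_trace_measurable finB qm) auto
  have sm: "?s \<in> borel_measurable ?M" by (intro borel_measurable_sum shift_eval_measurable Tm)
  have Tn: "0 \<le> ?T x a" for x a by (rule frame_trace_nonneg)
  have sn: "0 \<le> ?s x" for x using R by (intro sum_nonneg shift_eval_nonneg Tn) auto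
  have step: "(\<integral>\<^sup>+ y. ennreal (frame_trace B {..<Suc n} (\<lambda>i. q ((x(n := y)) i)) p) \<partial>G) \<le> ennreal (?T x p + \<sigma> * ?s x)"
    for x :: "nat \<Rightarrow> 'x"
  proof -
    let ?m = "\<lambda>y. frame_moment B {..<n} (\<lambda>i. q (x i)) (q y)"
    let ?t = "\<lambda>y. \<Sum>e<p. shift_eval (?m y) R e (p - 1 - e)"
    have mm: "(\<lambda>y. ?m y a) \<in> borel_measurable G" for a
      by (intro frame_moment_measurable finB meas) auto
    note smm = shift_eval_measurable[of ?m, OF mm]
    have tn: "0 \<le> shift_eval (?m y) R e c" for y e c using R by (intro shift_eval_nonneg) auto
    have "frame_trace B {..<Suc n} (\<lambda>i. q ((x(n := y)) i)) p \<le> ?T x p + ?t y" for y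
    proof -
      let ?q = "\<lambda>i. q ((x(n := y)) i)"
      have "frame_trace B (insert n {..<n}) ?q p \<le> frame_trace B {..<n} ?q p +
          (\<Sum>e<p. shift_eval (frame_moment B {..<n} ?q (?q n)) R e (p - 1 - e))"
        by (rule frame_trace_insert_le) (use finB bound in auto)
      moreover have "frame_trace B {..<n} ?q p = ?T x p" by (rule frame_trace_cong) simp
      moreover have "frame_moment B {..<n} ?q (?q n) = ?m y"
        by (rule ext, simp, rule frame_moment_cong, simp)
      ultimately show ?thesis by (simp add: lessThan_Suc)
    qed
    then have "(\<integral>\<^sup>+ y. ennreal (frame_trace B {..<Suc n} (\<lambda>i. q ((x(n := y)) i)) p) \<partial>G) \<le>
        (\<integral>\<^sup>+ y. ennreal (?T x p) + (\<Sum>e<p. ennreal (shift_eval (?m y) R e (p - 1 - e))) \<partial>G)"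
      using Tn tn by (intro nn_integral_mono) (simp add: sum_ennreal ennreal_plus[symmetric] sum_nonneg ennreal_leI del: ennreal_plus)
    also have "\<dots> = ennreal (?T x p) + (\<Sum>e<p. \<integral>\<^sup>+ y. ennreal (shift_eval (?m y) R e (p - 1 - e)) \<partial>G)"
      using smm by (subst nn_integral_add) (auto simp: nn_integral_sum emeasure_space_1)
    also have "\<dots> \<le> ennreal (?T x p) + (\<Sum>e<p. ennreal (\<sigma> * shift_eval (?T x) R e (p - 1 - e)))"
      using R \<sigma> Tn by (intro add_left_mono sum_mono nn_integral_shift_eval_le mm nn_integral_frame_moment) auto
    also have "\<dots> = ennreal (?T x p + \<sigma> * ?s x)"
      using R \<sigma> Tn sn
      by (simp add: sum_ennreal shift_eval_nonneg sum_distrib_left[symmetric] ennreal_plus[symmetric] del: ennreal_plus)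
    finally show ?thesis .
  qed
  have IH: "(\<integral>\<^sup>+ x. ennreal (?T x a) \<partial>?M) \<le> ennreal (1 * \<beta> a)" if "a \<le> P" for a
    using Suc.IH[OF that] by (simp add: \<beta>_def c0_def)
  have "(\<integral>\<^sup>+ x. ennreal (frame_trace B {..<Suc n} (\<lambda>i. q (x i)) p) \<partial>Pi\<^sub>M {..<Suc n} (\<lambda>_. G)) =
      (\<integral>\<^sup>+ x. (\<integral>\<^sup>+ y. ennreal (frame_trace B {..<Suc n} (\<lambda>i. q ((x(n := y)) i)) p) \<partial>G) \<partial>?M)"
    unfolding lessThan_Suc
    by (subst product_sigma_finite.product_nn_integral_insert[OF P.product_sigma_finite_axioms])
      (auto intro!: measurable_compose[OF frame_trace_measurable measurable_ennreal] finB qm)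
  also have "\<dots> \<le> (\<integral>\<^sup>+ x. ennreal (?T x p + \<sigma> * ?s x) \<partial>?M)" by (intro nn_integral_mono step)
  also have "\<dots> = (\<integral>\<^sup>+ x. ennreal (?T x p) + ennreal \<sigma> * (\<Sum>e<p. ennreal (shift_eval (?T x) R e (p - 1 - e))) \<partial>?M)"
    using Tn sn \<sigma> R by (intro nn_integral_cong) (simp add: ennreal_plus ennreal_mult sum_ennreal shift_eval_nonneg)
  also have "\<dots> = (\<integral>\<^sup>+ x. ennreal (?T x p) \<partial>?M) + ennreal \<sigma> * (\<Sum>e<p. \<integral>\<^sup>+ x. ennreal (shift_eval (?T x) R e (p - 1 - e)) \<partial>?M)"
    using Tm shift_eval_measurable[of ?T, OF Tm]
    by (subst nn_integral_add) (auto simp: nn_integral_cmult nn_integral_sum)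
  also have "\<dots> \<le> ennreal (\<beta> p) + ennreal \<sigma> * (\<Sum>e<p. ennreal (1 * shift_eval \<beta> R e (p - 1 - e)))"
    using Suc.prems R c0 \<Lambda>0 IH[of p]
    by (intro add_mono mult_left_mono sum_mono nn_integral_shift_eval_le Tm Tn IH) (auto simp: \<beta>_def)
  also have "\<dots> = ennreal (\<beta> p + \<sigma> * (\<Sum>e<p. shift_eval \<beta> R e (p - 1 - e)))"
    using R \<sigma> c0 \<Lambda>0
    by (simp add: sum_ennreal shift_eval_nonneg \<beta>_def sum_nonneg ennreal_plus[symmetric] ennreal_mult[symmetric] del: ennreal_plus)
  also have "\<beta> p + \<sigma> * (\<Sum>e<p. shift_eval \<beta> R e (p - 1 - e)) \<le> real (card B) * \<kappa> ^ Suc n * \<Lambda> ^ p"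
  proof -
    have "R * (\<Sum>e<p. shift_eval \<beta> R e (p - 1 - e)) = shift_eval \<beta> R 0 p - \<beta> p"
      by (subst shift_eval_unfold[of \<beta> R 0 p]) simp
    also have "\<dots> = c0 * ((\<Lambda> + R) ^ p - \<Lambda> ^ p)"
      unfolding \<beta>_def shift_eval_geometric by (simp add: algebra_simps)
    finally have eq: "R * (\<Sum>e<p. shift_eval \<beta> R e (p - 1 - e)) = c0 * ((\<Lambda> + R) ^ p - \<Lambda> ^ p)" .
    have "\<Lambda> + R = \<Lambda> * (1 + 1 / real P)" using P by (simp add: \<Lambda>_def field_simps)
    then have pw: "(\<Lambda> + R) ^ p = \<Lambda> ^ p * (1 + 1 / real P) ^ p" by (simp only: power_mult_distrib)
    have "(1 + 1 / real P) ^ p \<le> 3"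
    proof -
      have "(1 + 1 / real P) ^ p \<le> (exp (1 / real P)) ^ p" by (intro power_mono) (auto simp: exp_ge_add_one_self)
      also have "\<dots> = exp (real p / real P)" by (simp add: exp_of_nat_mult[symmetric])
      also have "\<dots> \<le> exp 1" using Suc.prems P by simp
      also have "\<dots> \<le> 3" by (rule exp_le)
      finally show ?thesis .
    qed
    then have "\<Lambda> ^ p * (1 + 1 / real P) ^ p \<le> \<Lambda> ^ p * 3" using \<Lambda>0 by (intro mult_left_mono) auto
    then have "c0 * ((\<Lambda> + R) ^ p - \<Lambda> ^ p) \<le> c0 * (\<Lambda> ^ p * 3 - \<Lambda> ^ p)"
      unfolding pw using c0 by (intro mult_left_mono) auto
    also have "\<dots> = 2 * \<beta> p" by (simp add: \<beta>_def)
    finally have "(\<Sum>e<p. shift_eval \<beta> R e (p - 1 - e)) \<le> 2 * \<beta> p / R"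
      unfolding eq[symmetric] using R by (simp add: pos_le_divide_eq mult.commute)
    then have "(\<Sum>e<p. shift_eval \<beta> R e (p - 1 - e)) \<le> 2 / R * \<beta> p" by simp
    then have "\<beta> p + \<sigma> * (\<Sum>e<p. shift_eval \<beta> R e (p - 1 - e)) \<le> \<beta> p + \<sigma> * (2 / R * \<beta> p)"
      using \<sigma> by (intro add_left_mono mult_left_mono)
    also have "\<dots> = real (card B) * \<kappa> ^ Suc n * \<Lambda> ^ p"
      by (simp add: \<beta>_def c0_def \<kappa>_def algebra_simps)
    finally show ?thesis .
  qed
  finally show ?case by (simp add: ennreal_leI)
qed

end

lemma markov_real:
  assumes "prob_space N" and u: "u \<in> borel_measurable N" "\<And>x. 0 \<le> u x"
    and e: "(\<integral>\<^sup>+ x. ennreal (u x) \<partial>N) \<le> ennreal e" and t: "0 < t" and e0: "0 \<le> e"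
  shows "measure N {x \<in> space N. t < u x} \<le> e / t"
proof -
  interpret prob_space N by fact
  have "emeasure N {x \<in> space N. t < u x} \<le> emeasure N {x \<in> space N. 1 \<le> ennreal (1 / t) * ennreal (u x)}"
  proof (rule emeasure_mono)
    show "{x \<in> space N. 1 \<le> ennreal (1 / t) * ennreal (u x)} \<in> sets N" using u by measurable
    show "{x \<in> space N. t < u x} \<subseteq> {x \<in> space N. 1 \<le> ennreal (1 / t) * ennreal (u x)}"
    proof (intro subsetI CollectI conjI; elim CollectE conjE)
      fix x assume "t < u x"
      then have "ennreal 1 \<le> ennreal (1 / t * u x)" using t by (intro ennreal_leI) simp
      also have "\<dots> = ennreal (1 / t) * ennreal (u x)" using t u(2) by (intro ennreal_mult) auto
      finally show "1 \<le> ennreal (1 / t) * ennreal (u x)" by simp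
    qed
  qed
  also have "\<dots> \<le> ennreal (1 / t) * (\<integral>\<^sup>+ x. ennreal (u x) * indicator (space N) x \<partial>N)"
    using u by (intro nn_integral_Markov_inequality) auto
  also have "(\<integral>\<^sup>+ x. ennreal (u x) * indicator (space N) x \<partial>N) = (\<integral>\<^sup>+ x. ennreal (u x) \<partial>N)"
    by (intro nn_integral_cong) auto
  also have "ennreal (1 / t) * (\<integral>\<^sup>+ x. ennreal (u x) \<partial>N) \<le> ennreal (1 / t) * ennreal e"
    by (intro mult_left_mono e) simp
  also have "\<dots> = ennreal (e / t)" using t e0 by (simp add: ennreal_mult[symmetric])
  finally show ?thesis using t e0 by (simp add: emeasure_eq_measure)
qed

section \<open>Isotropic samples\<close>

text \<open>\<open>good\<close> stands for the exact representation of the data by the features,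
  which is required only almost surely because the law may be singular in the ambient space.\<close>

locale isotropic_sample = prob_space G for G :: "'x measure" +
  fixes K :: nat and y :: "'x \<Rightarrow> nat \<Rightarrow> real" and good :: "'x \<Rightarrow> bool"
  assumes K: "0 < K"
    and meas: "\<And>a. a < K \<Longrightarrow> (\<lambda>x. y x a) \<in> borel_measurable G"
    and second: "\<And>A. (\<integral>\<^sup>+ x. ennreal ((dot ({..<K} \<times> {..<K}) A (quad (y x)))\<^sup>2) \<partial>G) \<le>
      ennreal (4 * dot ({..<K} \<times> {..<K}) A A)"
    and mean: "\<And>p. p \<in> {..<K} \<times> {..<K} \<Longrightarrow> (\<integral>x. quad (y x) p \<partial>G) = 0"
    and tail: "\<And>a t. a < K \<Longrightarrow> 0 \<le> t \<Longrightarrow> measure G {x \<in> space G. t < (y x a)\<^sup>2} \<le> 2 * exp (- t / 4)"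
    and good: "AE x in G. good x" and good_meas: "{x \<in> space G. good x} \<in> sets G"
begin

abbreviation "K2 \<equiv> {..<K} \<times> {..<K}"
abbreviation "PG J \<equiv> Pi\<^sub>M J (\<lambda>_ :: nat. G)"

lemma finK2: "finite K2" by simp

lemma quad_meas: "p \<in> K2 \<Longrightarrow> (\<lambda>x. quad (y x) p) \<in> borel_measurable G"
  using meas by (cases p) (auto simp: quad_def)

lemma quad_meas_PiM: "p \<in> K2 \<Longrightarrow> i \<in> J \<Longrightarrow> (\<lambda>x. quad (y (x i)) p) \<in> borel_measurable (PG J)"
  by (rule measurable_compose[where f = "\<lambda>x. x i" and N = G]) (auto intro: measurable_component_singleton quad_meas)

lemma prob_PiM: "prob_space (PG J)"
  by (rule prob_space_PiM) (rule prob_space_axioms)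

interpretation P: product_prob_space "\<lambda>_ :: nat. G" UNIV
  by unfold_locales

lemma quad_square:
  assumes p: "p \<in> K2"
  shows "integrable G (\<lambda>x. (quad (y x) p)\<^sup>2)" "(\<integral>x. (quad (y x) p)\<^sup>2 \<partial>G) \<le> 4" "integrable G (\<lambda>x. quad (y x) p)"
proof -
  have "dot K2 (\<lambda>a. of_bool (a = p)) (quad (y x)) = quad (y x) p" for x
    by (rule dot_unit[OF finK2 p])
  moreover have "dot K2 (\<lambda>a. of_bool (a = p)) (\<lambda>a. of_bool (a = p)) = 1"
    by (simp add: dot_unit[OF finK2 p])
  ultimately have le: "(\<integral>\<^sup>+ x. ennreal ((quad (y x) p)\<^sup>2) \<partial>G) \<le> ennreal 4"
    using second[of "\<lambda>a. of_bool (a = p)"] by simp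
  note [measurable] = quad_meas[OF p]
  show i: "integrable G (\<lambda>x. (quad (y x) p)\<^sup>2)"
    using le by (intro integrableI_bounded) (auto simp: le_less_trans)
  show "(\<integral>x. (quad (y x) p)\<^sup>2 \<partial>G) \<le> 4"
    using le unfolding nn_integral_eq_integral[OF i AE_I2[OF zero_le_power2]] by (subst (asm) ennreal_le_iff) auto
  show "integrable G (\<lambda>x. quad (y x) p)"
    by (rule square_integrable_imp_integrable[OF _ i]) simp
qed

lemma group_second_moment:
  assumes J: "finite J" and p: "p \<in> K2"
  shows "(\<integral>\<^sup>+ x. ennreal ((\<Sum>i\<in>J. quad (y (x i)) p)\<^sup>2) \<partial>PG J) \<le> ennreal (4 * real (card J))"
proof -
  let ?q = "\<lambda>x. quad (y x) p"
  \<comment> \<open>The factors multiply over J to the product of the entries at i and l, so that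
    the integral of each mixed term splits into one-sample integrals.\<close>
  define f where "f i l j = (if i = l then (if j = i then (\<lambda>x. (?q x)\<^sup>2) else (\<lambda>_. 1)) else
    (if j = i \<or> j = l then ?q else (\<lambda>_. 1)))" for i l j :: nat
  have fi: "integrable G (f i l j)" for i l j using quad_square[OF p] by (auto simp: f_def)
  have prod: "(\<Prod>j\<in>J. f i l j (x j)) = ?q (x i) * ?q (x l)" if il: "i \<in> J" "l \<in> J" for i l and x :: "nat \<Rightarrow> 'x"
  proof (cases "i = l")
    case True
    have "(\<Prod>j\<in>J. f i l j (x j)) = f i l i (x i) * (\<Prod>j\<in>J - {i}. f i l j (x j))"
      by (rule prod.remove[OF J il(1)])
    also have "(\<Prod>j\<in>J - {i}. f i l j (x j)) = 1" by (rule prod.neutral) (use True in \<open>auto simp: f_def\<close>)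
    finally show ?thesis using True by (simp add: f_def power2_eq_square)
  next
    case False
    have "(\<Prod>j\<in>J. f i l j (x j)) = f i l i (x i) * (\<Prod>j\<in>J - {i}. f i l j (x j))"
      by (rule prod.remove[OF J il(1)])
    also have "(\<Prod>j\<in>J - {i}. f i l j (x j)) = f i l l (x l) * (\<Prod>j\<in>J - {i} - {l}. f i l j (x j))"
      by (rule prod.remove) (use J il False in auto)
    also have "(\<Prod>j\<in>J - {i} - {l}. f i l j (x j)) = 1" by (rule prod.neutral) (use False in \<open>auto simp: f_def\<close>)
    finally show ?thesis using False by (simp add: f_def)
  qed
  have int: "integrable (PG J) (\<lambda>x. ?q (x i) * ?q (x l))" if il: "i \<in> J" "l \<in> J" for i l
    using product_sigma_finite.product_integrable_prod[OF P.product_sigma_finite_axioms J, of "f i l", OF fi]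
    by (simp add: prod[OF il])
  have val: "(\<integral>x. ?q (x i) * ?q (x l) \<partial>PG J) = (\<Prod>j\<in>J. \<integral>x. f i l j x \<partial>G)" if il: "i \<in> J" "l \<in> J" for i l
    using product_sigma_finite.product_integral_prod[OF P.product_sigma_finite_axioms J, of "f i l", OF fi]
    by (simp add: prod[OF il])
  have val0: "(\<integral>x. ?q (x i) * ?q (x l) \<partial>PG J) = 0" if il: "i \<in> J" "l \<in> J" "i \<noteq> l" for i l
  proof -
    have "(\<integral>x. f i l i x \<partial>G) = 0" using il mean[OF p] by (simp add: f_def)
    then show ?thesis unfolding val[OF il(1,2)] using J il(1) by (auto intro!: prod_zero)
  qed
  have val1: "(\<integral>x. ?q (x i) * ?q (x i) \<partial>PG J) \<le> 4" if i: "i \<in> J" for i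
  proof -
    have "(\<Prod>j\<in>J. \<integral>x. f i i j x \<partial>G) = (\<integral>x. f i i i x \<partial>G) * (\<Prod>j\<in>J - {i}. \<integral>x. f i i j x \<partial>G)"
      by (rule prod.remove[OF J i])
    also have "(\<Prod>j\<in>J - {i}. \<integral>x. f i i j x \<partial>G) = 1"
      by (rule prod.neutral) (auto simp: f_def prob_space)
    finally show ?thesis unfolding val[OF i i] using quad_square(2)[OF p] by (simp add: f_def)
  qed
  have sq: "(\<Sum>i\<in>J. ?q (x i))\<^sup>2 = (\<Sum>i\<in>J. \<Sum>l\<in>J. ?q (x i) * ?q (x l))" for x :: "nat \<Rightarrow> 'x"
    by (simp add: power2_eq_square sum_product)
  have I: "integrable (PG J) (\<lambda>x. (\<Sum>i\<in>J. ?q (x i))\<^sup>2)"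
    unfolding sq by (intro Bochner_Integration.integrable_sum int)
  have "(\<integral>x. (\<Sum>i\<in>J. ?q (x i))\<^sup>2 \<partial>PG J) = (\<Sum>i\<in>J. \<Sum>l\<in>J. \<integral>x. ?q (x i) * ?q (x l) \<partial>PG J)"
    unfolding sq by (simp add: Bochner_Integration.integral_sum int)
  also have "\<dots> = (\<Sum>i\<in>J. \<integral>x. ?q (x i) * ?q (x i) \<partial>PG J)"
  proof (intro sum.cong refl)
    fix i assume i: "i \<in> J"
    have "(\<Sum>l\<in>J. \<integral>x. ?q (x i) * ?q (x l) \<partial>PG J) = (\<Sum>l\<in>J. if l = i then \<integral>x. ?q (x i) * ?q (x i) \<partial>PG J else 0)"
      using i by (intro sum.cong refl) (auto simp: val0)
    then show "(\<Sum>l\<in>J. \<integral>x. ?q (x i) * ?q (x l) \<partial>PG J) = (\<integral>x. ?q (x i) * ?q (x i) \<partial>PG J)" using i J by simp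
  qed
  also have "\<dots> \<le> (\<Sum>i\<in>J. 4)" by (intro sum_mono val1)
  finally have "(\<integral>x. (\<Sum>i\<in>J. ?q (x i))\<^sup>2 \<partial>PG J) \<le> 4 * real (card J)" by simp
  then show ?thesis using nn_integral_eq_integral[OF I] by (simp add: ennreal_leI)
qed

section \<open>Lower bound by blocks\<close>

definition deviation :: "nat set \<Rightarrow> (nat \<Rightarrow> 'x) \<Rightarrow> real" where
  "deviation J x = (\<Sum>p\<in>K2. (\<Sum>i\<in>J. quad (y (x i)) p)\<^sup>2)"

lemma deviation_nonneg: "0 \<le> deviation J x"
  by (simp add: deviation_def sum_nonneg)

lemma deviation_meas: "J \<subseteq> J' \<Longrightarrow> (\<lambda>x. deviation J x) \<in> borel_measurable (PG J')"
  unfolding deviation_def by (intro borel_measurable_sum borel_measurable_power quad_meas_PiM) auto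

lemma deviation_expectation:
  assumes J: "finite J"
  shows "(\<integral>\<^sup>+ x. ennreal (deviation J x) \<partial>PG J) \<le> ennreal (4 * real (card J) * real K ^ 2)"
proof -
  have m: "(\<lambda>x. ennreal ((\<Sum>i\<in>J. quad (y (x i)) p)\<^sup>2)) \<in> borel_measurable (PG J)" if "p \<in> K2" for p
    using that by (intro measurable_compose[OF _ measurable_ennreal] borel_measurable_power borel_measurable_sum quad_meas_PiM)
  have "(\<integral>\<^sup>+ x. ennreal (deviation J x) \<partial>PG J) = (\<Sum>p\<in>K2. \<integral>\<^sup>+ x. ennreal ((\<Sum>i\<in>J. quad (y (x i)) p)\<^sup>2) \<partial>PG J)"
    unfolding deviation_def using m by (subst nn_integral_sum[symmetric]) (auto simp: sum_ennreal)
  also have "\<dots> \<le> (\<Sum>p\<in>K2. ennreal (4 * real (card J)))" by (intro sum_mono group_second_moment J)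
  also have "\<dots> = ennreal (\<Sum>p\<in>K2. 4 * real (card J))" by (rule sum_ennreal) simp
  also have "(\<Sum>p\<in>K2. 4 * real (card J)) = 4 * real (card J) * real K ^ 2" by (simp add: power2_eq_square)
  finally show ?thesis .
qed

definition block :: "nat \<Rightarrow> nat \<Rightarrow> nat set" where
  "block h g = {g * h..<g * h + h}"

definition bad_block :: "nat \<Rightarrow> nat \<Rightarrow> (nat \<Rightarrow> 'x) \<Rightarrow> bool" where
  "bad_block h g x \<longleftrightarrow> (real h / 2)\<^sup>2 < deviation (block h g) x"

text \<open>An exponential moment of the number of bad blocks. With base 64 = 8^2, more than half of
  the blocks being bad means a penalty of at least 8^r against an expectation of at most 2^r, so
  this has probability at most 4^(-r).\<close>

definition block_penalty :: "nat \<Rightarrow> nat \<Rightarrow> (nat \<Rightarrow> 'x) \<Rightarrow> ennreal" where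
  "block_penalty h r x = (\<Prod>g<r. if bad_block h g x then 64 else 1)"

lemma block_penalty_meas: "r * h \<le> n \<Longrightarrow> block_penalty h r \<in> borel_measurable (PG {..<n})"
proof -
  assume le: "r * h \<le> n"
  have "(\<lambda>x. if bad_block h g x then 64 else 1 :: ennreal) \<in> borel_measurable (PG {..<n})" if g: "g < r" for g
  proof -
    have "Suc g * h \<le> r * h" using g by (intro mult_right_mono) auto
    then have "block h g \<subseteq> {..<n}" using le by (auto simp: block_def)
    note [measurable] = deviation_meas[OF this]
    show ?thesis unfolding bad_block_def by measurable
  qed
  then show ?thesis unfolding block_penalty_def by (intro borel_measurable_prod_ennreal) auto
qed

lemma deviation_cong: "(\<And>i. i \<in> J \<Longrightarrow> x i = x' i) \<Longrightarrow> deviation J x = deviation J x'"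
  by (simp add: deviation_def)

text \<open>Blocks are independent, and second moments alone bound the expected penalty of one block
  by 1 + 1024 K^2 / h \<le> 2. This is where the lower bound asks for blocks of order K^2.\<close>

lemma block_penalty_expectation:
  assumes h: "1024 * real K ^ 2 \<le> real h"
  shows "(\<integral>\<^sup>+ x. block_penalty h r x \<partial>PG {..<r * h}) \<le> 2 ^ r"
proof (induction r)
  case 0
  show ?case by (simp add: block_penalty_def prob_space.emeasure_space_1[OF prob_PiM])
next
  case (Suc r)
  have "0 < real K ^ 2" using K by simp
  then have h0: "0 < real h" using h by linarith
  let ?I = "{..<r * h}" and ?J = "block h r"
  have un: "{..<Suc r * h} = ?I \<union> ?J" and dis: "?I \<inter> ?J = {}" by (auto simp: block_def)
  have fin: "finite ?J" "card ?J = h" by (auto simp: block_def)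
  let ?b = "\<lambda>x. if bad_block h r x then 64 else 1 :: ennreal"
  have m: "block_penalty h (Suc r) \<in> borel_measurable (PG (?I \<union> ?J))"
    unfolding un[symmetric] by (rule block_penalty_meas) simp
  note [measurable] = deviation_meas[of ?J ?J, OF order_refl]
  have bm: "?b \<in> borel_measurable (PG ?J)" unfolding bad_block_def by measurable
  have merge: "block_penalty h (Suc r) (merge ?I ?J (x, x')) = block_penalty h r x * ?b x'" for x x'
  proof -
    have "bad_block h g (merge ?I ?J (x, x')) = bad_block h g x" if g: "g < r" for g
    proof -
      have "Suc g * h \<le> r * h" using g by (intro mult_right_mono) auto
      then have "deviation (block h g) (merge ?I ?J (x, x')) = deviation (block h g) x"
        by (intro deviation_cong) (auto simp: merge_def block_def)
      then show ?thesis by (simp add: bad_block_def)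
    qed
    moreover have "deviation ?J (merge ?I ?J (x, x')) = deviation ?J x'"
      using dis by (intro deviation_cong) (auto simp: merge_def)
    ultimately show ?thesis by (simp add: block_penalty_def bad_block_def)
  qed
  \<comment> \<open>A bad block has deviation above h^2 / 4, so 256 / h^2 times the deviation
    exceeds 64 and dominates the penalty.\<close>
  have "(\<integral>\<^sup>+ x. ?b x \<partial>PG ?J) \<le> (\<integral>\<^sup>+ x. 1 + ennreal (256 / real h ^ 2) * ennreal (deviation ?J x) \<partial>PG ?J)"
  proof (rule nn_integral_mono)
    fix x
    show "?b x \<le> 1 + ennreal (256 / real h ^ 2) * ennreal (deviation ?J x)"
    proof (cases "bad_block h r x")
      case True
      then have "real h ^ 2 / 4 \<le> deviation ?J x" by (simp add: bad_block_def power_divide)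
      then have "256 / real h ^ 2 * (real h ^ 2 / 4) \<le> 256 / real h ^ 2 * deviation ?J x"
        by (intro mult_left_mono) auto
      then have "64 \<le> 256 / real h ^ 2 * deviation ?J x" using h0 by simp
      then have "ennreal 64 \<le> ennreal (256 / real h ^ 2 * deviation ?J x)" by (rule ennreal_leI)
      also have "\<dots> = ennreal (256 / real h ^ 2) * ennreal (deviation ?J x)"
        by (rule ennreal_mult) (auto simp: deviation_nonneg)
      finally show ?thesis using True by (simp add: add_increasing)
    next
      case False
      then show ?thesis by (simp add: add_increasing2)
    qed
  qed
  also have "\<dots> = 1 + ennreal (256 / real h ^ 2) * (\<integral>\<^sup>+ x. ennreal (deviation ?J x) \<partial>PG ?J)"
    by (subst nn_integral_add) (auto simp: nn_integral_cmult prob_space.emeasure_space_1[OF prob_PiM])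
  also have "\<dots> \<le> 1 + ennreal (256 / real h ^ 2) * ennreal (4 * real h * real K ^ 2)"
    using deviation_expectation[OF fin(1)] by (intro add_left_mono mult_left_mono) (auto simp: fin(2))
  also have "\<dots> = 1 + ennreal (1024 * real K ^ 2 / real h)"
    using h0 by (simp add: ennreal_mult[symmetric] power2_eq_square field_simps)
  also have "\<dots> \<le> 1 + ennreal 1" using h h0 by (intro add_left_mono ennreal_leI) simp
  finally have b: "(\<integral>\<^sup>+ x. ?b x \<partial>PG ?J) \<le> 2" by simp
  have "(\<integral>\<^sup>+ x. block_penalty h (Suc r) x \<partial>PG {..<Suc r * h}) =
      (\<integral>\<^sup>+ x. (\<integral>\<^sup>+ x'. block_penalty h r x * ?b x' \<partial>PG ?J) \<partial>PG ?I)"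
    unfolding un by (subst product_sigma_finite.product_nn_integral_fold[OF P.product_sigma_finite_axioms dis _ fin(1) m])
      (auto simp: merge)
  also have "\<dots> = (\<integral>\<^sup>+ x. block_penalty h r x * (\<integral>\<^sup>+ x'. ?b x' \<partial>PG ?J) \<partial>PG ?I)"
    using bm by (simp add: nn_integral_cmult)
  also have "\<dots> \<le> (\<integral>\<^sup>+ x. block_penalty h r x * 2 \<partial>PG ?I)" by (intro nn_integral_mono mult_left_mono b) simp
  also have "\<dots> = (\<integral>\<^sup>+ x. block_penalty h r x \<partial>PG ?I) * 2"
    by (rule nn_integral_multc) (rule block_penalty_meas, simp)
  also have "\<dots> \<le> 2 ^ r * 2" by (intro mult_right_mono Suc) simp
  finally show ?case by (simp add: mult.commute)
qed

end

text \<open>The growth over n samples contributes exp (8 x) \<le> exp (8 P), the normalization (3 /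
  32768)^P. The number 32768 is the first power of two above 3 exp 9, so that exp (- P)
  remains.\<close>

lemma trace_failure_bound:
  fixes x R N :: real and P :: nat
  assumes x: "x = real n / R" "1 \<le> x" and R: "0 < R" and P: "x \<le> real P" "real P \<le> 3 * x"
  shows "(1 + 8 / R) ^ n * (real P * R) ^ P / (32768 * real n) ^ P \<le> exp (- x)"
proof -
  have n: "0 < real n" using x R by (cases "n = 0") auto
  have "(1 + 8 / R) ^ n \<le> exp (8 / R) ^ n"
    using R exp_ge_add_one_self[of "8 / R"] by (intro power_mono) auto
  also have "\<dots> = exp (8 * x)" using x by (simp add: exp_of_nat_mult[symmetric])
  also have "\<dots> \<le> exp (8 * real P)" using P by simp
  also have "\<dots> = exp 8 ^ P" by (simp add: exp_of_nat_mult[symmetric] mult.commute)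
  finally have 1: "(1 + 8 / R) ^ n \<le> exp 8 ^ P" .
  have "real P * R / (32768 * real n) \<le> 3 * x * R / (32768 * real n)"
    using P R n by (intro divide_right_mono mult_right_mono) auto
  also have "\<dots> = 3 / 32768" using x R n by (simp add: field_simps)
  finally have 2: "real P * R / (32768 * real n) \<le> 3 / 32768" .
  have "(1 + 8 / R) ^ n * (real P * R) ^ P / (32768 * real n) ^ P = (1 + 8 / R) ^ n * (real P * R / (32768 * real n)) ^ P"
    by (simp add: power_divide)
  also have "\<dots> \<le> exp 8 ^ P * (3 / 32768) ^ P"
    using 1 2 R n by (intro mult_mono power_mono) auto
  also have "\<dots> = (exp 8 * (3 / 32768)) ^ P" by (rule power_mult_distrib[symmetric])
  also have "\<dots> \<le> exp (- 1) ^ P"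
  proof (rule power_mono)
    have "exp (9::real) = exp 1 ^ 9" using exp_of_nat_mult[of 9 "1::real"] by simp
    also have "\<dots> \<le> (272 / 100 :: real) ^ 9" using e_less_272 by (intro power_mono) auto
    also have "\<dots> \<le> 32768 / 3" by (simp add: power_divide)
    finally have "exp 9 * exp (- 1) * (3 / 32768) \<le> 1 * exp (- 1 :: real)" by (simp add: field_simps)
    then show "exp 8 * (3 / 32768) \<le> exp (- 1 :: real)" by (simp add: exp_add[symmetric])
  qed simp
  also have "\<dots> = exp (- real P)" by (simp add: exp_of_nat_mult[symmetric])
  also have "\<dots> \<le> exp (- x)" using P by simp
  finally show ?thesis .
qed

context isotropic_sample
begin

lemma component_measure:
  assumes "S \<in> sets G" "i \<in> J"
  shows "measure (PG J) {x \<in> space (PG J). x i \<in> S} = measure G S"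
proof -
  have m: "(\<lambda>x. x i) \<in> measurable (PG J) G" using assms(2) by (rule measurable_component_singleton)
  have "measure G S = measure (distr (PG J) G (\<lambda>x. x i)) S"
    using distr_PiM_component[of J "\<lambda>_. G" i] prob_space_axioms assms(2) by simp
  also have "\<dots> = measure (PG J) ((\<lambda>x. x i) -` S \<inter> space (PG J))" by (rule measure_distr[OF m assms(1)])
  finally show ?thesis by (simp add: vimage_def Int_def conj_commute)
qed

section \<open>Upper bound through truncated samples\<close>

definition atypical :: "real \<Rightarrow> 'x set" where
  "atypical t = {x \<in> space G. \<not> good x} \<union> (\<Union>a<K. {x \<in> space G. t < (y x a)\<^sup>2})"

lemma atypical_sets: "atypical t \<in> sets G"
proof -
  have "{x \<in> space G. \<not> good x} = space G - {x \<in> space G. good x}" by auto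
  moreover have "{x \<in> space G. t < (y x a)\<^sup>2} \<in> sets G" if "a < K" for a
  proof -
    note [measurable] = meas[OF that]
    show ?thesis by measurable
  qed
  ultimately show ?thesis unfolding atypical_def using good_meas by auto
qed

lemma atypical_measure: "0 \<le> t \<Longrightarrow> measure G (atypical t) \<le> real K * (2 * exp (- t / 4))"
proof -
  assume t: "0 \<le> t"
  have s: "{x \<in> space G. t < (y x a)\<^sup>2} \<in> sets G" if "a < K" for a
  proof -
    note [measurable] = meas[OF that]
    show ?thesis by measurable
  qed
  have b: "{x \<in> space G. \<not> good x} \<in> sets G" 
  proof -
    have "{x \<in> space G. \<not> good x} = space G - {x \<in> space G. good x}" by auto
    then show ?thesis using good_meas by auto
  qed
  have "measure G (atypical t) \<le> measure G {x \<in> space G. \<not> good x} + measure G (\<Union>a<K. {x \<in> space G. t < (y x a)\<^sup>2})"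
    unfolding atypical_def using b s by (intro measure_Un_le) auto
  also have "measure G {x \<in> space G. \<not> good x} = 0"
    using good b by (simp add: AE_iff_measurable[OF b] measure_def)
  also have "measure G (\<Union>a<K. {x \<in> space G. t < (y x a)\<^sup>2}) \<le> (\<Sum>a<K. measure G {x \<in> space G. t < (y x a)\<^sup>2})"
    using s by (intro finite_measure_subadditive_finite) auto
  also have "\<dots> \<le> (\<Sum>a<K. 2 * exp (- t / 4))" using t by (intro sum_mono tail) auto
  finally show ?thesis by simp
qed

text \<open>Truncation supplies the sure bound that the trace argument needs. Replacing by zero can
  only lower second moments, and it changes nothing on samples whose coordinates are all
  small.\<close>

definition truncated :: "real \<Rightarrow> 'x \<Rightarrow> nat \<times> nat \<Rightarrow> real" where
  "truncated \<rho> x = (if (\<Sum>a<K. (y x a)\<^sup>2) \<le> \<rho> then quad (y x) else (\<lambda>_. 0))"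

lemma bounded_truncated:
  assumes \<rho>: "real K \<le> \<rho>"
  shows "bounded_random_vector G K2 (truncated \<rho>) (2 * \<rho>\<^sup>2) 4"
proof unfold_locales
  have K1: "1 \<le> real K" using K by simp
  then have \<rho>1: "1 \<le> \<rho>" using \<rho> by linarith
  show "finite K2" by simp
  show "0 < 2 * \<rho>\<^sup>2" using \<rho>1 by simp
  show "(0::real) \<le> 4" by simp
  have nm: "(\<lambda>x. \<Sum>a<K. (y x a)\<^sup>2) \<in> borel_measurable G"
    by (intro borel_measurable_sum borel_measurable_power meas) auto
  show "random_variable borel (\<lambda>x. truncated \<rho> x b)" if "b \<in> K2" for b
  proof -
    have "(\<lambda>x. truncated \<rho> x b) = (\<lambda>x. if (\<Sum>a<K. (y x a)\<^sup>2) \<le> \<rho> then quad (y x) b else 0)"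
      by (auto simp: truncated_def)
    moreover note [measurable] = nm quad_meas[OF that]
    ultimately show ?thesis by simp
  qed
  show "dot K2 (truncated \<rho> x) (truncated \<rho> x) \<le> 2 * \<rho>\<^sup>2" for x
  proof (cases "(\<Sum>a<K. (y x a)\<^sup>2) \<le> \<rho>")
    case True
    let ?s = "dot {..<K} (y x) (y x)"
    have s: "0 \<le> ?s" "?s \<le> \<rho>" using True dot_self_nonneg[of "{..<K}" "y x"] by (auto simp: dot_def power2_eq_square)
    have "dot K2 (truncated \<rho> x) (truncated \<rho> x) = ?s\<^sup>2 - ?s - ?s + real K"
      using True by (simp add: truncated_def dot_quad_quad)
    also have "\<dots> \<le> \<rho>\<^sup>2 + \<rho>" using s \<rho> power_mono[of ?s \<rho> 2] by linarith
    also have "\<dots> \<le> \<rho>\<^sup>2 + \<rho>\<^sup>2" using \<rho>1 by (simp add: power2_eq_square)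
    finally show ?thesis by simp
  next
    case False
    then show ?thesis by (simp add: truncated_def dot_def)
  qed
  show "(\<integral>\<^sup>+ x. ennreal ((dot K2 A (truncated \<rho> x))\<^sup>2) \<partial>G) \<le> ennreal (4 * dot K2 A A)" for A
  proof -
    have "(\<integral>\<^sup>+ x. ennreal ((dot K2 A (truncated \<rho> x))\<^sup>2) \<partial>G) \<le> (\<integral>\<^sup>+ x. ennreal ((dot K2 A (quad (y x)))\<^sup>2) \<partial>G)"
      by (intro nn_integral_mono ennreal_leI) (auto simp: truncated_def dot_def)
    also have "\<dots> \<le> ennreal (4 * dot K2 A A)" by (rule second)
    finally show ?thesis .
  qed
qed

lemma trace_event:
  assumes \<rho>: "real K \<le> \<rho>" and n: "2 * \<rho>\<^sup>2 \<le> real n"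
  obtains P T where "even P" "0 < P" "T \<in> sets (PG {..<n})"
    "measure (PG {..<n}) T \<le> real K ^ 2 * exp (- (real n / (2 * \<rho>\<^sup>2)))"
    "\<And>x. x \<in> space (PG {..<n}) - T \<Longrightarrow> frame_trace K2 {..<n} (\<lambda>i. truncated \<rho> (x i)) P \<le> (32768 * real n) ^ P"
proof -
  interpret Q: bounded_random_vector G K2 "truncated \<rho>" "2 * \<rho>\<^sup>2" 4 by (rule bounded_truncated[OF \<rho>])
  let ?R = "2 * \<rho>\<^sup>2"
  define x where "x = real n / ?R"
  have x1: "1 \<le> x" using n Q.R by (simp add: x_def)
  \<comment> \<open>Even, as the trace criterion requires, and between x and 3 x because rounding up
    adds at most 2 \<le> 2 x.\<close>
  define P where "P = 2 * nat \<lceil>x / 2\<rceil>"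
  have P: "x \<le> real P" "real P \<le> 3 * x" "even P" "0 < P" using x1 unfolding P_def by (auto; linarith)+
  have n0: "0 < real n" using n Q.R by linarith
  let ?u = "\<lambda>x. frame_trace K2 {..<n} (\<lambda>i. truncated \<rho> (x i)) P"
  have um: "?u \<in> borel_measurable (PG {..<n})"
  proof (rule frame_trace_measurable)
    fix i b assume ib: "i \<in> {..<n}" "b \<in> K2"
    show "(\<lambda>x. truncated \<rho> (x i) b) \<in> borel_measurable (PG {..<n})"
      by (rule measurable_compose[where f = "\<lambda>x. x i" and N = G])
        (use ib in \<open>auto intro: measurable_component_singleton Q.meas\<close>)
  qed auto
  define T where "T = {x \<in> space (PG {..<n}). (32768 * real n) ^ P < ?u x}"
  have Tm: "T \<in> sets (PG {..<n})" unfolding T_def using um by measurable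
  let ?e = "real (card K2) * (1 + 2 * 4 / ?R) ^ n * (real P * ?R) ^ P"
  have "measure (PG {..<n}) T \<le> ?e / (32768 * real n) ^ P"
    unfolding T_def
  proof (rule markov_real[OF prob_PiM um])
    show "0 \<le> ?u x" for x by (rule frame_trace_nonneg)
    show "(\<integral>\<^sup>+ x. ennreal (?u x) \<partial>PG {..<n}) \<le> ennreal ?e" by (rule Q.trace_expectation[OF P(4)]) simp
    show "0 < (32768 * real n) ^ P" using n0 by simp
    have nn: "0 \<le> 1 + 2 * 4 / ?R" "0 \<le> real P * ?R" using Q.R by (intro add_nonneg_nonneg mult_nonneg_nonneg divide_nonneg_pos; simp)+
    show "0 \<le> ?e" by (rule mult_nonneg_nonneg[OF mult_nonneg_nonneg[OF of_nat_0_le_iff zero_le_power[OF nn(1)]] zero_le_power[OF nn(2)]])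
  qed
  also have "\<dots> = real K ^ 2 * ((1 + 8 / ?R) ^ n * (real P * ?R) ^ P / (32768 * real n) ^ P)"
    by (simp add: power2_eq_square)
  also have "\<dots> \<le> real K ^ 2 * exp (- x)"
    by (intro mult_left_mono trace_failure_bound[OF x_def x1 Q.R P(1,2)]) simp
  finally have "measure (PG {..<n}) T \<le> real K ^ 2 * exp (- (real n / ?R))" by (simp add: x_def)
  moreover have "?u x \<le> (32768 * real n) ^ P" if "x \<in> space (PG {..<n}) - T" for x using that by (auto simp: T_def)
  ultimately show thesis using that P Tm by blast
qed

lemma block_event:
  assumes h: "1024 * real K ^ 2 \<le> real h"
  obtains T where "T \<in> sets (PG {..<r * h})" "measure (PG {..<r * h}) T \<le> (1 / 4) ^ r"
    "\<And>x u. x \<in> space (PG {..<r * h}) - T \<Longrightarrow>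
      real (r * h) / 8 * dot {..<K} u u \<le> (\<Sum>i<r * h. (dot {..<K} u (y (x i)))\<^sup>2)"
proof -
  let ?N = "PG {..<r * h}"
  interpret N: prob_space ?N by (rule prob_PiM)
  define T where "T = {x \<in> space ?N. 1 \<le> ennreal ((1 / 8) ^ r) * block_penalty h r x}"
  have m: "block_penalty h r \<in> borel_measurable ?N" by (rule block_penalty_meas) simp
  have Tm: "T \<in> sets ?N" unfolding T_def using m by measurable
  have "emeasure ?N T \<le> ennreal ((1 / 8) ^ r) * (\<integral>\<^sup>+ x. block_penalty h r x * indicator (space ?N) x \<partial>?N)"
    unfolding T_def using m by (intro nn_integral_Markov_inequality) auto
  also have "(\<integral>\<^sup>+ x. block_penalty h r x * indicator (space ?N) x \<partial>?N) = (\<integral>\<^sup>+ x. block_penalty h r x \<partial>?N)"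
    by (intro nn_integral_cong) auto
  also have "ennreal ((1 / 8) ^ r) * (\<integral>\<^sup>+ x. block_penalty h r x \<partial>?N) \<le> ennreal ((1 / 8) ^ r) * ennreal (2 ^ r)"
    using block_penalty_expectation[OF h, of r] by (intro mult_left_mono) (simp_all add: ennreal_power[symmetric])
  also have "\<dots> = ennreal ((1 / 4) ^ r)"
    by (simp add: ennreal_mult[symmetric] power_mult_distrib[symmetric])
  finally have Tp: "measure ?N T \<le> (1 / 4) ^ r" by (simp add: N.emeasure_eq_measure)
  have "real (r * h) / 8 * dot {..<K} u u \<le> (\<Sum>i<r * h. (dot {..<K} u (y (x i)))\<^sup>2)" if x: "x \<in> space ?N - T" for x u
  proof -
    define bad where "bad = {g. g < r \<and> bad_block h g x}"
    have finb: "finite bad" by (simp add: bad_def)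
    have "block_penalty h r x = (\<Prod>g\<in>{..<r}. if g \<in> bad then 64 else 1)"
      unfolding block_penalty_def by (intro prod.cong refl) (simp add: bad_def)
    also have "\<dots> = 64 ^ card ({..<r} \<inter> bad)" by (simp add: prod.If_cases)
    also have "{..<r} \<inter> bad = bad" by (auto simp: bad_def)
    finally have pen: "block_penalty h r x = ennreal (64 ^ card bad)" by (simp add: ennreal_power[symmetric])
    have "2 * card bad \<le> r"
    proof (rule ccontr)
      assume "\<not> 2 * card bad \<le> r"
      then have "(8::real) ^ r \<le> 8 ^ (2 * card bad)" by (intro power_increasing) auto
      also have "\<dots> = 64 ^ card bad" by (simp add: power_mult)
      finally have "1 \<le> (1 / 8) ^ r * (64::real) ^ card bad" by (simp add: power_divide)
      then have "ennreal 1 \<le> ennreal ((1 / 8) ^ r * 64 ^ card bad)" by (rule ennreal_leI)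
      then have "1 \<le> ennreal ((1 / 8) ^ r) * block_penalty h r x" by (simp add: pen ennreal_mult[symmetric])
      then show False using x by (auto simp: T_def)
    qed
    let ?u = "dot {..<K} u u" and ?f = "\<lambda>i. (dot {..<K} u (y (x i)))\<^sup>2"
    \<comment> \<open>For a block that is not bad, Cauchy-Schwarz against u u^T bounds the gap
      between its energy and h |u|^2 by half of the latter, uniformly in u.\<close>
    have blk: "real h / 2 * ?u \<le> (\<Sum>i\<in>block h g. ?f i)" if g: "\<not> bad_block h g x" for g
    proof -
      let ?A = "\<lambda>(a, b). u a * u b"
      let ?S = "\<lambda>p. \<Sum>i\<in>block h g. 1 * quad (y (x i)) p"
      have "dot K2 ?A ?S = (\<Sum>i\<in>block h g. 1 * dot K2 ?A (quad (y (x i))))" by (rule dot_sum_right)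
      also have "\<dots> = (\<Sum>i\<in>block h g. ?f i) - real h * ?u"
        by (simp add: dot_quad_rank_one sum_subtractf block_def)
      finally have e: "dot K2 ?A ?S = (\<Sum>i\<in>block h g. ?f i) - real h * ?u" .
      have "(dot K2 ?A ?S)\<^sup>2 \<le> dot K2 ?A ?A * dot K2 ?S ?S" by (rule dot_Cauchy_Schwarz)
      also have "dot K2 ?A ?A = ?u\<^sup>2" by (rule dot_rank_one)
      also have "dot K2 ?S ?S = deviation (block h g) x" by (simp add: deviation_def dot_def power2_eq_square)
      also have "?u\<^sup>2 * deviation (block h g) x \<le> ?u\<^sup>2 * (real h / 2)\<^sup>2"
        using g by (intro mult_left_mono) (auto simp: bad_block_def)
      finally have "(dot K2 ?A ?S)\<^sup>2 \<le> (?u * (real h / 2))\<^sup>2" by (simp only: power_mult_distrib)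
      then have "\<bar>dot K2 ?A ?S\<bar> \<le> \<bar>?u * (real h / 2)\<bar>" by (simp only: abs_le_square_iff)
      also have "\<bar>?u * (real h / 2)\<bar> = ?u * (real h / 2)" by (rule abs_of_nonneg) simp
      finally have "- (?u * (real h / 2)) \<le> (\<Sum>i\<in>block h g. ?f i) - real h * ?u"
        unfolding e by linarith
      then have "real h * ?u - ?u * (real h / 2) \<le> (\<Sum>i\<in>block h g. ?f i)" by linarith
      then show ?thesis by (simp add: mult.commute[of ?u])
    qed
    have "real (r * h) / 8 * ?u \<le> real (r - card bad) * (real h / 2 * ?u)"
    proof -
      have "real r / 4 \<le> real (r - card bad)" using \<open>2 * card bad \<le> r\<close> by linarith
      then have "real r / 4 * (real h / 2 * ?u) \<le> real (r - card bad) * (real h / 2 * ?u)"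
        by (intro mult_right_mono) auto
      then show ?thesis by simp
    qed
    also have "real (r - card bad) * (real h / 2 * ?u) = (\<Sum>g\<in>{..<r} - bad. real h / 2 * ?u)"
      using finb by (simp add: card_Diff_subset bad_def subset_iff)
    also have "\<dots> \<le> (\<Sum>g\<in>{..<r} - bad. \<Sum>i\<in>block h g. ?f i)"
      by (intro sum_mono blk) (auto simp: bad_def)
    also have "\<dots> \<le> (\<Sum>g<r. \<Sum>i\<in>block h g. ?f i)" by (intro sum_mono2) (auto simp: sum_nonneg)
    also have "\<dots> = (\<Sum>i<r * h. ?f i)" unfolding block_def by (rule sum.nat_group)
    finally show ?thesis .
  qed
  then show thesis using that Tm Tp by blast
qed

text \<open>Three failures are excluded: an atypical row, a large trace, too many bad blocks. The
  bound \<rho> / K on each squared coordinate keeps every row inside the truncation radius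
  \<rho>.\<close>

theorem good_event:
  assumes h: "1024 * real K ^ 2 \<le> real h" and \<rho>: "real K \<le> \<rho>" and n: "2 * \<rho>\<^sup>2 \<le> real n" and nrh: "n = r * h"
  obtains E where "E \<in> sets (PG {..<n})"
    "1 - (2 * real n * real K * exp (- \<rho> / (4 * real K)) + real K ^ 2 * exp (- (real n / (2 * \<rho>\<^sup>2))) + (1 / 4) ^ r) \<le>
      measure (PG {..<n}) E"
    "\<And>x i. x \<in> E \<Longrightarrow> i < n \<Longrightarrow> good (x i)"
    "\<And>x A. x \<in> E \<Longrightarrow> (\<Sum>i<n. (dot K2 A (quad (y (x i))))\<^sup>2) \<le> 32768 * real n * dot K2 A A"
    "\<And>x u. x \<in> E \<Longrightarrow> real n / 8 * dot {..<K} u u \<le> (\<Sum>i<n. (dot {..<K} u (y (x i)))\<^sup>2)"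
proof -
  let ?N = "PG {..<n}"
  interpret N: prob_space ?N by (rule prob_PiM)
  obtain P T1 where T1: "even P" "0 < P" "T1 \<in> sets ?N" "measure ?N T1 \<le> real K ^ 2 * exp (- (real n / (2 * \<rho>\<^sup>2)))"
    "\<And>x. x \<in> space ?N - T1 \<Longrightarrow> frame_trace K2 {..<n} (\<lambda>i. truncated \<rho> (x i)) P \<le> (32768 * real n) ^ P"
    using trace_event[OF \<rho> n] by blast
  obtain T2 where T2: "T2 \<in> sets ?N" "measure ?N T2 \<le> (1 / 4) ^ r"
    "\<And>x u. x \<in> space ?N - T2 \<Longrightarrow> real n / 8 * dot {..<K} u u \<le> (\<Sum>i<n. (dot {..<K} u (y (x i)))\<^sup>2)"
    using block_event[OF h, of r] unfolding nrh by blast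
  define t where "t = \<rho> / real K"
  have K0: "0 < real K" using K by simp
  have t0: "0 \<le> t" using \<rho> K0 by (simp add: t_def)
  define T0 where "T0 = (\<Union>i<n. {x \<in> space ?N. x i \<in> atypical t})"
  have s: "{x \<in> space ?N. x i \<in> atypical t} \<in> sets ?N" if "i < n" for i
  proof -
    have "(\<lambda>x. x i) \<in> measurable ?N G" using that by (intro measurable_component_singleton) auto
    from measurable_sets[OF this atypical_sets[of t]] show ?thesis
      by (simp add: vimage_def Int_def conj_commute)
  qed
  have T0s: "T0 \<in> sets ?N" unfolding T0_def using s by auto
  have "measure ?N T0 \<le> (\<Sum>i<n. measure ?N {x \<in> space ?N. x i \<in> atypical t})"
    unfolding T0_def using s by (intro N.finite_measure_subadditive_finite) auto
  also have "\<dots> \<le> (\<Sum>i<n. real K * (2 * exp (- t / 4)))"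
    using atypical_measure[OF t0] by (intro sum_mono) (simp add: component_measure[OF atypical_sets])
  also have "\<dots> = 2 * real n * real K * exp (- \<rho> / (4 * real K))" by (simp add: t_def)
  finally have T0: "measure ?N T0 \<le> 2 * real n * real K * exp (- \<rho> / (4 * real K))" .
  define E where "E = space ?N - (T0 \<union> T1 \<union> T2)"
  have Es: "E \<in> sets ?N" unfolding E_def using T0s T1(3) T2(1) by auto
  have "measure ?N (T0 \<union> T1 \<union> T2) \<le> measure ?N T0 + measure ?N T1 + measure ?N T2"
    using measure_Un_le[of "T0 \<union> T1" ?N T2] measure_Un_le[of T0 ?N T1] T0s T1(3) T2(1) by (auto intro: order_trans)
  moreover have "measure ?N E = 1 - measure ?N (T0 \<union> T1 \<union> T2)"
    unfolding E_def using T0s T1(3) T2(1) by (intro N.prob_compl) auto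
  ultimately have Em: "1 - (2 * real n * real K * exp (- \<rho> / (4 * real K)) + real K ^ 2 * exp (- (real n / (2 * \<rho>\<^sup>2))) + (1 / 4) ^ r) \<le> measure ?N E"
    using T0 T1(4) T2(2) by linarith
  have typical: "good (x i) \<and> (\<forall>a<K. (y (x i) a)\<^sup>2 \<le> t)" if "x \<in> E" "i < n" for x i
  proof -
    have "x \<in> space ?N" "x i \<notin> atypical t" using that by (auto simp: E_def T0_def)
    moreover have "x i \<in> space G" using \<open>x \<in> space ?N\<close> that(2) by (auto simp: space_PiM)
    ultimately show ?thesis by (auto simp: atypical_def not_less)
  qed
  have up: "(\<Sum>i<n. (dot K2 A (quad (y (x i))))\<^sup>2) \<le> 32768 * real n * dot K2 A A" if x: "x \<in> E" for x A
  proof -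
    have tr: "truncated \<rho> (x i) = quad (y (x i))" if "i < n" for i
    proof -
      have "(\<Sum>a<K. (y (x i) a)\<^sup>2) \<le> (\<Sum>a<K. t)" using typical[OF x that] by (intro sum_mono) auto
      also have "\<dots> = \<rho>" using K0 by (simp add: t_def)
      finally show ?thesis by (simp add: truncated_def)
    qed
    have "(\<Sum>i<n. (dot K2 (truncated \<rho> (x i)) A)\<^sup>2) \<le> (32768 * real n) * dot K2 A A"
      by (rule quadratic_form_le_of_trace[OF finK2 T1(5) _ T1(1,2)]) (use x in \<open>auto simp: E_def\<close>)
    then show ?thesis by (simp add: tr dot_commute)
  qed
  show thesis
    by (rule that[OF Es Em]) (use typical up T2(3) in \<open>auto simp: E_def\<close>)
qed

end

section \<open>Gaussian vectors\<close>

abbreviation std_gauss :: "nat \<Rightarrow> (nat \<Rightarrow> real) measure" where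
  "std_gauss m \<equiv> Pi\<^sub>M {..<m} (\<lambda>_. density lborel std_normal_density)"

lemma prob_std_gauss: "prob_space (std_gauss m)"
  by (rule prob_space_PiM) (rule prob_space_normal_density, simp)

lemma std_gauss_component: "i < m \<Longrightarrow> distributed (std_gauss m) lborel (\<lambda>\<omega>. \<omega> i) std_normal_density"
proof -
  assume i: "i < m"
  have "distr (std_gauss m) lborel (\<lambda>\<omega>. \<omega> i) = distr (std_gauss m) (density lborel std_normal_density) (\<lambda>\<omega>. \<omega> i)"
    by (rule distr_cong) auto
  also have "\<dots> = density lborel std_normal_density"
    using i by (intro distr_PiM_component) (auto intro: prob_space_normal_density)
  moreover have "(\<lambda>\<omega>. \<omega> i) \<in> measurable (std_gauss m) lborel"
    using measurable_component_singleton[of i "{..<m}" "\<lambda>_. density lborel std_normal_density"] i by simp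
  ultimately show ?thesis unfolding distributed_def by auto
qed

lemma indep_std_gauss:
  assumes "0 < m"
  shows "prob_space.indep_vars (std_gauss m) (\<lambda>_. borel) (\<lambda>i \<omega>. \<omega> i) {..<m}"
proof -
  let ?N = "density lborel std_normal_density"
  interpret Z: prob_space "std_gauss m" by (rule prob_std_gauss)
  have rv: "(\<lambda>\<omega>. \<omega> i) \<in> borel_measurable (std_gauss m)" if "i \<in> {..<m}" for i
    using measurable_component_singleton[OF that, of "\<lambda>_. ?N"] by simp
  have sets: "sets (Pi\<^sub>M {..<m} (\<lambda>_. borel)) = sets (std_gauss m)" by (rule sets_PiM_cong) auto
  have "distr (std_gauss m) (Pi\<^sub>M {..<m} (\<lambda>_. borel)) (\<lambda>\<omega>. \<lambda>i\<in>{..<m}. \<omega> i) = distr (std_gauss m) (std_gauss m) (\<lambda>\<omega>. \<omega>)"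
    by (rule distr_cong) (auto simp: sets space_PiM PiE_def extensional_restrict)
  also have "\<dots> = std_gauss m" by (rule distr_id)
  also have "\<dots> = Pi\<^sub>M {..<m} (\<lambda>i. distr (std_gauss m) borel (\<lambda>\<omega>. \<omega> i))"
  proof (rule PiM_cong[OF refl])
    fix i assume i: "i \<in> {..<m}"
    have "distr (std_gauss m) borel (\<lambda>\<omega>. \<omega> i) = distr (std_gauss m) ?N (\<lambda>\<omega>. \<omega> i)"
      by (rule distr_cong) auto
    also have "\<dots> = ?N" using i by (intro distr_PiM_component) (auto intro: prob_space_normal_density)
    finally show "?N = distr (std_gauss m) borel (\<lambda>\<omega>. \<omega> i)" by simp
  qed
  finally show ?thesis using assms rv by (subst Z.indep_vars_iff_distr_eq_PiM') auto
qed

section \<open>Linear forms of a standard Gaussian vector\<close>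

definition lin :: "nat \<Rightarrow> (nat \<Rightarrow> real) \<Rightarrow> (nat \<Rightarrow> real) \<Rightarrow> real" where
  "lin m v \<omega> = (\<Sum>j<m. v j * \<omega> j)"

lemma lin_meas [measurable]: "lin m v \<in> borel_measurable (std_gauss m)"
proof -
  have "(\<lambda>\<omega>. \<omega> j) \<in> borel_measurable (std_gauss m)" if "j \<in> {..<m}" for j
    using measurable_component_singleton[OF that, of "\<lambda>_. density lborel std_normal_density"] by simp
  then show ?thesis unfolding lin_def[abs_def] by (intro borel_measurable_sum borel_measurable_times) auto
qed

lemma lin_distributed:
  assumes pos: "0 < dot {..<m} v v"
  shows "distributed (std_gauss m) lborel (lin m v) (normal_density 0 (sqrt (dot {..<m} v v)))"
proof -
  interpret Z: prob_space "std_gauss m" by (rule prob_std_gauss)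
  \<comment> \<open>A zero coefficient would give a degenerate summand without a density, so only
    the nonzero ones are summed.\<close>
  define I where "I = {i. i < m \<and> v i \<noteq> 0}"
  have "I \<noteq> {}"
  proof
    assume "I = {}"
    then have "\<forall>i\<in>{..<m}. v i * v i = 0" by (auto simp: I_def)
    then have "dot {..<m} v v = 0" unfolding dot_def by (rule sum.neutral)
    then show False using pos by simp
  qed
  then have I: "finite I" "I \<noteq> {}" "I \<subseteq> {..<m}" by (auto simp: I_def)
  then have m: "0 < m" by auto
  have lin: "lin m v \<omega> = (\<Sum>i\<in>I. v i * \<omega> i)" for \<omega>
    unfolding lin_def by (rule sum.mono_neutral_right) (auto simp: I_def)
  have vv: "(\<Sum>i\<in>I. \<bar>v i\<bar>\<^sup>2) = dot {..<m} v v"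
    unfolding dot_def by (simp only: power2_abs) (unfold power2_eq_square, rule sum.mono_neutral_left, auto simp: I_def)
  have "Z.indep_vars (\<lambda>_. borel) (\<lambda>i \<omega>. \<omega> i) I"
    by (rule Z.indep_vars_subset[OF indep_std_gauss[OF m] I(3)])
  then have ind: "Z.indep_vars (\<lambda>_. borel) (\<lambda>i \<omega>. v i * \<omega> i) I"
    by (rule Z.indep_vars_compose2) auto
  have "distributed (std_gauss m) lborel (\<lambda>\<omega>. v i * \<omega> i) (normal_density 0 \<bar>v i\<bar>)" if i: "i \<in> I" for i
    using Z.normal_density_affine[OF std_gauss_component[of i m], of "v i" 0] i by (simp add: I_def)
  then have "distributed (std_gauss m) lborel (\<lambda>\<omega>. \<Sum>i\<in>I. v i * \<omega> i)
      (normal_density (\<Sum>i\<in>I. 0) (sqrt (\<Sum>i\<in>I. \<bar>v i\<bar>\<^sup>2)))"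
    using I ind by (intro Z.sum_indep_normal) (auto simp: I_def)
  then show ?thesis unfolding vv by (simp add: lin[abs_def])
qed

lemma lin_zero: "dot {..<m} v v = 0 \<Longrightarrow> lin m v = (\<lambda>_. 0)"
  by (auto simp: dot_self_eq_0 lin_def)

lemma lin_moment_integrable: "integrable (std_gauss m) (\<lambda>\<omega>. lin m v \<omega> ^ k)"
proof (cases "dot {..<m} v v = 0")
  case True
  interpret Z: prob_space "std_gauss m" by (rule prob_std_gauss)
  show ?thesis by (simp add: lin_zero[OF True])
next
  case False
  then have pos: "0 < dot {..<m} v v" using dot_self_nonneg[of "{..<m}" v] by linarith
  have "integrable lborel (\<lambda>x. normal_density 0 (sqrt (dot {..<m} v v)) x * (x - 0) ^ k)"
    using pos by (intro integrable_normal_moment) simp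
  then show ?thesis
    using distributed_integrable[OF lin_distributed[OF pos], of "\<lambda>x. x ^ k"] by simp
qed

lemma lin_moments:
  shows "(\<integral>\<omega>. lin m v \<omega> \<partial>std_gauss m) = 0" "(\<integral>\<omega>. lin m v \<omega> ^ 2 \<partial>std_gauss m) = dot {..<m} v v"
    "(\<integral>\<omega>. lin m v \<omega> ^ 4 \<partial>std_gauss m) = 3 * (dot {..<m} v v)\<^sup>2"
proof -
  have "(\<integral>\<omega>. lin m v \<omega> \<partial>std_gauss m) = 0 \<and> (\<integral>\<omega>. lin m v \<omega> ^ 2 \<partial>std_gauss m) = dot {..<m} v v \<and>
    (\<integral>\<omega>. lin m v \<omega> ^ 4 \<partial>std_gauss m) = 3 * (dot {..<m} v v)\<^sup>2"
  proof (cases "dot {..<m} v v = 0")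
    case True
    then show ?thesis by (simp add: lin_zero[OF True])
  next
    case False
    then have pos: "0 < dot {..<m} v v" using dot_self_nonneg[of "{..<m}" v] by linarith
    let ?s = "sqrt (dot {..<m} v v)"
    have s: "0 < ?s" "?s\<^sup>2 = dot {..<m} v v" using pos by auto
    have eq: "(\<integral>\<omega>. lin m v \<omega> ^ k \<partial>std_gauss m) = (\<integral>x. normal_density 0 ?s x * (x - 0) ^ k \<partial>lborel)" for k
      using distributed_integral[OF lin_distributed[OF pos], of "\<lambda>x. x ^ k"] by simp
    have f4: "fact 4 = (24::real)" by (simp add: fact_numeral)
    show ?thesis
      using eq[of 1] eq[of 2] eq[of 4] integral_normal_moment_odd[OF s(1), of 0 0]
        integral_normal_moment_even[OF s(1), of 0 1] integral_normal_moment_even[OF s(1), of 0 2] s pos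
      by (auto simp: f4 power2_eq_square)
  qed
  then show "(\<integral>\<omega>. lin m v \<omega> \<partial>std_gauss m) = 0" "(\<integral>\<omega>. lin m v \<omega> ^ 2 \<partial>std_gauss m) = dot {..<m} v v"
    "(\<integral>\<omega>. lin m v \<omega> ^ 4 \<partial>std_gauss m) = 3 * (dot {..<m} v v)\<^sup>2" by auto
qed

text \<open>Markov's inequality for exp (g^2 / 4), whose expectation under the standard normal law
  is sqrt 2.\<close>

lemma lin_tail:
  assumes v: "dot {..<m} v v = 1" and t: "0 \<le> t"
  shows "measure (std_gauss m) {\<omega> \<in> space (std_gauss m). t < (lin m v \<omega>)\<^sup>2} \<le> 2 * exp (- t / 4)"
proof -
  let ?Z = "std_gauss m"
  interpret Z: prob_space ?Z by (rule prob_std_gauss)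
  have d: "distributed ?Z lborel (lin m v) std_normal_density" using lin_distributed[of m v] v by simp
  have ind: "{\<omega> \<in> space ?Z. t < (lin m v \<omega>)\<^sup>2} = {\<omega> \<in> space ?Z. exp (t / 4) < exp ((lin m v \<omega>)\<^sup>2 / 4)}" by auto
  have pw: "std_normal_density x * exp (x\<^sup>2 / 4) = sqrt 2 * normal_density 0 (sqrt 2) x" for x
  proof -
    have "exp (- x\<^sup>2 / 2) * exp (x\<^sup>2 / 4) = exp (- x\<^sup>2 / 4)" by (simp add: exp_add[symmetric])
    then show ?thesis unfolding normal_density_def by (simp add: real_sqrt_mult field_simps)
  qed
  have "(\<integral>\<^sup>+ \<omega>. ennreal (exp ((lin m v \<omega>)\<^sup>2 / 4)) \<partial>?Z) = (\<integral>\<^sup>+ x. ennreal (std_normal_density x) * ennreal (exp (x\<^sup>2 / 4)) \<partial>lborel)"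
    by (rule distributed_nn_integral[OF d, symmetric]) simp
  also have "\<dots> = (\<integral>\<^sup>+ x. ennreal (sqrt 2) * ennreal (normal_density 0 (sqrt 2) x) \<partial>lborel)"
    by (intro nn_integral_cong) (simp add: ennreal_mult[symmetric] pw)
  also have "\<dots> = ennreal (sqrt 2) * (\<integral>\<^sup>+ x. ennreal (normal_density 0 (sqrt 2) x) \<partial>lborel)"
    by (rule nn_integral_cmult) simp
  also have "(\<integral>\<^sup>+ x. ennreal (normal_density 0 (sqrt 2) x) \<partial>lborel) = 1"
    by (subst nn_integral_eq_integral) (auto simp: normal_density_nonneg)
  finally have e: "(\<integral>\<^sup>+ \<omega>. ennreal (exp ((lin m v \<omega>)\<^sup>2 / 4)) \<partial>?Z) \<le> ennreal (sqrt 2)" by simp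
  have "measure ?Z {\<omega> \<in> space ?Z. exp (t / 4) < exp ((lin m v \<omega>)\<^sup>2 / 4)} \<le> sqrt 2 / exp (t / 4)"
    by (rule markov_real[OF prob_std_gauss _ _ e]) auto
  also have "\<dots> \<le> 2 / exp (t / 4)" by (intro divide_right_mono real_le_lsqrt) auto
  finally show ?thesis unfolding ind by (simp add: exp_minus field_simps)
qed

text \<open>Fourth powers of signed sums suffice to produce any product of four factors, so mixed
  moments of Gaussian forms follow from the fourth moment of a single form.\<close>

lemma polarization_four:
  fixes a b c d :: real
  shows "192 * (a * b * c * d) =
    (a + b + c + d) ^ 4 - (a + b + c - d) ^ 4 - (a + b - c + d) ^ 4 + (a + b - c - d) ^ 4
    - (a - b + c + d) ^ 4 + (a - b + c - d) ^ 4 + (a - b - c + d) ^ 4 - (a - b - c - d) ^ 4"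
  by (simp add: power4_eq_xxxx algebra_simps)

lemma lin_add: "lin m u \<omega> + lin m v \<omega> = lin m (\<lambda>j. u j + v j) \<omega>"
  and lin_diff: "lin m u \<omega> - lin m v \<omega> = lin m (\<lambda>j. u j - v j) \<omega>"
  by (simp_all only: lin_def distrib_right left_diff_distrib sum.distrib sum_subtractf)

lemma dot_add_self: "dot B (\<lambda>j. u j + v j) (\<lambda>j. u j + v j) = dot B u u + 2 * dot B u v + dot B v v"
  and dot_diff_self: "dot B (\<lambda>j. u j - v j) (\<lambda>j. u j - v j) = dot B u u - 2 * dot B u v + dot B v v"
proof -
  have c: "(\<Sum>j\<in>B. v j * u j) = (\<Sum>j\<in>B. u j * v j)" by (simp only: mult.commute)
  show "dot B (\<lambda>j. u j + v j) (\<lambda>j. u j + v j) = dot B u u + 2 * dot B u v + dot B v v"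
    unfolding dot_def distrib_left distrib_right sum.distrib c by linarith
  show "dot B (\<lambda>j. u j - v j) (\<lambda>j. u j - v j) = dot B u u - 2 * dot B u v + dot B v v"
    unfolding dot_def left_diff_distrib right_diff_distrib sum_subtractf c by linarith
qed

lemma dot_add_left: "dot B (\<lambda>j. u j + v j) w = dot B u w + dot B v w"
  and dot_diff_left: "dot B (\<lambda>j. u j - v j) w = dot B u w - dot B v w"
  by (simp_all only: dot_def distrib_right left_diff_distrib sum.distrib sum_subtractf)

lemma lin_product:
  "integrable (std_gauss m) (\<lambda>\<omega>. lin m u \<omega> * lin m v \<omega>)"
  "(\<integral>\<omega>. lin m u \<omega> * lin m v \<omega> \<partial>std_gauss m) = dot {..<m} u v"
proof -
  have eq: "lin m u \<omega> * lin m v \<omega> = (lin m (\<lambda>j. u j + v j) \<omega> ^ 2 - lin m (\<lambda>j. u j - v j) \<omega> ^ 2) / 4" for \<omega>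
    unfolding lin_add[symmetric] lin_diff[symmetric] by (simp add: power2_eq_square algebra_simps)
  show "integrable (std_gauss m) (\<lambda>\<omega>. lin m u \<omega> * lin m v \<omega>)"
    unfolding eq by (intro integrable_divide_zero Bochner_Integration.integrable_diff lin_moment_integrable)
  show "(\<integral>\<omega>. lin m u \<omega> * lin m v \<omega> \<partial>std_gauss m) = dot {..<m} u v"
    unfolding eq by (simp add: Bochner_Integration.integral_diff lin_moment_integrable lin_moments dot_add_self dot_diff_self)
qed

lemma lin_isserlis:
  "integrable (std_gauss m) (\<lambda>\<omega>. lin m a \<omega> * lin m b \<omega> * lin m c \<omega> * lin m e \<omega>)"
  "(\<integral>\<omega>. lin m a \<omega> * lin m b \<omega> * lin m c \<omega> * lin m e \<omega> \<partial>std_gauss m) =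
    dot {..<m} a b * dot {..<m} c e + dot {..<m} a c * dot {..<m} b e + dot {..<m} a e * dot {..<m} b c"
proof -
  let ?D = "dot {..<m}"
  have eq: "lin m a \<omega> * lin m b \<omega> * lin m c \<omega> * lin m e \<omega> =
    (lin m (\<lambda>j. a j + b j + c j + e j) \<omega> ^ 4 - lin m (\<lambda>j. a j + b j + c j - e j) \<omega> ^ 4
     - lin m (\<lambda>j. a j + b j - c j + e j) \<omega> ^ 4 + lin m (\<lambda>j. a j + b j - c j - e j) \<omega> ^ 4
     - lin m (\<lambda>j. a j - b j + c j + e j) \<omega> ^ 4 + lin m (\<lambda>j. a j - b j + c j - e j) \<omega> ^ 4
     + lin m (\<lambda>j. a j - b j - c j + e j) \<omega> ^ 4 - lin m (\<lambda>j. a j - b j - c j - e j) \<omega> ^ 4) / 192" for \<omega>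
    unfolding lin_add[symmetric] lin_diff[symmetric] using polarization_four[of "lin m a \<omega>" "lin m b \<omega>" "lin m c \<omega>" "lin m e \<omega>"]
    by simp
  show "integrable (std_gauss m) (\<lambda>\<omega>. lin m a \<omega> * lin m b \<omega> * lin m c \<omega> * lin m e \<omega>)"
    unfolding eq by (intro integrable_divide_zero Bochner_Integration.integrable_diff Bochner_Integration.integrable_add lin_moment_integrable)
  \<comment> \<open>The fourth moment of a form is 3 times the square of its squared length. A, B,
    C, E stand for the squared lengths and the other symbols for pairwise inner products.\<close>
  have ring: "3 * (A + B + C + E + 2*ab + 2*ac + 2*ae + 2*bc + 2*be + 2*ce)\<^sup>2
      - 3 * (A + B + C + E + 2*ab + 2*ac - 2*ae + 2*bc - 2*be - 2*ce)\<^sup>2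
      - 3 * (A + B + C + E + 2*ab - 2*ac + 2*ae - 2*bc + 2*be - 2*ce)\<^sup>2
      + 3 * (A + B + C + E + 2*ab - 2*ac - 2*ae - 2*bc - 2*be + 2*ce)\<^sup>2
      - 3 * (A + B + C + E - 2*ab + 2*ac + 2*ae - 2*bc - 2*be + 2*ce)\<^sup>2
      + 3 * (A + B + C + E - 2*ab + 2*ac - 2*ae - 2*bc + 2*be - 2*ce)\<^sup>2
      + 3 * (A + B + C + E - 2*ab - 2*ac + 2*ae + 2*bc - 2*be - 2*ce)\<^sup>2
      - 3 * (A + B + C + E - 2*ab - 2*ac - 2*ae + 2*bc + 2*be + 2*ce)\<^sup>2
      = 192 * (ab * ce + ac * be + ae * bc)" for A B C E ab ac ae bc be ce :: real
    by (simp add: power2_eq_square algebra_simps)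
  have n: "?D (\<lambda>j. a j + b j + c j + e j) (\<lambda>j. a j + b j + c j + e j) =
      ?D a a + ?D b b + ?D c c + ?D e e + 2 * ?D a b + 2 * ?D a c + 2 * ?D a e + 2 * ?D b c + 2 * ?D b e + 2 * ?D c e"
    "?D (\<lambda>j. a j + b j + c j - e j) (\<lambda>j. a j + b j + c j - e j) =
      ?D a a + ?D b b + ?D c c + ?D e e + 2 * ?D a b + 2 * ?D a c - 2 * ?D a e + 2 * ?D b c - 2 * ?D b e - 2 * ?D c e"
    "?D (\<lambda>j. a j + b j - c j + e j) (\<lambda>j. a j + b j - c j + e j) =
      ?D a a + ?D b b + ?D c c + ?D e e + 2 * ?D a b - 2 * ?D a c + 2 * ?D a e - 2 * ?D b c + 2 * ?D b e - 2 * ?D c e"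
    "?D (\<lambda>j. a j + b j - c j - e j) (\<lambda>j. a j + b j - c j - e j) =
      ?D a a + ?D b b + ?D c c + ?D e e + 2 * ?D a b - 2 * ?D a c - 2 * ?D a e - 2 * ?D b c - 2 * ?D b e + 2 * ?D c e"
    "?D (\<lambda>j. a j - b j + c j + e j) (\<lambda>j. a j - b j + c j + e j) =
      ?D a a + ?D b b + ?D c c + ?D e e - 2 * ?D a b + 2 * ?D a c + 2 * ?D a e - 2 * ?D b c - 2 * ?D b e + 2 * ?D c e"
    "?D (\<lambda>j. a j - b j + c j - e j) (\<lambda>j. a j - b j + c j - e j) =
      ?D a a + ?D b b + ?D c c + ?D e e - 2 * ?D a b + 2 * ?D a c - 2 * ?D a e - 2 * ?D b c + 2 * ?D b e - 2 * ?D c e"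
    "?D (\<lambda>j. a j - b j - c j + e j) (\<lambda>j. a j - b j - c j + e j) =
      ?D a a + ?D b b + ?D c c + ?D e e - 2 * ?D a b - 2 * ?D a c + 2 * ?D a e + 2 * ?D b c - 2 * ?D b e - 2 * ?D c e"
    "?D (\<lambda>j. a j - b j - c j - e j) (\<lambda>j. a j - b j - c j - e j) =
      ?D a a + ?D b b + ?D c c + ?D e e - 2 * ?D a b - 2 * ?D a c - 2 * ?D a e + 2 * ?D b c + 2 * ?D b e + 2 * ?D c e"
    by (simp_all only: dot_add_self dot_diff_self dot_add_left dot_diff_left, simp_all)
  show "(\<integral>\<omega>. lin m a \<omega> * lin m b \<omega> * lin m c \<omega> * lin m e \<omega> \<partial>std_gauss m) =
    ?D a b * ?D c e + ?D a c * ?D b e + ?D a e * ?D b c"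
    unfolding eq
    by (simp only: integral_divide_zero Bochner_Integration.integral_diff Bochner_Integration.integral_add
        Bochner_Integration.integrable_diff Bochner_Integration.integrable_add lin_moment_integrable lin_moments n ring) simp
qed

lemma sum_of_bool_eq: "finite P \<Longrightarrow> p \<in> P \<Longrightarrow> (\<Sum>x\<in>P. f x * of_bool (p = x)) = (f p :: real)"
  by (simp add: of_bool_def if_distrib[of "\<lambda>x. _ * x"] cong: if_cong)

section \<open>Affine features of a Gaussian vector\<close>

definition affine_features :: "nat \<Rightarrow> (nat \<Rightarrow> nat \<Rightarrow> real) \<Rightarrow> (nat \<Rightarrow> real) \<Rightarrow> nat \<Rightarrow> real" where
  "affine_features m e z a = (case a of 0 \<Rightarrow> 1 | Suc l \<Rightarrow> lin m (e l) z)"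

lemma affine_features_simps [simp]:
  "affine_features m e z 0 = 1" "affine_features m e z (Suc l) = lin m (e l) z"
  by (simp_all add: affine_features_def)

context
  fixes m r :: nat and e :: "nat \<Rightarrow> nat \<Rightarrow> real"
  assumes orth: "\<And>l l'. l < r \<Longrightarrow> l' < r \<Longrightarrow> dot {..<m} (e l) (e l') = of_bool (l = l')"
begin

private abbreviation "g l z \<equiv> lin m (e l) z"
private abbreviation "q z p \<equiv> g (fst p) z * g (snd p) z - of_bool (fst p = snd p)"
private abbreviation "P \<equiv> {..<r} \<times> {..<r}"

text \<open>Of the three pairings in Isserlis' formula, centring cancels the one that pairs within p
  and within p'. The swap term appears because the entry at p equals the entry at its
  transpose.\<close>

lemma hermite_product:
  assumes "p \<in> P" "p' \<in> P"
  shows "integrable (std_gauss m) (\<lambda>z. q z p * q z p')"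
    "(\<integral>z. q z p * q z p' \<partial>std_gauss m) = of_bool (p = p') + of_bool (prod.swap p = p')"
proof -
  interpret Z: prob_space "std_gauss m" by (rule prob_std_gauss)
  obtain a b c f where p: "p = (a, b)" "p' = (c, f)" by (cases p, cases p')
  then have lt: "a < r" "b < r" "c < r" "f < r" using assms by auto
  have eq: "q z p * q z p' = g a z * g b z * g c z * g f z - of_bool (c = f) * (g a z * g b z)
      - of_bool (a = b) * (g c z * g f z) + of_bool (a = b) * of_bool (c = f)" for z
    by (simp add: p algebra_simps)
  have int: "integrable (std_gauss m) (\<lambda>z. of_bool (c = f) * (g a z * g b z))"
    "integrable (std_gauss m) (\<lambda>z. of_bool (a = b) * (g c z * g f z))"
    "integrable (std_gauss m) (\<lambda>z. of_bool (a = b) * of_bool (c = f) :: real)"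
    by (intro integrable_mult_right lin_product Z.integrable_const)+
  show "integrable (std_gauss m) (\<lambda>z. q z p * q z p')"
    unfolding eq by (intro Bochner_Integration.integrable_add Bochner_Integration.integrable_diff int lin_isserlis)
  have ring: "ab * cf + ac * bf + af * bc - cf * ab - ab * cf + ab * cf = ac * bf + bc * af" for ab cf ac bf af bc :: real
    by (simp add: algebra_simps)
  have "(\<integral>z. q z p * q z p' \<partial>std_gauss m) = (\<integral>z. g a z * g b z * g c z * g f z \<partial>std_gauss m)
      - of_bool (c = f) * (\<integral>z. g a z * g b z \<partial>std_gauss m) - of_bool (a = b) * (\<integral>z. g c z * g f z \<partial>std_gauss m)
      + of_bool (a = b) * of_bool (c = f)"
    unfolding eq
    by (simp only: Bochner_Integration.integral_add Bochner_Integration.integral_diff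
        Bochner_Integration.integrable_add Bochner_Integration.integrable_diff int lin_isserlis(1)
        integral_mult_right_zero lebesgue_integral_const Z.prob_space scaleR_one)
  also have "\<dots> = of_bool (a = c \<and> b = f) + of_bool (b = c \<and> a = f)"
    unfolding lin_isserlis lin_product orth[OF lt(1,2)] orth[OF lt(3,4)] orth[OF lt(1,3)] orth[OF lt(2,4)]
      orth[OF lt(1,4)] orth[OF lt(2,3)] of_bool_conj by (rule ring)
  finally show "(\<integral>z. q z p * q z p' \<partial>std_gauss m) = of_bool (p = p') + of_bool (prod.swap p = p')" by (simp add: p)
qed

text \<open>The swap term at most doubles the energy, by 2 x y \<le> x^2 + y^2 and the symmetry of
  the index set.\<close>

lemma hermite_second_moment:
  "integrable (std_gauss m) (\<lambda>z. (\<Sum>p\<in>P. B p * q z p)\<^sup>2)"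
  "(\<integral>z. (\<Sum>p\<in>P. B p * q z p)\<^sup>2 \<partial>std_gauss m) \<le> 2 * dot P B B"
proof -
  have eq: "(\<Sum>p\<in>P. B p * q z p)\<^sup>2 = (\<Sum>p\<in>P. \<Sum>p'\<in>P. (B p * B p') * (q z p * q z p'))" for z
    unfolding power2_eq_square sum_product by (intro sum.cong refl) (simp only: mult_ac)
  have i: "integrable (std_gauss m) (\<lambda>z. (B p * B p') * (q z p * q z p'))" if "p \<in> P" "p' \<in> P" for p p'
    by (rule integrable_mult_right) (rule hermite_product(1)[OF that])
  have ii: "integrable (std_gauss m) (\<lambda>z. \<Sum>p'\<in>P. (B p * B p') * (q z p * q z p'))" if "p \<in> P" for p
    by (rule Bochner_Integration.integrable_sum) (rule i[OF that])
  show "integrable (std_gauss m) (\<lambda>z. (\<Sum>p\<in>P. B p * q z p)\<^sup>2)"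
    unfolding eq by (rule Bochner_Integration.integrable_sum) (rule ii)
  have fin: "finite P" by simp
  have "(\<integral>z. (\<Sum>p\<in>P. B p * q z p)\<^sup>2 \<partial>std_gauss m) =
      (\<Sum>p\<in>P. \<integral>z. (\<Sum>p'\<in>P. (B p * B p') * (q z p * q z p')) \<partial>std_gauss m)"
    unfolding eq by (rule Bochner_Integration.integral_sum) (rule ii)
  also have "\<dots> = (\<Sum>p\<in>P. \<Sum>p'\<in>P. \<integral>z. (B p * B p') * (q z p * q z p') \<partial>std_gauss m)"
    by (rule sum.cong[OF refl], rule Bochner_Integration.integral_sum) (rule i)
  also have "\<dots> = (\<Sum>p\<in>P. \<Sum>p'\<in>P. B p * B p' * (of_bool (p = p') + of_bool (prod.swap p = p')))"
    by (intro sum.cong refl) (simp only: integral_mult_right_zero hermite_product(2))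
  also have "\<dots> = (\<Sum>p\<in>P. B p * B p + B p * B (prod.swap p))"
  proof (rule sum.cong[OF refl])
    fix p assume p: "p \<in> P"
    then have s: "prod.swap p \<in> P" by auto
    show "(\<Sum>p'\<in>P. B p * B p' * (of_bool (p = p') + of_bool (prod.swap p = p'))) = B p * B p + B p * B (prod.swap p)"
      unfolding distrib_left sum.distrib by (simp only: sum_of_bool_eq[OF fin p] sum_of_bool_eq[OF fin s])
  qed
  also have "\<dots> \<le> (\<Sum>p\<in>P. B p * B p + (B p * B p + B (prod.swap p) * B (prod.swap p)) / 2)"
  proof (rule sum_mono)
    fix p
    have "0 \<le> (B p - B (prod.swap p))\<^sup>2" by simp
    then show "B p * B p + B p * B (prod.swap p) \<le> B p * B p + (B p * B p + B (prod.swap p) * B (prod.swap p)) / 2"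
      by (simp add: power2_eq_square algebra_simps)
  qed
  also have "\<dots> = (\<Sum>p\<in>P. B p * B p) + ((\<Sum>p\<in>P. B p * B p) + (\<Sum>p\<in>P. B (prod.swap p) * B (prod.swap p))) / 2"
    by (simp only: sum.distrib sum_divide_distrib[symmetric])
  also have "(\<Sum>p\<in>P. B (prod.swap p) * B (prod.swap p)) = (\<Sum>p\<in>P. B p * B p)"
    by (rule sum.reindex_bij_witness[of _ prod.swap prod.swap]) auto
  finally show "(\<integral>z. (\<Sum>p\<in>P. B p * q z p)\<^sup>2 \<partial>std_gauss m) \<le> 2 * dot P B B" by (simp add: dot_def)
qed

lemma linear_second_moment:
  "integrable (std_gauss m) (\<lambda>z. (\<Sum>l<r. c l * g l z)\<^sup>2)"
  "(\<integral>z. (\<Sum>l<r. c l * g l z)\<^sup>2 \<partial>std_gauss m) = (\<Sum>l<r. c l * c l)"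
proof -
  have eq: "(\<Sum>l<r. c l * g l z) = lin m (\<lambda>j. \<Sum>l<r. c l * e l j) z" for z
    unfolding lin_def sum_distrib_left sum_distrib_right by (subst sum.swap) (simp only: mult_ac)
  show "integrable (std_gauss m) (\<lambda>z. (\<Sum>l<r. c l * g l z)\<^sup>2)" unfolding eq by (rule lin_moment_integrable)
  have "dot {..<m} (\<lambda>j. \<Sum>l<r. c l * e l j) (\<lambda>j. \<Sum>l<r. c l * e l j)
      = (\<Sum>l<r. c l * dot {..<m} (\<lambda>j. \<Sum>l<r. c l * e l j) (e l))" by (rule dot_sum_right)
  also have "\<dots> = (\<Sum>l<r. c l * c l)"
  proof (rule sum.cong[OF refl])
    fix l assume l: "l \<in> {..<r}"
    have "dot {..<m} (\<lambda>j. \<Sum>l<r. c l * e l j) (e l) = (\<Sum>l'<r. c l' * dot {..<m} (e l) (e l'))"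
      by (subst dot_commute) (rule dot_sum_right)
    also have "\<dots> = (\<Sum>l'<r. c l' * of_bool (l = l'))" using l by (intro sum.cong refl) (simp only: orth lessThan_iff)
    also have "\<dots> = c l" by (rule sum_of_bool_eq) (use l in auto)
    finally show "c l * dot {..<m} (\<lambda>j. \<Sum>l<r. c l * e l j) (e l) = c l * c l" by simp
  qed
  finally show "(\<integral>z. (\<Sum>l<r. c l * g l z)\<^sup>2 \<partial>std_gauss m) = (\<Sum>l<r. c l * c l)" unfolding eq lin_moments .
qed

text \<open>The constant feature makes the entry (0, 0) vanish and turns row and column 0 into a
  linear part. Separating linear and quadratic parts costs a factor 2, and each part has another
  factor 2.\<close>

lemma affine_features_second:
  fixes A :: "nat \<times> nat \<Rightarrow> real"
  shows "(\<integral>\<^sup>+ z. ennreal ((dot ({..<Suc r} \<times> {..<Suc r}) A (quad (affine_features m e z)))\<^sup>2) \<partial>std_gauss m)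
    \<le> ennreal (4 * dot ({..<Suc r} \<times> {..<Suc r}) A A)"
proof -
  define c where "c l = A (0, Suc l) + A (Suc l, 0)" for l
  define B where "B p = A (Suc (fst p), Suc (snd p))" for p
  have split: "dot ({..<Suc r} \<times> {..<Suc r}) A v = A (0, 0) * v (0, 0) + (\<Sum>l<r. A (0, Suc l) * v (0, Suc l))
      + ((\<Sum>l<r. A (Suc l, 0) * v (Suc l, 0)) + (\<Sum>p\<in>P. B p * v (Suc (fst p), Suc (snd p))))" for v
  proof -
    have "(\<Sum>p\<in>P. B p * v (Suc (fst p), Suc (snd p))) = (\<Sum>l<r. \<Sum>l'<r. A (Suc l, Suc l') * v (Suc l, Suc l'))"
      unfolding sum.cartesian_product B_def by (rule sum.cong) auto
    then show ?thesis unfolding dot_prod sum.lessThan_Suc_shift sum.distrib by simp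
  qed
  have dec: "dot ({..<Suc r} \<times> {..<Suc r}) A (quad (affine_features m e z)) = (\<Sum>l<r. c l * g l z) + (\<Sum>p\<in>P. B p * q z p)" for z
    unfolding split by (simp add: quad_def c_def distrib_right sum.distrib)
  have "(\<integral>\<^sup>+ z. ennreal ((dot ({..<Suc r} \<times> {..<Suc r}) A (quad (affine_features m e z)))\<^sup>2) \<partial>std_gauss m) \<le>
      (\<integral>\<^sup>+ z. ennreal (2 * (\<Sum>l<r. c l * g l z)\<^sup>2 + 2 * (\<Sum>p\<in>P. B p * q z p)\<^sup>2) \<partial>std_gauss m)"
    unfolding dec by (intro nn_integral_mono ennreal_leI square_add_le)
  also have "\<dots> = ennreal (\<integral>z. 2 * (\<Sum>l<r. c l * g l z)\<^sup>2 + 2 * (\<Sum>p\<in>P. B p * q z p)\<^sup>2 \<partial>std_gauss m)"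
    by (intro nn_integral_eq_integral Bochner_Integration.integrable_add integrable_mult_right
        hermite_second_moment(1) linear_second_moment(1)) simp
  also have "(\<integral>z. 2 * (\<Sum>l<r. c l * g l z)\<^sup>2 + 2 * (\<Sum>p\<in>P. B p * q z p)\<^sup>2 \<partial>std_gauss m) =
      2 * (\<Sum>l<r. c l * c l) + 2 * (\<integral>z. (\<Sum>p\<in>P. B p * q z p)\<^sup>2 \<partial>std_gauss m)"
    by (simp only: Bochner_Integration.integral_add integrable_mult_right hermite_second_moment(1)
        linear_second_moment integral_mult_right_zero)
  also have "ennreal \<dots> \<le> ennreal (4 * dot ({..<Suc r} \<times> {..<Suc r}) A A)"
  proof (rule ennreal_leI)
    have "(\<Sum>l<r. c l * c l) \<le> (\<Sum>l<r. 2 * (A (0, Suc l) * A (0, Suc l)) + 2 * (A (Suc l, 0) * A (Suc l, 0)))"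
      unfolding c_def by (intro sum_mono) (use square_add_le in \<open>simp add: power2_eq_square\<close>)
    also have "\<dots> = 2 * (\<Sum>l<r. A (0, Suc l) * A (0, Suc l)) + 2 * (\<Sum>l<r. A (Suc l, 0) * A (Suc l, 0))"
      by (simp only: sum.distrib sum_distrib_left)
    finally have 1: "(\<Sum>l<r. c l * c l) \<le> \<dots>" .
    have 2: "dot ({..<Suc r} \<times> {..<Suc r}) A A = A (0, 0) * A (0, 0) + (\<Sum>l<r. A (0, Suc l) * A (0, Suc l))
      + ((\<Sum>l<r. A (Suc l, 0) * A (Suc l, 0)) + dot P B B)"
      by (subst split) (simp only: dot_def B_def)
    have "0 \<le> A (0, 0) * A (0, 0)" by simp
    then show "2 * (\<Sum>l<r. c l * c l) + 2 * (\<integral>z. (\<Sum>p\<in>P. B p * q z p)\<^sup>2 \<partial>std_gauss m) \<le> 4 * dot ({..<Suc r} \<times> {..<Suc r}) A A"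
      using 1 2 hermite_second_moment(2)[of B] by linarith
  qed
  finally show ?thesis .
qed

lemma affine_features_mean:
  assumes "p \<in> {..<Suc r} \<times> {..<Suc r}"
  shows "(\<integral>z. quad (affine_features m e z) p \<partial>std_gauss m) = 0"
proof -
  interpret Z: prob_space "std_gauss m" by (rule prob_std_gauss)
  obtain a b where p: "p = (a, b)" by (cases p)
  show ?thesis
  proof (cases a; cases b)
    fix l l' assume s: "a = Suc l" "b = Suc l'"
    then have lt: "l < r" "l' < r" using assms p by auto
    have "(\<integral>z. g l z * g l' z - of_bool (l = l') \<partial>std_gauss m) = (\<integral>z. g l z * g l' z \<partial>std_gauss m) - of_bool (l = l')"
      by (simp add: Bochner_Integration.integral_diff lin_product(1) Z.prob_space)
    then show ?thesis using s lt by (simp add: p quad_def lin_product orth)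
  qed (use assms in \<open>auto simp: p quad_def lin_moments\<close>)
qed

lemma affine_features_tail:
  assumes "a < Suc r" "0 \<le> t"
  shows "measure (std_gauss m) {z \<in> space (std_gauss m). t < (affine_features m e z a)\<^sup>2} \<le> 2 * exp (- t / 4)"
proof (cases a)
  case 0
  interpret Z: prob_space "std_gauss m" by (rule prob_std_gauss)
  show ?thesis
  proof (cases "t < 1")
    case True
    \<comment> \<open>For t < 1 the constant feature exceeds t surely, and 2 exp (- t / 4) is then
      still at least 1.\<close>
    have "1 + (- t / 4) \<le> exp (- t / 4)" by (rule exp_ge_add_one_self)
    then show ?thesis using True 0 Z.prob_space by simp
  qed (use 0 in simp)
next
  case (Suc l)
  then show ?thesis using lin_tail[OF _ assms(2), of m "e l"] orth[of l l] assms(1) by simp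
qed

end

text \<open>The samples are the data x and not the hidden normals z, so y has to be a function of x;
  all properties are transported along the map \<phi> from z to x.\<close>

lemma isotropic_affine_features:
  assumes orth: "\<And>l l'. l < r \<Longrightarrow> l' < r \<Longrightarrow> dot {..<m} (e l) (e l') = of_bool (l = l')"
    and \<phi>: "\<phi> \<in> measurable (std_gauss m) N"
    and y: "\<And>a. a < Suc r \<Longrightarrow> (\<lambda>x. y x a) \<in> borel_measurable N"
    and y\<phi>: "\<And>z a. a < Suc r \<Longrightarrow> y (\<phi> z) a = affine_features m e z a"
    and good: "\<And>z. good (\<phi> z)" and good_meas: "{x \<in> space N. good x} \<in> sets N"
  shows "isotropic_sample (distr (std_gauss m) N \<phi>) (Suc r) y good"
proof -
  let ?G = "distr (std_gauss m) N \<phi>" and ?K = "{..<Suc r} \<times> {..<Suc r}"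
  interpret Z: prob_space "std_gauss m" by (rule prob_std_gauss)
  interpret G: prob_space ?G by (rule Z.prob_space_distr[OF \<phi>])
  have q: "quad (y (\<phi> z)) p = quad (affine_features m e z) p" if "p \<in> ?K" for z p
    using that y\<phi> by (auto simp: quad_def)
  have qm: "(\<lambda>x. quad (y x) p) \<in> borel_measurable N" if "p \<in> ?K" for p
    using that y by (cases p) (auto simp: quad_def)
  have dq: "dot ?K A (quad (y (\<phi> z))) = dot ?K A (quad (affine_features m e z))" for A z
    unfolding dot_def by (intro sum.cong refl arg_cong2[where f = "(*)"] q)
  have dm: "(\<lambda>x. ennreal ((dot ?K A (quad (y x)))\<^sup>2)) \<in> borel_measurable ?G" for A
    unfolding dot_def measurable_distr_eq1 using qm by (intro measurable_compose[OF _ measurable_ennreal] borel_measurable_power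
      borel_measurable_sum borel_measurable_times) auto
  show ?thesis
  proof
    show "0 < Suc r" by simp
    show "(\<lambda>x. y x a) \<in> borel_measurable ?G" if "a < Suc r" for a using y[OF that] by simp
    show "(\<integral>\<^sup>+ x. ennreal ((dot ?K A (quad (y x)))\<^sup>2) \<partial>?G) \<le> ennreal (4 * dot ?K A A)" for A
      unfolding nn_integral_distr[OF \<phi> dm] dq by (rule affine_features_second[OF orth])
    show "(\<integral>x. quad (y x) p \<partial>?G) = 0" if p: "p \<in> ?K" for p
      unfolding integral_distr[OF \<phi> qm[OF p]] q[OF p] by (rule affine_features_mean[OF orth p])
    show "measure ?G {x \<in> space ?G. t < (y x a)\<^sup>2} \<le> 2 * exp (- t / 4)" if a: "a < Suc r" and t: "0 \<le> t" for a t
    proof -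
      have "{x \<in> space N. t < (y x a)\<^sup>2} \<in> sets N" using y[OF a] by measurable
      then have "measure ?G {x \<in> space ?G. t < (y x a)\<^sup>2} =
          measure (std_gauss m) (\<phi> -` {x \<in> space N. t < (y x a)\<^sup>2} \<inter> space (std_gauss m))"
        using measure_distr[OF \<phi>] by simp
      also have "\<phi> -` {x \<in> space N. t < (y x a)\<^sup>2} \<inter> space (std_gauss m) =
          {z \<in> space (std_gauss m). t < (affine_features m e z a)\<^sup>2}"
        using measurable_space[OF \<phi>] y\<phi>[OF a] by auto
      finally show ?thesis using affine_features_tail[OF orth a t] by simp
    qed
    show "AE x in ?G. good x" using AE_distr_iff[OF \<phi> good_meas] good by simp
    show "{x \<in> space ?G. good x} \<in> sets ?G" using good_meas by simp
  qed
qed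

lemma mult_mat_vec_sum:
  assumes "A \<in> carrier_mat d m" "v \<in> carrier_vec m" "i < d"
  shows "(A *\<^sub>v v) $ i = (\<Sum>j<m. A $$ (i, j) * v $ j)"
  using assms by (simp add: scalar_prod_def lessThan_atLeast0)

lemma gram_entry:
  assumes "A \<in> carrier_mat d m" "i < d" "i' < d"
  shows "(A * transpose_mat A) $$ (i, i') = (\<Sum>j<m. A $$ (i, j) * A $$ (i', j))"
  using assms by (simp add: scalar_prod_def lessThan_atLeast0)

text \<open>The features are recovered from the data by y_0 = 1 and y_l = <Q_l, x - \<mu>>. The
  columns of M are \<mu> and those of L, and K \<le> k + 1 because T exhibits r independent columns
  of \<Sigma>.\<close>

theorem gaussian_law_isotropic:
  assumes law: "gaussian_law d \<mu> \<Sigma> G" and \<mu>: "\<mu> \<in> carrier_vec d" and rk: "vec_space.rank d \<Sigma> = k"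
  obtains K y M where "isotropic_sample G K y (\<lambda>x. \<forall>i<d. x i = (\<Sum>a<K. M i a * y x a))" "K \<le> k + 1"
    "col_space d \<Sigma> \<union> {\<mu>} \<subseteq> carrier_vec d"
    "\<And>a. a < K \<Longrightarrow> vec d (\<lambda>c. M c a) \<in> span d (col_space d \<Sigma> \<union> {\<mu>})"
    "\<And>w. w \<in> col_space d \<Sigma> \<union> {\<mu>} \<Longrightarrow> \<exists>t. w = vec d (\<lambda>c. \<Sum>a<K. M c a * t a)"
proof -
  from law obtain m A where A: "A \<in> carrier_mat d m" and S: "A * transpose_mat A = \<Sigma>"
    and G: "G = distr (std_gauss m) (Pi\<^sub>M {..<d} (\<lambda>_. borel)) (\<lambda>z. \<lambda>i\<in>{..<d}. \<mu> $ i + (\<Sum>j<m. A $$ (i, j) * z j))"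
    unfolding gaussian_law_def by blast
  obtain r e L Q T where T: "T \<subseteq> {..<d}" "card T = r"
    and orth: "\<forall>l<r. \<forall>l'<r. (\<Sum>j<m. e l j * e l' j) = of_bool (l = l')"
    and aL: "\<forall>i<d. \<forall>j<m. A $$ (i, j) = (\<Sum>l<r. L i l * e l j)"
    and eQ: "\<forall>l<r. \<forall>j<m. e l j = (\<Sum>i<d. Q l i * A $$ (i, j))"
    and ind: "\<forall>t. (\<forall>j<m. (\<Sum>b\<in>T. t b * A $$ (b, j)) = 0) \<longrightarrow> (\<forall>b\<in>T. t b = 0)"
    using orthonormal_factorization[of d m "\<lambda>i j. A $$ (i, j)"] by blast
  let ?N = "Pi\<^sub>M {..<d} (\<lambda>_. borel :: real measure)"
  let ?\<phi> = "\<lambda>z. \<lambda>i\<in>{..<d}. \<mu> $ i + (\<Sum>j<m. A $$ (i, j) * z j)"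
  define y where "y x a = (case a of 0 \<Rightarrow> 1 | Suc l \<Rightarrow> \<Sum>i<d. Q l i * (x i - \<mu> $ i))" for x :: "nat \<Rightarrow> real" and a
  define M where "M i a = (case a of 0 \<Rightarrow> \<mu> $ i | Suc l \<Rightarrow> L i l)" for i a
  define W where "W = col_space d \<Sigma> \<union> {\<mu>}"
  have Sc: "\<Sigma> \<in> carrier_mat d d" using S A by auto
  have cs: "col_space d \<Sigma> = {v \<in> carrier_vec d. \<exists>x\<in>carrier_vec d. \<Sigma> *\<^sub>v x = v}"
    using vec_space.col_space_eq[OF Sc] Sc by simp
  have W: "W \<subseteq> carrier_vec d" unfolding W_def cs using \<mu> by auto
  have \<phi>m: "?\<phi> \<in> measurable (std_gauss m) ?N"
  proof (rule measurable_restrict)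
    fix i assume "i \<in> {..<d}"
    show "(\<lambda>z. \<mu> $ i + (\<Sum>j<m. A $$ (i, j) * z j)) \<in> borel_measurable (std_gauss m)"
      using lin_meas[of m "\<lambda>j. A $$ (i, j)"] unfolding lin_def[abs_def] by (intro borel_measurable_add) auto
  qed
  have ym: "(\<lambda>x. y x a) \<in> borel_measurable ?N" for a
    unfolding y_def by (cases a) (auto intro!: borel_measurable_sum borel_measurable_times borel_measurable_diff measurable_component_singleton)
  have y\<phi>: "y (?\<phi> z) a = affine_features m e z a" if a: "a < Suc r" for z a
  proof (cases a)
    case (Suc l)
    then have l: "l < r" using a by simp
    have "(\<Sum>i<d. Q l i * (?\<phi> z i - \<mu> $ i)) = (\<Sum>i<d. \<Sum>j<m. Q l i * A $$ (i, j) * z j)"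
      by (intro sum.cong refl) (simp add: sum_distrib_left mult.assoc)
    also have "\<dots> = (\<Sum>j<m. \<Sum>i<d. Q l i * A $$ (i, j) * z j)" by (rule sum.swap)
    also have "\<dots> = (\<Sum>j<m. e l j * z j)"
      using eQ l by (intro sum.cong refl) (simp add: sum_distrib_right)
    finally show ?thesis using Suc by (simp add: y_def lin_def)
  qed (simp add: y_def)
  have good: "\<forall>i<d. ?\<phi> z i = (\<Sum>a<Suc r. M i a * y (?\<phi> z) a)" for z
  proof (intro allI impI)
    fix i assume i: "i < d"
    have "(\<Sum>j<m. A $$ (i, j) * z j) = (\<Sum>j<m. \<Sum>l<r. L i l * (e l j * z j))"
      using aL i by (intro sum.cong refl) (simp add: sum_distrib_right mult.assoc)
    also have "\<dots> = (\<Sum>l<r. \<Sum>j<m. L i l * (e l j * z j))" by (rule sum.swap)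
    also have "\<dots> = (\<Sum>l<r. L i l * lin m (e l) z)" by (simp only: lin_def sum_distrib_left)
    also have "\<dots> = (\<Sum>l<r. M i (Suc l) * y (?\<phi> z) (Suc l))"
      by (intro sum.cong refl) (simp only: y\<phi> lessThan_iff Suc_less_eq affine_features_simps, simp add: M_def)
    finally have 1: "(\<Sum>j<m. A $$ (i, j) * z j) = \<dots>" .
    have "(\<Sum>a<Suc r. M i a * y (?\<phi> z) a) = M i 0 * y (?\<phi> z) 0 + (\<Sum>l<r. M i (Suc l) * y (?\<phi> z) (Suc l))"
      by (rule sum.lessThan_Suc_shift)
    also have "\<dots> = \<mu> $ i + (\<Sum>j<m. A $$ (i, j) * z j)" unfolding 1 by (simp add: M_def y_def)
    finally show "?\<phi> z i = (\<Sum>a<Suc r. M i a * y (?\<phi> z) a)" using i by simp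
  qed
  have good_meas: "{x \<in> space ?N. \<forall>i<d. x i = (\<Sum>a<Suc r. M i a * y x a)} \<in> sets ?N"
  proof -
    have "{x \<in> space ?N. \<forall>i\<in>{..<d}. x i = (\<Sum>a<Suc r. M i a * y x a)} \<in> sets ?N"
    proof (rule sets.sets_Collect_finite_All)
      fix i assume i: "i \<in> {..<d}"
      have "(\<lambda>x. x i) \<in> borel_measurable ?N" using i by (rule measurable_component_singleton)
      moreover have "(\<lambda>x. \<Sum>a<Suc r. M i a * y x a) \<in> borel_measurable ?N"
        using ym by (intro borel_measurable_sum borel_measurable_times) auto
      ultimately show "{x \<in> space ?N. x i = (\<Sum>a<Suc r. M i a * y x a)} \<in> sets ?N" by (rule borel_measurable_eq)
    qed auto
    then show ?thesis by (simp only: Ball_def lessThan_iff)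
  qed
  have iso: "isotropic_sample G (Suc r) y (\<lambda>x. \<forall>i<d. x i = (\<Sum>a<Suc r. M i a * y x a))"
    unfolding G
  proof (rule isotropic_affine_features[where e = e])
    show "dot {..<m} (e l) (e l') = of_bool (l = l')" if "l < r" "l' < r" for l l'
      unfolding dot_def using orth that by (simp only:)
  qed (rule \<phi>m ym y\<phi> good good_meas | assumption)+
  have "card T \<le> vec_space.rank d (A * transpose_mat A)" by (rule rank_ge_gram[OF A T(1) ind[THEN spec, THEN mp]])
  then have K: "Suc r \<le> k + 1" unfolding S rk T(2) by simp
  \<comment> \<open>L = A e^T and e = Q A give L = \<Sigma> Q^T, so the columns of L lie in the
    column space of \<Sigma>.\<close>
  have Lcol: "L i l = (\<Sum>i'<d. \<Sigma> $$ (i, i') * Q l i')" if i: "i < d" and l: "l < r" for i l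
  proof -
    have "(\<Sum>j<m. A $$ (i, j) * e l j) = (\<Sum>j<m. \<Sum>l'<r. L i l' * (e l j * e l' j))"
      using aL i by (intro sum.cong refl) (simp add: sum_distrib_left sum_distrib_right mult_ac)
    also have "\<dots> = (\<Sum>l'<r. \<Sum>j<m. L i l' * (e l j * e l' j))" by (rule sum.swap)
    also have "\<dots> = (\<Sum>l'<r. L i l' * of_bool (l = l'))"
      using orth l by (intro sum.cong refl) (simp add: sum_distrib_left[symmetric])
    also have "\<dots> = L i l" by (rule sum_of_bool_eq) (use l in auto)
    finally have "L i l = (\<Sum>j<m. A $$ (i, j) * e l j)" by simp
    also have "\<dots> = (\<Sum>j<m. \<Sum>i'<d. A $$ (i, j) * A $$ (i', j) * Q l i')"
      using eQ l by (intro sum.cong refl) (simp add: sum_distrib_left mult_ac)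
    also have "\<dots> = (\<Sum>i'<d. \<Sum>j<m. A $$ (i, j) * A $$ (i', j) * Q l i')" by (rule sum.swap)
    also have "\<dots> = (\<Sum>i'<d. \<Sigma> $$ (i, i') * Q l i')"
      unfolding S[symmetric] using i A by (intro sum.cong refl) (simp only: gram_entry lessThan_iff sum_distrib_right)
    finally show ?thesis .
  qed
  interpret V: vec_space "TYPE(real)" d .
  have sub: "W \<subseteq> span d W" using V.in_own_span[of W] W by simp
  have cols: "vec d (\<lambda>c. M c a) \<in> span d W" if a: "a < Suc r" for a
  proof -
    have "vec d (\<lambda>c. M c a) \<in> W"
    proof (cases a)
      case 0
      then have "vec d (\<lambda>c. M c a) = \<mu>" using \<mu> by (auto simp: M_def)
      then show ?thesis by (simp add: W_def)
    next
      case (Suc l)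
      then have l: "l < r" using a by simp
      have "\<Sigma> *\<^sub>v vec d (Q l) = vec d (\<lambda>c. M c a)"
        using Sc Lcol l Suc by (intro eq_vecI) (auto simp: mult_mat_vec_sum[OF Sc] M_def simp del: index_mult_mat_vec)
      then show ?thesis unfolding W_def cs by force
    qed
    then show ?thesis using sub by blast
  qed
  have rng: "\<exists>t. w = vec d (\<lambda>c. \<Sum>a<Suc r. M c a * t a)" if w: "w \<in> W" for w
  proof -
    consider "w = \<mu>" | x where "x \<in> carrier_vec d" "w = \<Sigma> *\<^sub>v x" using w unfolding W_def cs by auto
    then show ?thesis
    proof cases
      case 1
      have "w = vec d (\<lambda>c. \<Sum>a<Suc r. M c a * of_bool (0 = a))"
        unfolding 1 using \<mu> by (intro eq_vecI) (auto simp: sum_of_bool_eq M_def simp del: sum.lessThan_Suc)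
      then show ?thesis by (rule exI[of _ "\<lambda>a. of_bool (0 = a)"])
    next
      case 2
      \<comment> \<open>\<Sigma> x = A (A^T x), and A = L e turns this into L applied to e (A^T
        x).\<close>
      let ?u = "\<lambda>j. \<Sum>i'<d. A $$ (i', j) * x $ i'"
      let ?t = "\<lambda>a. case a of 0 \<Rightarrow> 0 | Suc l \<Rightarrow> \<Sum>j<m. e l j * ?u j"
      have "w $ i = (\<Sum>a<Suc r. M i a * ?t a)" if i: "i < d" for i
      proof -
        have "w $ i = (\<Sum>i'<d. \<Sigma> $$ (i, i') * x $ i')" unfolding 2 by (rule mult_mat_vec_sum[OF Sc 2(1) i])
        also have "\<dots> = (\<Sum>i'<d. \<Sum>j<m. A $$ (i, j) * (A $$ (i', j) * x $ i'))"
          unfolding S[symmetric] using i A by (intro sum.cong refl) (simp only: gram_entry lessThan_iff sum_distrib_right mult.assoc)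
        also have "\<dots> = (\<Sum>j<m. \<Sum>i'<d. A $$ (i, j) * (A $$ (i', j) * x $ i'))" by (rule sum.swap)
        also have "\<dots> = (\<Sum>j<m. A $$ (i, j) * ?u j)" by (simp only: sum_distrib_left)
        also have "\<dots> = (\<Sum>j<m. \<Sum>l<r. L i l * (e l j * ?u j))"
          using aL i by (intro sum.cong refl) (simp only: lessThan_iff sum_distrib_right mult.assoc)
        also have "\<dots> = (\<Sum>l<r. \<Sum>j<m. L i l * (e l j * ?u j))" by (rule sum.swap)
        also have "\<dots> = (\<Sum>l<r. L i l * (\<Sum>j<m. e l j * ?u j))" by (simp only: sum_distrib_left)
        also have "\<dots> = (\<Sum>a<Suc r. M i a * ?t a)" unfolding sum.lessThan_Suc_shift by (simp add: M_def)
        finally show ?thesis .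
      qed
      moreover have "dim_vec w = d" using 2 Sc by simp
      ultimately have "w = vec d (\<lambda>c. \<Sum>a<Suc r. M c a * ?t a)" by (intro eq_vecI) (simp_all del: sum.lessThan_Suc)
      then show ?thesis by (rule exI[of _ ?t])
    qed
  qed
  show ?thesis by (rule that[OF iso K W[unfolded W_def] cols[unfolded W_def] rng[unfolded W_def]])
qed

section \<open>Corruption sets\<close>

lemma finite_subsets_of_size: "finite (subsets_of_size d s)"
  by (rule finite_subset[of _ "Pow {..<d}"]) (auto simp: subsets_of_size_def)

lemma card_subsets_of_size: "card (subsets_of_size d s) = d choose s"
  unfolding subsets_of_size_def using n_subsets[of "{..<d}" s] by simp

lemma prob_subsets_of_size:
  assumes "s \<le> d"
  shows "prob_space (uniform_count_measure (subsets_of_size d s))"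
proof (rule prob_space_uniform_count_measure[OF finite_subsets_of_size])
  have "0 < card (subsets_of_size d s)" using assms by (simp add: card_subsets_of_size)
  then show "subsets_of_size d s \<noteq> {}" by auto
qed

text \<open>Removing b matches these sets with the (s - 1)-subsets of the other coordinates; the
  rest is the absorption identity for binomial coefficients.\<close>

lemma card_subsets_containing:
  assumes b: "b < d"
  shows "real d * real (card {S \<in> subsets_of_size d s. b \<in> S}) = real s * real (d choose s)"
proof (cases s)
  case 0
  have e: "{S \<in> subsets_of_size d s. b \<in> S} = {}"
    using 0 by (auto simp: subsets_of_size_def dest!: finite_subset[OF _ finite_lessThan])
  show ?thesis unfolding e using 0 by simp
next
  case (Suc s')
  have "bij_betw (insert b) {S. S \<subseteq> {..<d} - {b} \<and> card S = s'} {S \<in> subsets_of_size d s. b \<in> S}"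
  proof (rule bij_betw_byWitness[where f' = "\<lambda>S. S - {b}"])
    show "insert b ` {S. S \<subseteq> {..<d} - {b} \<and> card S = s'} \<subseteq> {S \<in> subsets_of_size d s. b \<in> S}"
    proof safe
      fix S assume S: "S \<subseteq> {..<d} - {b}" "s' = card S"
      then have "finite S" "b \<notin> S" by (auto intro: finite_subset)
      then show "insert b S \<in> subsets_of_size d s" using S b Suc by (auto simp: subsets_of_size_def)
    qed
    show "(\<lambda>S. S - {b}) ` {S \<in> subsets_of_size d s. b \<in> S} \<subseteq> {S. S \<subseteq> {..<d} - {b} \<and> card S = s'}"
      using Suc by (auto simp: subsets_of_size_def card_Diff_singleton)
  qed auto
  then have "card {S \<in> subsets_of_size d s. b \<in> S} = card {S. S \<subseteq> {..<d} - {b} \<and> card S = s'}"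
    by (rule bij_betw_same_card[symmetric])
  also have "\<dots> = (d - 1) choose s'" using n_subsets[of "{..<d} - {b}" s'] b by (simp add: card_Diff_singleton)
  finally have "d * card {S \<in> subsets_of_size d s. b \<in> S} = s * (d choose s)"
    using binomial_absorption[of s' d] Suc by simp
  then show ?thesis by (simp only: of_nat_mult[symmetric])
qed

text \<open>At parameter 1/2 an indicator b satisfies exp (b / 2) \<le> 1 + b, since sqrt e \<le> 2;
  averaging gives 1 + s / d \<le> exp (s / d).\<close>

lemma corruption_mgf:
  assumes s: "s \<le> d" and b: "b < d"
  shows "(\<integral>\<^sup>+ S. ennreal (exp (of_bool (b \<in> S) / 2)) \<partial>uniform_count_measure (subsets_of_size d s))
    \<le> ennreal (exp (real s / real d))"
proof -
  let ?A = "subsets_of_size d s" and ?p = "real s / real d"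
  have c: "0 < real (d choose s)" using s by simp
  have ce: "real (card ?A) = real (d choose s)" by (simp add: card_subsets_of_size)
  have mem: "(\<Sum>S\<in>?A. of_bool (b \<in> S)) = ?p * real (d choose s)"
  proof -
    have "(\<Sum>S\<in>?A. of_bool (b \<in> S)) = real (card {S \<in> ?A. b \<in> S})"
      using finite_subsets_of_size[of d s] by (simp add: of_bool_def sum.If_cases Int_def)
    then show ?thesis using card_subsets_containing[OF b, of s] b by (simp add: field_simps)
  qed
  have "(\<integral>\<^sup>+ S. ennreal (exp (of_bool (b \<in> S) / 2)) \<partial>uniform_count_measure ?A)
      = ennreal (\<Sum>S\<in>?A. exp (of_bool (b \<in> S) / 2) / real (d choose s))"
    unfolding uniform_count_measure_def
    by (subst nn_integral_point_measure_finite[OF finite_subsets_of_size])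
       (simp add: ce ennreal_mult[symmetric])
  also have "\<dots> \<le> ennreal (exp ?p)"
  proof (rule ennreal_leI)
    have "exp (1 / 2 :: real) \<le> 2" using exp_bound_half[of "1 / 2 :: real"] by simp
    then have "exp (of_bool (b \<in> S) / 2) \<le> 1 + (of_bool (b \<in> S) :: real)" for S :: "nat set" by simp
    then have "(\<Sum>S\<in>?A. exp (of_bool (b \<in> S) / 2) / real (d choose s)) \<le> (\<Sum>S\<in>?A. (1 + of_bool (b \<in> S)) / real (d choose s))"
      by (intro sum_mono divide_right_mono) auto
    also have "\<dots> = (real (d choose s) + ?p * real (d choose s)) / real (d choose s)"
      unfolding sum_divide_distrib[symmetric] sum.distrib mem by (simp add: ce)
    also have "\<dots> = 1 + ?p" using c by (simp add: field_simps)
    also have "\<dots> \<le> exp ?p" by (rule exp_ge_add_one_self)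
    finally show "(\<Sum>S\<in>?A. exp (of_bool (b \<in> S) / 2) / real (d choose s)) \<le> exp ?p" .
  qed
  finally show ?thesis .
qed

abbreviation corruption_law :: "nat \<Rightarrow> nat \<Rightarrow> nat \<Rightarrow> (nat \<Rightarrow> nat set) measure" where
  "corruption_law n d s \<equiv> Pi\<^sub>M {..<n} (\<lambda>_. uniform_count_measure (subsets_of_size d s))"

lemma corruption_count_tail:
  assumes s: "s \<le> d" and b: "b < d"
  shows "{S \<in> space (corruption_law n d s). t < real (card {i. i < n \<and> b \<in> S i})} \<in> sets (corruption_law n d s)"
    "measure (corruption_law n d s) {S \<in> space (corruption_law n d s). t < real (card {i. i < n \<and> b \<in> S i})}
      \<le> exp (real n * (real s / real d) - t / 2)"
proof -
  let ?U = "uniform_count_measure (subsets_of_size d s)" and ?Q = "corruption_law n d s"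
  let ?u = "\<lambda>S. \<Prod>i<n. exp (of_bool (b \<in> S i) / 2 :: real)"
  interpret U: prob_space ?U by (rule prob_subsets_of_size[OF s])
  interpret Q: prob_space ?Q by (rule prob_space_PiM) (rule U.prob_space_axioms)
  interpret P: product_sigma_finite "\<lambda>_ :: nat. ?U" by unfold_locales
  have f: "(\<lambda>S. exp (of_bool (b \<in> S) / 2 :: real)) \<in> borel_measurable ?U"
    by (simp add: measurable_def space_uniform_count_measure sets_uniform_count_measure)
  have fi: "(\<lambda>S. exp (of_bool (b \<in> S i) / 2 :: real)) \<in> borel_measurable ?Q" if "i \<in> {..<n}" for i
    using measurable_compose[OF measurable_component_singleton[OF that] f] .
  have um: "?u \<in> borel_measurable ?Q" by (rule borel_measurable_prod) (rule fi)
  have u: "?u S = exp (real (card {i. i < n \<and> b \<in> S i}) / 2)" for S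
  proof -
    have "(\<Sum>i<n. of_bool (b \<in> S i) / 2) = (real (card {i. i < n \<and> b \<in> S i}) / 2 :: real)"
      by (simp add: sum_divide_distrib[symmetric] of_bool_def sum.If_cases Int_def)
    then show ?thesis by (simp add: exp_sum[symmetric])
  qed
  have eq: "{S \<in> space ?Q. t < real (card {i. i < n \<and> b \<in> S i})} = {S \<in> space ?Q. exp (t / 2) < ?u S}"
    unfolding u by simp
  show "{S \<in> space ?Q. t < real (card {i. i < n \<and> b \<in> S i})} \<in> sets ?Q"
    unfolding eq using um by measurable
  have "(\<integral>\<^sup>+ S. ennreal (?u S) \<partial>?Q) = (\<integral>\<^sup>+ S. (\<Prod>i<n. ennreal (exp (of_bool (b \<in> S i) / 2))) \<partial>?Q)"
    by (intro nn_integral_cong) (simp add: prod_ennreal)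
  also have "\<dots> = (\<Prod>i<n. \<integral>\<^sup>+ S. ennreal (exp (of_bool (b \<in> S) / 2)) \<partial>?U)"
    by (rule P.product_nn_integral_prod) (use f in auto)
  also have "\<dots> \<le> (\<Prod>i<n. ennreal (exp (real s / real d)))"
    unfolding prod_constant by (intro power_mono corruption_mgf s b) simp
  also have "\<dots> = ennreal (exp (real n * (real s / real d)))"
    by (simp add: ennreal_power exp_of_nat_mult[symmetric])
  finally have e: "(\<integral>\<^sup>+ S. ennreal (?u S) \<partial>?Q) \<le> ennreal (exp (real n * (real s / real d)))" .
  have "measure ?Q {S \<in> space ?Q. exp (t / 2) < ?u S} \<le> exp (real n * (real s / real d)) / exp (t / 2)"
    by (rule markov_real[OF Q.prob_space_axioms um _ e]) (auto intro: prod_nonneg)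
  then show "measure ?Q {S \<in> space ?Q. t < real (card {i. i < n \<and> b \<in> S i})} \<le> exp (real n * (real s / real d) - t / 2)"
    unfolding eq by (simp add: exp_diff)
qed

text \<open>Within one sample the corrupted coordinates are dependent, but each coordinate is
  treated alone: its corruptions in different samples are independent, and a union bound over the d
  coordinates suffices.\<close>

lemma few_corruptions_event:
  assumes s: "s \<le> d"
  obtains E where "E \<in> sets (corruption_law n d s)"
    "1 - real d * exp (real n * (real s / real d) - t / 2) \<le> measure (corruption_law n d s) E"
    "\<And>S b. S \<in> E \<Longrightarrow> b < d \<Longrightarrow> real (card {i. i < n \<and> b \<in> S i}) \<le> t"
proof -
  let ?Q = "corruption_law n d s"
  let ?B = "\<lambda>b. {S \<in> space ?Q. t < real (card {i. i < n \<and> b \<in> S i})}"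
  interpret Q: prob_space ?Q by (rule prob_space_PiM) (rule prob_subsets_of_size[OF s])
  let ?E = "space ?Q - (\<Union>b<d. ?B b)"
  have B: "?B b \<in> sets ?Q" if "b < d" for b by (rule corruption_count_tail[OF s that])
  have UB: "(\<Union>b<d. ?B b) \<in> sets ?Q"
    by (rule sets.finite_UN[OF finite_lessThan]) (rule B, simp only: lessThan_iff)
  have "measure ?Q (\<Union>b<d. ?B b) \<le> (\<Sum>b<d. measure ?Q (?B b))"
    by (rule Q.finite_measure_subadditive_finite[OF finite_lessThan image_subsetI]) (rule B, simp only: lessThan_iff)
  also have "\<dots> \<le> (\<Sum>b<d. exp (real n * (real s / real d) - t / 2))"
    by (rule sum_mono, rule corruption_count_tail(2)[OF s]) (simp only: lessThan_iff)
  finally have "measure ?Q (\<Union>b<d. ?B b) \<le> real d * exp (real n * (real s / real d) - t / 2)" by simp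
  then have pr: "1 - real d * exp (real n * (real s / real d) - t / 2) \<le> measure ?Q ?E"
    using Q.prob_compl[OF UB] by simp
  have c: "real (card {i. i < n \<and> b \<in> S i}) \<le> t" if "S \<in> ?E" "b < d" for S b
  proof (rule ccontr)
    assume "\<not> real (card {i. i < n \<and> b \<in> S i}) \<le> t"
    then have "S \<in> ?B b" using that(1) by (simp only: DiffD1 mem_Collect_eq not_le simp_thms)
    then show False using that by blast
  qed
  show ?thesis by (rule that[OF sets.compl_sets[OF UB] pr c])
qed

section \<open>Choice of parameters\<close>

text \<open>Exponential decay in \<tau> beats the cubic factor. In the application \<tau> scales the
  logarithm in the sample size, \<delta> is 4096 c0, and a is the exponent of d in the failure
  probability.\<close>

lemma parameter_exists:
  fixes a \<delta> :: real
  assumes "0 < \<delta>"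
  obtains \<tau> :: real where "1 \<le> \<tau>" "1 \<le> \<delta> * \<tau>\<^sup>2" "0 \<le> \<tau> / 4 - 6 - a" "131072 * \<tau> ^ 3 * exp (- (\<tau> / 4 - 6 - a)) \<le> 1"
proof -
  have "((\<lambda>\<tau>::real. 131072 * \<tau> ^ 3 * exp (- (\<tau> / 4 - 6 - a))) \<longlongrightarrow> 0) at_top" by real_asymp
  then have "eventually (\<lambda>\<tau>. 131072 * \<tau> ^ 3 * exp (- (\<tau> / 4 - 6 - a)) < 1) at_top"
    by (rule order_tendstoD) simp
  moreover have "eventually (\<lambda>\<tau>::real. \<tau> \<ge> max 1 (max (1 / \<delta>) (4 * (6 + a)))) at_top" by (rule eventually_ge_at_top)
  ultimately have "eventually (\<lambda>\<tau>. 131072 * \<tau> ^ 3 * exp (- (\<tau> / 4 - 6 - a)) < 1 \<and> \<tau> \<ge> max 1 (max (1 / \<delta>) (4 * (6 + a)))) at_top"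
    by (rule eventually_conj)
  from eventually_happens'[OF trivial_limit_at_top_linorder this]
  obtain \<tau> where "131072 * \<tau> ^ 3 * exp (- (\<tau> / 4 - 6 - a)) < 1" "max 1 (max (1 / \<delta>) (4 * (6 + a))) \<le> \<tau>" by blast
  then have t: "131072 * \<tau> ^ 3 * exp (- (\<tau> / 4 - 6 - a)) < 1" "1 \<le> \<tau>" "1 / \<delta> \<le> \<tau>" "4 * (6 + a) \<le> \<tau>"
    by (simp_all only: max.bounded_iff)
  have "1 \<le> \<delta> * \<tau>" using t(3) assms by (simp add: field_simps)
  also have "\<dots> \<le> \<delta> * \<tau>\<^sup>2" using t(2) assms by (simp add: power2_eq_square)
  finally have "1 \<le> \<delta> * \<tau>\<^sup>2" .
  moreover have "0 \<le> \<tau> / 4 - 6 - a" using t(4) by simp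
  ultimately show ?thesis using t(2) less_imp_le[OF t(1)] by (intro that)
qed

section \<open>Recovery with high probability\<close>

text \<open>The truncation radius \<rho> = K \<kappa> makes up \<kappa>^2 of the factor r, which is
  about \<kappa>^3; one more \<kappa> brings the exponent n / (2 \<rho>^2) of the trace failure up
  to \<kappa>. The blocks have size 4096 k^2 \<ge> 1024 K^2, by K \<le> 2 k.\<close>

lemma failure_probability_bound:
  fixes \<tau> \<kappa> c0 :: real and d k K r a :: nat
  assumes d: "2 \<le> d" and k: "1 \<le> k" "k \<le> d" and K: "1 \<le> K" "K \<le> k + 1"
    and \<tau>: "1 \<le> \<tau>" "1 \<le> 4096 * c0 * \<tau>\<^sup>2" "0 \<le> \<tau> / 4 - 6 - real a" "131072 * \<tau> ^ 3 * exp (- (\<tau> / 4 - 6 - real a)) \<le> 1"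
    and c0: "0 < c0" and \<kappa>: "\<kappa> = \<tau> * ln (real d + 1)"
    and r: "\<kappa> ^ 3 \<le> real r" "real r \<le> \<kappa> ^ 3 + 1" and n: "n = r * (4096 * k\<^sup>2)"
  shows "1 \<le> \<kappa>" "2 * (real K * \<kappa>)\<^sup>2 \<le> real n"
    "2 * real n * real K * exp (- (real K * \<kappa>) / (4 * real K)) + real K ^ 2 * exp (- (real n / (2 * (real K * \<kappa>)\<^sup>2)))
      + (1 / 4) ^ r + real d * exp (- (c0 * real n / real k)) \<le> 1 / real d ^ a"
proof -
  define l where "l = ln (real d + 1)"
  have \<kappa>l: "\<kappa> = \<tau> * l" by (simp add: \<kappa> l_def)
  have el: "exp l = real d + 1" unfolding l_def by (rule exp_ln) simp
  have l1: "1 \<le> l"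
  proof -
    have "exp 1 \<le> exp l" unfolding el using exp_le d by simp
    then show ?thesis by simp
  qed
  have "1 * 1 \<le> \<tau> * l" using \<tau>(1) l1 by (intro mult_mono) auto
  then show \<kappa>1: "1 \<le> \<kappa>" by (simp add: \<kappa>l)
  have \<kappa>23: "\<kappa> \<le> \<kappa>\<^sup>2" "\<kappa>\<^sup>2 \<le> \<kappa> ^ 3" using power_increasing[of 1 2 \<kappa>] power_increasing[of 2 3 \<kappa>] \<kappa>1 by auto
  have l3: "l \<le> l ^ 3" using power_increasing[of 1 3 l] l1 by auto
  have rl: "\<kappa> \<le> real r" using \<kappa>23 r(1) by linarith
  have nn: "real n = real r * (4096 * (real k)\<^sup>2)" by (simp add: n)
  have K2: "real K \<le> 2 * real k" using K k by simp
  then have K4: "(real K)\<^sup>2 \<le> 4 * (real k)\<^sup>2" using power_mono[OF K2, of 2] by (simp add: power_mult_distrib)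
  have K0: "0 < real K" and k0: "0 < real k" using K k by auto
  have kl: "real k \<le> exp l" and dl: "real d \<le> exp l" using el k by auto
  have ll: "l \<le> exp l" using exp_ge_add_one_self[of l] by linarith
  have key: "\<kappa> * (2 * (real K * \<kappa>)\<^sup>2) \<le> real n"
  proof -
    have "\<kappa> * (2 * (real K * \<kappa>)\<^sup>2) = 2 * (real K)\<^sup>2 * \<kappa> ^ 3" by (simp add: power_mult_distrib power2_eq_square power3_eq_cube)
    also have "\<dots> \<le> (4096 * (real k)\<^sup>2) * real r"
    proof (rule mult_mono[OF _ r(1)])
      show "2 * (real K)\<^sup>2 \<le> 4096 * (real k)\<^sup>2" using K4 zero_le_power2[of "real k"] by linarith
    qed (use \<kappa>1 in auto)
    finally show ?thesis by (simp add: nn mult.commute)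
  qed
  have "1 * (2 * (real K * \<kappa>)\<^sup>2) \<le> \<kappa> * (2 * (real K * \<kappa>)\<^sup>2)" using \<kappa>1 by (intro mult_right_mono) auto
  then show "2 * (real K * \<kappa>)\<^sup>2 \<le> real n" using key by simp
  \<comment> \<open>\<open>X\<close> dominates each of the four failure probabilities.\<close>
  define X where "X = 32768 * \<tau> ^ 3 * exp (6 * l - \<kappa> / 4)"
  have t3: "1 \<le> \<tau> ^ 3" using \<tau>(1) by simp
  have small: "4 * exp (2 * l - \<kappa>) \<le> X"
  proof -
    have "4 * exp (2 * l - \<kappa>) \<le> 32768 * \<tau> ^ 3 * exp (6 * l - \<kappa> / 4)"
    proof (rule mult_mono)
      show "4 \<le> 32768 * \<tau> ^ 3" using t3 by linarith
    qed (use l1 \<kappa>1 \<tau>(1) in auto)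
    then show ?thesis by (simp add: X_def)
  qed
  have T1: "2 * real n * real K * exp (- (real K * \<kappa>) / (4 * real K)) \<le> X"
  proof -
    have "real r \<le> 2 * \<kappa> ^ 3" using r(2) \<kappa>1 one_le_power[of \<kappa> 3] by linarith
    then have "2 * real n * real K \<le> 2 * (2 * \<kappa> ^ 3 * (4096 * (real k)\<^sup>2)) * (2 * real k)"
      unfolding nn using K2 \<kappa>1 by (intro mult_mono) auto
    also have "\<dots> = 32768 * \<tau> ^ 3 * (l * real k) ^ 3" by (simp add: \<kappa>l power_mult_distrib power2_eq_square power3_eq_cube)
    also have "\<dots> \<le> 32768 * \<tau> ^ 3 * (exp l * exp l) ^ 3"
      using kl ll l1 \<tau>(1) by (intro mult_left_mono power_mono mult_mono) auto
    also have "(exp l * exp l) ^ 3 = exp (6 * l)" by (simp add: exp_add[symmetric] exp_of_nat_mult[symmetric])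
    finally have "2 * real n * real K \<le> 32768 * \<tau> ^ 3 * exp (6 * l)" .
    then have "2 * real n * real K * exp (- \<kappa> / 4) \<le> 32768 * \<tau> ^ 3 * exp (6 * l) * exp (- \<kappa> / 4)"
      by (rule mult_right_mono) simp
    also have "\<dots> = X" unfolding X_def mult.assoc exp_add[symmetric] by simp
    finally show ?thesis using K0 by (simp add: field_simps)
  qed
  have T2: "real K ^ 2 * exp (- (real n / (2 * (real K * \<kappa>)\<^sup>2))) \<le> X"
  proof -
    have "0 < 2 * (real K * \<kappa>)\<^sup>2" using K0 \<kappa>1 by simp
    then have e: "\<kappa> \<le> real n / (2 * (real K * \<kappa>)\<^sup>2)" using key by (simp only: pos_le_divide_eq)
    have "(real k)\<^sup>2 \<le> (exp l)\<^sup>2" using kl by (intro power_mono) auto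
    then have "(real K)\<^sup>2 \<le> 4 * exp (2 * l)" using K4 by (simp add: power2_eq_square exp_add[symmetric])
    then have "(real K)\<^sup>2 * exp (- (real n / (2 * (real K * \<kappa>)\<^sup>2))) \<le> 4 * exp (2 * l) * exp (- \<kappa>)"
      using e by (intro mult_mono) auto
    also have "\<dots> = 4 * exp (2 * l - \<kappa>)" by (simp add: exp_diff exp_minus field_simps)
    finally show ?thesis using small by linarith
  qed
  have T3: "(1 / 4) ^ r \<le> X"
  proof -
    have "(1 / 4 :: real) \<le> exp (- 1)" using exp_le by (simp add: exp_minus field_simps)
    then have "(1 / 4) ^ r \<le> exp (- 1 :: real) ^ r" by (rule power_mono) simp
    also have "\<dots> = exp (- real r)" by (simp add: exp_of_nat_mult[symmetric])
    also have "\<dots> \<le> exp (2 * l - \<kappa>)" using rl l1 by simp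
    also have "\<dots> \<le> 4 * exp (2 * l - \<kappa>)" by simp
    finally show ?thesis using small by linarith
  qed
  have T4: "real d * exp (- (c0 * real n / real k)) \<le> X"
  proof -
    have "1 * (\<tau> * l) \<le> (4096 * c0 * \<tau>\<^sup>2) * (\<tau> * l)" using \<tau> l1 by (intro mult_right_mono) auto
    also have "\<dots> = 4096 * c0 * \<tau> ^ 3 * l" by (simp add: power2_eq_square power3_eq_cube)
    also have "\<dots> \<le> 4096 * c0 * \<tau> ^ 3 * l ^ 3" using l3 c0 \<tau>(1) by (intro mult_left_mono) auto
    also have "\<dots> = 4096 * c0 * \<kappa> ^ 3" by (simp add: \<kappa>l power_mult_distrib)
    also have "\<dots> \<le> 4096 * c0 * real r" using r(1) c0 by (intro mult_left_mono) auto
    also have "\<dots> \<le> 4096 * c0 * real r * real k" 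
      using mult_left_mono[of 1 "real k" "4096 * c0 * real r"] k c0 by simp
    also have "\<dots> = c0 * real n / real k" using k0 by (simp add: nn power2_eq_square)
    finally have "\<kappa> \<le> c0 * real n / real k" by (simp add: \<kappa>l)
    then have "real d * exp (- (c0 * real n / real k)) \<le> exp l * exp (- \<kappa>)" using dl by (intro mult_mono) auto
    also have "\<dots> = exp (l - \<kappa>)" by (simp add: exp_diff exp_minus field_simps)
    also have "\<dots> \<le> exp (2 * l - \<kappa>)" using l1 by simp
    also have "\<dots> \<le> 4 * exp (2 * l - \<kappa>)" by simp
    finally show ?thesis using small by linarith
  qed
  \<comment> \<open>Splitting exp (6 l - \<tau> l / 4) as exp (- (\<tau> / 4 - 6 - a) l) * exp (- a
    l) isolates the wanted d^(-a), and l \<ge> 1 reduces the rest to the condition on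
    \<tau>.\<close>
  have "4 * X = 131072 * \<tau> ^ 3 * (exp (- (\<tau> / 4 - 6 - real a) * l) * exp (- (real a * l)))"
    unfolding exp_add[symmetric] by (simp add: X_def \<kappa>l algebra_simps)
  also have "\<dots> \<le> 131072 * \<tau> ^ 3 * (exp (- (\<tau> / 4 - 6 - real a)) * exp (- (real a * l)))"
  proof -
    have "(\<tau> / 4 - 6 - real a) * 1 \<le> (\<tau> / 4 - 6 - real a) * l" using \<tau>(3) l1 by (intro mult_left_mono) auto
    then have "exp (- (\<tau> / 4 - 6 - real a) * l) \<le> exp (- (\<tau> / 4 - 6 - real a))"
      by (simp only: mult_minus_left mult_1_right neg_le_iff_le exp_le_cancel_iff)
    then show ?thesis using \<tau>(1) by (intro mult_left_mono mult_right_mono) (assumption | simp)+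
  qed
  also have "\<dots> \<le> 1 * exp (- (real a * l))" unfolding mult.assoc[symmetric] by (intro mult_right_mono \<tau>(4)) simp
  also have "\<dots> = 1 / exp l ^ a" by (simp add: exp_minus exp_of_nat_mult[symmetric] inverse_eq_divide)
  also have "\<dots> \<le> 1 / real d ^ a" using d dl by (intro divide_left_mono power_mono mult_pos_pos) auto
  finally show "2 * real n * real K * exp (- (real K * \<kappa>) / (4 * real K)) + real K ^ 2 * exp (- (real n / (2 * (real K * \<kappa>)\<^sup>2)))
      + (1 / 4) ^ r + real d * exp (- (c0 * real n / real k)) \<le> 1 / real d ^ a"
    using T1 T2 T3 T4 by linarith
qed

lemma measure_pair_ge:
  assumes "prob_space M" "prob_space N" "A \<in> sets M" "B \<in> sets N" "1 - e \<le> measure M A" "1 - f \<le> measure N B"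
  shows "1 - (e + f) \<le> measure (M \<Otimes>\<^sub>M N) (A \<times> B)"
proof -
  interpret M: prob_space M by fact
  interpret N: prob_space N by fact
  have "measure (M \<Otimes>\<^sub>M N) (A \<times> B) = measure M A * measure N B"
    unfolding measure_def N.emeasure_pair_measure_Times[OF assms(3,4)] by (simp add: enn2real_mult)
  moreover have "0 \<le> (1 - measure M A) * (1 - measure N B)" by simp
  ultimately show ?thesis using assms(5,6) by (simp add: algebra_simps)
qed

text \<open>
  The value of \<open>c0\<close> is \<open>1 / (768 * 402653184)\<close>: every coordinate is corrupted in at most \<open>4 * c0 * n / k\<close>
  samples, and with \<open>K + 1 \<le> 3 * k\<close> this gives the bound \<open>n / (64 * 402653184)\<close> on the corrupted rows.
\<close>

lemma subspace_prog_correct: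
  fixes \<kappa> c0 :: real
  assumes c0: "c0 = 1 / 309237645312" and k: "1 \<le> k" and s: "s \<le> d" and ks: "real k * real s \<le> c0 * real d"
    and \<mu>: "\<mu> \<in> carrier_vec d" and rk: "vec_space.rank d \<Sigma> = k" and law: "gaussian_law d \<mu> \<Sigma> G"
    and adv: "admissible_adversary n d adv" and n: "n = r * (4096 * k\<^sup>2)" "0 < n" and d: "0 < d"
    and fail: "\<And>K. 1 \<le> K \<Longrightarrow> K \<le> k + 1 \<Longrightarrow> real K \<le> real K * \<kappa> \<and> 2 * (real K * \<kappa>)\<^sup>2 \<le> real n \<and>
      2 * real n * real K * exp (- (real K * \<kappa>) / (4 * real K)) + real K ^ 2 * exp (- (real n / (2 * (real K * \<kappa>)\<^sup>2)))
      + (1 / 4) ^ r + real d * exp (- (c0 * real n / real k)) \<le> \<epsilon>"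
  shows "holds_with_prob (clean_model n d s G) (1 - \<epsilon>)
    (\<lambda>(x, S). outputs_subspace subspace_prog n d (adv x S) (span d (col_space d \<Sigma> \<union> {\<mu>})))"
proof -
  obtain K y M where iso: "isotropic_sample G K y (\<lambda>x. \<forall>i<d. x i = (\<Sum>a<K. M i a * y x a))" and K: "K \<le> k + 1"
    and W: "col_space d \<Sigma> \<union> {\<mu>} \<subseteq> carrier_vec d"
    and cols: "\<And>a. a < K \<Longrightarrow> vec d (\<lambda>c. M c a) \<in> span d (col_space d \<Sigma> \<union> {\<mu>})"
    and rng: "\<And>w. w \<in> col_space d \<Sigma> \<union> {\<mu>} \<Longrightarrow> \<exists>t. w = vec d (\<lambda>c. \<Sum>a<K. M c a * t a)"
    by (rule gaussian_law_isotropic[OF law \<mu> rk]) (rule that; (assumption | blast))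
  interpret I: isotropic_sample G K y "\<lambda>x. \<forall>i<d. x i = (\<Sum>a<K. M i a * y x a)" by (rule iso)
  have K1: "1 \<le> K" using I.K by simp
  note f = fail[OF K1 K]
  have K2: "real K \<le> 2 * real k" using K k by simp
  have h: "1024 * real K ^ 2 \<le> real (4096 * k\<^sup>2)" using power_mono[OF K2, of 2] by (simp add: power_mult_distrib)
  let ?ex = "2 * real n * real K * exp (- (real K * \<kappa>) / (4 * real K)) + real K ^ 2 * exp (- (real n / (2 * (real K * \<kappa>)\<^sup>2))) + (1 / 4) ^ r"
  obtain E1 where E1: "E1 \<in> sets (I.PG {..<n})" "1 - ?ex \<le> measure (I.PG {..<n}) E1"
    "\<And>x i. x \<in> E1 \<Longrightarrow> i < n \<Longrightarrow> \<forall>j<d. x i j = (\<Sum>a<K. M j a * y (x i) a)"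
    "\<And>x A. x \<in> E1 \<Longrightarrow> (\<Sum>i<n. (dot I.K2 A (quad (y (x i))))\<^sup>2) \<le> 32768 * real n * dot I.K2 A A"
    "\<And>x u. x \<in> E1 \<Longrightarrow> real n / 8 * dot {..<K} u u \<le> (\<Sum>i<n. (dot {..<K} u (y (x i)))\<^sup>2)"
    by (rule I.good_event[OF h conjunct1[OF f] conjunct1[OF conjunct2[OF f]] n(1)]) (rule that; (assumption | blast))
  \<comment> \<open>Half of t enters the tail exponent as 2 c0 n / k; the mean n s / d uses up at
    most c0 n / k of it, and - c0 n / k remains.\<close>
  define t where "t = 4 * c0 * real n / real k"
  obtain E2 where E2: "E2 \<in> sets (corruption_law n d s)"
    "1 - real d * exp (real n * (real s / real d) - t / 2) \<le> measure (corruption_law n d s) E2"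
    "\<And>S b. S \<in> E2 \<Longrightarrow> b < d \<Longrightarrow> real (card {i. i < n \<and> b \<in> S i}) \<le> t"
    by (rule few_corruptions_event[OF s, of n t]) (rule that; (assumption | blast))
  have "real s / real d \<le> c0 / real k" using ks k d by (simp add: field_simps)
  then have "real n * (real s / real d) \<le> real n * (c0 / real k)" by (rule mult_left_mono) simp
  then have "real n * (real s / real d) - t / 2 \<le> - (c0 * real n / real k)"
    by (simp add: t_def mult.commute[of c0] diff_le_eq)
  then have "real d * exp (real n * (real s / real d) - t / 2) \<le> real d * exp (- (c0 * real n / real k))"
    by (intro mult_left_mono) (simp_all only: exp_le_cancel_iff of_nat_0_le_iff)
  then have E2': "1 - real d * exp (- (c0 * real n / real k)) \<le> measure (corruption_law n d s) E2" using E2(2) by linarith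
  have "1 - (?ex + real d * exp (- (c0 * real n / real k))) \<le> measure (clean_model n d s G) (E1 \<times> E2)"
    unfolding clean_model_def
    by (rule measure_pair_ge[OF I.prob_PiM prob_space_PiM[OF prob_subsets_of_size[OF s]] E1(1) E2(1) E1(2) E2'])
  then have pr: "1 - \<epsilon> \<le> measure (clean_model n d s G) (E1 \<times> E2)" using f by linarith
  have ev: "E1 \<times> E2 \<in> sets (clean_model n d s G)" unfolding clean_model_def using E1(1) E2(1) by (rule pair_measureI)
  \<comment> \<open>On E1 and E2 recovery is deterministic, whatever admissible corruption is
    chosen, so a measurable event inside the success set is at hand, as inner probability
    asks.\<close>
  have "outputs_subspace subspace_prog n d (adv x S) (span d (col_space d \<Sigma> \<union> {\<mu>}))" if x: "x \<in> E1" and S: "S \<in> E2" for x S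
  proof -
    interpret C: clean_data n d "adv x S" 402653184 K "\<lambda>i. y (x i)" M S 32768
    proof
      show "adv x S i j = (\<Sum>a<K. M j a * y (x i) a)" if "i < n" "j < d" "j \<notin> S i" for i j
        using adv E1(3)[OF x that(1)] that unfolding admissible_adversary_def by metis
      show "real (card {i. i < n \<and> j \<in> S i}) * real (K + 1) \<le> real n / (64 * 402653184)" if "j < d" for j
      proof -
        have "real (card {i. i < n \<and> j \<in> S i}) * real (K + 1) \<le> t * (3 * real k)"
          using E2(3)[OF S that] K k by (intro mult_mono) auto
        also have "\<dots> = real n / (64 * 402653184)" using k by (simp add: t_def c0)
        finally show ?thesis .
      qed
    qed (use n E1(4)[OF x] E1(5)[OF x] in auto)
    obtain u m where m: "exec subspace_prog (input_state n d (adv x S)) u m" "ireg m 0 = d"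
      "\<forall>b<d. \<forall>c<d. arr m 0 b c = C.basis_vec b c"
      using subspace_prog_exec[of n d "adv x S"] n(2) by blast
    have "output_vectors d m = (\<lambda>l. vec d (C.basis_vec l)) ` {..<d}"
      unfolding output_vectors_def m(2) using m(3) by (intro image_cong refl eq_vecI) auto
    then have "span d (output_vectors d m) = span d (col_space d \<Sigma> \<union> {\<mu>})"
      using C.span_basis_vec[OF W cols rng] by simp
    then show ?thesis unfolding outputs_subspace_def using m(1) by blast
  qed
  then show ?thesis unfolding holds_with_prob_def using ev pr by (intro bexI[of _ "E1 \<times> E2"]) auto
qed

theorem theorem2:
  shows "\<exists>c0::real. c0 > 0 \<and> (\<exists>alg::prog. \<forall>a::nat.
    \<exists>(N :: nat \<Rightarrow> nat \<Rightarrow> nat) (C::real) (p::nat) (q::nat).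
      (\<forall>d k. d \<ge> 1 \<longrightarrow> real (N d k) \<le> C * real k ^ 2 * ln (real d + 1) ^ p) \<and>
      (\<forall>d k s. 1 \<le> k \<longrightarrow> k \<le> d \<longrightarrow> s \<le> d \<longrightarrow> real k * real s \<le> c0 * real d \<longrightarrow>
        (\<forall>y. halts_within alg (input_state (N d k) d y) (C * real d ^ q)) \<and>
        (\<forall>\<mu> \<Sigma> G adv.
          \<mu> \<in> carrier_vec d \<longrightarrow> \<Sigma> \<in> carrier_mat d d \<longrightarrow> vec_space.rank d \<Sigma> = k \<longrightarrow>
          gaussian_law d \<mu> \<Sigma> G \<longrightarrow> admissible_adversary (N d k) d adv \<longrightarrow>
          holds_with_prob (clean_model (N d k) d s G) (1 - 1 / real d ^ a)
            (\<lambda>(x, S). outputs_subspace alg (N d k) d (adv x S)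
                         (span d (col_space d \<Sigma> \<union> {\<mu>}))))))"
proof -
  define c0 :: real where "c0 = 1 / 309237645312"
  have c0: "0 < c0" by (simp add: c0_def)
  obtain c q where time: "\<And>n d. 1 \<le> d \<Longrightarrow> stmt_time main_stmt (max n d) + 1 \<le> c * (max n d) ^ q"
    using subspace_prog_time by blast
  show ?thesis
  proof (rule exI[of _ c0], rule conjI[OF c0], rule exI[of _ subspace_prog], rule allI)
    fix a :: nat
    have "0 < 4096 * c0" using c0 by simp
    then obtain \<tau> :: real where \<tau>: "1 \<le> \<tau>" "1 \<le> 4096 * c0 * \<tau>\<^sup>2" "0 \<le> \<tau> / 4 - 6 - real a"
      "131072 * \<tau> ^ 3 * exp (- (\<tau> / 4 - 6 - real a)) \<le> 1" by (rule parameter_exists)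
    define l where "l d = ln (real d + 1)" for d :: nat
    define r where "r d = nat \<lceil>(\<tau> * l d) ^ 3\<rceil>" for d
    define N where "N d k = r d * (4096 * k\<^sup>2)" for d k
    \<comment> \<open>The 8 absorbs the rounding in r, since ln (d + 1) \<ge> 1/2 gives 1 \<le> 8 *
      ln (d + 1)^3.\<close>
    define C1 where "C1 = 4096 * (\<tau> ^ 3 + 8)"
    \<comment> \<open>One constant serves both the sample bound and the time bound c * (C1 d^5)^q,
      where n \<le> C1 d^5 because k \<le> d and ln (d + 1) \<le> d.\<close>
    define C where "C = C1 + real c * C1 ^ q"
    have t3: "1 \<le> \<tau> ^ 3" using \<tau>(1) by simp
    then have C1: "1 \<le> C1" by (simp add: C1_def)
    have lhalf: "1 / 2 \<le> l d" if "1 \<le> d" for d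
    proof -
      have "exp (1 / 2 :: real) \<le> 2" using exp_bound_half[of "1 / 2 :: real"] by simp
      also have "\<dots> \<le> exp (l d)" using that by (simp add: l_def)
      finally show ?thesis by simp
    qed
    have ld: "l d \<le> real d" for d unfolding l_def using ln_add_one_self_le_self[of "real d"] by (simp add: add.commute)
    have r: "(\<tau> * l d) ^ 3 \<le> real (r d)" "real (r d) \<le> (\<tau> * l d) ^ 3 + 1" if "1 \<le> d" for d
    proof -
      have "0 \<le> (\<tau> * l d) ^ 3" using lhalf[OF that] \<tau>(1) by simp
      then show "(\<tau> * l d) ^ 3 \<le> real (r d)" "real (r d) \<le> (\<tau> * l d) ^ 3 + 1" unfolding r_def by linarith+
    qed
    have N: "real (N d k) \<le> C1 * real k ^ 2 * l d ^ 3" if d: "1 \<le> d" for d k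
    proof -
      have "(1 / 2) ^ 3 \<le> l d ^ 3" using lhalf[OF d] by (intro power_mono) auto
      then have "1 \<le> 8 * l d ^ 3" by (simp add: power_divide)
      then have "real (r d) \<le> (\<tau> ^ 3 + 8) * l d ^ 3"
        using r(2)[OF d] unfolding power_mult_distrib distrib_right by linarith
      then have "real (r d) * (4096 * real k ^ 2) \<le> (\<tau> ^ 3 + 8) * l d ^ 3 * (4096 * real k ^ 2)" by (rule mult_right_mono) simp
      then show ?thesis by (simp add: N_def C1_def mult_ac)
    qed
    show "\<exists>(N :: nat \<Rightarrow> nat \<Rightarrow> nat) (C::real) (p::nat) (q::nat).
      (\<forall>d k. d \<ge> 1 \<longrightarrow> real (N d k) \<le> C * real k ^ 2 * ln (real d + 1) ^ p) \<and>
      (\<forall>d k s. 1 \<le> k \<longrightarrow> k \<le> d \<longrightarrow> s \<le> d \<longrightarrow> real k * real s \<le> c0 * real d \<longrightarrow>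
        (\<forall>y. halts_within subspace_prog (input_state (N d k) d y) (C * real d ^ q)) \<and>
        (\<forall>\<mu> \<Sigma> G adv.
          \<mu> \<in> carrier_vec d \<longrightarrow> \<Sigma> \<in> carrier_mat d d \<longrightarrow> vec_space.rank d \<Sigma> = k \<longrightarrow>
          gaussian_law d \<mu> \<Sigma> G \<longrightarrow> admissible_adversary (N d k) d adv \<longrightarrow>
          holds_with_prob (clean_model (N d k) d s G) (1 - 1 / real d ^ a)
            (\<lambda>(x, S). outputs_subspace subspace_prog (N d k) d (adv x S)
                         (span d (col_space d \<Sigma> \<union> {\<mu>})))))"
    proof (rule exI[of _ N], rule exI[of _ C], rule exI[of _ 3], rule exI[of _ "5 * q"], rule conjI; intro allI impI)
      fix d k :: nat assume d: "1 \<le> d"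
      have "C1 * (real k ^ 2 * l d ^ 3) \<le> C * (real k ^ 2 * l d ^ 3)"
        using C1 lhalf[OF d] by (intro mult_right_mono) (auto simp: C_def)
      then show "real (N d k) \<le> C * real k ^ 2 * ln (real d + 1) ^ 3"
        using N[OF d, of k] by (simp add: l_def mult.assoc)
    next
      fix d k s :: nat
      assume k: "1 \<le> k" "k \<le> d" and s: "s \<le> d" and ks: "real k * real s \<le> c0 * real d"
      then have d: "1 \<le> d" by simp
      have halt: "halts_within subspace_prog (input_state (N d k) d y) (C * real d ^ (5 * q))" for y
      proof -
        obtain t m where t: "exec subspace_prog (input_state (N d k) d y) t m" "t \<le> stmt_time main_stmt (max (N d k) d) + 1"
          using subspace_prog_exec[of "N d k" d y] by blast
        have "real (max (N d k) d) \<le> C1 * real d ^ 5"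
        proof -
          have "real (N d k) \<le> C1 * real k ^ 2 * l d ^ 3" by (rule N[OF d])
          also have "\<dots> \<le> C1 * real d ^ 2 * real d ^ 3"
            using C1 k ld[of d] lhalf[OF d] by (intro mult_mono power_mono) auto
          finally have 1: "real (N d k) \<le> C1 * real d ^ 5"
            unfolding mult.assoc power_add[symmetric] by simp
          have "1 * real d ^ 1 \<le> C1 * real d ^ 5" using C1 d by (intro mult_mono power_increasing) auto
          then show ?thesis using 1 by simp
        qed
        then have "real (max (N d k) d) ^ q \<le> (C1 * real d ^ 5) ^ q" by (rule power_mono) simp
        then have "real c * real (max (N d k) d) ^ q \<le> real c * (C1 * real d ^ 5) ^ q" by (rule mult_left_mono) simp
        also have "\<dots> = real c * C1 ^ q * real d ^ (5 * q)" by (simp add: power_mult_distrib power_mult)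
        also have "\<dots> \<le> C * real d ^ (5 * q)" using C1 by (intro mult_right_mono) (auto simp: C_def)
        finally have "real (c * (max (N d k) d) ^ q) \<le> C * real d ^ (5 * q)" by simp
        moreover have "real t \<le> real (c * (max (N d k) d) ^ q)" using t(2) time[OF d, of "N d k"] by (simp only: of_nat_le_iff)
        ultimately show ?thesis unfolding halts_within_def using t(1) by (intro exI conjI) auto
      qed
      have prob: "holds_with_prob (clean_model (N d k) d s G) (1 - 1 / real d ^ a)
            (\<lambda>(x, S). outputs_subspace subspace_prog (N d k) d (adv x S) (span d (col_space d \<Sigma> \<union> {\<mu>})))"
        if h: "\<mu> \<in> carrier_vec d" "vec_space.rank d \<Sigma> = k" "gaussian_law d \<mu> \<Sigma> G" "admissible_adversary (N d k) d adv" for \<mu> \<Sigma> G adv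
      proof (cases "d = 1")
        case True
        \<comment> \<open>For d = 1 the required probability 1 - 1 / d^a is 0, so the empty event
          suffices.\<close>
        then show ?thesis unfolding holds_with_prob_def by (intro bexI[of _ "{}"]) auto
      next
        case False
        then have d2: "2 \<le> d" using d by simp
        note b = failure_probability_bound[OF d2 k _ _ \<tau> c0 refl, of _ "r d" "N d k", folded l_def, OF _ _ r[OF d] N_def]
        have "1 \<le> \<tau> * l d" using b(1)[of 1] by simp
        then have "1 \<le> (\<tau> * l d) ^ 3" by simp
        then have "0 < r d" using r(1)[OF d] by linarith
        then have n: "0 < N d k" using k by (simp add: N_def)
        show ?thesis
        proof (rule subspace_prog_correct[OF c0_def k(1) s ks h N_def n, where \<kappa> = "\<tau> * l d"])
          show "0 < d" using d by simp
          fix K :: nat assume K: "1 \<le> K" "K \<le> k + 1"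
          show "real K \<le> real K * (\<tau> * l d) \<and> 2 * (real K * (\<tau> * l d))\<^sup>2 \<le> real (N d k) \<and>
            2 * real (N d k) * real K * exp (- (real K * (\<tau> * l d)) / (4 * real K)) +
            real K ^ 2 * exp (- (real (N d k) / (2 * (real K * (\<tau> * l d))\<^sup>2))) + (1 / 4) ^ r d +
            real d * exp (- (c0 * real (N d k) / real k)) \<le> 1 / real d ^ a"
            using b[OF K] \<open>1 \<le> \<tau> * l d\<close> mult_left_mono[of 1 "\<tau> * l d" "real K"] by simp
        qed
      qed
      show "(\<forall>y. halts_within subspace_prog (input_state (N d k) d y) (C * real d ^ (5 * q))) \<and>
        (\<forall>\<mu> \<Sigma> G adv.
          \<mu> \<in> carrier_vec d \<longrightarrow> \<Sigma> \<in> carrier_mat d d \<longrightarrow> vec_space.rank d \<Sigma> = k \<longrightarrow>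
          gaussian_law d \<mu> \<Sigma> G \<longrightarrow> admissible_adversary (N d k) d adv \<longrightarrow>
          holds_with_prob (clean_model (N d k) d s G) (1 - 1 / real d ^ a)
            (\<lambda>(x, S). outputs_subspace subspace_prog (N d k) d (adv x S) (span d (col_space d \<Sigma> \<union> {\<mu>}))))"
        using halt prob by blast
    qed
  qed
qed

end
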